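(* Let $A\subseteq\mathbb Z_{\ge 0}^n$ be a finite nonempty set such that $\{z\in\mathbb C^n: z^a=0 \text{ for all } a\in A\}=\{0\}$, and let $R^{z^A}=\sum_{B\subseteq A}R_B$ be the corresponding Bochner–Martinelli residue current. Then for every subset $B\subseteq A$, $$R_B=C_B\,\bar\partial\Big[\frac{1}{z_1^{\alpha^B_1}}\Big]\wedge\cdots\wedge\bar\partial\Big[\frac{1}{z_n^{\alpha^B_n}}\Big]\wedge e_B,$$ where $C_B$ is a constant which is nonzero if $B$ is an essential set and zero otherwise.
   Context: For $a=(a_1,\dots,a_n)\in\mathbb Z_{\ge0}^n$ write $z^a=z_1^{a_1}\cdots z_n^{a_n}$; $z^A$ denotes the tuple $(z^a)_{a\in A}$ and $|z^A|^2=\sum_{a\in A}|z^a|^2$. Fix an ordering of $A$ and let $E$ be the trivial vector bundle over $\mathbb C^n$ of rank $|A|$ with global holomorphic frame $\{e_a\}_{a\in A}$ (trivial metric). Forms take values in $\Lambda(E\oplus T^*_{0,1}(\mathbb C^n))$ with the convention $e_a\wedge d\bar z_i=-d\bar z_i\wedge e_a$. For $B\subseteq A$ with $|B|=k\ge1$ let $s_B=\sum_{a\in B}\bar z^a e_a$ and $u_B=s_B\wedge(\bar\partial s_B)^{k-1}/|z^A|^{2k}$. The form $\bar\partial|z^A|^{2\lambda}\wedge u_B$ (defined for $\mathrm{Re}\,\lambda\gg0$) has an analytic continuation as a current to $\mathrm{Re}\,\lambda>-\epsilon$, and $R_B$ denotes its value at $\lambda=0$; the (full) Bochner–Martinelli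 residue current is $R^{z^A}=\sum_{B\subseteq A}R_B$. Here $e_B=\bigwedge_{a\in B}e_a$, the wedge product taken with respect to the fixed ordering. For a positive integer $p$, $\bar\partial[1/z_j^p]$ denotes the value at $\lambda=0$ of the analytic continuation of $\bar\partial|z_j|^{2\lambda}/z_j^p$; the wedge product above is the tensor product of these one-variable currents. For $B\subseteq A$ put $\alpha^B=\sum_{a\in B}a=(\alpha^B_1,\dots,\alpha^B_n)$. The Newton polyhedron $\Gamma^+(A)$ is the convex hull of $\bigcup_{a\in A}(a+\mathbb R_{\ge0}^n)$. A subset $B=\{a_1,\dots,a_n\}\subseteq A$ of cardinality $n$ is called essential if it is contained in some facet (face of dimension $n-1$) of $\Gamma^+(A)$ and $\det(a_1,\dots,a_n)\neq0$. *)

theory Defs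
  imports "HOL-Analysis.Analysis"
begin

definition zmon :: "('n::finite \<Rightarrow> nat) \<Rightarrow> complex^'n \<Rightarrow> complex" where
  "zmon a z = (\<Prod>i\<in>UNIV. (z$i) ^ a i)"

definition zbmon :: "('n::finite \<Rightarrow> nat) \<Rightarrow> complex^'n \<Rightarrow> complex" where
  "zbmon a z = (\<Prod>i\<in>UNIV. (cnj (z$i)) ^ a i)"

definition normsqA :: "('n::finite \<Rightarrow> nat) set \<Rightarrow> complex^'n \<Rightarrow> real" where
  "normsqA A z = (\<Sum>a\<in>A. (cmod (zmon a z))^2)"

definition alphaB :: "('n::finite \<Rightarrow> nat) set \<Rightarrow> 'n \<Rightarrow> nat" where
  "alphaB B i = (\<Sum>a\<in>B. a i)"

definition rvec :: "('n::finite \<Rightarrow> nat) \<Rightarrow> real^'n" where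
  "rvec a = (\<chi> i. real (a i))"

definition newton_polyhedron :: "('n::finite \<Rightarrow> nat) set \<Rightarrow> (real^'n) set" where
  "newton_polyhedron A = convex hull (\<Union>a\<in>A. {x. \<forall>i. rvec a $ i \<le> x $ i})"

definition essential :: "('n::finite \<Rightarrow> nat) set \<Rightarrow> ('n \<Rightarrow> nat) set \<Rightarrow> bool" where
  "essential A B \<longleftrightarrow> B \<subseteq> A \<and> card B = CARD('n) \<and>
     (\<exists>F. F facet_of newton_polyhedron A \<and> rvec ` B \<subseteq> F) \<and>
     (\<exists>f::'n \<Rightarrow> ('n \<Rightarrow> nat). bij_betw f UNIV B \<and> det (\<chi> i j. real (f j i)) \<noteq> 0)"

text \<open>Generators: Inl i is d(zbar_i), Inr a is e_a.  A form is a coefficient function on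
  finite sets of generators; the set S stands for the wedge of its elements in increasing
  rank.  The rank puts dzbar_1,...,dzbar_n (order of the list ordN) first and then the e_a
  in the fixed ordering ordA of A.\<close>

type_synonym 'n gen = "'n + ('n \<Rightarrow> nat)"
type_synonym 'n form = "'n gen set \<Rightarrow> complex"

definition lpos :: "'a list \<Rightarrow> 'a \<Rightarrow> nat" where
  "lpos xs x = (LEAST k. k < length xs \<and> xs ! k = x)"

fun rk :: "'n list \<Rightarrow> ('n \<Rightarrow> nat) list \<Rightarrow> 'n gen \<Rightarrow> nat" where
  "rk oN oA (Inl i) = lpos oN i"
| "rk oN oA (Inr a) = length oN + lpos oA a"

text \<open>sign of (wedge of S) wedge (wedge of T) relative to wedge of S union T (S, T disjoint)\<close>
definition wsgn :: "'n list \<Rightarrow> ('n \<Rightarrow> nat) list \<Rightarrow> 'n gen set \<Rightarrow> 'n gen set \<Rightarrow> complex" where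
  "wsgn oN oA S T = (-1) ^ card {(s,t). s \<in> S \<and> t \<in> T \<and> rk oN oA t < rk oN oA s}"

definition wedge :: "'n list \<Rightarrow> ('n \<Rightarrow> nat) list \<Rightarrow> 'n form \<Rightarrow> 'n form \<Rightarrow> 'n form" where
  "wedge oN oA \<omega> \<eta> U = (\<Sum>S\<in>Pow U. \<omega> S * \<eta> (U - S) * wsgn oN oA S (U - S))"

definition mono :: "'n gen set \<Rightarrow> complex \<Rightarrow> 'n form" where
  "mono S c U = (if U = S then c else 0)"

fun wpow :: "'n list \<Rightarrow> ('n \<Rightarrow> nat) list \<Rightarrow> 'n form \<Rightarrow> nat \<Rightarrow> 'n form" where
  "wpow oN oA \<omega> 0 = mono {} 1"
| "wpow oN oA \<omega> (Suc k) = wedge oN oA \<omega> (wpow oN oA \<omega> k)"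

definition wirt :: "'n::finite \<Rightarrow> (complex^'n \<Rightarrow> complex) \<Rightarrow> complex^'n \<Rightarrow> complex" where
  "wirt i f z = (frechet_derivative f (at z) (axis i 1)
                 + \<i> * frechet_derivative f (at z) (axis i \<i>)) / 2"

definition wirt1 :: "(complex \<Rightarrow> complex) \<Rightarrow> complex \<Rightarrow> complex" where
  "wirt1 f w = (frechet_derivative f (at w) 1 + \<i> * frechet_derivative f (at w) \<i>) / 2"

definition dbarF :: "'n list \<Rightarrow> ('n \<Rightarrow> nat) list \<Rightarrow> (complex^'n \<Rightarrow> 'n::finite form)
                      \<Rightarrow> complex^'n \<Rightarrow> 'n form" where
  "dbarF oN oA F z U = (\<Sum>i\<in>UNIV. wedge oN oA (mono {Inl i} 1) (\<lambda>V. wirt i (\<lambda>w. F w V) z) U)"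

definition acont0 :: "(complex \<Rightarrow> complex) \<Rightarrow> complex" where
  "acont0 F = (THE v. \<exists>\<epsilon>>0. \<exists>g. g holomorphic_on {s. - \<epsilon> < Re s} \<and>
                         (\<exists>c. \<forall>s. c < Re s \<longrightarrow> g s = F s) \<and> g 0 = v)"

fun Ck :: "nat \<Rightarrow> ('a::real_normed_vector \<Rightarrow> complex) \<Rightarrow> bool" where
  "Ck 0 f = continuous_on UNIV f"
| "Ck (Suc k) f = ((\<forall>z. f differentiable (at z)) \<and> (\<forall>v. Ck k (\<lambda>z. frechet_derivative f (at z) v)))"

definition test_fun :: "('a::real_normed_vector \<Rightarrow> complex) \<Rightarrow> bool" where
  "test_fun \<phi> \<longleftrightarrow> (\<forall>k. Ck k \<phi>) \<and> (\<exists>K. compact K \<and> (\<forall>z. z \<notin> K \<longrightarrow> \<phi> z = 0))"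

text \<open>A current with values in Lambda(E + T*_{0,1}) is represented by its coefficient
  distributions: (T U) \<phi> is the coefficient of the basis monomial U, tested against the
  test function \<phi> (with respect to Lebesgue measure).\<close>

definition sB :: "('n::finite \<Rightarrow> nat) set \<Rightarrow> complex^'n \<Rightarrow> 'n form" where
  "sB B z = (\<lambda>U. \<Sum>a\<in>B. mono {Inr a} (zbmon a z) U)"

definition uB :: "'n list \<Rightarrow> ('n \<Rightarrow> nat) list \<Rightarrow> ('n::finite \<Rightarrow> nat) set \<Rightarrow> ('n \<Rightarrow> nat) set
                   \<Rightarrow> complex^'n \<Rightarrow> 'n form" where
  "uB oN oA A B z = (\<lambda>U. wedge oN oA (sB B z) (wpow oN oA (dbarF oN oA (sB B) z) (card B - 1)) U
                        / of_real (normsqA A z) ^ card B)"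

definition omegaB :: "'n list \<Rightarrow> ('n \<Rightarrow> nat) list \<Rightarrow> ('n::finite \<Rightarrow> nat) set \<Rightarrow> ('n \<Rightarrow> nat) set
                   \<Rightarrow> complex \<Rightarrow> complex^'n \<Rightarrow> 'n form" where
  "omegaB oN oA A B s z = wedge oN oA
      (dbarF oN oA (\<lambda>w. mono {} (of_real (normsqA A w) powr s)) z) (uB oN oA A B z)"

definition RB :: "'n list \<Rightarrow> ('n \<Rightarrow> nat) list \<Rightarrow> ('n::finite \<Rightarrow> nat) set \<Rightarrow> ('n \<Rightarrow> nat) set
                   \<Rightarrow> 'n gen set \<Rightarrow> (complex^'n \<Rightarrow> complex) \<Rightarrow> complex" where
  "RB oN oA A B U \<phi> = acont0 (\<lambda>s. \<integral>z. omegaB oN oA A B s z U * \<phi> z \<partial>lborel)"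

text \<open>one-variable current dbar[1/w^p], coefficient of dwbar\<close>
definition dbar_inv :: "nat \<Rightarrow> (complex \<Rightarrow> complex) \<Rightarrow> complex" where
  "dbar_inv p \<psi> = acont0 (\<lambda>s. \<integral>w. wirt1 (\<lambda>w. of_real ((cmod w)^2) powr s) w / w ^ p * \<psi> w \<partial>lborel)"

text \<open>Tensor product of the one-variable currents dbar[1/z_i^(p i)] over the coordinates in the
  list, applied iteratively (Schwartz's definition of the tensor product).\<close>
fun tens :: "'n list \<Rightarrow> ('n::finite \<Rightarrow> nat) \<Rightarrow> (complex^'n \<Rightarrow> complex) \<Rightarrow> complex^'n \<Rightarrow> complex" where
  "tens [] p \<phi> z = \<phi> z"
| "tens (i # is) p \<phi> z = dbar_inv (p i) (\<lambda>w. tens is p \<phi> (\<chi> j. if j = i then w else z $ j))"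

definition PB :: "'n list \<Rightarrow> ('n::finite \<Rightarrow> nat) set \<Rightarrow> 'n gen set \<Rightarrow> (complex^'n \<Rightarrow> complex) \<Rightarrow> complex" where
  "PB oN B U \<phi> = (if U = Inl ` UNIV \<union> Inr ` B then tens oN (alphaB B) \<phi> 0 else 0)"

end

theory Submission
  imports Defs "HOL-Complex_Analysis.Complex_Analysis" "Jordan_Normal_Form.Determinant"
begin

no_notation fps_nth (infixl "$" 75)
no_notation vec_index (infixl "$" 100)


text \<open>
  Off the coordinate hyperplanes each component of \<open>dbar |z^A|^(2s) \<and> u_B\<close>, with \<open>k = card B\<close>, is \<open>s\<close> times a sum over
  \<open>c \<in> A\<close> of \<open>|z^A|^(2s) |z^c|^2 cnj(z)^\<alpha> / |z^A|^(2k+2)\<close>, divided by the conjugates of the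
  coordinates in the component, with a constant coefficient that is a determinant of exponents bordered by \<open>c\<close>.
  Replace the test function by a Taylor polynomial: for the remainder the integral is analytic at
  \<open>s = 0\<close>, so the factor \<open>s\<close> kills it. Rotating one coordinate kills every Taylor monomial except
  those that turn the integrand into \<open>|z^m|^2 / |z^A|^(2k+2)\<close>. In logarithmic coordinates such an integral
  converges beyond \<open>s = 0\<close> unless some linear form is 1 on \<open>B\<close> and \<open>c\<close> and at least 1 on \<open>A\<close>, which means
  that \<open>B\<close> lies in a facet containing \<open>c\<close>; then only the Taylor coefficient of \<open>z^(\<alpha>-1)\<close> survives, and this is
  what the tensor product of the one-variable currents computes. For these terms an Euler identity
  in the direction of the linear form writes \<open>s\<close> times the integral, at \<open>s = 0\<close>, as the integral of a positive
  function, and the bordered determinant equals the determinant of \<open>B\<close> independently of \<open>c\<close>. So nothing cancels.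
\<close>

section \<open>Analytic continuation from a half-plane\<close>

text \<open>Only a half-plane slightly beyond 0 is asked for, so no resolution of singularities is
  set up: each term either has an absolutely convergent integral for some negative real part of
  \<open>s\<close>, or is rewritten by such integrals. Convergence is decided by a linear condition:
  at each nonzero \<open>x\<close> of the nonpositive orthant some \<open>a \<in> A\<close> must
  beat the exponent of the integrand strictly. Homogeneity and compactness of the unit sphere turn
  this into a uniform gap. The dichotomy comes from its failure: the exponent is a sum of
  \<open>card B + 1\<close> forms taken from \<open>A\<close> plus nonnegative slack, so failing at
  \<open>x\<close> means that an average reaches the maximum; hence all these forms agree at
  \<open>x\<close> and the slack vanishes. The Euler identity is chosen so that the borderline
  integral is multiplied by exactly \<open>s\<close>; the integrals on the other side carry a factor
  vanishing at the origin or a monomial off the facet, and converge again. Existence of the limits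
  is not enough for nonvanishing: several \<open>c\<close> on the facet may contribute, so the sign
  of each limit has to be known.\<close>

definition acv :: "(complex \<Rightarrow> complex) \<Rightarrow> complex \<Rightarrow> bool" where
  "acv F v \<longleftrightarrow> (\<exists>\<epsilon>>0. \<exists>g. g holomorphic_on {s. - \<epsilon> < Re s} \<and>
                         (\<exists>c. \<forall>s. c < Re s \<longrightarrow> g s = F s) \<and> g 0 = v)"

lemma acvI:
  assumes "\<epsilon> > 0" "g holomorphic_on {s. - \<epsilon> < Re s}" "\<And>s. c < Re s \<Longrightarrow> F s = g s" "g 0 = v"
  shows "acv F v"
  unfolding acv_def using assms by metis

text \<open>A half-plane is convex, hence connected, so agreement on the nonempty open half-plane
  far to the right propagates by the identity theorem.\<close>

lemma holomorphic_eq_on_halfplane: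
  assumes "f holomorphic_on {s. a < Re s}" "g holomorphic_on {s. a < Re s}"
    and "\<And>s. c < Re s \<Longrightarrow> f s = g s" and "a < Re s0"
  shows "f s0 = g s0"
proof -
  let ?S = "{s. a < Re s}"
  let ?d = "max a c + 1"
  have "open ?S" by (rule open_halfspace_Re_gt)
  moreover have "connected ?S"
    by (intro convex_connected convex_halfspace_Re_gt)
  moreover have "{s. ?d < Re s} \<subseteq> ?S" by auto
  moreover have "open {s. ?d < Re s}" by (rule open_halfspace_Re_gt)
  moreover have "{s. ?d < Re s} \<noteq> {}"
    using gt_ex[of ?d] by (metis (mono_tags, lifting) Re_complex_of_real empty_iff mem_Collect_eq)
  moreover have "f s - g s = 0" if "s \<in> {s. ?d < Re s}" for s
    using that assms(3)[of s] by auto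
  ultimately have "(\<lambda>s. f s - g s) s0 = 0"
    using analytic_continuation_open[of "{s. ?d < Re s}" ?S "\<lambda>s. f s - g s" "\<lambda>_. 0"] assms
    by (auto intro!: holomorphic_intros)
  then show ?thesis by simp
qed

lemma acv_unique:
  assumes "acv F v" "acv F w"
  shows "v = w"
proof -
  obtain e g c where 1: "e > 0" "g holomorphic_on {s. - e < Re s}" "\<And>s. c < Re s \<Longrightarrow> g s = F s" "g 0 = v"
    using assms(1) unfolding acv_def by blast
  obtain e' g' c' where 2: "e' > 0" "g' holomorphic_on {s. - e' < Re s}" "\<And>s. c' < Re s \<Longrightarrow> g' s = F s" "g' 0 = w"
    using assms(2) unfolding acv_def by blast
  let ?e = "min e e'"
  have "g 0 = g' 0"
    by (rule holomorphic_eq_on_halfplane[of g "- ?e" g' "max c c'"])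
       (use 1 2 in \<open>auto intro: holomorphic_on_subset\<close>)
  then show ?thesis using 1 2 by simp
qed

text \<open>The bridge from the relation \<open>acv\<close> to the definite description in
  \<open>acont0\<close>. The relation combines linearly, whereas for \<open>acont0\<close> existence
  would have to be known before each step.\<close>

lemma acont0_eq:
  assumes "acv F v"
  shows "acont0 F = v"
proof -
  have "acont0 F = (THE v. acv F v)" by (simp add: acont0_def acv_def)
  also have "\<dots> = v" using assms acv_unique by blast
  finally show ?thesis .
qed

text \<open>Agreement far to the right suffices, so an integral may be replaced by a formula that
  has been verified only where everything converges absolutely.\<close>

lemma acv_cong:
  assumes "acv F v" "\<And>s. c < Re s \<Longrightarrow> F s = G s"
  shows "acv G v"
proof -
  obtain e g d where 1: "e > 0" "g holomorphic_on {s. - e < Re s}" "\<And>s. d < Re s \<Longrightarrow> g s = F s" "g 0 = v"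
    using assms(1) unfolding acv_def by blast
  show ?thesis
    by (rule acvI[of e g "max c d"]) (use 1 assms in auto)
qed

lemma acv_zero: "acv (\<lambda>s. 0) 0"
  by (rule acvI[of 1 "\<lambda>s. 0"]) auto

lemma acv_cmult:
  assumes "acv F v"
  shows "acv (\<lambda>s. k * F s) (k * v)"
proof -
  obtain e g d where 1: "e > 0" "g holomorphic_on {s. - e < Re s}" "\<And>s. d < Re s \<Longrightarrow> g s = F s" "g 0 = v"
    using assms(1) unfolding acv_def by blast
  show ?thesis
    by (rule acvI[of e "\<lambda>s. k * g s" d]) (use 1 in \<open>auto intro!: holomorphic_intros\<close>)
qed

lemma acv_add:
  assumes "acv F v" "acv G w"
  shows "acv (\<lambda>s. F s + G s) (v + w)"
proof -
  obtain e g d where 1: "e > 0" "g holomorphic_on {s. - e < Re s}" "\<And>s. d < Re s \<Longrightarrow> g s = F s" "g 0 = v"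
    using assms(1) unfolding acv_def by blast
  obtain e' g' d' where 2: "e' > 0" "g' holomorphic_on {s. - e' < Re s}" "\<And>s. d' < Re s \<Longrightarrow> g' s = G s" "g' 0 = w"
    using assms(2) unfolding acv_def by blast
  have "g holomorphic_on {s. - min e e' < Re s}" "g' holomorphic_on {s. - min e e' < Re s}"
    using 1(2) 2(2) by (auto elim!: holomorphic_on_subset)
  then show ?thesis
    by (intro acvI[of "min e e'" "\<lambda>s. g s + g' s" "max d d'"]) (use 1 2 in \<open>auto intro!: holomorphic_intros\<close>)
qed

lemma acv_sum:
  assumes "\<And>i. i \<in> I \<Longrightarrow> acv (F i) (v i)"
  shows "acv (\<lambda>s. \<Sum>i\<in>I. F i s) (\<Sum>i\<in>I. v i)"
  using assms
  by (induction I rule: infinite_finite_induct) (auto intro: acv_zero acv_add)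

section \<open>Differentiation of powers under the integral sign\<close>

lemma abs_ln_mult_powr_le:
  fixes y d :: real
  assumes "y > 0" "d > 0"
  shows "\<bar>ln y\<bar> \<le> (y powr d + y powr (- d)) / d"
proof -
  have "d * \<bar>ln y\<bar> \<le> exp (d * \<bar>ln y\<bar>)"
    using exp_ge_add_one_self[of "d * \<bar>ln y\<bar>"] by linarith
  also have "\<dots> \<le> y powr d + y powr (- d)"
    using assms by (cases "ln y \<ge> 0") (auto simp: powr_def)
  finally show ?thesis using assms by (simp add: field_simps)
qed

lemma norm_exp_diff_quotient_le:
  fixes u h :: complex
  assumes "h \<noteq> 0"
  shows "norm ((exp (h * u) - 1) / h) \<le> norm u * exp (norm h * norm u)"
proof -
  have "norm (exp (h * u) - exp 0) \<le> exp (norm h * norm u) * norm (h * u - 0)"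
  proof (rule field_differentiable_bound[where S="cball 0 (norm (h*u))" and f'=exp])
    show "cmod (exp z) \<le> exp (cmod h * cmod u)" if "z \<in> cball 0 (cmod (h * u))" for z
      using that abs_Re_le_cmod[of z] by (auto simp: norm_mult)
  qed (auto intro!: derivative_eq_intros)
  then show ?thesis using assms by (simp add: norm_divide norm_mult field_simps)
qed

text \<open>On the support of \<open>h\<close> the base is bounded, so raising the exponent from
  \<open>a\<close> to \<open>Re s\<close> costs a constant; where \<open>N\<close> is 0 both
  integrands are 0 by the convention for \<open>powr\<close>.\<close>

lemma integrable_powr_mult:
  fixes N :: "'a \<Rightarrow> real" and h :: "'a \<Rightarrow> complex"
  assumes [measurable]: "N \<in> borel_measurable M" "h \<in> borel_measurable M"
    and N: "\<And>x. 0 \<le> N x" "\<And>x. h x \<noteq> 0 \<Longrightarrow> N x \<le> C"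
    and int: "integrable M (\<lambda>x. N x powr a * norm (h x))" and s: "a \<le> Re s"
  shows "integrable M (\<lambda>x. of_real (N x) powr s * h x)"
proof (rule Bochner_Integration.integrable_bound)
  define K where "K = max C 1"
  show "integrable M (\<lambda>x. K powr (Re s - a) * (N x powr a * norm (h x)))"
    using int by (intro integrable_mult_right)
  show "AE x in M. norm (of_real (N x) powr s * h x) \<le> norm (K powr (Re s - a) * (N x powr a * norm (h x)))"
  proof (rule AE_I2)
    fix x
    show "norm (of_real (N x) powr s * h x) \<le> norm (K powr (Re s - a) * (N x powr a * norm (h x)))"
    proof (cases "N x = 0 \<or> h x = 0")
      case False
      have "N x powr Re s = N x powr (Re s - a) * N x powr a" by (simp flip: powr_add)
      also have "N x powr (Re s - a) \<le> K powr (Re s - a)"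
        using N[of x] s False by (intro powr_mono2) (auto simp: K_def)
      finally have "N x powr Re s * norm (h x) \<le> K powr (Re s - a) * N x powr a * norm (h x)"
        by (simp add: mult_right_mono)
      then show ?thesis using N(1)[of x] by (simp add: norm_mult norm_powr_real_powr mult.assoc)
    qed auto
  qed
qed measurable

text \<open>Difference quotients of \<open>N powr s\<close> are dominated by
  \<open>N powr Re s\<close> times \<open>|ln N|\<close> times an exponential in
  \<open>|ln N|\<close>. Up to constants the last two factors are at most a sum of two small powers
  of \<open>N\<close> each, so the single hypothesis at exponent \<open>a\<close> dominates
  everything.\<close>

lemma holomorphic_integral_powr:
  fixes N :: "'a \<Rightarrow> real" and h :: "'a \<Rightarrow> complex"
  assumes [measurable]: "N \<in> borel_measurable M" "h \<in> borel_measurable M"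
    and N: "\<And>x. 0 \<le> N x" "\<And>x. N x \<le> C"
    and int: "integrable M (\<lambda>x. N x powr a * norm (h x))"
  shows "(\<lambda>s. \<integral>x. of_real (N x) powr s * h x \<partial>M) holomorphic_on {s. a < Re s}"
proof -
  define K where "K = max C 1"
  have K: "K \<ge> 1" "\<And>x. N x \<le> K" using N by (auto simp: K_def intro: max.coboundedI1)
  have pw: "(N x) powr b \<le> K powr (b - a) * N x powr a" if "b \<ge> a" for b x
  proof (cases "N x = 0")
    case False
    have "N x powr b = N x powr (b - a) * N x powr a" by (simp flip: powr_add)
    also have "N x powr (b - a) \<le> K powr (b - a)"
      using K N that by (intro powr_mono2) auto
    finally show ?thesis by (simp add: mult_right_mono)
  qed auto
  have nrm: "norm (of_real (N x) powr s :: complex) = N x powr Re s" for x s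
    using N[of x] by (simp add: norm_powr_real_powr)
  have intg: "integrable M (\<lambda>x. of_real (N x) powr s * h x)" if "a < Re s" for s
    using integrable_powr_mult[OF assms(1,2) N int] that by simp
  have "((\<lambda>s. \<integral>x. of_real (N x) powr s * h x \<partial>M) has_field_derivative
          (\<integral>x. of_real (ln (N x)) * of_real (N x) powr s * h x \<partial>M)) (at s)" if s: "a < Re s" for s
  proof -
    \<comment> \<open>A quarter of the distance to \<open>a\<close>: two factors
      \<open>N powr (- d)\<close> then still leave an exponent above \<open>a\<close>.\<close>
    define d where "d = (Re s - a) / 4"
    have d: "d > 0" using s by (simp add: d_def)
    define q where "q h' x = ((of_real (N x) powr (s + h') * h x - of_real (N x) powr s * h x) / h')" for h' x
    \<comment> \<open>Expanding \<open>(N powr d + N powr (- d))^2\<close> gives four powers, each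
      at most \<open>K powr (6*d)\<close> times \<open>N powr a\<close>; the largest exponent
      \<open>Re s + 2*d\<close> exceeds \<open>a\<close> by exactly \<open>6*d\<close>.\<close>
    let ?W = "\<lambda>x. (1/d) * (4 * K powr (6*d)) * (N x powr a * norm (h x))"
    have qb: "norm (q h' x) \<le> ?W x"
      if h': "h' \<noteq> 0" "norm h' < d" for h' x
    proof (cases "N x = 0")
      case True then show ?thesis using K d by (simp add: q_def)
    next
      case False
      then have Nx: "N x > 0" using N[of x] by simp
      define u where "u = (of_real (ln (N x)) :: complex)"
      have pe: "of_real (N x) powr t = exp (t * u)" for t :: complex
        using Nx by (auto simp: powr_def u_def Ln_of_real)
      have qe: "q h' x = of_real (N x) powr s * ((exp (h' * u) - 1) / h') * h x"
        by (simp add: q_def pe exp_add[symmetric] field_simps)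
      have "norm (q h' x) = N x powr Re s * norm ((exp (h' * u) - 1) / h') * norm (h x)"
        unfolding qe norm_mult nrm ..
      also have "\<dots> \<le> N x powr Re s * (norm u * exp (norm h' * norm u)) * norm (h x)"
        by (intro mult_right_mono mult_left_mono norm_exp_diff_quotient_le h') auto
      also have "\<dots> \<le> N x powr Re s * (((N x powr d + N x powr (-d))/d) * (N x powr d + N x powr (-d))) * norm (h x)"
      proof (intro mult_right_mono mult_left_mono mult_mono)
        show "norm u \<le> (N x powr d + N x powr (-d))/d"
          using abs_ln_mult_powr_le[OF Nx d] by (simp add: u_def)
        have "norm h' * \<bar>ln (N x)\<bar> \<le> d * \<bar>ln (N x)\<bar>" using h' by (intro mult_right_mono) auto
        then have "exp (norm h' * norm u) \<le> exp (d * \<bar>ln (N x)\<bar>)" by (simp add: u_def)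
        also have "\<dots> \<le> N x powr d + N x powr (-d)"
          using Nx d by (cases "ln (N x) \<ge> 0") (auto simp: powr_def)
        finally show "exp (norm h' * norm u) \<le> N x powr d + N x powr (-d)" .
      qed (use d in auto)
      also have "\<dots> = (1/d) * (N x powr (Re s + 2*d) + N x powr (Re s) + N x powr (Re s) + N x powr (Re s - 2*d)) * norm (h x)"
      proof -
        have "N x powr (Re s + 2*d) = N x powr Re s * N x powr d * N x powr d"
          unfolding powr_add[symmetric] by (rule arg_cong[where f="\<lambda>t. N x powr t"]) simp
        moreover have "N x powr Re s * N x powr d * N x powr -d = N x powr (Re s)"
          unfolding powr_add[symmetric] by (rule arg_cong[where f="\<lambda>t. N x powr t"]) simp
        moreover have "N x powr (Re s - 2*d) = N x powr Re s * N x powr -d * N x powr -d"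
          unfolding powr_add[symmetric] by (rule arg_cong[where f="\<lambda>t. N x powr t"]) simp
        ultimately show ?thesis by (simp add: algebra_simps add_divide_distrib)
      qed
      also have "\<dots> \<le> (1/d) * (K powr (Re s + 2*d - a) * N x powr a + K powr (Re s - a) * N x powr a + K powr (Re s - a) * N x powr a + K powr (Re s - 2*d-a) * N x powr a) * norm (h x)"
        using d by (intro mult_right_mono mult_left_mono add_mono pw) (auto simp: d_def field_simps)
      also have "\<dots> \<le> (1/d) * (K powr (6*d) * N x powr a + K powr (6*d) * N x powr a + K powr (6*d) * N x powr a + K powr (6*d) * N x powr a) * norm (h x)"
        using d K by (intro mult_right_mono mult_left_mono add_mono powr_mono) (auto simp: d_def field_simps)
      finally show ?thesis by (simp add: algebra_simps)
    qed
    have lim: "(\<lambda>i. \<integral>x. q (X i) x \<partial>M) \<longlonglongrightarrow> (\<integral>x. of_real (ln (N x)) * of_real (N x) powr s * h x \<partial>M)"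
      if X: "\<And>i. X i \<noteq> 0" "\<And>i. norm (X i) < d" "X \<longlonglongrightarrow> 0" for X
    proof (rule integral_dominated_convergence[where w="?W"])
      show "AE x in M. (\<lambda>i. q (X i) x) \<longlonglongrightarrow> of_real (ln (N x)) * of_real (N x) powr s * h x"
      proof (rule AE_I2)
        fix x
        show "(\<lambda>i. q (X i) x) \<longlonglongrightarrow> of_real (ln (N x)) * of_real (N x) powr s * h x"
        proof (cases "N x = 0")
          case False
          then have Nx: "N x > 0" using N[of x] by simp
          have "((\<lambda>s. of_real (N x) powr s * h x) has_field_derivative of_real (ln (N x)) * of_real (N x) powr s * h x) (at s)"
            using Nx by (auto intro!: derivative_eq_intros simp: Ln_of_real)
          then have "((\<lambda>h'. q h' x) \<longlongrightarrow> of_real (ln (N x)) * of_real (N x) powr s * h x) (at 0)"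
            by (simp add: DERIV_def q_def)
          then show ?thesis
            unfolding tendsto_at_iff_sequentially o_def using X by blast
        qed (simp add: q_def)
      qed
      show "integrable M ?W" by (intro integrable_mult_right int)
      show "AE x in M. norm (q (X i) x) \<le> ?W x" for i
        using qb[OF X(1,2)] by simp
    qed (simp_all add: q_def)
    have qi: "(\<integral>x. q h' x \<partial>M) = ((\<integral>x. of_real (N x) powr (s + h') * h x \<partial>M) - (\<integral>x. of_real (N x) powr s * h x \<partial>M)) / h'"
      if "norm h' < d" for h'
    proof -
      have "a < Re (s + h')" using that abs_Re_le_cmod[of h'] s d by (simp add: d_def)
      then show ?thesis using intg s by (simp add: q_def)
    qed
    show ?thesis
      unfolding DERIV_def tendsto_at_iff_sequentially o_def
    proof (intro allI impI)
      fix X :: "nat \<Rightarrow> complex" assume X: "\<forall>i. X i \<in> UNIV - {0}" "X \<longlonglongrightarrow> 0"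
      from X(2) d obtain n0 where n0: "\<And>n. n \<ge> n0 \<Longrightarrow> norm (X n) < d"
        by (metis LIMSEQ_D diff_zero)
      have "(\<lambda>i. \<integral>x. q (X (i + n0)) x \<partial>M) \<longlonglongrightarrow> (\<integral>x. of_real (ln (N x)) * of_real (N x) powr s * h x \<partial>M)"
        using X n0 by (intro lim LIMSEQ_ignore_initial_segment) auto
      then have "(\<lambda>i. ((\<integral>x. of_real (N x) powr (s + X (i+n0)) * h x \<partial>M) - (\<integral>x. of_real (N x) powr s * h x \<partial>M)) / X (i+n0)) \<longlonglongrightarrow> (\<integral>x. of_real (ln (N x)) * of_real (N x) powr s * h x \<partial>M)"
        using n0 by (simp add: qi)
      then show "(\<lambda>i. ((\<integral>x. of_real (N x) powr (s + X i) * h x \<partial>M) - (\<integral>x. of_real (N x) powr s * h x \<partial>M)) / X i) \<longlonglongrightarrow> (\<integral>x. of_real (ln (N x)) * of_real (N x) powr s * h x \<partial>M)"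
        by (rule LIMSEQ_offset)
    qed
  qed
  then show ?thesis
    by (intro holomorphic_onI) (auto simp: field_differentiable_def intro: has_field_derivative_at_within)
qed

text \<open>The value keeps the factor with exponent 0: since \<open>0 powr 0\<close> is 0, it may
  not be dropped at zeros of \<open>N\<close>.\<close>

lemma acv_integral_powr:
  fixes N :: "'a \<Rightarrow> real" and h :: "'a \<Rightarrow> complex"
  assumes [measurable]: "N \<in> borel_measurable M" "h \<in> borel_measurable M"
    and N: "\<And>x. 0 \<le> N x" "\<And>x. h x \<noteq> 0 \<Longrightarrow> N x \<le> C"
    and e: "e > 0" and int: "integrable M (\<lambda>x. N x powr (- e) * norm (h x))"
  shows "acv (\<lambda>s. \<integral>x. of_real (N x) powr s * h x \<partial>M) (\<integral>x. of_real (N x) powr 0 * h x \<partial>M)"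
proof -
  \<comment> \<open>Resetting the base to 0 off the support of \<open>h\<close> makes it globally
    bounded and changes no integrand.\<close>
  define N' where "N' x = (if h x = 0 then 0 else N x)" for x
  have eq: "of_real (N' x) powr s * h x = of_real (N x) powr s * h x" for s x
    by (simp add: N'_def)
  have "(\<lambda>s. \<integral>x. of_real (N' x) powr s * h x \<partial>M) holomorphic_on {s. - e < Re s}"
  proof (rule holomorphic_integral_powr)
    show "N' \<in> borel_measurable M" unfolding N'_def by measurable
    have "(\<lambda>x. N' x powr (- e) * norm (h x)) = (\<lambda>x. N x powr (- e) * norm (h x))"
      by (auto simp: N'_def)
    then show "integrable M (\<lambda>x. N' x powr (- e) * norm (h x))" using int by (simp only:)
    show "N' x \<le> max C 0" for x using N(2) by (auto simp: N'_def intro: max.coboundedI1)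
  qed (use N in \<open>auto simp: N'_def\<close>)
  then show ?thesis
    unfolding eq by (rule acvI[OF e]) (rule refl)+
qed

lemma acv_mult_0:
  assumes "acv F v"
  shows "acv (\<lambda>s. s * F s) 0"
proof -
  obtain e g d where 1: "e > 0" "g holomorphic_on {s. - e < Re s}" "\<And>s. d < Re s \<Longrightarrow> g s = F s" "g 0 = v"
    using assms(1) unfolding acv_def by blast
  show ?thesis
    by (rule acvI[of e "\<lambda>s. s * g s" d]) (use 1 in \<open>auto intro!: holomorphic_intros\<close>)
qed

section \<open>Lebesgue measure on complex n-space\<close>

lemma prod_Basis_vec:
  "(\<Prod>b\<in>(Basis :: ('a::euclidean_space^'n) set). f b) = (\<Prod>i\<in>UNIV. \<Prod>u\<in>Basis. f (axis i u))"
proof -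
  have "(Basis :: ('a^'n) set) = (\<lambda>(i,u). axis i u) ` (UNIV \<times> Basis)"
    by (auto simp: Basis_vec_def)
  moreover have "inj_on (\<lambda>(i,u). axis i u :: 'a^'n) (UNIV \<times> Basis)"
    by (auto simp: inj_on_def axis_eq_axis nonzero_Basis)
  ultimately have "(\<Prod>b\<in>(Basis :: ('a::euclidean_space^'n) set). f b) = (\<Prod>(i,u)\<in>UNIV \<times> Basis. f (axis i u))"
    using prod.reindex[of "\<lambda>(i,u). axis i u :: 'a^'n" "UNIV \<times> Basis" f] by (simp only: o_def case_prod_unfold)
  then show ?thesis by (simp add: prod.cartesian_product)
qed

lemma mem_box_vec:
  fixes x :: "'a::euclidean_space^'n"
  shows "x \<in> box l u \<longleftrightarrow> (\<forall>i. x$i \<in> box (l$i) (u$i))"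
  by (auto simp: mem_box Basis_vec_def inner_axis)

lemma vec_lambda_measurable [measurable]:
  fixes f :: "'n::finite \<Rightarrow> 'b \<Rightarrow> 'a::euclidean_space"
  assumes [measurable]: "\<And>i. f i \<in> borel_measurable M"
  shows "(\<lambda>x. \<chi> i. f i x) \<in> borel_measurable M"
  by (subst borel_measurable_euclidean_space) (auto simp: Basis_vec_def inner_axis)

lemma vec_nth_borel [measurable]: "(\<lambda>z. z $ i) \<in> borel_measurable (borel :: ('a::euclidean_space^'n) measure)"
  by (intro borel_measurable_continuous_onI continuous_intros)

lemma emeasure_lborel_box_vec:
  fixes l u :: "'a::euclidean_space^'n"
  assumes "\<And>b. b \<in> Basis \<Longrightarrow> l \<bullet> b \<le> u \<bullet> b"
  shows "(\<Prod>i\<in>UNIV. emeasure lborel (box (l$i) (u$i))) = ennreal (\<Prod>b\<in>Basis. (u - l) \<bullet> b)"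
proof -
  have le: "l$i \<bullet> b \<le> u$i \<bullet> b" if "b \<in> Basis" for i b
    using assms[of "axis i b"] that by (simp add: inner_axis)
  have "emeasure lborel (box (l$i) (u$i)) = ennreal (\<Prod>b\<in>Basis. (u$i - l$i) \<bullet> b)" for i
    using le by (intro emeasure_lborel_box) auto
  moreover have "0 \<le> (\<Prod>b\<in>Basis. (u$i - l$i) \<bullet> b)" for i
    using le by (intro prod_nonneg) (auto simp: inner_diff_left)
  ultimately have "(\<Prod>i\<in>UNIV. emeasure lborel (box (l$i) (u$i))) = ennreal (\<Prod>i\<in>UNIV. \<Prod>b\<in>Basis. (u$i - l$i) \<bullet> b)"
    by (simp add: prod_ennreal)
  then show ?thesis by (simp add: prod_Basis_vec inner_axis)
qed

text \<open>Boxes determine Lebesgue measure, and a box of vectors is a product of boxes. This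
  carries the product measure theory of \<open>Pi\<^sub>M\<close> over to the vector type.\<close>

lemma lborel_eq_distr_PiM:
  "lborel = distr (Pi\<^sub>M UNIV (\<lambda>_. lborel)) borel (\<lambda>f. \<chi> i. f i :: 'a::euclidean_space^'n)"
proof (rule lborel_eqI)
  interpret product_sigma_finite "\<lambda>_::'n. lborel :: 'a measure"
    by standard
  fix l u :: "'a^'n" assume lu: "\<And>b. b \<in> Basis \<Longrightarrow> l \<bullet> b \<le> u \<bullet> b"
  have "emeasure (distr (Pi\<^sub>M UNIV (\<lambda>_. lborel)) borel (\<lambda>f. \<chi> i. f i)) (box l u)
      = emeasure (Pi\<^sub>M UNIV (\<lambda>_. lborel)) ((\<lambda>f. \<chi> i. f i) -` box l u \<inter> space (Pi\<^sub>M UNIV (\<lambda>_. lborel)))"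
    by (rule emeasure_distr) auto
  also have "(\<lambda>f. \<chi> i. f i) -` box l u \<inter> space (Pi\<^sub>M UNIV (\<lambda>_. lborel)) = Pi\<^sub>E UNIV (\<lambda>i. box (l$i) (u$i))"
    by (auto simp: mem_box_vec space_PiM PiE_def Pi_def)
  also have "emeasure (Pi\<^sub>M UNIV (\<lambda>_. lborel)) (Pi\<^sub>E UNIV (\<lambda>i. box (l$i) (u$i))) = (\<Prod>i\<in>UNIV. emeasure lborel (box (l$i) (u$i)))"
    by (rule emeasure_PiM) auto
  finally show "emeasure (distr (Pi\<^sub>M UNIV (\<lambda>_. lborel)) borel (\<lambda>f. \<chi> i. f i)) (box l u) = ennreal (\<Prod>b\<in>Basis. (u - l) \<bullet> b)"
    using emeasure_lborel_box_vec[OF lu] by simp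
qed simp

lemma integrable_prod_vec:
  fixes f :: "'n::finite \<Rightarrow> 'a::euclidean_space \<Rightarrow> real"
  assumes "\<And>i. integrable lborel (f i)"
  shows "integrable lborel (\<lambda>z::'a^'n. \<Prod>i\<in>UNIV. f i (z$i))"
proof -
  interpret product_sigma_finite "\<lambda>_::'n. lborel :: 'a measure"
    by standard
  have [measurable]: "f i \<in> borel_measurable borel" for i
    using borel_measurable_integrable[OF assms[of i]] by simp
  show ?thesis
    by (subst lborel_eq_distr_PiM, subst integrable_distr_eq)
       (auto intro!: product_integrable_prod assms)
qed

text \<open>Maps preserving the measure in each component preserve the volume of product boxes. Used
  with a rotation in one coordinate and the identity in the others.\<close>

lemma lborel_distr_componentwise:
  fixes T :: "'n::finite \<Rightarrow> 'a::euclidean_space \<Rightarrow> 'a"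
  assumes [measurable]: "\<And>i. T i \<in> borel_measurable borel" and T: "\<And>i. distr lborel borel (T i) = lborel"
  shows "distr lborel borel (\<lambda>z::'a^'n. \<chi> i. T i (z$i)) = lborel"
proof (rule sym, rule lborel_eqI)
  interpret product_sigma_finite "\<lambda>_::'n. lborel :: 'a measure"
    by standard
  fix l u :: "'a^'n" assume lu: "\<And>b. b \<in> Basis \<Longrightarrow> l \<bullet> b \<le> u \<bullet> b"
  have "emeasure (distr lborel borel (\<lambda>z::'a^'n. \<chi> i. T i (z$i))) (box l u)
      = emeasure lborel ((\<lambda>z::'a^'n. \<chi> i. T i (z$i)) -` box l u \<inter> space lborel)"
    by (rule emeasure_distr) auto
  also have "\<dots> = emeasure (Pi\<^sub>M UNIV (\<lambda>_. lborel)) ((\<lambda>f. \<chi> i. f i) -` ((\<lambda>z::'a^'n. \<chi> i. T i (z$i)) -` box l u \<inter> space lborel) \<inter> space (Pi\<^sub>M UNIV (\<lambda>_. lborel)))"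
    by (subst lborel_eq_distr_PiM, rule emeasure_distr) (auto intro!: measurable_sets_borel[where M=borel])
  also have "(\<lambda>f. \<chi> i. f i) -` ((\<lambda>z::'a^'n. \<chi> i. T i (z$i)) -` box l u \<inter> space lborel) \<inter> space (Pi\<^sub>M UNIV (\<lambda>_. lborel)) = Pi\<^sub>E UNIV (\<lambda>i. T i -` box (l$i) (u$i))"
    by (auto simp: mem_box_vec space_PiM PiE_def Pi_def)
  also have "emeasure (Pi\<^sub>M UNIV (\<lambda>_. lborel)) (Pi\<^sub>E UNIV (\<lambda>i. T i -` box (l$i) (u$i))) = (\<Prod>i\<in>UNIV. emeasure lborel (T i -` box (l$i) (u$i)))"
    by (rule emeasure_PiM) (auto intro!: measurable_sets_borel[where M=borel])
  also have "\<dots> = (\<Prod>i\<in>UNIV. emeasure (distr lborel borel (T i)) (box (l$i) (u$i)))"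
    by (intro prod.cong refl, subst emeasure_distr) auto
  finally show "emeasure (distr lborel borel (\<lambda>z::'a^'n. \<chi> i. T i (z$i))) (box l u) = ennreal (\<Prod>b\<in>Basis. (u - l) \<bullet> b)"
    using emeasure_lborel_box_vec[OF lu] by (simp add: T)
qed simp

text \<open>Scaling by a different factor in each coordinate; the Jacobian is \<open>r i ^ 2\<close>
  per complex coordinate. The Euler identity rests on these weighted dilations.\<close>

lemma lborel_scale_componentwise:
  fixes r :: "'n::finite \<Rightarrow> real"
  assumes r: "\<And>i. r i > 0"
  shows "lborel = density (distr lborel borel (\<lambda>z::'a::euclidean_space^'n. \<chi> i. r i *\<^sub>R z$i)) (\<lambda>_. \<Prod>i\<in>UNIV. r i ^ DIM('a))"
proof (rule lborel_eqI)
  fix l u :: "'a^'n" assume lu: "\<And>b. b \<in> Basis \<Longrightarrow> l \<bullet> b \<le> u \<bullet> b"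
  let ?l = "\<chi> i. l$i /\<^sub>R r i" and ?u = "\<chi> i. u$i /\<^sub>R r i"
  have "(\<lambda>z::'a^'n. \<chi> i. r i *\<^sub>R z$i) -` box l u = box ?l ?u"
    using r by (auto simp: mem_box_vec mem_box field_simps)
  moreover have "?l \<bullet> b \<le> ?u \<bullet> b" if b: "b \<in> Basis" for b
  proof -
    obtain i v where "b = axis i v" "v \<in> Basis" using b by (auto simp: Basis_vec_def)
    then show ?thesis using lu[of "axis i v"] b r[of i] by (auto simp: inner_axis intro: divide_right_mono)
  qed
  moreover have "(\<Prod>i\<in>UNIV. r i ^ DIM('a)) * (\<Prod>b\<in>Basis. (?u - ?l) \<bullet> b) = (\<Prod>b\<in>Basis. (u - l) \<bullet> b)"
    unfolding prod_Basis_vec prod.distrib[symmetric]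
  proof (intro prod.cong refl)
    fix i :: 'n
    have "r i ^ DIM('a) = (\<Prod>b\<in>(Basis::'a set). r i)" by simp
    then have "r i ^ DIM('a) * (\<Prod>v\<in>Basis. (?u - ?l) \<bullet> axis i v) = (\<Prod>v\<in>Basis. r i * ((?u - ?l) \<bullet> axis i v))"
      by (simp only: prod.distrib)
    also have "\<dots> = (\<Prod>v\<in>Basis. (u - l) \<bullet> axis i v)"
      using r[of i] by (intro prod.cong refl) (auto simp: inner_axis inner_diff_left field_simps)
    finally show "r i ^ DIM('a) * (\<Prod>v\<in>Basis. (?u - ?l) \<bullet> axis i v) = (\<Prod>v\<in>Basis. (u - l) \<bullet> axis i v)" .
  qed
  ultimately show "emeasure (density (distr lborel borel (\<lambda>z::'a^'n. \<chi> i. r i *\<^sub>R z$i)) (\<lambda>_. \<Prod>i\<in>UNIV. r i ^ DIM('a))) (box l u)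
        = ennreal (\<Prod>b\<in>Basis. (u - l) \<bullet> b)"
    using r by (simp add: emeasure_density nn_integral_cmult emeasure_distr emeasure_lborel_box
          ennreal_mult'[symmetric] prod_nonneg less_imp_le)
qed simp

lemma integral_scale_componentwise:
  fixes r :: "'n::finite \<Rightarrow> real" and g :: "'a::euclidean_space^'n \<Rightarrow> complex"
  assumes r: "\<And>i. r i > 0" and [measurable]: "g \<in> borel_measurable borel"
  shows "(\<integral>z. g z \<partial>lborel) = (\<Prod>i\<in>UNIV. r i ^ DIM('a)) * (\<integral>z. g (\<chi> i. r i *\<^sub>R z$i) \<partial>lborel)"
proof -
  have "(\<integral>z. g z \<partial>lborel) = (\<integral>z. g z \<partial>density (distr lborel borel (\<lambda>z::'a^'n. \<chi> i. r i *\<^sub>R z$i)) (\<lambda>_. \<Prod>i\<in>UNIV. r i ^ DIM('a)))"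
    by (subst lborel_scale_componentwise[where r=r, OF r]) (rule refl)
  also have "\<dots> = (\<integral>z. (\<Prod>i\<in>UNIV. r i ^ DIM('a)) *\<^sub>R g z \<partial>distr lborel borel (\<lambda>z::'a^'n. \<chi> i. r i *\<^sub>R z$i))"
    by (subst integral_density) (auto simp: prod_nonneg less_imp_le r)
  also have "\<dots> = (\<Prod>i\<in>UNIV. r i ^ DIM('a)) * (\<integral>z. g (\<chi> i. r i *\<^sub>R z$i) \<partial>lborel)"
    by (subst integral_distr) (auto simp: scaleR_conv_of_real)
  finally show ?thesis .
qed

text \<open>Invariance is imported from orthogonal maps of \<open>real^2\<close>, with which the
  plane is identified by the measure-preserving bijection \<open>V\<close>.\<close>

lemma lborel_complex_rotate:
  fixes c :: complex
  assumes c: "norm c = 1"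
  shows "distr lborel borel (\<lambda>w. c * w) = lborel"
proof -
  define V :: "real^2 \<Rightarrow> complex" where "V x = Complex (x$1) (x$2)" for x
  define W :: "complex \<Rightarrow> real^2" where "W w = vector [Re w, Im w]" for w
  have VW: "V (W w) = w" and WV: "W (V x) = x" for w x
    by (auto simp: V_def W_def Finite_Cartesian_Product.vec_eq_iff forall_2)
  have V1: "V x \<in> box l u \<longleftrightarrow> x \<in> box (W l) (W u)" for x l u
    by (auto simp: V_def W_def mem_box Basis_complex_def Basis_vec_def inner_axis forall_2)
  have Vm: "V \<in> borel_measurable borel"
    unfolding V_def Complex_eq by measurable
  have V: "lborel = distr lborel borel V"
  proof (rule lborel_eqI)
    fix l u :: complex assume lu: "\<And>b. b \<in> Basis \<Longrightarrow> l \<bullet> b \<le> u \<bullet> b"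
    have "V -` box l u = box (W l) (W u)" using V1 by auto
    moreover have "W l \<bullet> b \<le> W u \<bullet> b" if "b \<in> Basis" for b
      using that lu[of 1] lu[of \<i>] by (auto simp: W_def Basis_vec_def inner_axis Basis_complex_def exhaust_2 vector_2 forall_2) (metis (full_types) exhaust_2 vector_2)
    ultimately show "emeasure (distr lborel borel V) (box l u) = (\<Prod>b\<in>Basis. (u - l) \<bullet> b)"
      using Vm by (simp add: emeasure_distr emeasure_lborel_box prod_Basis_vec inner_axis UNIV_2 Basis_complex_def W_def)
  qed simp
  \<comment> \<open>Invariance under orthogonal maps is a statement about images, whereas a
    push-forward asks for a preimage; hence the inverse rotation, by the conjugate of
    \<open>c\<close>.\<close>
  define R where "R x = W (cnj c * V x)" for x
  have orth: "orthogonal_transformation R"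
  proof -
    have lin: "linear R"
      by (auto intro!: linearI simp: R_def V_def W_def Finite_Cartesian_Product.vec_eq_iff forall_2 algebra_simps)
    have nrm: "norm (V x) = norm x" for x
      by (simp add: V_def norm_vec_def L2_set_def sum_2 cmod_def)
    have "norm (R x) = norm x" for x
      using nrm[of "R x"] nrm[of x] c by (simp add: R_def VW norm_mult)
    with lin show ?thesis by (simp add: orthogonal_transformation)
  qed
  have cc: "cnj c * c = 1" using c by (metis complex_norm_square mult.commute of_real_1 power_one)
  have [measurable]: "V \<in> borel_measurable borel" by (fact Vm)
  show ?thesis
  proof (rule sym, rule lborel_eqI)
    fix l u :: complex assume lu: "\<And>b. b \<in> Basis \<Longrightarrow> l \<bullet> b \<le> u \<bullet> b"
    have *: "V -` ((\<lambda>w. c * w) -` box l u) = R ` (V -` box l u)"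
    proof (intro equalityI subsetI)
      fix x assume "x \<in> V -` ((\<lambda>w. c * w) -` box l u)"
      moreover have "x = R (W (c * V x))" by (simp add: R_def VW WV cc mult.assoc[symmetric])
      ultimately show "x \<in> R ` (V -` box l u)" by (auto simp: VW image_iff intro!: exI[of _ "W (c * V x)"])
    next
      fix x assume "x \<in> R ` (V -` box l u)"
      then show "x \<in> V -` ((\<lambda>w. c * w) -` box l u)"
        using cc by (auto simp: R_def VW mult.assoc[symmetric] mult.commute)
    qed
    have bx: "V -` box l u = box (W l) (W u)" using V1 by auto
    have "emeasure (distr lborel borel (\<lambda>w. c * w)) (box l u) = emeasure (distr lborel borel V) ((\<lambda>w. c * w) -` box l u)"
      by (subst emeasure_distr) (auto simp flip: V)
    also have "\<dots> = emeasure lborel (V -` ((\<lambda>w. c * w) -` box l u))"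
      by (subst emeasure_distr) (auto intro!: measurable_sets_borel[where M=borel])
    also have "\<dots> = emeasure lebesgue (R ` (V -` box l u))"
    proof -
      have "V -` ((\<lambda>w. c * w) -` box l u) \<in> sets borel"
        by (auto intro!: measurable_sets_borel[where M=borel])
      then show ?thesis using * by simp
    qed
    also have "\<dots> = emeasure lebesgue (V -` box l u)"
      unfolding bx using measurable_orthogonal_image[OF orth, of "box (W l) (W u)"] measure_orthogonal_image[OF orth, of "box (W l) (W u)"]
      by (simp add: emeasure_eq_measure2 fmeasurableD2 emeasure_eq_ennreal_measure)
    also have "\<dots> = emeasure (distr lborel borel V) (box l u)"
      by (simp add: bx emeasure_distr)
    also have "\<dots> = (\<Prod>b\<in>Basis. (u - l) \<bullet> b)"
      using lu by (simp flip: V)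
    finally show "emeasure (distr lborel borel (\<lambda>w. c * w)) (box l u) = (\<Prod>b\<in>Basis. (u - l) \<bullet> b)" .
  qed simp
qed

section \<open>Residue currents in one variable\<close>

lemma cnj_borel_measurable [measurable]: "cnj \<in> borel_measurable borel"
  by (intro borel_measurable_continuous_onI continuous_intros)

lemma pred_cball [measurable]: "Measurable.pred borel (\<lambda>x. x \<in> cball a r)"
proof -
  have "cball a r \<in> sets borel" by simp
  then show ?thesis by (simp add: pred_def del: mem_cball)
qed

text \<open>Polar coordinates without the angle: the disc \<open>|w|^2 \<le> b\<close> has area
  \<open>pi * b\<close>, so the squared modulus pushes area forward to \<open>pi\<close> times
  length on the half-line. Half-lines form an intersection-stable generator.\<close>

lemma distr_cmod_square:
  "distr lborel borel (\<lambda>w::complex. (cmod w)^2) = density lborel (\<lambda>y. ennreal (pi * indicator {0..} y))"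
proof -
  let ?E = "range (\<lambda>a::real. {..a})"
  let ?M = "distr lborel borel (\<lambda>w::complex. (cmod w)^2)"
  let ?N = "density lborel (\<lambda>y::real. ennreal (pi * indicator {0..} y))"
  have M: "emeasure ?M {..b} = ennreal (if b \<ge> 0 then pi * b else 0)" for b
  proof -
    have "(\<lambda>w::complex. (cmod w)^2) -` {..b} = (if b \<ge> 0 then cball 0 (sqrt b) else {})"
      by (auto simp: real_le_rsqrt order.trans[OF zero_le_power2] dest: sqrt_ge_absD intro: real_sqrt_ge_zero)
         (metis norm_ge_zero power2_le_iff_abs_le abs_of_nonneg real_sqrt_pow2 power_mono)
    then show ?thesis
      by (auto simp: emeasure_distr emeasure_cball unit_ball_vol_2)
  qed
  have N: "emeasure ?N {..b} = ennreal (if b \<ge> 0 then pi * b else 0)" for b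
  proof -
    have "emeasure ?N {..b} = (\<integral>\<^sup>+y. ennreal pi * indicator {0..b} y \<partial>lborel)"
      by (subst emeasure_density) (auto intro!: nn_integral_cong simp: indicator_def)
    then show ?thesis
      by (auto simp: nn_integral_cmult ennreal_mult'[symmetric])
  qed
  show ?thesis
  proof (rule measure_eqI_generator_eq[where E="?E" and \<Omega>=UNIV and A="\<lambda>i. {..real i}"])
    show "Int_stable ?E" by (auto simp: Int_stable_def)
    show "sets ?M = sigma_sets UNIV ?E" "sets ?N = sigma_sets UNIV ?E"
      by (simp_all add: borel_eq_atMost)
    show "(\<Union>i. {..real i}) = UNIV" using real_arch_simple by auto
  qed (auto simp: M N)
qed

lemma integrable_cmod_square:
  fixes g :: "real \<Rightarrow> complex"
  assumes [measurable]: "g \<in> borel_measurable borel"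
  shows "integrable lborel (\<lambda>w::complex. g ((cmod w)^2)) \<longleftrightarrow> integrable lborel (\<lambda>y. indicator {0..} y *\<^sub>R g y)"
    and "(\<integral>w. g ((cmod w)^2) \<partial>lborel) = pi * (\<integral>y. indicator {0..} y *\<^sub>R g y \<partial>lborel)"
proof -
  have "integrable lborel (\<lambda>w::complex. g ((cmod w)^2)) \<longleftrightarrow> integrable (density lborel (\<lambda>y. ennreal (pi * indicator {0..} y))) g"
    unfolding distr_cmod_square[symmetric] by (subst integrable_distr_eq) auto
  also have "\<dots> \<longleftrightarrow> integrable lborel (\<lambda>y. (pi * indicator {0..} y) *\<^sub>R g y)"
    by (subst integrable_density) auto
  also have "\<dots> \<longleftrightarrow> integrable lborel (\<lambda>y. indicator {0..} y *\<^sub>R g y)"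
  proof
    assume "integrable lborel (\<lambda>y. (pi * indicator {0..} y) *\<^sub>R g y)"
    then have "integrable lborel (\<lambda>y. (1/pi) *\<^sub>R ((pi * indicator {0..} y) *\<^sub>R g y))"
      by (intro integrable_scaleR_right)
    then show "integrable lborel (\<lambda>y. indicator {0..} y *\<^sub>R g y)" by simp
  next
    assume "integrable lborel (\<lambda>y. indicator {0..} y *\<^sub>R g y)"
    then have "integrable lborel (\<lambda>y. pi *\<^sub>R (indicator {0..} y *\<^sub>R g y))"
      by (intro integrable_scaleR_right)
    then show "integrable lborel (\<lambda>y. (pi * indicator {0..} y) *\<^sub>R g y)" by simp
  qed
  finally show "integrable lborel (\<lambda>w::complex. g ((cmod w)^2)) \<longleftrightarrow> integrable lborel (\<lambda>y. indicator {0..} y *\<^sub>R g y)" .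
  have "(\<integral>w. g ((cmod w)^2) \<partial>lborel) = (\<integral>y. g y \<partial>density lborel (\<lambda>y. ennreal (pi * indicator {0..} y)))"
    unfolding distr_cmod_square[symmetric] by (subst integral_distr) auto
  also have "\<dots> = (\<integral>y. (pi * indicator {0..} y) *\<^sub>R g y \<partial>lborel)"
    by (subst integral_density) auto
  finally show "(\<integral>w. g ((cmod w)^2) \<partial>lborel) = pi * (\<integral>y. indicator {0..} y *\<^sub>R g y \<partial>lborel)"
    unfolding scaleR_scaleR[symmetric] by (simp add: scaleR_conv_of_real)
qed

text \<open>With \<open>y = |w|^2\<close> the integrand becomes \<open>y powr (d - 1)\<close>,
  integrable at 0 because \<open>d > 0\<close>. Exponents are kept in the form
  \<open>2 * d - 2\<close> so that \<open>d\<close> is the power of \<open>|w|^2\<close> relative to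
  the measure \<open>dy / y\<close>.\<close>

lemma integrable_norm_powr_cball:
  fixes d R :: real
  assumes d: "d > 0" and R: "R \<ge> 0"
  shows "integrable lborel (\<lambda>w::complex. indicator (cball 0 R) w * cmod w powr (2 * d - 2))"
proof -
  define g where "g y = (of_real (indicator {0..R^2} y * y powr (d - 1)) :: complex)" for y
  have [measurable]: "g \<in> borel_measurable borel" unfolding g_def by measurable
  have "(\<lambda>y. y powr (d - 1)) absolutely_integrable_on {0..R^2}"
    by (rule nonnegative_absolutely_integrable_1) (use d integrable_on_powr_from_0[of "d-1" "R^2"] in auto)
  then have "integrable lebesgue (\<lambda>y. indicator {0..R^2} y *\<^sub>R (y powr (d - 1)))"
    by (simp add: set_integrable_def)
  then have "integrable lborel (\<lambda>y. indicator {0..R^2} y *\<^sub>R (y powr (d - 1)))"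
    by (subst (asm) integrable_completion) auto
  then have "integrable lborel (\<lambda>y. complex_of_real (indicator {0..R^2} y * y powr (d - 1)))"
    by (simp only: integrable_of_real real_scaleR_def)
  also have "(\<lambda>y. complex_of_real (indicator {0..R^2} y * y powr (d - 1))) = (\<lambda>y. indicator {0..} y *\<^sub>R g y)"
    by (auto simp: g_def indicator_def)
  finally have "integrable lborel (\<lambda>w::complex. g ((cmod w)^2))"
    by (subst integrable_cmod_square) auto
  also have "(\<lambda>w::complex. g ((cmod w)^2)) = (\<lambda>w. of_real (indicator (cball 0 R) w * cmod w powr (2 * d - 2)))"
  proof
    fix w :: complex
    have "(cmod w)^2 \<le> R^2 \<longleftrightarrow> cmod w \<le> R" using R by (simp add: power2_le_iff_abs_le)
    moreover have "((cmod w)^2) powr (d - 1) = cmod w powr (2 * d - 2)"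
    proof (cases "w = 0")
      case False
      then have "(cmod w)^2 = cmod w powr 2" by simp
      then have "((cmod w)^2) powr (d - 1) = cmod w powr (2 * (d - 1))" by (simp only: powr_powr)
      then show ?thesis by (simp add: algebra_simps)
    qed simp
    ultimately show "g ((cmod w)^2) = of_real (indicator (cball 0 R) w * cmod w powr (2 * d - 2))"
      by (auto simp: g_def indicator_def)
  qed
  finally show ?thesis by (simp only: integrable_of_real complex_of_real_integrable_eq)
qed

lemma unit_power_neq:
  fixes a b :: nat
  assumes "a \<noteq> b"
  obtains c :: complex where "norm c = 1" "c ^ a \<noteq> c ^ b"
proof
  \<comment> \<open>With this angle both multiples lie in \<open>[0, 1]\<close>, hence in
    \<open>[0, pi]\<close>, where the cosine is injective.\<close>
  let ?t = "1 / (1 + real a + real b)"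
  show "norm (cis ?t) = 1" by simp
  show "cis ?t ^ a \<noteq> cis ?t ^ b"
  proof
    define d where "d = 1 + real a + real b"
    have d: "d > 0" by (simp add: d_def add_pos_nonneg)
    assume "cis ?t ^ a = cis ?t ^ b"
    then have "cis (real a * (1/d)) = cis (real b * (1/d))" unfolding d_def by (simp only: Complex.DeMoivre)
    then have c: "cos (real a / d) = cos (real b / d)" by (metis cis.sel(1) times_divide_eq_right mult.right_neutral)
    have "real a \<le> d" "real b \<le> d" by (simp_all add: d_def)
    then have 1: "real a / d \<le> 1" "real b / d \<le> 1"
      using d by (metis divide_le_eq_1_pos)+
    have "1 \<le> pi" using pi_gt3 by simp
    have 2: "real a / d \<ge> 0" "real b / d \<ge> 0" using d by simp_all
    from 1 \<open>1 \<le> pi\<close> have 3: "real a / d \<le> pi" "real b / d \<le> pi" by (meson order_trans)+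
    from cos_inj_pi[OF 2(1) 3(1) 2(2) 3(2) c] have "real a / d = real b / d" .
    then have "real a = real b" using d by (metis nonzero_divide_eq_eq less_irrefl divide_eq_eq)
    then show False using assms by simp
  qed
qed

lemma integral_eq_0_of_rotation:
  fixes h :: "complex \<Rightarrow> complex"
  assumes [measurable]: "h \<in> borel_measurable borel" and "norm c = 1" "k \<noteq> 1" "\<And>w. h (c * w) = k * h w"
  shows "(\<integral>w. h w \<partial>lborel) = 0"
proof -
  have "(\<integral>w. h w \<partial>lborel) = (\<integral>w. h w \<partial>distr lborel borel (\<lambda>w. c * w))"
    using assms lborel_complex_rotate by simp
  also have "\<dots> = k * (\<integral>w. h w \<partial>lborel)"
    by (subst integral_distr) (auto simp: assms)
  finally show ?thesis using assms by simp
qed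

text \<open>The pole at 0 that cancels the factor \<open>s\<close> in the derivative of
  \<open>|w|^(2s)\<close>; the constant \<open>pi\<close> of the one-variable residue comes from
  here.\<close>

lemma integral_powr_unit_disc:
  fixes s :: complex
  assumes s: "Re s > 1"
  shows "(\<integral>w. indicator (cball 0 1) w * (of_real ((cmod w)^2) powr s / of_real ((cmod w)^2)) \<partial>lborel) = pi / s"
proof -
  define g :: "real \<Rightarrow> complex" where "g y = indicator {0..1} y * (of_real y powr s / of_real y)" for y
  have [measurable]: "g \<in> borel_measurable borel" unfolding g_def by measurable
  have ge: "g y = indicator {0..1} y *\<^sub>R (of_real y powr (s - 1))" for y
    by (auto simp: g_def indicator_def powr_diff)
  have cont: "continuous_on {0..1} (\<lambda>y::real. (of_real y :: complex) powr t)" if "Re t > 0" for t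
    using that by (intro continuous_on_powr_complex continuous_intros) auto
  have sint: "set_integrable lborel {0..1} (\<lambda>y::real. (of_real y :: complex) powr (s - 1))"
    using s by (intro borel_integrable_atLeastAtMost' cont) auto
  have "((\<lambda>y::real. (of_real y :: complex) powr (s - 1)) has_integral (of_real 1 powr s / s - of_real 0 powr s / s)) {0..1}"
  proof (rule fundamental_theorem_of_calculus_interior)
    show "continuous_on {0..1} (\<lambda>y::real. (of_real y :: complex) powr s / s)"
      using s by (intro continuous_on_divide cont continuous_intros) auto
    show "((\<lambda>y::real. (of_real y :: complex) powr s / s) has_vector_derivative of_real x powr (s - 1)) (at x)"
      if "x \<in> {0<..<1}" for x
    proof -
      have "((\<lambda>z. z powr s / s) has_field_derivative of_real x powr (s - 1)) (at (of_real x))"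
        using that s by (auto intro!: derivative_eq_intros)
      then show ?thesis using has_vector_derivative_real_field by blast
    qed
  qed auto
  then have 1: "integral {0..1} (\<lambda>y::real. (of_real y :: complex) powr (s - 1)) = 1 / s"
    using s by (auto simp: integral_unique)
  have "(\<integral>w. indicator (cball 0 1) w * (of_real ((cmod w)^2) powr s / of_real ((cmod w)^2)) \<partial>lborel) = (\<integral>w. g ((cmod w)^2) \<partial>lborel)"
    by (intro Bochner_Integration.integral_cong refl) (auto simp: g_def indicator_def power_le_one_iff)
  also have "\<dots> = pi * (\<integral>y. indicator {0..} y *\<^sub>R g y \<partial>lborel)"
    by (rule integrable_cmod_square) measurable
  also have "(\<integral>y. indicator {0..} y *\<^sub>R g y \<partial>lborel) = (LINT y:{0..1}|lborel. (of_real y :: complex) powr (s - 1))"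
    unfolding set_lebesgue_integral_def by (intro Bochner_Integration.integral_cong refl) (auto simp: ge indicator_def)
  also have "\<dots> = 1 / s"
    using set_borel_integral_eq_integral(2)[OF sint] 1 by simp
  finally show ?thesis by simp
qed

lemma wirt1_cmod_powr:
  assumes "w \<noteq> 0"
  shows "wirt1 (\<lambda>w. of_real ((cmod w)^2) powr s) w = s * of_real ((cmod w)^2) powr s / of_real ((cmod w)^2) * w"
proof -
  have sq: "of_real ((cmod w)^2) = w * cnj w" for w by (rule complex_norm_square)
  have nz: "w * cnj w \<notin> \<real>\<^sub>\<le>\<^sub>0"
    unfolding sq[symmetric] using assms by (simp add: complex_nonpos_Reals_iff)
  have d1: "((\<lambda>w. w * cnj w) has_derivative (\<lambda>h. h * cnj w + w * cnj h)) (at w)"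
    by (auto intro!: derivative_eq_intros has_derivative_bounded_linear bounded_linear.has_derivative[OF bounded_linear_cnj])
  have "((\<lambda>z. z powr s) has_field_derivative s * (w * cnj w) powr (s - 1)) (at (w * cnj w))"
    using nz by (rule has_field_derivative_powr)
  from has_derivative_compose[OF d1 this[unfolded has_field_derivative_def]]
  have "((\<lambda>w. of_real ((cmod w)^2) powr s) has_derivative (\<lambda>h. s * (w * cnj w) powr (s - 1) * (h * cnj w + w * cnj h))) (at w)"
    unfolding sq .
  note fd = frechet_derivative_at[OF this, symmetric]
  show ?thesis
    unfolding wirt1_def fd unfolding sq using assms by (simp add: powr_diff field_simps)
qed

text \<open>The integrand has angular weight \<open>b + 1 - p - g\<close>, and rotation kills it
  unless this is 0. In the balanced case the integral is \<open>pi / (s + g)\<close>: for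
  \<open>g = 0\<close> the pole cancels the factor \<open>s\<close> and \<open>pi\<close> remains,
  for \<open>g > 0\<close> there is no pole at 0 and the factor \<open>s\<close> wins.\<close>

lemma acv_disc_monomial:
  assumes p: "p \<ge> 1"
  shows "acv (\<lambda>s. s * (\<integral>w. of_real ((cmod w)^2) powr s *
            (indicator (cball 0 1) w * (w ^ b * cnj w ^ g * (w / (of_real ((cmod w)^2) * w ^ p)))) \<partial>lborel))
          (if b = p - 1 \<and> g = 0 then pi else 0)"
proof (cases "b + 1 = p + g")
  case False
  then obtain c :: complex where c: "norm c = 1" "c ^ (b + 1) \<noteq> c ^ (p + g)" by (rule unit_power_neq)
  then have c0: "c \<noteq> 0" by auto
  have cc: "cnj c = 1 / c"
    using c(1) c0 complex_norm_square[of c] by (simp add: field_simps)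
  have "(\<integral>w. of_real ((cmod w)^2) powr s *
            (indicator (cball 0 1) w * (w ^ b * cnj w ^ g * (w / (of_real ((cmod w)^2) * w ^ p)))) \<partial>lborel) = 0" for s
  proof (rule integral_eq_0_of_rotation[OF _ c(1), where k="c ^ (b+1) / c ^ (p + g)"])
    show "c ^ (b + 1) / c ^ (p + g) \<noteq> 1" using c c0 by auto
    fix w
    show "of_real ((cmod (c * w))^2) powr s * (indicator (cball 0 1) (c * w) *
           ((c * w) ^ b * cnj (c * w) ^ g * (c * w / (of_real ((cmod (c * w))^2) * (c * w) ^ p)))) =
         c ^ (b + 1) / c ^ (p + g) * (of_real ((cmod w)^2) powr s *
          (indicator (cball 0 1) w * (w ^ b * cnj w ^ g * (w / (of_real ((cmod w)^2) * w ^ p)))))"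
      using c0 c(1) by (simp add: norm_mult indicator_def cc power_mult_distrib power_add power_divide field_simps)
  qed measurable
  then show ?thesis using False p by (auto intro: acv_zero)
next
  case True
  have eq: "of_real ((cmod w)^2) powr s * (indicator (cball 0 1) w * (w ^ b * cnj w ^ g * (w / (of_real ((cmod w)^2) * w ^ p))))
     = indicator (cball 0 1) w * (of_real ((cmod w)^2) powr (s + of_nat g) / of_real ((cmod w)^2))" for s w
  proof (cases "w = 0")
    case False
    have "w ^ b * w = w ^ p * w ^ g" using True by (metis power_add power_Suc2 Suc_eq_plus1)
    then have "w ^ b * cnj w ^ g * (w / (of_real ((cmod w)^2) * w ^ p)) = (w * cnj w) ^ g / of_real ((cmod w)^2)"
      using False by (simp add: field_simps power_mult_distrib)
    also have "(w * cnj w) ^ g = of_real ((cmod w)^2) powr of_nat g"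
      using False by (simp add: powr_nat complex_norm_square del: of_real_power)
    finally show ?thesis by (simp add: powr_add)
  qed simp
  have I: "(\<integral>w. of_real ((cmod w)^2) powr s *
            (indicator (cball 0 1) w * (w ^ b * cnj w ^ g * (w / (of_real ((cmod w)^2) * w ^ p)))) \<partial>lborel) = pi / (s + of_nat g)"
    if "Re s > 1" for s :: complex
    unfolding eq using that by (intro integral_powr_unit_disc) auto
  show ?thesis
  proof (cases "g = 0")
    case True
    show ?thesis
      by (rule acvI[of 1 "\<lambda>_. pi" 1]) (use I \<open>b + 1 = p + g\<close> True in auto)
  next
    case False
    have "s + of_nat g \<noteq> 0" if "- real g < Re s" for s :: complex
      using that by (auto simp: complex_eq_iff)
    then show ?thesis
      by (intro acvI[of "real g" "\<lambda>s. s * (pi / (s + of_nat g))" 1]) (use I False in \<open>auto intro!: holomorphic_intros\<close>)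
  qed
qed

text \<open>A remainder of order \<open>K \<ge> p\<close> cancels the pole of the kernel and
  contributes nothing; among the monomials only \<open>w^(p-1)\<close> has a nonzero value, namely
  \<open>pi\<close>. One constant \<open>C\<close> bounds both \<open>\<psi>\<close> and the
  remainder, so that the difference from the polynomial cut off at the unit disc is at most
  \<open>C * |w|^p\<close> on the whole plane.\<close>

lemma dbar_inv_eq:
  fixes \<psi> :: "complex \<Rightarrow> complex" and c :: "nat \<Rightarrow> nat \<Rightarrow> complex"
  assumes [measurable]: "\<psi> \<in> borel_measurable borel"
    and bd: "\<And>w. cmod (\<psi> w) \<le> C" and supp: "\<And>w. cmod w > R \<Longrightarrow> \<psi> w = 0"
    and p: "p \<ge> 1" "p \<le> K"
    and tay: "\<And>w. cmod w \<le> 1 \<Longrightarrow> cmod (\<psi> w - (\<Sum>b<K. \<Sum>g<K. c b g * w ^ b * cnj w ^ g)) \<le> C * cmod w ^ K"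
  shows "dbar_inv p \<psi> = pi * c (p - 1) 0"
proof -
  define m where "m b g w = indicator (cball 0 1) w * (w ^ b * cnj w ^ g * (w / (of_real ((cmod w)^2) * w ^ p)))" for b g w
  define \<rho> where "\<rho> w = \<psi> w - indicator (cball 0 1) w * (\<Sum>b<K. \<Sum>g<K. c b g * w ^ b * cnj w ^ g)" for w
  define r where "r w = \<rho> w * (w / (of_real ((cmod w)^2) * w ^ p))" for w
  have [measurable]: "m b g \<in> borel_measurable borel" "r \<in> borel_measurable borel" for b g
    unfolding m_def r_def \<rho>_def by measurable
  define R' where "R' = max R 1"
  have C: "C \<ge> 0" using bd[of 0] norm_ge_zero order_trans by blast
  have \<rho>1: "cmod (\<rho> w) \<le> C * cmod w ^ p" for w
  proof (cases "cmod w \<le> 1")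
    case True
    then have "cmod (\<rho> w) \<le> C * cmod w ^ K" using tay by (simp add: \<rho>_def)
    also have "\<dots> \<le> C * cmod w ^ p" using True p C by (intro mult_left_mono power_decreasing) auto
    finally show ?thesis .
  next
    case False
    then have "1 \<le> cmod w ^ p" by (intro one_le_power) simp
    then have "C * 1 \<le> C * cmod w ^ p" using C by (rule mult_left_mono)
    with False bd[of w] show ?thesis by (simp add: \<rho>_def)
  qed
  have \<rho>2: "\<rho> w = 0" if "cmod w > R'" for w
    using that supp by (simp add: \<rho>_def R'_def)
  \<comment> \<open>The kernel has size \<open>|w|^(-1-p)\<close>, so the product is at most
    \<open>C / |w|\<close>. An additional \<open>|w|^(-1/2)\<close> keeps it integrable in the
    plane, which gives room to continue past 0.\<close>
  have rb: "((cmod w)^2) powr (-(1/4)) * cmod (r w) \<le> C * (indicator (cball 0 R') w * cmod w powr (2 * (1/4) - 2))" for w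
  proof (cases "w = 0 \<or> cmod w > R'")
    case False
    have "cmod (r w) = cmod (\<rho> w) / (cmod w * cmod w ^ p)"
      using False by (simp add: r_def norm_mult norm_divide norm_power power2_eq_square)
    also have "\<dots> \<le> (C * cmod w ^ p) / (cmod w * cmod w ^ p)"
      by (intro divide_right_mono \<rho>1) auto
    also have "\<dots> = C * cmod w powr (-1)" using False by (simp add: powr_minus_divide)
    finally have 1: "cmod (r w) \<le> C * cmod w powr (-1)" .
    have 2: "((cmod w)^2) powr (-(1/4)) = cmod w powr (-1/2)"
    proof -
      have "(cmod w)^2 = cmod w powr 2" using False by simp
      then show ?thesis by (simp only: powr_powr) simp
    qed
    have 3: "cmod w powr (-1/2) * cmod w powr (-1) = cmod w powr (2 * (1/4) - 2)"
      unfolding powr_add[symmetric] by simp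
    have "((cmod w)^2) powr (-(1/4)) * cmod (r w) \<le> cmod w powr (-1/2) * (C * cmod w powr (-1))"
      unfolding 2 by (rule mult_left_mono[OF 1]) simp
    also have "\<dots> = C * cmod w powr (2 * (1/4) - 2)" using 3 by (simp only: mult.left_commute)
    finally show ?thesis using False by simp
  qed (use C \<rho>2 in \<open>auto simp: r_def\<close>)
  have ri: "integrable lborel (\<lambda>w. ((cmod w)^2) powr (-(1/4)) * cmod (r w))"
  proof (rule Bochner_Integration.integrable_bound)
    show "integrable lborel (\<lambda>w::complex. C * (indicator (cball 0 R') w * cmod w powr (2 * (1/4) - 2)))"
      by (intro integrable_mult_right integrable_norm_powr_cball) (auto simp: R'_def)
    show "AE w in lborel. norm (((cmod w)^2) powr (-(1/4)) * cmod (r w)) \<le> norm (C * (indicator (cball 0 R') w * cmod w powr (2 * (1/4) - 2)))"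
    proof (rule AE_I2)
      fix w
      have "norm (((cmod w)^2) powr (-(1/4)) * cmod (r w)) = ((cmod w)^2) powr (-(1/4)) * cmod (r w)" by simp
      also note rb[of w]
      also have "C * (indicator (cball 0 R') w * cmod w powr (2 * (1/4) - 2)) \<le> norm (C * (indicator (cball 0 R') w * cmod w powr (2 * (1/4) - 2)))"
        by simp
      finally show "norm (((cmod w)^2) powr (-(1/4)) * cmod (r w)) \<le> norm (C * (indicator (cball 0 R') w * cmod w powr (2 * (1/4) - 2)))" .
    qed
  qed measurable
  have rN: "(cmod w)^2 \<le> R'^2" if "r w \<noteq> 0" for w
    using that \<rho>2[of w] by (intro power_mono) (auto simp: r_def not_less[symmetric])
  have racv: "acv (\<lambda>s. s * (\<integral>w. of_real ((cmod w)^2) powr s * r w \<partial>lborel)) 0"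
    by (rule acv_mult_0, rule acv_integral_powr[OF _ _ _ rN _ ri]) auto
  \<comment> \<open>The factor \<open>|w|^(2p)\<close> outweighs the pole and leaves at most
    \<open>|w|^(-1)\<close> on the unit disc, so all monomial integrals converge once
    \<open>Re s > p\<close>.\<close>
  have mi: "integrable lborel (\<lambda>w. ((cmod w)^2) powr (real p) * cmod (m b g w))" for b g
  proof (rule Bochner_Integration.integrable_bound[OF integrable_norm_powr_cball[of "1/2" 1]])
    show "AE w in lborel. norm ((cmod w)\<^sup>2 powr real p * cmod (m b g w)) \<le> norm (indicator (cball 0 1) w * cmod w powr (2 * (1/2) - 2))"
    proof (rule AE_I2)
      fix w :: complex
      show "norm ((cmod w)\<^sup>2 powr real p * cmod (m b g w)) \<le> norm (indicator (cball 0 1) w * cmod w powr (2 * (1/2) - 2))"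
      proof (cases "w = 0 \<or> cmod w > 1")
        case False
        have "(cmod w)\<^sup>2 powr real p * cmod (m b g w) = (cmod w ^ p * cmod w ^ b * cmod w ^ g) * (1 / cmod w)"
          using False by (simp add: m_def norm_mult norm_divide norm_power powr_realpow power2_eq_square power_mult_distrib)
        also have "\<dots> \<le> 1 * (1 / cmod w)"
          using False by (intro mult_right_mono) (auto intro!: mult_le_one power_le_one)
        finally show ?thesis using False by (simp add: powr_minus_divide)
      qed (auto simp: m_def)
    qed
  qed auto
  have eq: "(\<integral>w. wirt1 (\<lambda>w. of_real ((cmod w)^2) powr s) w / w ^ p * \<psi> w \<partial>lborel)
     = (\<Sum>b<K. \<Sum>g<K. c b g * (s * (\<integral>w. of_real ((cmod w)^2) powr s * m b g w \<partial>lborel)))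
        + s * (\<integral>w. of_real ((cmod w)^2) powr s * r w \<partial>lborel)" if s: "Re s > real p" for s
  proof -
    have m: "integrable lborel (\<lambda>w. of_real ((cmod w)^2) powr s * m b g w)" for b g
      by (rule integrable_powr_mult[where C=1, OF _ _ _ _ mi]) (use s in \<open>auto simp: m_def indicator_def power_le_one split: if_splits\<close>)
    have r: "integrable lborel (\<lambda>w. of_real ((cmod w)^2) powr s * r w)"
      by (rule integrable_powr_mult[where C="R'^2", OF _ _ _ _ ri]) (use s rN in auto)
    have "(\<integral>w. wirt1 (\<lambda>w. of_real ((cmod w)^2) powr s) w / w ^ p * \<psi> w \<partial>lborel)
        = (\<integral>w. s * ((\<Sum>b<K. \<Sum>g<K. c b g * (of_real ((cmod w)^2) powr s * m b g w)) + of_real ((cmod w)^2) powr s * r w) \<partial>lborel)"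
    proof (rule integral_cong_AE)
      have "AE w in lborel. w \<noteq> (0::complex)" by (rule AE_lborel_singleton)
      then show "AE w in lborel. wirt1 (\<lambda>w. of_real ((cmod w)^2) powr s) w / w ^ p * \<psi> w
        = s * ((\<Sum>b<K. \<Sum>g<K. c b g * (of_real ((cmod w)^2) powr s * m b g w)) + of_real ((cmod w)^2) powr s * r w)"
      proof eventually_elim
        case (elim w)
        define k where "k = of_real ((cmod w)^2) powr s * (w / (of_real ((cmod w)^2) * w ^ p))"
        have "(\<Sum>b<K. \<Sum>g<K. c b g * (of_real ((cmod w)^2) powr s * m b g w))
            = k * (indicator (cball 0 1) w * (\<Sum>b<K. \<Sum>g<K. c b g * w ^ b * cnj w ^ g))"
          unfolding sum_distrib_left by (intro sum.cong refl) (simp add: m_def k_def)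
        moreover have "of_real ((cmod w)^2) powr s * r w = k * \<rho> w" by (simp add: r_def k_def)
        ultimately have "(\<Sum>b<K. \<Sum>g<K. c b g * (of_real ((cmod w)^2) powr s * m b g w)) + of_real ((cmod w)^2) powr s * r w = k * \<psi> w"
          by (simp add: \<rho>_def algebra_simps)
        then show ?case
          unfolding wirt1_cmod_powr[OF elim] by (simp add: k_def)
      qed
      \<comment> \<open>The explicit derivative holds off the origin only; one exceptional point
        does not affect measurability.\<close>
      have "(\<lambda>w. wirt1 (\<lambda>w. of_real ((cmod w)^2) powr s) w) \<in> borel_measurable borel"
      proof -
        have "(\<lambda>w. wirt1 (\<lambda>w. of_real ((cmod w)^2) powr s) w)
          = (\<lambda>w. if w = 0 then wirt1 (\<lambda>w. of_real ((cmod w)^2) powr s) 0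
                 else s * of_real ((cmod w)^2) powr s / of_real ((cmod w)^2) * w)"
          using wirt1_cmod_powr by auto
        also have "\<dots> \<in> borel_measurable borel" by measurable
        finally show ?thesis .
      qed
      then show "(\<lambda>w. wirt1 (\<lambda>w. of_real ((cmod w)^2) powr s) w / w ^ p * \<psi> w) \<in> borel_measurable lborel"
        by measurable
    qed measurable
    also have "\<dots> = (\<Sum>b<K. \<Sum>g<K. c b g * (s * (\<integral>w. of_real ((cmod w)^2) powr s * m b g w \<partial>lborel)))
        + s * (\<integral>w. of_real ((cmod w)^2) powr s * r w \<partial>lborel)"
      using m r by (simp add: Bochner_Integration.integral_add Bochner_Integration.integral_sum ring_distribs sum_distrib_left mult_ac)
    finally show ?thesis .
  qed
  have "acv (\<lambda>s. (\<Sum>b<K. \<Sum>g<K. c b g * (s * (\<integral>w. of_real ((cmod w)^2) powr s * m b g w \<partial>lborel)))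
        + s * (\<integral>w. of_real ((cmod w)^2) powr s * r w \<partial>lborel))
       ((\<Sum>b<K. \<Sum>g<K. c b g * (if b = p - 1 \<and> g = 0 then pi else 0)) + 0)"
    unfolding m_def by (intro acv_add acv_sum acv_cmult acv_disc_monomial p racv)
  then have "acv (\<lambda>s. \<integral>w. wirt1 (\<lambda>w. of_real ((cmod w)^2) powr s) w / w ^ p * \<psi> w \<partial>lborel)
       ((\<Sum>b<K. \<Sum>g<K. c b g * (if b = p - 1 \<and> g = 0 then pi else 0)) + 0)"
    by (rule acv_cong[where c="real p"]) (rule eq[symmetric])
  moreover have "(\<Sum>b<K. \<Sum>g<K. c b g * (if b = p - 1 \<and> g = 0 then pi else 0)) = pi * c (p - 1) 0"
  proof -
    have K: "p - 1 \<in> {..<K}" "0 \<in> {..<K}" using p by auto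
    have "(\<Sum>g<K. c b g * (if b = p - 1 \<and> g = 0 then pi else 0)) = (if b = p - 1 then c b 0 * pi else 0)" for b
    proof -
      have "(\<Sum>g<K. c b g * (if b = p - 1 \<and> g = 0 then pi else 0)) = (\<Sum>g<K. if g = 0 then (if b = p - 1 then c b g * pi else 0) else 0)"
        by (intro sum.cong refl) auto
      also have "\<dots> = (if b = p - 1 then c b 0 * pi else 0)"
        using K(2) by (subst sum.delta) auto
      finally show ?thesis .
    qed
    then have "(\<Sum>b<K. \<Sum>g<K. c b g * (if b = p - 1 \<and> g = 0 then pi else 0)) = (\<Sum>b<K. if b = p - 1 then c b 0 * pi else 0)"
      by (intro sum.cong refl)
    also have "\<dots> = c (p - 1) 0 * pi"
      using K(1) by (subst sum.delta) auto
    finally show ?thesis by (simp only: mult.commute)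
  qed
  ultimately show ?thesis
    unfolding dbar_inv_def by (simp add: acont0_eq)
qed

section \<open>Components of the Bochner--Martinelli form\<close>

lemma lpos_nth:
  assumes "distinct xs" "k < length xs"
  shows "lpos xs (xs ! k) = k"
  unfolding lpos_def using assms by (intro Least_equality) (auto simp: nth_eq_iff_index_eq)

lemma lpos_less: "x \<in> set xs \<Longrightarrow> lpos xs x < length xs \<and> xs ! lpos xs x = x"
  unfolding lpos_def by (rule LeastI_ex) (simp add: in_set_conv_nth)

lemma sorted_lpos: "distinct xs \<Longrightarrow> sorted_wrt (\<lambda>x y. lpos xs x < lpos xs y) xs"
  by (simp add: sorted_wrt_iff_nth_less lpos_nth)

text \<open>The list counterpart of deleting a row or column with \<open>mat_delete\<close>;
  \<open>insert_index p\<close> is the renumbering that both share.\<close>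

definition delnth :: "nat \<Rightarrow> 'a list \<Rightarrow> 'a list" where
  "delnth p xs = take p xs @ drop (Suc p) xs"

lemma length_delnth: "p < length xs \<Longrightarrow> length (delnth p xs) = length xs - 1"
  by (auto simp: delnth_def)

lemma nth_delnth: "r < length xs - 1 \<Longrightarrow> p < length xs \<Longrightarrow> delnth p xs ! r = xs ! insert_index p r"
  by (auto simp: delnth_def nth_append insert_index_def)

lemma sorted_wrt_delnth: "sorted_wrt P xs \<Longrightarrow> sorted_wrt P (delnth p xs)"
proof -
  assume s: "sorted_wrt P xs"
  then have "sorted_wrt P (take p xs @ drop p xs)" by simp
  then have "\<forall>x\<in>set (take p xs). \<forall>y\<in>set (drop p xs). P x y" unfolding sorted_wrt_append by blast
  moreover have "set (drop (Suc p) xs) \<subseteq> set (drop p xs)" by (rule set_drop_subset_set_drop) simp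
  ultimately show ?thesis
    unfolding delnth_def sorted_wrt_append using s by (auto intro: sorted_wrt_take sorted_wrt_drop)
qed

lemma sorted_distinct:
  fixes f :: "'b \<Rightarrow> nat"
  assumes "sorted_wrt (\<lambda>x y. f x < f y) xs"
  shows "distinct xs"
  using assms by (auto simp: sorted_wrt_iff_nth_less distinct_conv_nth) (metis less_irrefl linorder_neqE_nat)

lemma set_delnth:
  assumes "distinct xs" "p < length xs"
  shows "set (delnth p xs) = set xs - {xs ! p}"
proof -
  have "xs = take p xs @ xs ! p # drop (Suc p) xs" using assms by (simp add: id_take_nth_drop)
  then have *: "distinct (take p xs @ xs ! p # drop (Suc p) xs)" "set xs = set (take p xs @ xs ! p # drop (Suc p) xs)"
    using assms by metis+
  show ?thesis unfolding *(2) using *(1) by (auto simp: delnth_def)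
qed

text \<open>Converts the inversion counts in \<open>wsgn\<close> into positions in a sorted list,
  which are the exponents of cofactor signs.\<close>

lemma card_less_sorted:
  fixes f :: "'b \<Rightarrow> nat"
  assumes s: "sorted_wrt (\<lambda>x y. f x < f y) xs" and p: "p < length xs"
  shows "card {x \<in> set xs - {xs ! p}. f x < f (xs ! p)} = p"
proof -
  have "{x \<in> set xs - {xs ! p}. f x < f (xs ! p)} = set (take p xs)"
  proof (intro equalityI subsetI)
    fix x assume "x \<in> {x \<in> set xs - {xs ! p}. f x < f (xs ! p)}"
    then obtain q where q: "q < length xs" "x = xs ! q" "f (xs ! q) < f (xs ! p)"
      by (auto simp: in_set_conv_nth)
    have "q < p"
    proof (rule ccontr)
      assume "\<not> q < p"
      then have "q = p \<or> p < q" by auto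
      then show False using q s by (auto simp: sorted_wrt_iff_nth_less) (metis less_asym)
    qed
    then show "x \<in> set (take p xs)" using q by (auto simp: in_set_conv_nth intro!: exI[of _ q])
  next
    fix x assume "x \<in> set (take p xs)"
    then obtain q where "q < p" "x = xs ! q" by (auto simp: in_set_conv_nth)
    then have "f x < f (xs ! p)" "x \<in> set xs" using s p by (auto simp: sorted_wrt_iff_nth_less)
    then show "x \<in> {x \<in> set xs - {xs ! p}. f x < f (xs ! p)}" by auto
  qed
  moreover have "distinct (take p xs)" using sorted_distinct[OF s] by simp
  ultimately show ?thesis using p by (simp add: distinct_card)
qed

text \<open>The sign \<open>(-1)^(k(k-1)/2)\<close> of sorting a product of \<open>k\<close> pairs
  \<open>dzbar \<and> e\<close> so that all \<open>dzbar\<close> come in front.\<close>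

fun epsk :: "nat \<Rightarrow> complex" where
  "epsk 0 = 1" | "epsk (Suc k) = (-1) ^ k * epsk k"

lemma epsk_nz: "epsk k \<noteq> 0" by (induction k) auto

definition dmat :: "('n::finite \<Rightarrow> ('n \<Rightarrow> nat) \<Rightarrow> complex) \<Rightarrow> 'n list \<Rightarrow> ('n \<Rightarrow> nat) list \<Rightarrow> complex mat" where
  "dmat \<delta> L L' = mat (length L) (length L') (\<lambda>(p,q). \<delta> (L ! p) (L' ! q))"

lemma mat_delete_dmat:
  assumes "length L = Suc k" "length L' = Suc k" "p < Suc k" "q < Suc k"
  shows "mat_delete (dmat \<delta> L L') p q = dmat \<delta> (delnth p L) (delnth q L')"
  using assms
  by (intro eq_matI) (auto simp: mat_delete_def dmat_def length_delnth nth_delnth insert_index_def)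

lemma sum_nth_sorted:
  fixes f :: "'b \<Rightarrow> complex"
  assumes "distinct xs"
  shows "sum f (set xs) = (\<Sum>p<length xs. f (xs ! p))"
  using assms by (simp add: sum.distinct_set_conv_list sum_list_sum_nth atLeast0LessThan)

text \<open>For lists of equal length this is, up to sign, the determinant of \<open>dmat\<close>
  bordered by the column \<open>g\<close>, the row \<open>h\<close> and a corner 0. The derivative
  of the scalar factor will supply \<open>g\<close>, the section \<open>sB\<close> will supply
  \<open>h\<close>.\<close>

definition cmat :: "('n::finite \<Rightarrow> ('n \<Rightarrow> nat) \<Rightarrow> complex) \<Rightarrow> 'n list \<Rightarrow> ('n \<Rightarrow> nat) list \<Rightarrow> ('n \<Rightarrow> complex) \<Rightarrow> (('n \<Rightarrow> nat) \<Rightarrow> complex) \<Rightarrow> complex" where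
  "cmat \<delta> L L' g h = (\<Sum>p<length L. \<Sum>q<length L'. g (L ! p) * h (L' ! q) * cofactor (dmat \<delta> L L') p q)"

context
  fixes oN :: "'n::finite list" and oA :: "('n \<Rightarrow> nat) list"
  assumes dN: "distinct oN" and sN: "set oN = UNIV" and dA: "distinct oA"
begin

abbreviation (input) lt1 where "lt1 x y \<equiv> lpos oN x < lpos oN y"
abbreviation (input) lt2 where "lt2 x y \<equiv> lpos oA x < lpos oA y"

lemma lpos_oN_less: "lpos oN i < length oN"
  using lpos_less[of i oN] sN by auto

section \<open>Signs and supports of wedge products\<close>

lemma wsgn_insert:
  assumes "finite S" "finite T" "x \<notin> S"
  shows "wsgn oN oA (insert x S) T = (-1) ^ card {t\<in>T. rk oN oA t < rk oN oA x} * wsgn oN oA S T"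
proof -
  let ?X = "{t\<in>T. rk oN oA t < rk oN oA x}" and ?Y = "{(s,t). s \<in> S \<and> t \<in> T \<and> rk oN oA t < rk oN oA s}"
  have "{(s,t). s \<in> insert x S \<and> t \<in> T \<and> rk oN oA t < rk oN oA s} = Pair x ` ?X \<union> ?Y" by auto
  moreover have "finite ?Y" by (rule finite_subset[of _ "S \<times> T"]) (use assms in auto)
  then have "card (Pair x ` ?X \<union> ?Y) = card (Pair x ` ?X) + card ?Y"
    using assms by (intro card_Un_disjoint) auto
  moreover have "card (Pair x ` ?X) = card ?X" by (intro card_image) (auto simp: inj_on_def)
  ultimately show ?thesis by (simp add: wsgn_def power_add)
qed

lemma wsgn_empty [simp]: "wsgn oN oA {} T = 1"
  by (simp add: wsgn_def)

lemma wsgn_singleton: "finite T \<Longrightarrow> wsgn oN oA {x} T = (-1) ^ card {t\<in>T. rk oN oA t < rk oN oA x}"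
  using wsgn_insert[of "{}" T x] by simp

text \<open>Forms are functions on arbitrary sets of generators; the guard \<open>finite U\<close>
  records that a sum over an infinite power set is 0.\<close>

lemma wedge_mono:
  "wedge oN oA (mono S c) \<eta> U = (if finite U \<and> S \<subseteq> U then c * \<eta> (U - S) * wsgn oN oA S (U - S) else 0)"
proof (cases "finite U")
  case True
  have "wedge oN oA (mono S c) \<eta> U = (\<Sum>S'\<in>Pow U. if S' = S then c * \<eta> (U - S) * wsgn oN oA S (U - S) else 0)"
    unfolding wedge_def by (intro sum.cong) (auto simp: mono_def)
  then show ?thesis using True by (simp add: sum.delta)
next
  case False
  then have "infinite (Pow U)" by simp
  then show ?thesis using False by (simp add: wedge_def)
qed

lemma wedge_sum_left:
  "wedge oN oA (\<lambda>V. \<Sum>x\<in>X. \<omega> x V) \<eta> U = (\<Sum>x\<in>X. wedge oN oA (\<omega> x) \<eta> U)"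
  unfolding wedge_def by (subst sum.swap) (simp add: sum_distrib_right)

lemma wedge_sum_right:
  "wedge oN oA \<omega> (\<lambda>V. \<Sum>x\<in>X. \<eta> x V) U = (\<Sum>x\<in>X. wedge oN oA \<omega> (\<eta> x) U)"
  unfolding wedge_def by (subst sum.swap) (simp add: sum_distrib_right sum_distrib_left)

lemma wirt_zero [simp]: "wirt i (\<lambda>w. 0) z = 0"
  by (simp add: wirt_def)

text \<open>In a fixed component \<open>V\<close> at most one summand of \<open>sB\<close> is
  present, so the derivative passes through the sum with no differentiability argument.\<close>

lemma wirt_sB:
  assumes "finite B"
  shows "wirt i (\<lambda>w. sB B w V) z = (\<Sum>a\<in>B. mono {Inr a} (wirt i (zbmon a) z) V)"
proof (cases "\<exists>a\<in>B. V = {Inr a}")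
  case True
  then obtain a where a: "a \<in> B" "V = {Inr a}" by auto
  have "(\<Sum>b\<in>B. mono {Inr b} (h b) V) = h a" for h
    using a assms by (simp add: mono_def sum.delta)
  then show ?thesis by (simp add: sB_def)
next
  case False
  then have "(\<Sum>b\<in>B. mono {Inr b} (h b) V) = 0" for h
    by (intro sum.neutral) (auto simp: mono_def)
  then show ?thesis by (simp add: sB_def)
qed

text \<open>Every \<open>dzbar\<close> ranks below every \<open>e\<close>, so no sign
  appears.\<close>

lemma dbarF_sB:
  assumes "finite B"
  shows "dbarF oN oA (sB B) z = (\<lambda>U. \<Sum>i\<in>UNIV. \<Sum>a\<in>B. mono {Inl i, Inr a} (wirt i (zbmon a) z) U)"
proof
  fix U
  have "wedge oN oA (mono {Inl i} 1) (mono {Inr a} c) U = mono {Inl i, Inr a} c U" for i a c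
  proof (cases "U = {Inl i, Inr a}")
    case True
    have "lpos oN i < length oN" by (rule lpos_oN_less)
    then have "{t \<in> {Inr a}. rk oN oA t < rk oN oA (Inl i)} = {}" by auto
    then have "wsgn oN oA {Inl i} {Inr a} = 1" by (simp only: wsgn_singleton finite.intros card.empty power_0)
    moreover have "U - {Inl i} = {Inr a}" using True by auto
    ultimately show ?thesis using True by (simp add: wedge_mono mono_def)
  next
    case False
    then have "\<not> (finite U \<and> {Inl i} \<subseteq> U \<and> U - {Inl i} = {Inr a})" by blast
    then show ?thesis using False by (auto simp: wedge_mono mono_def)
  qed
  then show "dbarF oN oA (sB B) z U = (\<Sum>i\<in>UNIV. \<Sum>a\<in>B. mono {Inl i, Inr a} (wirt i (zbmon a) z) U)"
    unfolding dbarF_def wirt_sB[OF assms] wedge_sum_right by simp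
qed

lemma card_rk_Inl:
  assumes "finite J" "finite B"
  shows "card {t \<in> Inl ` J \<union> Inr ` B. rk oN oA t < rk oN oA (Inl i)} = card {j\<in>J. lpos oN j < lpos oN i}"
proof -
  have "{t \<in> Inl ` J \<union> Inr ` B. rk oN oA t < rk oN oA (Inl i)} = Inl ` {j\<in>J. lpos oN j < lpos oN i}"
    using lpos_oN_less[of i] by auto
  then show ?thesis by (simp add: card_image)
qed

lemma card_rk_Inr:
  assumes "finite J" "finite B"
  shows "card {t \<in> Inl ` J \<union> Inr ` B. rk oN oA t < rk oN oA (Inr a)} = card J + card {b\<in>B. lpos oA b < lpos oA a}"
proof -
  have "lpos oN i < length oN + lpos oA a" for i
    using lpos_oN_less[of i] by simp
  then have "{t \<in> Inl ` J \<union> Inr ` B. rk oN oA t < rk oN oA (Inr a)} = Inl ` J \<union> Inr ` {b\<in>B. lpos oA b < lpos oA a}"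
    by auto
  moreover have "card (Inl ` J \<union> Inr ` {b\<in>B. lpos oA b < lpos oA a}) = card J + card {b\<in>B. lpos oA b < lpos oA a}"
    using assms by (subst card_Un_disjoint) (auto simp: card_image)
  ultimately show ?thesis by simp
qed

lemma wsgn_Inl:
  assumes "finite J" "finite B"
  shows "wsgn oN oA {Inl i} (Inl ` J \<union> Inr ` B) = (-1) ^ card {j\<in>J. lpos oN j < lpos oN i}"
  using assms by (simp only: wsgn_singleton card_rk_Inl finite_UnI finite_imageI)

lemma wsgn_Inr:
  assumes "finite J" "finite B"
  shows "wsgn oN oA {Inr a} (Inl ` J \<union> Inr ` B) = (-1) ^ (card J + card {b\<in>B. lpos oA b < lpos oA a})"
  using assms by (simp only: wsgn_singleton card_rk_Inr finite_UnI finite_imageI)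

lemma wsgn_pair:
  assumes "finite J" "finite B"
  shows "wsgn oN oA {Inl i, Inr a} (Inl ` J \<union> Inr ` B) =
    (-1) ^ card {j\<in>J. lpos oN j < lpos oN i} * (-1) ^ (card J + card {b\<in>B. lpos oA b < lpos oA a})"
proof -
  have 1: "finite {Inr a}" and 2: "finite (Inl ` J \<union> Inr ` B)" and 3: "Inl i \<notin> {Inr a}"
    using assms by auto
  show ?thesis
    unfolding wsgn_insert[OF 1 2 3] wsgn_Inr[OF assms] card_rk_Inl[OF assms] ..
qed

lemma wedge_OM:
  assumes "finite B"
  shows "wedge oN oA (\<lambda>U. \<Sum>i\<in>UNIV. \<Sum>a\<in>B. mono {Inl i, Inr a} (\<delta> i a) U) \<eta> U
    = (\<Sum>i\<in>UNIV. \<Sum>a\<in>B. if finite U \<and> {Inl i, Inr a} \<subseteq> U then \<delta> i a * \<eta> (U - {Inl i, Inr a}) * wsgn oN oA {Inl i, Inr a} (U - {Inl i, Inr a}) else 0)"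
  by (simp only: wedge_sum_left wedge_mono)

text \<open>Each factor adds one \<open>dzbar\<close> and one \<open>e\<close> from
  \<open>B\<close>, both new; so the index sets of nonzero components grow by one on either
  side.\<close>

lemma wpow_zero:
  assumes "finite B"
    and "\<not> (\<exists>J B'. U = Inl ` J \<union> Inr ` B' \<and> B' \<subseteq> B \<and> card J = k \<and> card B' = k)"
  shows "wpow oN oA (\<lambda>U. \<Sum>i\<in>UNIV. \<Sum>a\<in>B. mono {Inl i, Inr a} (\<delta> i a) U) k U = 0"
  using assms(2)
proof (induction k arbitrary: U)
  case 0
  have "U \<noteq> {}"
  proof
    assume "U = {}"
    then have "U = Inl ` {} \<union> Inr ` {} \<and> {} \<subseteq> B \<and> card {} = (0::nat) \<and> card {} = (0::nat)" by simp
    with 0 show False by blast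
  qed
  then show ?case by (simp add: mono_def)
next
  case (Suc k)
  have "(if finite U \<and> {Inl i, Inr a} \<subseteq> U then \<delta> i a *
      wpow oN oA (\<lambda>U. \<Sum>i\<in>UNIV. \<Sum>a\<in>B. mono {Inl i, Inr a} (\<delta> i a) U) k (U - {Inl i, Inr a}) * wsgn oN oA {Inl i, Inr a} (U - {Inl i, Inr a}) else 0) = 0"
    if a: "a \<in> B" for i a
  proof (cases "{Inl i, Inr a} \<subseteq> U")
    case True
    have "\<not> (\<exists>J B'. U - {Inl i, Inr a} = Inl ` J \<union> Inr ` B' \<and> B' \<subseteq> B \<and> card J = k \<and> card B' = k)"
    proof (rule notI, elim exE conjE)
      fix J B' assume *: "U - {Inl i, Inr a} = Inl ` J \<union> Inr ` B'" "B' \<subseteq> B" "card J = k" "card B' = k"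
      have U: "U = (U - {Inl i, Inr a}) \<union> {Inl i, Inr a}" using True by auto
      have "U = Inl ` insert i J \<union> Inr ` insert a B'" by (subst U, subst *(1)) auto
      moreover have "i \<notin> J" "a \<notin> B'" using *(1) by blast+
      moreover have "finite J" "finite B'" using assms(1) *(2) finite_subset by auto
      ultimately show False using Suc.prems a * by (metis card_insert_disjoint insert_subset)
    qed
    from Suc.IH[OF this] show ?thesis by simp
  qed auto
  then show ?case
    unfolding wpow.simps wedge_OM[OF assms(1)] by (intro sum.neutral ballI)
qed

text \<open>The powers of a sum of products \<open>dzbar_i \<and> e_a\<close> with coefficients
  \<open>\<delta> i a\<close> have minors as components, times \<open>fact k\<close> for the
  orderings of the commuting factors. Splitting off one factor removes one row and one column, which
  is a Laplace expansion.\<close>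

lemma wpow_value:
  assumes fB: "finite B"
    and "length L = k" "length L' = k" "sorted_wrt lt1 L" "sorted_wrt lt2 L'" "set L' \<subseteq> B"
  shows "wpow oN oA (\<lambda>U. \<Sum>i\<in>UNIV. \<Sum>a\<in>B. mono {Inl i, Inr a} (\<delta> i a) U) k (Inl ` set L \<union> Inr ` set L')
      = epsk k * fact k * Determinant.det (dmat \<delta> L L')"
  using assms(2-)
proof (induction k arbitrary: L L')
  case 0
  then show ?case by (simp add: mono_def dmat_def det_dim_zero)
next
  case (Suc k)
  let ?W = "wpow oN oA (\<lambda>U. \<Sum>i\<in>UNIV. \<Sum>a\<in>B. mono {Inl i, Inr a} (\<delta> i a) U) k"
  let ?U = "Inl ` set L \<union> Inr ` set L' :: 'n gen set"
  let ?M = "dmat \<delta> L L'"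
  have dL: "distinct L" "distinct L'" using Suc.prems sorted_distinct by blast+
  have M: "?M \<in> carrier_mat (Suc k) (Suc k)" using Suc.prems by (simp add: dmat_def)
  \<comment> \<open>Removing position \<open>p\<close> among the \<open>dzbar\<close> and
    \<open>q\<close> among the \<open>e\<close> gives the cofactor sign \<open>(-1)^(p+q)\<close>;
    the remaining \<open>(-1)^k\<close> is the cost of moving \<open>e\<close> across the other
    \<open>k\<close> of the \<open>dzbar\<close>.\<close>
  have trm: "?W (?U - {Inl (L ! p), Inr (L' ! q)}) * wsgn oN oA {Inl (L!p), Inr (L'!q)} (?U - {Inl (L!p), Inr (L'!q)})
      = (-1) ^ k * epsk k * fact k * cofactor ?M p q" if pq: "p < Suc k" "q < Suc k" for p q
  proof -
    let ?L = "delnth p L" and ?L' = "delnth q L'"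
    have p': "p < length L" "q < length L'" using pq Suc.prems by auto
    have U: "?U - {Inl (L ! p), Inr (L' ! q)} = Inl ` set ?L \<union> Inr ` set ?L'"
      using set_delnth[OF dL(1) p'(1)] set_delnth[OF dL(2) p'(2)] by auto
    have "card (set ?L) = k"
      using Suc.prems p' distinct_card[OF sorted_distinct[OF sorted_wrt_delnth[OF Suc.prems(3), of p]]]
      by (simp add: length_delnth)
    then have "wsgn oN oA {Inl (L!p), Inr (L'!q)} (Inl ` set ?L \<union> Inr ` set ?L') = (-1) ^ p * (-1) ^ (k + q)"
      using card_less_sorted[OF Suc.prems(3) p'(1)] card_less_sorted[OF Suc.prems(4) p'(2)]
      by (simp only: wsgn_pair finite_set finite_Diff set_delnth[OF dL(1) p'(1)] set_delnth[OF dL(2) p'(2)])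
    moreover have "?W (Inl ` set ?L \<union> Inr ` set ?L') = epsk k * fact k * Determinant.det (dmat \<delta> ?L ?L')"
      using Suc.prems p' set_delnth[OF dL(2) p'(2)]
      by (intro Suc.IH sorted_wrt_delnth) (auto simp: length_delnth)
    ultimately show ?thesis
      unfolding U using pq Suc.prems by (simp add: cofactor_def mat_delete_dmat power_add)
  qed
  have "wpow oN oA (\<lambda>U. \<Sum>i\<in>UNIV. \<Sum>a\<in>B. mono {Inl i, Inr a} (\<delta> i a) U) (Suc k) ?U
     = (\<Sum>i\<in>set L. \<Sum>a\<in>set L'. \<delta> i a * (?W (?U - {Inl i, Inr a}) * wsgn oN oA {Inl i, Inr a} (?U - {Inl i, Inr a})))"
    unfolding wpow.simps wedge_OM[OF fB]
  proof (rule sum.mono_neutral_cong_right)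
    fix i assume "i \<in> set L"
    then show "(\<Sum>a\<in>B. if finite ?U \<and> {Inl i, Inr a} \<subseteq> ?U then \<delta> i a * ?W (?U - {Inl i, Inr a}) * wsgn oN oA {Inl i, Inr a} (?U - {Inl i, Inr a}) else 0) =
         (\<Sum>a\<in>set L'. \<delta> i a * (?W (?U - {Inl i, Inr a}) * wsgn oN oA {Inl i, Inr a} (?U - {Inl i, Inr a})))"
      using Suc.prems fB by (intro sum.mono_neutral_cong_right) (auto simp: mult.assoc)
  qed (auto intro!: sum.neutral)
  also have "\<dots> = (\<Sum>p<Suc k. \<Sum>q<Suc k. \<delta> (L!p) (L'!q) * ((-1) ^ k * epsk k * fact k * cofactor ?M p q))"
    using Suc.prems by (simp only: sum_nth_sorted[OF dL(1)] sum_nth_sorted[OF dL(2)]) (intro sum.cong refl, simp only: trm lessThan_iff)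
  also have "\<dots> = (-1) ^ k * epsk k * fact k * (\<Sum>p<Suc k. \<Sum>q<Suc k. ?M $$ (p,q) * cofactor ?M p q)"
    unfolding sum_distrib_left using Suc.prems by (intro sum.cong refl) (simp add: dmat_def)
  \<comment> \<open>Expansion along each of the \<open>Suc k\<close> rows yields the same
    determinant; their number is the new factor of the factorial.\<close>
  also have "(\<Sum>p<Suc k. \<Sum>q<Suc k. ?M $$ (p,q) * cofactor ?M p q) = (\<Sum>p<Suc k. Determinant.det ?M)"
    by (intro sum.cong refl) (simp only: laplace_expansion_row[OF M] lessThan_iff)
  finally show ?case by simp
qed

lemma dbarF_scalar:
  "dbarF oN oA (\<lambda>w. mono {} (f w)) z = (\<lambda>U. \<Sum>i\<in>UNIV. mono {Inl i} (wirt i f z) U)"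
proof
  fix U
  have w: "(\<lambda>V. wirt i (\<lambda>w. mono {} (f w) V) z) = mono {} (wirt i f z)" for i
    by (auto simp: mono_def)
  have "wedge oN oA (mono {Inl i} 1) (mono {} c) U = mono {Inl i} c U" for i c
  proof (cases "U = {Inl i}")
    case False
    then have "\<not> (finite U \<and> {Inl i} \<subseteq> U \<and> U - {Inl i} = {})" by blast
    then show ?thesis using False by (auto simp: wedge_mono mono_def)
  qed (simp add: wedge_mono mono_def wsgn_singleton)
  then show "dbarF oN oA (\<lambda>w. mono {} (f w)) z U = (\<Sum>i\<in>UNIV. mono {Inl i} (wirt i f z) U)"
    unfolding dbarF_def w by simp
qed

lemma omegaB_expand:
  assumes fB: "finite B"
  shows "omegaB oN oA A B s z U = (\<Sum>i\<in>UNIV. \<Sum>a\<in>B. if finite U \<and> Inl i \<in> U \<and> Inr a \<in> U then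
     wirt i (\<lambda>w. of_real (normsqA A w) powr s) z * zbmon a z *
     (wpow oN oA (\<lambda>U. \<Sum>i\<in>UNIV. \<Sum>a\<in>B. mono {Inl i, Inr a} (wirt i (zbmon a) z) U) (card B - 1) (U - {Inl i, Inr a})
       * wsgn oN oA {Inr a} (U - {Inl i, Inr a}) * wsgn oN oA {Inl i} (U - {Inl i})) / of_real (normsqA A z) ^ card B else 0)"
proof -
  have "wedge oN oA (sB B z) \<eta> V = (\<Sum>a\<in>B. wedge oN oA (mono {Inr a} (zbmon a z)) \<eta> V)" for \<eta> V
    unfolding sB_def wedge_sum_left ..
  then have *: "uB oN oA A B z V = (\<Sum>a\<in>B. if finite V \<and> {Inr a} \<subseteq> V then zbmon a z *
      wpow oN oA (\<lambda>U. \<Sum>i\<in>UNIV. \<Sum>a\<in>B. mono {Inl i, Inr a} (wirt i (zbmon a) z) U) (card B - 1) (V - {Inr a}) * wsgn oN oA {Inr a} (V - {Inr a}) else 0) / of_real (normsqA A z) ^ card B" for V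
    unfolding uB_def dbarF_sB[OF fB] by (simp only: wedge_mono)
  have D: "U - {Inl i} - {Inr a} = U - {Inl i, Inr a}" for i :: 'n and a :: "'n \<Rightarrow> nat" by auto
  show ?thesis
    unfolding omegaB_def dbarF_scalar wedge_sum_left wedge_mono
  proof (intro sum.cong refl)
    fix i
    show "(if finite U \<and> {Inl i} \<subseteq> U then wirt i (\<lambda>w. of_real (normsqA A w) powr s) z * uB oN oA A B z (U - {Inl i}) * wsgn oN oA {Inl i} (U - {Inl i}) else 0)
     = (\<Sum>a\<in>B. if finite U \<and> Inl i \<in> U \<and> Inr a \<in> U then
     wirt i (\<lambda>w. of_real (normsqA A w) powr s) z * zbmon a z *
     (wpow oN oA (\<lambda>U. \<Sum>i\<in>UNIV. \<Sum>a\<in>B. mono {Inl i, Inr a} (wirt i (zbmon a) z) U) (card B - 1) (U - {Inl i, Inr a})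
       * wsgn oN oA {Inr a} (U - {Inl i, Inr a}) * wsgn oN oA {Inl i} (U - {Inl i})) / of_real (normsqA A z) ^ card B else 0)"
      unfolding * D sum_divide_distrib sum_distrib_left sum_distrib_right
      by (cases "finite U \<and> Inl i \<in> U") (auto intro!: sum.cong simp: mult_ac)
  qed
qed

text \<open>In a nonzero component the \<open>card B\<close> factors \<open>e\<close> are distinct
  elements of \<open>B\<close> and therefore exhaust it.\<close>

lemma omegaB_zero:
  assumes fB: "finite B" "B \<noteq> {}"
    and no: "\<not> (\<exists>J. U = Inl ` J \<union> Inr ` B \<and> card J = card B)"
  shows "omegaB oN oA A B s z U = 0"
  unfolding omegaB_expand[OF fB(1)]
proof (intro sum.neutral ballI)
  fix i a assume a: "a \<in> B"
  have "\<not> (\<exists>J B'. U - {Inl i, Inr a} = Inl ` J \<union> Inr ` B' \<and> B' \<subseteq> B \<and> card J = card B - 1 \<and> card B' = card B - 1)"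
    if "Inl i \<in> U" "Inr a \<in> U"
  proof (rule notI, elim exE conjE)
    fix J B' assume *: "U - {Inl i, Inr a} = Inl ` J \<union> Inr ` B'" "B' \<subseteq> B" "card J = card B - 1" "card B' = card B - 1"
    have U: "U = (U - {Inl i, Inr a}) \<union> {Inl i, Inr a}" using that by auto
    have U2: "U = Inl ` insert i J \<union> Inr ` insert a B'" by (subst U, subst *(1)) auto
    have n: "i \<notin> J" "a \<notin> B'" using *(1) by blast+
    have f: "finite J" "finite B'" using fB *(2) finite_subset by auto
    have c: "card B > 0" using fB by (simp add: card_gt_0_iff)
    have "insert a B' \<subseteq> B" "card (insert a B') = card B" using a * n f c by auto
    then have "insert a B' = B" using fB by (intro card_subset_eq)
    moreover have "card (insert i J) = card B" using n f c * by simp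
    ultimately show False using U2 no by blast
  qed
  then show "(if finite U \<and> Inl i \<in> U \<and> Inr a \<in> U then
     wirt i (\<lambda>w. of_real (normsqA A w) powr s) z * zbmon a z *
     (wpow oN oA (\<lambda>U. \<Sum>i\<in>UNIV. \<Sum>a\<in>B. mono {Inl i, Inr a} (wirt i (zbmon a) z) U) (card B - 1) (U - {Inl i, Inr a})
       * wsgn oN oA {Inr a} (U - {Inl i, Inr a}) * wsgn oN oA {Inl i} (U - {Inl i})) / of_real (normsqA A z) ^ card B else 0) = 0"
    using wpow_zero[OF fB(1), of "U - {Inl i, Inr a}" "card B - 1"] by auto
qed

text \<open>The scalar derivative selects a row and \<open>sB\<close> a column; the power
  \<open>m\<close> of the derivative of \<open>sB\<close> fills the complementary minor. Summing
  over both choices produces the bilinear cofactor sum \<open>cmat\<close>.\<close>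

lemma omegaB_value:
  assumes L: "length L = Suc m" "length L' = Suc m" "sorted_wrt lt1 L" "sorted_wrt lt2 L'"
  shows "omegaB oN oA A (set L') s z (Inl ` set L \<union> Inr ` set L') =
     (-1) ^ m * epsk m * fact m / of_real (normsqA A z) ^ Suc m *
     cmat (\<lambda>i a. wirt i (zbmon a) z) L L' (\<lambda>i. wirt i (\<lambda>w. of_real (normsqA A w) powr s) z) (\<lambda>a. zbmon a z)"
proof -
  let ?\<delta> = "\<lambda>i a. wirt i (zbmon a) z"
  let ?g = "\<lambda>i. wirt i (\<lambda>w. of_real (normsqA A w) powr s) z"
  let ?W = "wpow oN oA (\<lambda>U. \<Sum>i\<in>UNIV. \<Sum>a\<in>set L'. mono {Inl i, Inr a} (?\<delta> i a) U) m"
  let ?U = "Inl ` set L \<union> Inr ` set L' :: 'n gen set"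
  let ?M = "dmat ?\<delta> L L'"
  have dL: "distinct L" "distinct L'" using L sorted_distinct by blast+
  have c: "card (set L') - 1 = m" "card (set L') = Suc m" using dL L by (simp_all add: distinct_card)
  have trm: "?W (?U - {Inl (L ! p), Inr (L' ! q)}) * wsgn oN oA {Inr (L'!q)} (?U - {Inl (L!p), Inr (L'!q)}) * wsgn oN oA {Inl (L!p)} (?U - {Inl (L!p)})
      = (-1) ^ m * epsk m * fact m * cofactor ?M p q" if pq: "p < Suc m" "q < Suc m" for p q
  proof -
    let ?L = "delnth p L" and ?L' = "delnth q L'"
    have p': "p < length L" "q < length L'" using pq L by auto
    have U: "?U - {Inl (L ! p), Inr (L' ! q)} = Inl ` set ?L \<union> Inr ` set ?L'"
      using set_delnth[OF dL(1) p'(1)] set_delnth[OF dL(2) p'(2)] by auto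
    have U1: "?U - {Inl (L ! p)} = Inl ` set ?L \<union> Inr ` set L'"
      using set_delnth[OF dL(1) p'(1)] by auto
    have "card (set ?L) = m"
      using L p' distinct_card[OF sorted_distinct[OF sorted_wrt_delnth[OF L(3), of p]]]
      by (simp add: length_delnth)
    then have "wsgn oN oA {Inr (L'!q)} (Inl ` set ?L \<union> Inr ` set ?L') = (-1) ^ (m + q)"
      using card_less_sorted[OF L(4) p'(2)]
      by (simp only: wsgn_Inr finite_set finite_Diff set_delnth[OF dL(2) p'(2)])
    moreover have "wsgn oN oA {Inl (L!p)} (Inl ` set ?L \<union> Inr ` set L') = (-1) ^ p"
      using card_less_sorted[OF L(3) p'(1)]
      by (simp only: wsgn_Inl finite_set finite_Diff set_delnth[OF dL(1) p'(1)])
    moreover have "?W (Inl ` set ?L \<union> Inr ` set ?L') = epsk m * fact m * Determinant.det (dmat ?\<delta> ?L ?L')"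
      using L p' set_delnth[OF dL(2) p'(2)]
      by (intro wpow_value sorted_wrt_delnth) (auto simp: length_delnth)
    ultimately show ?thesis
      unfolding U U1 using pq L by (simp add: cofactor_def mat_delete_dmat power_add)
  qed
  have dbl: "(\<Sum>i\<in>set L. \<Sum>a\<in>set L'. f i a) = (\<Sum>p<Suc m. \<Sum>q<Suc m. f (L!p) (L'!q))" for f :: "'n \<Rightarrow> ('n \<Rightarrow> nat) \<Rightarrow> complex"
    by (simp only: sum_nth_sorted[OF dL(1)] sum_nth_sorted[OF dL(2)] L)
  have "omegaB oN oA A (set L') s z ?U
     = (\<Sum>i\<in>set L. \<Sum>a\<in>set L'. ?g i * zbmon a z * (?W (?U - {Inl i, Inr a}) * wsgn oN oA {Inr a} (?U - {Inl i, Inr a}) * wsgn oN oA {Inl i} (?U - {Inl i})) / of_real (normsqA A z) ^ Suc m)"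
    unfolding omegaB_expand[OF finite_set] c(2) diff_Suc_1
  proof (rule sum.mono_neutral_cong_right)
    fix i assume "i \<in> set L"
    then show "(\<Sum>a\<in>set L'. if finite ?U \<and> Inl i \<in> ?U \<and> Inr a \<in> ?U then
     ?g i * zbmon a z * (?W (?U - {Inl i, Inr a}) * wsgn oN oA {Inr a} (?U - {Inl i, Inr a}) * wsgn oN oA {Inl i} (?U - {Inl i})) / of_real (normsqA A z) ^ Suc m else 0) =
      (\<Sum>a\<in>set L'. ?g i * zbmon a z * (?W (?U - {Inl i, Inr a}) * wsgn oN oA {Inr a} (?U - {Inl i, Inr a}) * wsgn oN oA {Inl i} (?U - {Inl i})) / of_real (normsqA A z) ^ Suc m)"
      by (intro sum.cong) auto
  qed (auto intro!: sum.neutral)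
  also have "\<dots> = (\<Sum>p<Suc m. \<Sum>q<Suc m. ?g (L!p) * zbmon (L'!q) z * ((-1) ^ m * epsk m * fact m * cofactor ?M p q) / of_real (normsqA A z) ^ Suc m)"
    by (subst dbl) (intro sum.cong refl, simp only: trm lessThan_iff)
  also have "\<dots> = (-1) ^ m * epsk m * fact m / of_real (normsqA A z) ^ Suc m * cmat ?\<delta> L L' ?g (\<lambda>a. zbmon a z)"
    unfolding cmat_def sum_distrib_left L by (intro sum.cong refl) (simp add: field_simps)
  finally show ?thesis .
qed

end

section \<open>Taylor expansion at the coordinate hyperplanes\<close>

definition upd :: "complex^'n \<Rightarrow> 'n \<Rightarrow> complex \<Rightarrow> complex^'n::finite" where
  "upd z i w = (\<chi> j. if j = i then w else z $ j)"

lemma upd_nth [simp]: "upd z i w $ j = (if j = i then w else z $ j)"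
  by (simp add: upd_def)

lemma upd_upd: "upd (upd z i v) i w = upd z i w" and upd_id: "upd z i (z $ i) = z"
  by (simp_all add: Finite_Cartesian_Product.vec_eq_iff)

lemma upd_commute: "i \<noteq> j \<Longrightarrow> upd (upd z i v) j w = upd (upd z j w) i v"
  by (simp add: Finite_Cartesian_Product.vec_eq_iff)

section \<open>Smooth functions constant in some coordinates, with bounded support in the
  others\<close>

definition smooth :: "('a::real_normed_vector \<Rightarrow> complex) \<Rightarrow> bool" where
  "smooth f \<longleftrightarrow> (\<forall>k. Ck k f)"

lemma smooth_continuous: "smooth f \<Longrightarrow> continuous_on UNIV f"
  unfolding smooth_def by (metis Ck.simps(1))

lemma smooth_differentiable: "smooth f \<Longrightarrow> f differentiable (at z)"
  unfolding smooth_def by (metis Ck.simps(2))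

lemma smooth_has_derivative: "smooth f \<Longrightarrow> (f has_derivative frechet_derivative f (at z)) (at z)"
  using smooth_differentiable frechet_derivative_works by blast

lemma smooth_frechet: "smooth f \<Longrightarrow> smooth (\<lambda>z. frechet_derivative f (at z) v)"
  unfolding smooth_def by (metis Ck.simps(2))

text \<open>A coinductive principle: a family of continuous, differentiable functions that is stable
  under directional derivatives consists of smooth functions. It spares the closure lemmas any chain
  rule of order \<open>k\<close>.\<close>

lemma smoothI_invariant:
  assumes "P f"
    and "\<And>f. P f \<Longrightarrow> continuous_on UNIV f" "\<And>f z. P f \<Longrightarrow> f differentiable (at z)"
    and "\<And>f v. P f \<Longrightarrow> P (\<lambda>z. frechet_derivative f (at z) v)"
  shows "smooth f"
proof -
  have "Ck k f" if "P f" for k f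
    using that by (induction k arbitrary: f) (auto intro: assms)
  then show ?thesis using assms(1) by (simp add: smooth_def)
qed

lemma smooth_zero: "smooth (\<lambda>z. 0)"
  by (rule smoothI_invariant[where P="\<lambda>f. f = (\<lambda>z. 0)"]) auto

lemma smooth_add:
  assumes "smooth f" "smooth g"
  shows "smooth (\<lambda>z. f z + g z)"
proof (rule smoothI_invariant[where P="\<lambda>h. \<exists>f g. smooth f \<and> smooth g \<and> h = (\<lambda>z. f z + g z)"])
  fix h assume "\<exists>f g. smooth f \<and> smooth g \<and> h = (\<lambda>z. f z + g z)"
  then obtain f g where fg: "smooth f" "smooth g" "h = (\<lambda>z. f z + g z)" by blast
  have d: "(h has_derivative (\<lambda>v. frechet_derivative f (at z) v + frechet_derivative g (at z) v)) (at z)" for z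
    unfolding fg(3) by (intro has_derivative_add smooth_has_derivative fg)
  then show "h differentiable (at z)" for z by (auto simp: differentiable_def)
  show "continuous_on UNIV h"
    unfolding fg(3) by (intro continuous_on_add smooth_continuous fg)
  have "frechet_derivative h (at z) = (\<lambda>v. frechet_derivative f (at z) v + frechet_derivative g (at z) v)" for z
    using frechet_derivative_at[OF d] by simp
  then show "\<exists>f g. smooth f \<and> smooth g \<and> (\<lambda>z. frechet_derivative h (at z) v) = (\<lambda>z. f z + g z)" for v
    by (intro exI[of _ "\<lambda>z. frechet_derivative f (at z) v"] exI[of _ "\<lambda>z. frechet_derivative g (at z) v"] conjI smooth_frechet fg) simp
qed (use assms in auto)

lemma smooth_cmult:
  assumes "smooth f"
  shows "smooth (\<lambda>z. c * f z)"
proof (rule smoothI_invariant[where P="\<lambda>h. \<exists>f. smooth f \<and> h = (\<lambda>z. c * f z)"])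
  fix h assume "\<exists>f. smooth f \<and> h = (\<lambda>z. c * f z)"
  then obtain f where fg: "smooth f" "h = (\<lambda>z. c * f z)" by blast
  have d: "(h has_derivative (\<lambda>v. c * frechet_derivative f (at z) v)) (at z)" for z
    unfolding fg(2) by (intro has_derivative_mult_right smooth_has_derivative fg)
  then show "h differentiable (at z)" for z by (auto simp: differentiable_def)
  show "continuous_on UNIV h"
    unfolding fg(2) by (intro continuous_on_mult continuous_on_const smooth_continuous fg)
  have "frechet_derivative h (at z) = (\<lambda>v. c * frechet_derivative f (at z) v)" for z
    using frechet_derivative_at[OF d] by simp
  then show "\<exists>f. smooth f \<and> (\<lambda>z. frechet_derivative h (at z) v) = (\<lambda>z. c * f z)" for v
    by (intro exI[of _ "\<lambda>z. frechet_derivative f (at z) v"] conjI smooth_frechet fg) simp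
qed (use assms in auto)

lemma smooth_compose_linear:
  assumes "smooth f" "bounded_linear L"
  shows "smooth (\<lambda>z. f (L z))"
proof (rule smoothI_invariant[where P="\<lambda>h. \<exists>f. smooth f \<and> h = (\<lambda>z. f (L z))"])
  fix h assume "\<exists>f. smooth f \<and> h = (\<lambda>z. f (L z))"
  then obtain f where fg: "smooth f" "h = (\<lambda>z. f (L z))" by blast
  have d: "(h has_derivative (\<lambda>v. frechet_derivative f (at (L z)) (L v))) (at z)" for z
    unfolding fg(2)
    by (rule has_derivative_compose[OF bounded_linear_imp_has_derivative[OF assms(2)] smooth_has_derivative[OF fg(1)]])
  then show "h differentiable at z" for z by (auto simp: differentiable_def)
  have "frechet_derivative h (at z) = (\<lambda>v. frechet_derivative f (at (L z)) (L v))" for z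
    using frechet_derivative_at[OF d] by simp
  then show "\<exists>f. smooth f \<and> (\<lambda>z. frechet_derivative h (at z) v) = (\<lambda>z. f (L z))" for v
    using smooth_frechet[OF fg(1), of "L v"] by auto
  show "continuous_on UNIV h"
    unfolding fg(2) using assms(2)
    by (intro continuous_on_compose2[OF smooth_continuous[OF fg(1)]] linear_continuous_on) auto
qed (use assms in auto)

text \<open>The Wirtinger derivatives as constant multiples of directional derivatives; in this form
  closure under \<open>cls\<close> is a matter of sums and multiples. \<open>dzb\<close> agrees with
  \<open>wirt\<close>.\<close>

definition dz :: "'n::finite \<Rightarrow> (complex^'n \<Rightarrow> complex) \<Rightarrow> complex^'n \<Rightarrow> complex" where
  "dz i f z = (1/2) * frechet_derivative f (at z) (axis i 1) + (- \<i>/2) * frechet_derivative f (at z) (axis i \<i>)"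

definition dzb :: "'n::finite \<Rightarrow> (complex^'n \<Rightarrow> complex) \<Rightarrow> complex^'n \<Rightarrow> complex" where
  "dzb i f z = (1/2) * frechet_derivative f (at z) (axis i 1) + (\<i>/2) * frechet_derivative f (at z) (axis i \<i>)"

lemma frechet_axis:
  assumes "smooth f"
  shows "frechet_derivative f (at z) (axis i u) = u * dz i f z + cnj u * dzb i f z"
proof -
  let ?D = "frechet_derivative f (at z)"
  have lin: "linear ?D" using smooth_has_derivative[OF assms] has_derivative_linear by blast
  have "axis i u = Re u *\<^sub>R axis i 1 + Im u *\<^sub>R axis i \<i>"
    by (simp add: Finite_Cartesian_Product.vec_eq_iff axis_def complex_eq_iff)
  then have "?D (axis i u) = Re u *\<^sub>R ?D (axis i 1) + Im u *\<^sub>R ?D (axis i \<i>)"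
    by (simp add: linear_add[OF lin] linear_scale[OF lin])
  moreover have "Re u *\<^sub>R x = ((u + cnj u) / 2) * x" "Im u *\<^sub>R x = (- \<i> * (u - cnj u) / 2) * x" for x :: complex
    by (auto simp: complex_eq_iff)
  ultimately show ?thesis
    by (simp add: dz_def dzb_def field_simps)
qed

text \<open>The class of Taylor coefficients once the coordinates in \<open>S\<close> have been
  expanded: independent of these, and zero as soon as another coordinate is large. It contains the
  test functions for \<open>S = {}\<close>, and for \<open>S = UNIV\<close> it consists of
  constants.\<close>

definition cls :: "'n set \<Rightarrow> (complex^'n::finite \<Rightarrow> complex) \<Rightarrow> bool" where
  "cls S f \<longleftrightarrow> smooth f \<and> (\<forall>z. \<forall>j\<in>S. \<forall>w. f (upd z j w) = f z) \<and> (\<exists>R. \<forall>z. (\<exists>j. j \<notin> S \<and> cmod (z $ j) > R) \<longrightarrow> f z = 0)"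

lemma cls_smooth: "cls S f \<Longrightarrow> smooth f" by (simp add: cls_def)
lemma cls_upd: "cls S f \<Longrightarrow> j \<in> S \<Longrightarrow> f (upd z j w) = f z" by (simp add: cls_def)
lemma cls_supp:
  fixes f :: "complex^'n::finite \<Rightarrow> complex"
  assumes "cls S f" obtains R where "\<And>z j. j \<notin> S \<Longrightarrow> cmod (z $ j) > R \<Longrightarrow> f z = 0"
  using assms unfolding cls_def by blast

lemma cls_zero: "cls S (\<lambda>z. 0)"
  by (simp add: cls_def smooth_zero)

lemma cls_add:
  assumes "cls S f" "cls S g"
  shows "cls S (\<lambda>z. f z + g z)"
proof -
  obtain R1 where R1: "\<And>z j. j \<notin> S \<Longrightarrow> cmod (z $ j) > R1 \<Longrightarrow> f z = 0" using assms(1) by (rule cls_supp) blast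
  obtain R2 where R2: "\<And>z j. j \<notin> S \<Longrightarrow> cmod (z $ j) > R2 \<Longrightarrow> g z = 0" using assms(2) by (rule cls_supp) blast
  show ?thesis
    unfolding cls_def
  proof (intro conjI exI[of _ "max R1 R2"] allI impI)
    show "smooth (\<lambda>z. f z + g z)" using assms by (intro smooth_add cls_smooth)
    fix z show "\<forall>j\<in>S. \<forall>w. f (upd z j w) + g (upd z j w) = f z + g z" using assms cls_upd by metis
    assume "\<exists>j. j \<notin> S \<and> max R1 R2 < cmod (z $ j)"
    then show "f z + g z = 0" using R1 R2 by fastforce
  qed
qed

lemma cls_cmult:
  assumes "cls S f"
  shows "cls S (\<lambda>z. c * f z)"
proof -
  obtain R where R: "\<And>z j. j \<notin> S \<Longrightarrow> cmod (z $ j) > R \<Longrightarrow> f z = 0" using assms by (rule cls_supp) blast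
  show ?thesis
    unfolding cls_def using R
    by (intro conjI exI[of _ R] smooth_cmult cls_smooth[OF assms] allI ballI impI) (auto simp: cls_upd[OF assms])
qed

lemma cls_translate:
  assumes "cls S f" "j \<in> S"
  shows "f (z + axis j w) = f z"
proof -
  have "z + axis j w = upd z j (z $ j + w)" by (simp add: Finite_Cartesian_Product.vec_eq_iff axis_def)
  then show ?thesis using cls_upd[OF assms] by simp
qed

text \<open>Invariance under translations in the directions of \<open>S\<close> passes to the
  derivative, and on the open set where another coordinate exceeds \<open>R\<close> the function is
  locally 0.\<close>

lemma cls_frechet:
  fixes f :: "complex^'n::finite \<Rightarrow> complex"
  assumes "cls S f"
  shows "cls S (\<lambda>z. frechet_derivative f (at z) v)"
proof -
  obtain R where R: "\<And>z j. j \<notin> S \<Longrightarrow> cmod (z $ j) > R \<Longrightarrow> f z = 0" using assms by (rule cls_supp) blast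
  note sm = cls_smooth[OF assms]
  have inv: "frechet_derivative f (at (z + axis j w)) = frechet_derivative f (at z)" if "j \<in> S" for z j w
  proof -
    have "((\<lambda>z. f (z + axis j w)) has_derivative (\<lambda>v. frechet_derivative f (at (z + axis j w)) v)) (at z)"
      by (rule has_derivative_compose[OF _ smooth_has_derivative[OF sm]]) (auto intro!: derivative_eq_intros)
    moreover have "(\<lambda>z. f (z + axis j w)) = f" using cls_translate[OF assms that] by auto
    ultimately have "(f has_derivative frechet_derivative f (at (z + axis j w))) (at z)" by simp
    then show ?thesis by (rule frechet_derivative_at)
  qed
  have zero: "frechet_derivative f (at z) = (\<lambda>v. 0)" if "j \<notin> S" "cmod (z $ j) > R" for z j
  proof -
    have op: "open {z :: complex^'n. R < cmod (z $ j)}" by (intro open_Collect_less continuous_intros)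
    have "((\<lambda>z. 0) has_derivative (\<lambda>v. 0)) (at z)" by simp
    then have "(f has_derivative (\<lambda>v. 0)) (at z)"
      by (rule has_derivative_transform_within_open[OF _ op]) (use that R in auto)
    then show ?thesis using frechet_derivative_at by metis
  qed
  show ?thesis
    unfolding cls_def
  proof (intro conjI exI[of _ R] allI impI)
    show "smooth (\<lambda>z. frechet_derivative f (at z) v)" by (rule smooth_frechet[OF sm])
    fix z :: "complex^'n"
    have "upd z j w = z + axis j (w - z $ j)" for j w by (simp add: Finite_Cartesian_Product.vec_eq_iff axis_def)
    then show "\<forall>j\<in>S. \<forall>w. frechet_derivative f (at (upd z j w)) v = frechet_derivative f (at z) v"
      using inv by metis
    assume "\<exists>j. j \<notin> S \<and> R < cmod (z $ j)"
    then show "frechet_derivative f (at z) v = 0" using zero by auto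
  qed
qed

lemma cls_dz: "cls S f \<Longrightarrow> cls S (dz i f)"
  unfolding dz_def[abs_def] by (intro cls_add cls_cmult cls_frechet)

lemma cls_dzb: "cls S f \<Longrightarrow> cls S (dzb i f)"
  unfolding dzb_def[abs_def] by (intro cls_add cls_cmult cls_frechet)

lemma bounded_linear_upd: "bounded_linear (\<lambda>z. upd z i 0)"
  by (intro linear_conv_bounded_linear[THEN iffD1] linearI) (auto simp: Finite_Cartesian_Product.vec_eq_iff)

lemma cls_restrict:
  assumes "cls S f"
  shows "cls (insert i S) (\<lambda>z. f (upd z i 0))"
proof -
  obtain R where R: "\<And>z j. j \<notin> S \<Longrightarrow> cmod (z $ j) > R \<Longrightarrow> f z = 0" using assms by (rule cls_supp) blast
  show ?thesis
    unfolding cls_def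
  proof (intro conjI exI[of _ R] allI impI ballI)
    show "smooth (\<lambda>z. f (upd z i 0))" by (rule smooth_compose_linear[OF cls_smooth[OF assms] bounded_linear_upd])
    show "f (upd (upd z j w) i 0) = f (upd z i 0)" if "j \<in> insert i S" for z j w
    proof (cases "j = i")
      case False
      then have "j \<in> S" using that by simp
      have "upd (upd z j w) i 0 = upd (upd z i 0) j w" using False by (rule upd_commute)
      then show ?thesis using cls_upd[OF assms \<open>j \<in> S\<close>] by simp
    qed (simp add: upd_upd)
    show "f (upd z i 0) = 0" if "\<exists>j. j \<notin> insert i S \<and> R < cmod (z $ j)" for z
    proof -
      obtain j where j: "j \<notin> S" "j \<noteq> i" "R < cmod (z $ j)" using \<open>\<exists>j. j \<notin> insert i S \<and> R < cmod (z $ j)\<close> by blast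
      show ?thesis by (rule R[OF j(1)]) (simp add: j(2,3))
    qed
  qed
qed

lemma cls_project:
  assumes "cls S f" "T \<subseteq> S"
  shows "f (\<chi> j. if j \<in> T then 0 else z $ j) = f z"
proof -
  have "finite T" by simp
  then show ?thesis using assms(2)
  proof (induction T)
    case (insert x T)
    have "(\<chi> j. if j \<in> insert x T then 0 else z $ j) = upd (\<chi> j. if j \<in> T then 0 else z $ j) x 0"
      by (simp add: Finite_Cartesian_Product.vec_eq_iff)
    then show ?case using insert cls_upd[OF assms(1)] by simp
  qed (simp add: vec_lambda_eta)
qed

text \<open>Setting the coordinates in \<open>S\<close> to 0 does not change the value and moves
  every point where the function may be nonzero into one compact ball.\<close>

lemma cls_bounded:
  assumes "cls S f"
  obtains C where "\<And>z. cmod (f z) \<le> C"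
proof -
  obtain R where R: "\<And>z j. j \<notin> S \<Longrightarrow> cmod (z $ j) > R \<Longrightarrow> f z = 0" using assms by (rule cls_supp) blast
  let ?K = "cball 0 (real CARD('a) * \<bar>R\<bar>) :: (complex^'a) set"
  have "compact (f ` ?K)"
    by (intro compact_continuous_image continuous_on_subset[OF smooth_continuous[OF cls_smooth[OF assms]]]) auto
  then have "bounded (f ` ?K)" by (rule compact_imp_bounded)
  then obtain C where C: "\<And>z. z \<in> ?K \<Longrightarrow> cmod (f z) \<le> C" unfolding bounded_iff by blast
  have "cmod (f z) \<le> max C 0" for z
  proof (cases "\<exists>j. j \<notin> S \<and> cmod (z $ j) > R")
    case True then show ?thesis using R by auto
  next
    case False
    let ?z = "(\<chi> j. if j \<in> S then 0 else z $ j) :: complex^'a"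
    have "norm ?z \<le> (\<Sum>j\<in>UNIV. cmod (?z $ j))" unfolding norm_vec_def by (rule L2_set_le_sum) auto
    also have "\<dots> \<le> (\<Sum>j\<in>(UNIV::'a set). \<bar>R\<bar>)" using False by (intro sum_mono) (auto simp: not_less intro: order_trans[OF _ abs_ge_self])
    finally have "?z \<in> ?K" by simp
    from C[OF this] show ?thesis using cls_project[OF assms subset_refl, of z] by simp
  qed
  then show ?thesis using that by blast
qed

text \<open>Taylor expansion in \<open>z_i\<close> and its conjugate, with coefficients depending on
  the remaining variables. Expansions of order \<open>K\<close> of both Wirtinger derivatives
  integrate, along the segment from \<open>upd z i 0\<close> to \<open>z\<close>, to one of order
  \<open>Suc K\<close> of \<open>f\<close>. The error constant is uniform because the induction
  starts from boundedness.\<close>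

lemma taylor_coord:
  assumes "cls S f" "i \<notin> S"
  shows "\<exists>c C. (\<forall>b g. cls (insert i S) (c b g)) \<and>
    (\<forall>z. cmod (f z - (\<Sum>b<K. \<Sum>g<K. c b g z * z$i ^ b * cnj (z$i) ^ g)) \<le> C * cmod (z$i) ^ K)"
  using assms
proof (induction K arbitrary: f)
  case 0
  obtain C where "\<And>z. cmod (f z) \<le> C" using cls_bounded[OF 0(1)] by blast
  then show ?case by (intro exI[of _ "\<lambda>b g z. 0"] exI[of _ C]) (auto simp: cls_zero)
next
  case (Suc K)
  obtain c1 C1 where c1: "\<And>b g. cls (insert i S) (c1 b g)"
    "\<And>z. cmod (dz i f z - (\<Sum>b<K. \<Sum>g<K. c1 b g z * z$i ^ b * cnj (z$i) ^ g)) \<le> C1 * cmod (z$i) ^ K"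
    using Suc.IH[OF cls_dz[OF Suc.prems(1)] Suc.prems(2)] by blast
  obtain c2 C2 where c2: "\<And>b g. cls (insert i S) (c2 b g)"
    "\<And>z. cmod (dzb i f z - (\<Sum>b<K. \<Sum>g<K. c2 b g z * z$i ^ b * cnj (z$i) ^ g)) \<le> C2 * cmod (z$i) ^ K"
    using Suc.IH[OF cls_dzb[OF Suc.prems(1)] Suc.prems(2)] by blast
  \<comment> \<open>Integrating \<open>r^(b+g-1)\<close> over the segment gives the denominators
    \<open>b + g\<close>. The guards \<open>g < K\<close> and \<open>b < K\<close> discard what lies
    outside the two expansions of order \<open>K\<close>.\<close>
  define c where "c b g z = (if b = 0 \<and> g = 0 then 1 else 0) * f (upd z i 0) +
     ((if b > 0 \<and> g < K then 1 / of_nat (b + g) else 0) * c1 (b - 1) g z +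
      (if g > 0 \<and> b < K then 1 / of_nat (b + g) else 0) * c2 b (g - 1) z)" for b g z
  have cc: "cls (insert i S) (c b g)" for b g
    unfolding c_def[abs_def] by (intro cls_add cls_cmult cls_restrict Suc.prems c1 c2)
  have C12: "C1 \<ge> 0" "C2 \<ge> 0"
    using order_trans[OF norm_ge_zero c1(2)[of "axis i 1"]] order_trans[OF norm_ge_zero c2(2)[of "axis i 1"]]
    by (simp_all add: axis_def)
  have "cmod (f z - (\<Sum>b<Suc K. \<Sum>g<Suc K. c b g z * z$i ^ b * cnj (z$i) ^ g)) \<le> (C1 + C2) * cmod (z$i) ^ Suc K" for z
  proof -
    define u where "u = z $ i"
    define zr where "zr r = upd z i (of_real r * u)" for r :: real
    define e where "e b g = u ^ b * cnj u ^ g * (u * c1 b g z + cnj u * c2 b g z)" for b g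
    \<comment> \<open>The Taylor error along the segment, with the polynomial already integrated in
      \<open>r\<close>. It is 0 at \<open>r = 0\<close> and is the desired error at
      \<open>r = 1\<close>, so a bound on the derivative \<open>H'\<close> suffices.\<close>
    define H where "H r = f (zr r) - f (zr 0) - (\<Sum>b<K. \<Sum>g<K. of_real (r ^ (b + g + 1) / real (b + g + 1)) * e b g)" for r :: real
    define H' where "H' r = frechet_derivative f (at (zr r)) (axis i u) - (\<Sum>b<K. \<Sum>g<K. of_real (r ^ (b + g)) * e b g)" for r :: real
    have zr_nth: "zr r $ i = of_real r * u" for r by (simp add: zr_def)
    have c_zr: "c1 b g (zr r) = c1 b g z" "c2 b g (zr r) = c2 b g z" for b g r
      unfolding zr_def by (auto intro: cls_upd[OF c1(1)] cls_upd[OF c2(1)])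
    have dzr: "(zr has_derivative (\<lambda>h. h *\<^sub>R axis i u)) (at r within T)" for r T
    proof -
      have "zr = (\<lambda>r. upd z i 0 + r *\<^sub>R axis i u)"
        by (rule ext) (simp add: zr_def Finite_Cartesian_Product.vec_eq_iff axis_def scaleR_conv_of_real[where 'a=complex])
      then show ?thesis by (auto intro!: derivative_eq_intros)
    qed
    have dH: "(H has_derivative (\<lambda>h. h *\<^sub>R H' r)) (at r within {0..1})" for r
    proof -
      have "((\<lambda>r. f (zr r)) has_derivative (\<lambda>h. frechet_derivative f (at (zr r)) (h *\<^sub>R axis i u))) (at r within {0..1})"
        by (rule has_derivative_compose[OF dzr smooth_has_derivative[OF cls_smooth[OF Suc.prems(1)]]])
      moreover have "frechet_derivative f (at (zr r)) (h *\<^sub>R axis i u) = h *\<^sub>R frechet_derivative f (at (zr r)) (axis i u)" for h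
        using has_derivative_linear[OF smooth_has_derivative[OF cls_smooth[OF Suc.prems(1)]]] by (rule linear_scale)
      ultimately have 1: "((\<lambda>r. f (zr r)) has_vector_derivative frechet_derivative f (at (zr r)) (axis i u)) (at r within {0..1})"
        by (simp add: has_vector_derivative_def)
      have "((\<lambda>r. r ^ Suc n / real (Suc n)) has_real_derivative r ^ n) (at r within {0..1})" for n
        by (rule derivative_eq_intros refl | simp)+
      from this[of "_ + _"] have "((\<lambda>r. r ^ (b + g + 1) / real (b + g + 1)) has_real_derivative r ^ (b + g)) (at r within {0..1})" for b g
        unfolding add_Suc_right[symmetric] One_nat_def Nat.add_0_right by simp
      then have 2: "((\<lambda>r. of_real (r ^ (b + g + 1) / real (b + g + 1)) * e b g) has_vector_derivative of_real (r ^ (b + g)) * e b g) (at r within {0..1})" for b g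
        by (intro has_vector_derivative_mult_left has_vector_derivative_of_real)
          (simp add: has_real_derivative_iff_has_vector_derivative)
      have "(H has_vector_derivative H' r) (at r within {0..1})"
        unfolding H_def[abs_def] H'_def
        by (rule derivative_eq_intros 1 2 | simp)+
      then show ?thesis by (simp add: has_vector_derivative_def)
    qed
    have bH: "cmod (H' r) \<le> (C1 + C2) * cmod u ^ Suc K" if r: "r \<in> {0..1}" for r
    proof -
      have e: "of_real (r ^ (b + g)) * e b g = u * (c1 b g (zr r) * zr r $ i ^ b * cnj (zr r $ i) ^ g) + cnj u * (c2 b g (zr r) * zr r $ i ^ b * cnj (zr r $ i) ^ g)" for b g
        by (simp add: e_def c_zr zr_nth power_mult_distrib power_add algebra_simps)
      have "H' r = u * (dz i f (zr r) - (\<Sum>b<K. \<Sum>g<K. c1 b g (zr r) * zr r $ i ^ b * cnj (zr r $ i) ^ g))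
         + cnj u * (dzb i f (zr r) - (\<Sum>b<K. \<Sum>g<K. c2 b g (zr r) * zr r $ i ^ b * cnj (zr r $ i) ^ g))"
        unfolding H'_def frechet_axis[OF cls_smooth[OF Suc.prems(1)]] e sum.distrib
        by (simp add: right_diff_distrib sum_distrib_left)
      also have "cmod \<dots> \<le> cmod u * (C1 * cmod (zr r $ i) ^ K) + cmod u * (C2 * cmod (zr r $ i) ^ K)"
        by (rule norm_triangle_le) (auto simp: norm_mult intro!: add_mono mult_left_mono c1(2) c2(2))
      also have "\<dots> = (C1 + C2) * (cmod u * cmod (zr r $ i) ^ K)" by (simp add: algebra_simps)
      also have "cmod (zr r $ i) ^ K \<le> cmod u ^ K"
        using r by (intro power_mono) (auto simp: zr_nth norm_mult mult_left_le_one_le)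
      finally show ?thesis using C12 by (simp add: mult_left_mono)
    qed
    have "norm (H 1 - H 0) \<le> ((C1 + C2) * cmod u ^ Suc K) * norm (1 - 0 :: real)"
    proof (rule differentiable_bound[where S="{0..1}"])
      show "onorm (\<lambda>h. h *\<^sub>R H' r) \<le> (C1 + C2) * cmod u ^ Suc K" if "r \<in> {0..1}" for r
      proof (rule onorm_le)
        fix x :: real
        show "norm (x *\<^sub>R H' r) \<le> (C1 + C2) * cmod u ^ Suc K * norm x"
          using mult_left_mono[OF bH[OF that], of "\<bar>x\<bar>"] by (simp add: mult.commute)
      qed
    qed (use dH in auto)
    moreover have "H 0 = 0" by (simp add: H_def)
    moreover have "H 1 = f z - (\<Sum>b<Suc K. \<Sum>g<Suc K. c b g z * u ^ b * cnj u ^ g)"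
    proof -
      have s0: "(\<Sum>b<Suc K. \<Sum>g<Suc K. (if b = 0 \<and> g = 0 then 1 else 0) * f (upd z i 0) * u ^ b * cnj u ^ g) = f (upd z i 0)"
        by (simp add: sum.lessThan_Suc_shift del: sum.lessThan_Suc)
      have s1: "(\<Sum>b<Suc K. \<Sum>g<Suc K. (if b > 0 \<and> g < K then 1 / of_nat (b + g) else 0) * c1 (b - 1) g z * u ^ b * cnj u ^ g)
          = (\<Sum>b<K. \<Sum>g<K. 1 / of_nat (b + g + 1) * c1 b g z * u ^ Suc b * cnj u ^ g)"
      proof -
        have "(\<Sum>g<Suc K. (if Suc b > 0 \<and> g < K then 1 / of_nat (Suc b + g) else 0) * c1 (Suc b - 1) g z * u ^ Suc b * cnj u ^ g)
          = (\<Sum>g<K. 1 / of_nat (b + g + 1) * c1 b g z * u ^ Suc b * cnj u ^ g)" for b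
          by simp
        then show ?thesis
          by (subst sum.lessThan_Suc_shift) (simp only: less_irrefl False_implies_equals simp_thms if_False mult_zero_left sum.neutral_const add_0)
      qed
      have s2: "(\<Sum>b<Suc K. \<Sum>g<Suc K. (if g > 0 \<and> b < K then 1 / of_nat (b + g) else 0) * c2 b (g - 1) z * u ^ b * cnj u ^ g)
          = (\<Sum>b<K. \<Sum>g<K. 1 / of_nat (b + g + 1) * c2 b g z * u ^ b * cnj u ^ Suc g)"
      proof -
        have "(\<Sum>g<Suc K. (if g > 0 \<and> b < K then 1 / of_nat (b + g) else 0) * c2 b (g - 1) z * u ^ b * cnj u ^ g)
          = (if b < K then (\<Sum>g<K. 1 / of_nat (b + g + 1) * c2 b g z * u ^ b * cnj u ^ Suc g) else 0)" for b
          by (subst sum.lessThan_Suc_shift) simp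
        then have "(\<Sum>b<Suc K. \<Sum>g<Suc K. (if g > 0 \<and> b < K then 1 / of_nat (b + g) else 0) * c2 b (g - 1) z * u ^ b * cnj u ^ g)
          = (\<Sum>b<Suc K. if b < K then (\<Sum>g<K. 1 / of_nat (b + g + 1) * c2 b g z * u ^ b * cnj u ^ Suc g) else 0)"
          by (simp only:)
        also have "\<dots> = (\<Sum>b<K. (\<Sum>g<K. 1 / of_nat (b + g + 1) * c2 b g z * u ^ b * cnj u ^ Suc g))"
          by (subst sum.lessThan_Suc) simp
        finally show ?thesis .
      qed
      have "(\<Sum>b<Suc K. \<Sum>g<Suc K. c b g z * u ^ b * cnj u ^ g) = f (upd z i 0) +
         ((\<Sum>b<K. \<Sum>g<K. 1 / of_nat (b + g + 1) * c1 b g z * u ^ Suc b * cnj u ^ g) + (\<Sum>b<K. \<Sum>g<K. 1 / of_nat (b + g + 1) * c2 b g z * u ^ b * cnj u ^ Suc g))"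
        unfolding c_def distrib_right sum.distrib s0 s1 s2 ..
      moreover have "of_real (1 ^ (b + g + 1) / real (b + g + 1)) * e b g = 1 / of_nat (b + g + 1) * c1 b g z * u ^ Suc b * cnj u ^ g + 1 / of_nat (b + g + 1) * c2 b g z * u ^ b * cnj u ^ Suc g" for b g
      proof -
        have "of_real (1 ^ (b + g + 1) / real (b + g + 1)) = (1 / of_nat (b + g + 1) :: complex)"
          by (simp only: power_one of_real_divide of_real_1 of_real_of_nat_eq)
        then show ?thesis by (simp only: e_def distrib_left power_Suc mult_ac)
      qed
      moreover have "zr 1 = z" "zr 0 = upd z i 0" by (simp_all add: zr_def u_def upd_id)
      ultimately show ?thesis
        unfolding H_def sum.distrib[symmetric] by (simp only: diff_diff_eq)
    qed
    ultimately show ?thesis by (simp add: u_def)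
  qed
  then show ?case using cc by blast
qed


lemma test_fun_cls:
  fixes \<phi> :: "complex^'n::finite \<Rightarrow> complex"
  assumes t: "test_fun \<phi>"
  shows "cls {} \<phi>"
proof -
  from t obtain K where K: "compact K" "\<And>z. z \<notin> K \<Longrightarrow> \<phi> z = 0" unfolding test_fun_def by blast
  from compact_imp_bounded[OF K(1)] obtain R where R: "\<And>z. z \<in> K \<Longrightarrow> norm z \<le> R" unfolding bounded_iff by blast
  have "\<phi> z = 0" if "cmod (z $ j) > R" for z j
    using that K(2) R[of z] Finite_Cartesian_Product.norm_nth_le[of z j] by fastforce
  then show ?thesis using t unfolding cls_def test_fun_def smooth_def by blast
qed

section \<open>Expansion in all coordinates and evaluation of the tensor product\<close>

definition zz :: "('n::finite \<Rightarrow> nat) \<Rightarrow> ('n \<Rightarrow> nat) \<Rightarrow> complex^'n \<Rightarrow> complex" where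
  "zz \<beta> \<gamma> z = (\<Prod>i\<in>UNIV. z$i ^ \<beta> i * cnj (z$i) ^ \<gamma> i)"

lemma norm_zz_le_1: "(\<And>i. cmod (z$i) \<le> 1) \<Longrightarrow> cmod (zz \<beta> \<gamma> z) \<le> 1"
  unfolding zz_def prod_norm[symmetric]
  by (intro prod_le_1) (auto simp: norm_mult norm_power intro!: mult_le_one power_le_one)

lemma zz_fun_upd:
  assumes "\<beta> i = 0" "\<gamma> i = 0"
  shows "zz (\<beta>(i := b)) (\<gamma>(i := g)) z = z$i ^ b * cnj (z$i) ^ g * zz \<beta> \<gamma> z"
proof -
  have "zz (\<beta>(i := b)) (\<gamma>(i := g)) z = (z$i ^ b * cnj (z$i) ^ g) * (\<Prod>j\<in>UNIV - {i}. z$j ^ \<beta> j * cnj (z$j) ^ \<gamma> j)"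
    unfolding zz_def by (subst prod.remove[of _ i]) (auto intro!: prod.cong)
  moreover have "zz \<beta> \<gamma> z = (\<Prod>j\<in>UNIV - {i}. z$j ^ \<beta> j * cnj (z$j) ^ \<gamma> j)"
    unfolding zz_def using assms by (subst prod.remove[of _ i]) auto
  ultimately show ?thesis by simp
qed

lemma tens_Cons_upd: "tens (i # l) p \<phi> z = dbar_inv (p i) (\<lambda>w. tens l p \<phi> (upd z i w))"
  by (simp add: upd_def)

text \<open>The scalar \<open>k\<close> carries the powers of \<open>pi\<close> gathered from
  coordinates already treated; the remaining variables enter as parameters.\<close>

lemma dbar_inv_coord:
  fixes k :: complex and c :: "nat \<Rightarrow> nat \<Rightarrow> complex^'n::finite \<Rightarrow> complex"
  assumes f: "cls S f" and i: "i \<notin> S"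
    and c: "\<And>b g. cls (insert i S) (c b g)"
    "\<And>z. cmod (f z - (\<Sum>b<K. \<Sum>g<K. c b g z * z$i ^ b * cnj (z$i) ^ g)) \<le> D * cmod (z$i) ^ K"
    and p: "1 \<le> p" "p \<le> K"
  shows "dbar_inv p (\<lambda>w. k * f (upd z i w)) = pi * (k * c (p - 1) 0 z)"
proof -
  obtain B where B: "\<And>z. cmod (f z) \<le> B" using cls_bounded[OF f] by blast
  obtain R where R: "\<And>z j. j \<notin> S \<Longrightarrow> cmod (z $ j) > R \<Longrightarrow> f z = 0" using cls_supp[OF f] by blast
  have cu: "continuous_on UNIV (\<lambda>w. upd z i w)"
    unfolding upd_def
  proof (rule continuous_on_vec_lambda)
    show "continuous_on UNIV (\<lambda>w. if j = i then w else z $ j)" for j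
      by (cases "j = i") (simp_all add: continuous_on_id continuous_on_const)
  qed
  show ?thesis
  proof (rule dbar_inv_eq[OF _ _ _ p])
    show "(\<lambda>w. k * f (upd z i w)) \<in> borel_measurable borel"
      by (rule borel_measurable_continuous_onI, rule continuous_on_mult[OF continuous_on_const],
          rule continuous_on_compose2[OF smooth_continuous[OF cls_smooth[OF f]] cu]) simp
    show "cmod (k * f (upd z i w)) \<le> cmod k * max B D" for w
      unfolding norm_mult by (intro mult_left_mono max.coboundedI1 B) simp
    show "k * f (upd z i w) = 0" if "cmod w > R" for w
      using R[OF i, of "upd z i w"] that by simp
    show "cmod (k * f (upd z i w) - (\<Sum>b<K. \<Sum>g<K. (k * c b g z) * w ^ b * cnj w ^ g)) \<le> cmod k * max B D * cmod w ^ K" for w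
    proof -
      have "k * f (upd z i w) - (\<Sum>b<K. \<Sum>g<K. (k * c b g z) * w ^ b * cnj w ^ g) = k * (f (upd z i w) - (\<Sum>b<K. \<Sum>g<K. c b g z * w ^ b * cnj w ^ g))"
        by (simp add: right_diff_distrib sum_distrib_left mult.assoc)
      moreover have "cmod (f (upd z i w) - (\<Sum>b<K. \<Sum>g<K. c b g z * w ^ b * cnj w ^ g)) \<le> D * cmod w ^ K"
        using c(2)[of "upd z i w"] by (simp add: cls_upd[OF c(1)])
      moreover have "D * cmod w ^ K \<le> max B D * cmod w ^ K" by (intro mult_right_mono) auto
      ultimately show ?thesis
        using mult_left_mono[of "cmod (f (upd z i w) - (\<Sum>b<K. \<Sum>g<K. c b g z * w ^ b * cnj w ^ g))" "max B D * cmod w ^ K" "cmod k"]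
        by (simp only: norm_mult mult.assoc norm_ge_zero)
    qed
  qed
qed

text \<open>Each step expands the present coefficients in one more coordinate. Remainder and tensor
  product share one induction because \<open>tens\<close> peels off coordinates in the same order
  and so singles out the same coefficient. The restriction to \<open>|z_i| \<le> 1\<close> keeps the
  monomials bounded by which new remainders are multiplied.\<close>

lemma taylor_multi:
  fixes \<phi> :: "complex^'n::finite \<Rightarrow> complex"
  assumes "cls {} \<phi>" "distinct l" "\<And>i. p i \<le> K" "K \<ge> 1"
  shows "\<exists>Q \<Phi> C. finite Q \<and> (\<forall>(\<beta>,\<gamma>)\<in>Q. \<forall>i. i \<notin> set l \<longrightarrow> \<beta> i = 0 \<and> \<gamma> i = 0) \<and>
     (\<forall>\<beta> \<gamma>. cls (set l) (\<Phi> \<beta> \<gamma>)) \<and>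
     (\<forall>z. (\<forall>i. cmod (z$i) \<le> 1) \<longrightarrow>
        cmod (\<phi> z - (\<Sum>(\<beta>,\<gamma>)\<in>Q. \<Phi> \<beta> \<gamma> z * zz \<beta> \<gamma> z)) \<le> C * (\<Sum>i\<in>UNIV. cmod (z$i) ^ K)) \<and>
     (\<lambda>i. if i \<in> set l then p i - 1 else 0, \<lambda>i. 0) \<in> Q \<and>
     ((\<forall>i. p i \<ge> 1) \<longrightarrow> (\<forall>z. tens l p \<phi> z = of_real pi ^ length l * \<Phi> (\<lambda>i. if i \<in> set l then p i - 1 else 0) (\<lambda>i. 0) z))"
  using assms(2)
proof (induction l)
  case Nil
  have "zz (\<lambda>i. 0) (\<lambda>i. 0) z = 1" for z :: "complex^'n" by (simp add: zz_def)
  then have "\<phi> z - (\<Sum>(\<beta>,\<gamma>)\<in>{(\<lambda>i. 0, \<lambda>i. 0)}. \<phi> z * zz \<beta> \<gamma> z) = 0" for z by simp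
  then show ?case
    using assms(1)
    by (intro exI[of _ "{(\<lambda>i. 0, \<lambda>i. 0)}"] exI[of _ "\<lambda>_ _. \<phi>"] exI[of _ 0] conjI) (simp_all del: sum.insert)
next
  case (Cons i l)
  have dl: "distinct l" and i: "i \<notin> set l" using Cons.prems by simp_all
  from Cons.IH[OF dl] obtain Q \<Phi> C where Q0: "finite Q" "\<forall>(\<beta>,\<gamma>)\<in>Q. \<forall>i. i \<notin> set l \<longrightarrow> \<beta> i = 0 \<and> \<gamma> i = 0"
    "\<forall>\<beta> \<gamma>. cls (set l) (\<Phi> \<beta> \<gamma>)"
    "\<forall>z. (\<forall>i. cmod (z$i) \<le> 1) \<longrightarrow>
        cmod (\<phi> z - (\<Sum>(\<beta>,\<gamma>)\<in>Q. \<Phi> \<beta> \<gamma> z * zz \<beta> \<gamma> z)) \<le> C * (\<Sum>i\<in>UNIV. cmod (z$i) ^ K)"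
    "(\<lambda>i. if i \<in> set l then p i - 1 else 0, \<lambda>i. 0) \<in> Q"
    "(\<forall>i. p i \<ge> 1) \<longrightarrow> (\<forall>z. tens l p \<phi> z = of_real pi ^ length l * \<Phi> (\<lambda>i. if i \<in> set l then p i - 1 else 0) (\<lambda>i. 0) z)"
    by (elim exE conjE) (rule that)
  have "\<beta> i = 0 \<and> \<gamma> i = 0" if "(\<beta>,\<gamma>) \<in> Q" "i \<notin> set l" for \<beta> \<gamma> i
    using bspec[OF Q0(2) that(1)] that(2) by simp
  note Q = Q0(1) this Q0(3)[rule_format] Q0(4)[rule_format] Q0(5) Q0(6)[rule_format]
  have "\<forall>\<beta> \<gamma>. \<exists>c C. (\<forall>b g. cls (insert i (set l)) (c b g)) \<and>
    (\<forall>z. cmod (\<Phi> \<beta> \<gamma> z - (\<Sum>b<K. \<Sum>g<K. c b g z * z$i ^ b * cnj (z$i) ^ g)) \<le> C * cmod (z$i) ^ K)"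
    using taylor_coord[OF Q(3) i] by blast
  from this[unfolded choice_iff] obtain c CC where cc: "\<forall>\<beta> \<gamma>. (\<forall>b g. cls (insert i (set l)) (c \<beta> \<gamma> b g)) \<and>
    (\<forall>z. cmod (\<Phi> \<beta> \<gamma> z - (\<Sum>b<K. \<Sum>g<K. c \<beta> \<gamma> b g z * z$i ^ b * cnj (z$i) ^ g)) \<le> CC \<beta> \<gamma> * cmod (z$i) ^ K)"
    by (elim exE) (rule that)
  have c: "cls (insert i (set l)) (c \<beta> \<gamma> b g)"
    "cmod (\<Phi> \<beta> \<gamma> z - (\<Sum>b<K. \<Sum>g<K. c \<beta> \<gamma> b g z * z$i ^ b * cnj (z$i) ^ g)) \<le> CC \<beta> \<gamma> * cmod (z$i) ^ K" for \<beta> \<gamma> b g z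
    using cc[rule_format] by (rule conjunct1[THEN spec2], rule conjunct2[THEN spec])
  define \<Phi>' where "\<Phi>' \<beta> \<gamma> = c (\<beta>(i := 0)) (\<gamma>(i := 0)) (\<beta> i) (\<gamma> i)" for \<beta> \<gamma>
  define em where "em = (\<lambda>((\<beta> :: 'n \<Rightarrow> nat, \<gamma> :: 'n \<Rightarrow> nat), b :: nat, g :: nat). (\<beta>(i := b), \<gamma>(i := g)))"
  let ?P = "Q \<times> ({..<K} \<times> {..<K})"
  define Q' where "Q' = em ` ?P"
  have z0: "\<beta>(i := 0) = \<beta>" "\<gamma>(i := 0) = \<gamma>" if "(\<beta>,\<gamma>) \<in> Q" for \<beta> \<gamma>
    using Q(2)[OF that i] by auto
  have inj: "inj_on em ?P"
  proof (rule inj_onI, clarsimp simp: em_def)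
    fix \<beta> \<gamma> b g \<beta>' \<gamma>' b' g'
    assume *: "(\<beta>,\<gamma>) \<in> Q" "(\<beta>',\<gamma>') \<in> Q" "\<beta>(i := b) = \<beta>'(i := b')" "\<gamma>(i := g) = \<gamma>'(i := g')"
    then show "\<beta> = \<beta>' \<and> \<gamma> = \<gamma>' \<and> b = b' \<and> g = g'"
      by (metis z0 fun_upd_upd fun_upd_same)
  qed
  have sumQ': "(\<Sum>(\<beta>,\<gamma>)\<in>Q'. \<Phi>' \<beta> \<gamma> z * zz \<beta> \<gamma> z) = (\<Sum>(\<beta>,\<gamma>)\<in>Q. (\<Sum>b<K. \<Sum>g<K. c \<beta> \<gamma> b g z * z$i ^ b * cnj (z$i) ^ g) * zz \<beta> \<gamma> z)" for z
  proof -
    have "(\<Sum>(\<beta>,\<gamma>)\<in>Q'. \<Phi>' \<beta> \<gamma> z * zz \<beta> \<gamma> z) = (\<Sum>x\<in>?P. case em x of (\<beta>,\<gamma>) \<Rightarrow> \<Phi>' \<beta> \<gamma> z * zz \<beta> \<gamma> z)"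
      unfolding Q'_def by (subst sum.reindex[OF inj]) (simp add: o_def)
    also have "\<dots> = (\<Sum>x\<in>?P. case x of ((\<beta>,\<gamma>),b,g) \<Rightarrow> c \<beta> \<gamma> b g z * z$i ^ b * cnj (z$i) ^ g * zz \<beta> \<gamma> z)"
    proof (intro sum.cong refl, clarify)
      fix \<beta> \<gamma> b g assume q: "(\<beta>,\<gamma>) \<in> Q"
      have "\<beta> i = 0" "\<gamma> i = 0" using Q(2)[OF q i] by auto
      then show "(case em ((\<beta>, \<gamma>), b, g) of (\<beta>, \<gamma>) \<Rightarrow> \<Phi>' \<beta> \<gamma> z * zz \<beta> \<gamma> z) = c \<beta> \<gamma> b g z * z$i ^ b * cnj (z$i) ^ g * zz \<beta> \<gamma> z"
        using z0[OF q] by (simp add: em_def \<Phi>'_def zz_fun_upd)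
    qed
    also have "\<dots> = (\<Sum>(\<beta>,\<gamma>)\<in>Q. \<Sum>b<K. \<Sum>g<K. c \<beta> \<gamma> b g z * z$i ^ b * cnj (z$i) ^ g * zz \<beta> \<gamma> z)"
      by (simp add: sum.cartesian_product split_beta)
    finally show ?thesis by (simp add: sum_distrib_right split_beta)
  qed
  let ?pm = "\<lambda>i. if i \<in> set l then p i - 1 else 0" and ?pm' = "\<lambda>j. if j \<in> set (i # l) then p j - 1 else 0"
  have pm: "?pm' = ?pm(i := p i - 1)" "(\<lambda>j. 0 :: nat) = (\<lambda>j. 0)(i := 0)" "?pm'(i := 0) = ?pm" using i by auto
  define C' where "C' = C + (\<Sum>(\<beta>,\<gamma>)\<in>Q. \<bar>CC \<beta> \<gamma>\<bar>)"
  have T: "tens (i # l) p \<phi> z = of_real pi ^ length (i # l) * \<Phi>' ?pm' (\<lambda>i. 0) z" if p: "\<forall>i. 1 \<le> p i" for z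
  proof -
      let ?f = "\<Phi> ?pm (\<lambda>i. 0)" and ?c = "c ?pm (\<lambda>i. 0)"
      let ?l = "of_real pi ^ length l :: complex"
      have dbi: "dbar_inv (p i) (\<lambda>w. ?l * ?f (upd z i w)) = pi * (?l * ?c (p i - 1) 0 z)"
        by (rule dbar_inv_coord[OF Q(3) i c p[rule_format] assms(3)])
      have t1: "tens (i # l) p \<phi> z = dbar_inv (p i) (\<lambda>w. ?l * ?f (upd z i w))"
        unfolding tens_Cons_upd Q(6)[OF p[rule_format]] ..
      have ph: "\<Phi>' ?pm' (\<lambda>i. 0) z = ?c (p i - 1) 0 z"
      proof -
        have "?pm' i = p i - 1" "(\<lambda>j. 0 :: nat)(i := 0) = (\<lambda>j. 0)" by auto
        then show ?thesis unfolding \<Phi>'_def pm(3) by (simp only:)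
      qed
      have len: "of_real pi ^ length (i # l) = of_real pi * ?l" by simp
      have e1: "tens (i # l) p \<phi> z = of_real pi * (?l * ?c (p i - 1) 0 z)" using t1 dbi by (rule trans)
      have e2: "\<dots> = of_real pi ^ length (i # l) * ?c (p i - 1) 0 z" unfolding len mult.assoc ..
      have e3: "of_real pi ^ length (i # l) * ?c (p i - 1) 0 z = of_real pi ^ length (i # l) * \<Phi>' ?pm' (\<lambda>i. 0) z"
        by (rule arg_cong[OF ph[symmetric]])
      have e4: "tens (i # l) p \<phi> z = of_real pi ^ length (i # l) * \<Phi>' ?pm' (\<lambda>i. 0) z"
        by (rule trans[OF e1 trans[OF e2 e3]])
      show ?thesis by (rule e4)
  qed
    have F1: "finite Q'" using Q(1) by (simp add: Q'_def)
    have F2: "\<forall>(\<beta>, \<gamma>)\<in>Q'. \<forall>ia. ia \<notin> set (i # l) \<longrightarrow> \<beta> ia = 0 \<and> \<gamma> ia = 0"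
      using Q(2) by (auto simp: Q'_def em_def)
    have F3: "\<forall>\<beta> \<gamma>. cls (set (i # l)) (\<Phi>' \<beta> \<gamma>)" using c(1) by (simp add: \<Phi>'_def)
    have "em ((?pm, \<lambda>i. 0), p i - 1, 0) \<in> Q'"
      unfolding Q'_def using Q(5) assms(3)[of i] assms(4) by (intro imageI) auto
    then have F5: "(?pm', \<lambda>i. 0) \<in> Q'" using pm by (simp add: em_def)
    have F4: "\<forall>z. (\<forall>i. cmod (z $ i) \<le> 1) \<longrightarrow> cmod (\<phi> z - (\<Sum>(\<beta>, \<gamma>)\<in>Q'. \<Phi>' \<beta> \<gamma> z * zz \<beta> \<gamma> z)) \<le> C' * (\<Sum>i\<in>UNIV. cmod (z $ i) ^ K)"
    proof (intro allI impI)
      fix z :: "complex^'n" assume z: "\<forall>i. cmod (z $ i) \<le> 1"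
      let ?S = "\<Sum>i\<in>UNIV. cmod (z $ i) ^ K"
      have iS: "cmod (z $ i) ^ K \<le> ?S" by (rule member_le_sum) auto
      let ?X = "(\<phi> z - (\<Sum>(\<beta>,\<gamma>)\<in>Q. \<Phi> \<beta> \<gamma> z * zz \<beta> \<gamma> z))
         + (\<Sum>(\<beta>,\<gamma>)\<in>Q. (\<Phi> \<beta> \<gamma> z - (\<Sum>b<K. \<Sum>g<K. c \<beta> \<gamma> b g z * z$i ^ b * cnj (z$i) ^ g)) * zz \<beta> \<gamma> z)"
      have eqn: "\<phi> z - (\<Sum>(\<beta>, \<gamma>)\<in>Q'. \<Phi>' \<beta> \<gamma> z * zz \<beta> \<gamma> z) = ?X"
        unfolding sumQ' by (simp add: split_beta left_diff_distrib sum_subtractf)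
      have le: "cmod ?X \<le> C * ?S + (\<Sum>(\<beta>,\<gamma>)\<in>Q. \<bar>CC \<beta> \<gamma>\<bar>) * ?S"
      proof (rule norm_triangle_le, rule add_mono)
        show "cmod (\<phi> z - (\<Sum>(\<beta>,\<gamma>)\<in>Q. \<Phi> \<beta> \<gamma> z * zz \<beta> \<gamma> z)) \<le> C * ?S" using Q(4) z by blast
        show "cmod (\<Sum>(\<beta>,\<gamma>)\<in>Q. (\<Phi> \<beta> \<gamma> z - (\<Sum>b<K. \<Sum>g<K. c \<beta> \<gamma> b g z * z$i ^ b * cnj (z$i) ^ g)) * zz \<beta> \<gamma> z) \<le> (\<Sum>(\<beta>,\<gamma>)\<in>Q. \<bar>CC \<beta> \<gamma>\<bar>) * ?S"
          unfolding sum_distrib_right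
        proof (rule sum_norm_le, clarify)
          fix \<beta> \<gamma>
          have "cmod ((\<Phi> \<beta> \<gamma> z - (\<Sum>b<K. \<Sum>g<K. c \<beta> \<gamma> b g z * z$i ^ b * cnj (z$i) ^ g)) * zz \<beta> \<gamma> z) \<le> (CC \<beta> \<gamma> * cmod (z$i) ^ K) * 1"
            unfolding norm_mult using z order_trans[OF norm_ge_zero c(2)]
            by (intro mult_mono c(2) norm_zz_le_1) auto
          also have "\<dots> \<le> \<bar>CC \<beta> \<gamma>\<bar> * ?S" using iS by (simp add: mult_mono)
          finally show "cmod ((\<Phi> \<beta> \<gamma> z - (\<Sum>b<K. \<Sum>g<K. c \<beta> \<gamma> b g z * z$i ^ b * cnj (z$i) ^ g)) * zz \<beta> \<gamma> z) \<le> \<bar>CC \<beta> \<gamma>\<bar> * ?S" .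
        qed
      qed
      show "cmod (\<phi> z - (\<Sum>(\<beta>, \<gamma>)\<in>Q'. \<Phi>' \<beta> \<gamma> z * zz \<beta> \<gamma> z)) \<le> C' * ?S"
        unfolding eqn C'_def distrib_right by (rule le)
    qed
    have F6: "(\<forall>i. 1 \<le> p i) \<longrightarrow> (\<forall>z. tens (i # l) p \<phi> z = of_real pi ^ length (i # l) * \<Phi>' ?pm' (\<lambda>i. 0) z)"
      by (intro impI allI) (rule T)
  show ?case
    by (rule exI[of _ Q'], rule exI[of _ \<Phi>'], rule exI[of _ C'], rule conjI[OF F1 conjI[OF F2 conjI[OF F3 conjI[OF F4 conjI[OF F5 F6]]]]])
qed

section \<open>The form off the coordinate hyperplanes\<close>

lemma has_derivative_zbmon:
  "(zbmon a has_derivative (\<lambda>h. \<Sum>i\<in>UNIV. (of_nat (a i) * cnj (h$i) * cnj (z$i) ^ (a i - 1)) * (\<Prod>j\<in>UNIV - {i}. cnj (z$j) ^ a j))) (at z)"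
proof -
  have "((\<lambda>z. cnj (z$i) ^ a i) has_derivative (\<lambda>h. of_nat (a i) * cnj (h$i) * cnj (z$i) ^ (a i - 1))) (at z)" for i
  proof -
    have "((\<lambda>z. cnj (z$i)) has_derivative (\<lambda>h. cnj (h$i))) (at z)"
      by (rule bounded_linear_imp_has_derivative) (rule bounded_linear_compose[OF bounded_linear_cnj bounded_linear_vec_nth])
    from has_derivative_power[OF this, of "a i"] show ?thesis by simp
  qed
  then show ?thesis
    unfolding zbmon_def[abs_def] by (rule has_derivative_prod)
qed

lemma has_derivative_zmon:
  "(zmon a has_derivative (\<lambda>h. \<Sum>i\<in>UNIV. (of_nat (a i) * h$i * (z$i) ^ (a i - 1)) * (\<Prod>j\<in>UNIV - {i}. (z$j) ^ a j))) (at z)"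
proof -
  have "((\<lambda>z. (z$i) ^ a i) has_derivative (\<lambda>h. of_nat (a i) * h$i * (z$i) ^ (a i - 1))) (at z)" for i
  proof -
    have "((\<lambda>z. z$i) has_derivative (\<lambda>h. h$i)) (at z)"
      by (rule bounded_linear_imp_has_derivative) (rule bounded_linear_vec_nth)
    from has_derivative_power[OF this, of "a i"] show ?thesis by simp
  qed
  then show ?thesis
    unfolding zmon_def[abs_def] by (rule has_derivative_prod)
qed

text \<open>Written as exponent times \<open>zbmon a z / cnj (z$i)\<close>, so that a row factor
  \<open>1 / cnj (z$i)\<close> and a column factor \<open>zbmon a z\<close> can be pulled out of
  determinants. The case \<open>a i = 0\<close> is covered because both sides vanish.\<close>

lemma frechet_zbmon:
  assumes "z$i \<noteq> 0"
  shows "frechet_derivative (zbmon a) (at z) (axis i c) = cnj c * (of_nat (a i) * zbmon a z / cnj (z$i))"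
proof -
  have "frechet_derivative (zbmon a) (at z) (axis i c) =
     (\<Sum>k\<in>UNIV. (of_nat (a k) * cnj (axis i c $ k) * cnj (z$k) ^ (a k - 1)) * (\<Prod>j\<in>UNIV - {k}. cnj (z$j) ^ a j))"
    by (simp only: frechet_derivative_at[OF has_derivative_zbmon, symmetric])
  also have "\<dots> = (\<Sum>k\<in>UNIV. if k = i then (of_nat (a i) * cnj c * cnj (z$i) ^ (a i - 1)) * (\<Prod>j\<in>UNIV - {i}. cnj (z$j) ^ a j) else 0)"
    by (intro sum.cong refl) (simp add: axis_def)
  also have "\<dots> = (of_nat (a i) * cnj c * cnj (z$i) ^ (a i - 1)) * (\<Prod>j\<in>UNIV - {i}. cnj (z$j) ^ a j)"
    by simp
  also have "\<dots> = cnj c * (of_nat (a i) * (cnj (z$i) ^ a i * (\<Prod>j\<in>UNIV - {i}. cnj (z$j) ^ a j)) / cnj (z$i))"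
    using assms by (cases "a i") simp_all
  also have "cnj (z$i) ^ a i * (\<Prod>j\<in>UNIV - {i}. cnj (z$j) ^ a j) = zbmon a z"
    unfolding zbmon_def using prod.remove[of UNIV i "\<lambda>j. cnj (z$j) ^ a j"] by simp
  finally show ?thesis .
qed

text \<open>Complex linearity of the derivative; it makes the holomorphic half drop out of
  \<open>wirt\<close>.\<close>

lemma frechet_zmon:
  "frechet_derivative (zmon a) (at z) (axis i c) = c * frechet_derivative (zmon a) (at z) (axis i 1)"
proof -
  have f: "frechet_derivative (zmon a) (at z) (axis i c) =
     (\<Sum>k\<in>UNIV. (of_nat (a k) * (axis i c $ k) * (z$k) ^ (a k - 1)) * (\<Prod>j\<in>UNIV - {k}. (z$j) ^ a j))" for c
    by (simp only: frechet_derivative_at[OF has_derivative_zmon, symmetric])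
  show ?thesis
    unfolding f sum_distrib_left by (intro sum.cong refl) (simp add: axis_def)
qed

lemma wirt_zbmon:
  assumes "z$i \<noteq> 0"
  shows "wirt i (zbmon a) z = of_nat (a i) * zbmon a z / cnj (z$i)"
  unfolding wirt_def frechet_zbmon[OF assms] by (simp add: algebra_simps)

lemma normsqA_complex: "complex_of_real (normsqA A z) = (\<Sum>a\<in>A. zmon a z * zbmon a z)"
proof -
  have "cnj (zmon a z) = zbmon a z" for a by (simp add: zmon_def zbmon_def)
  then show ?thesis unfolding normsqA_def of_real_sum by (metis complex_norm_square)
qed

lemma zmon_zbmon: "zmon a z * zbmon a z = of_real ((cmod (zmon a z))^2)"
proof -
  have "cnj (zmon a z) = zbmon a z" by (simp add: zmon_def zbmon_def)
  then show ?thesis by (metis complex_norm_square)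
qed

lemma wirt_normsqA_powr:
  assumes z: "z$i \<noteq> 0" and N: "normsqA A z > 0"
  shows "wirt i (\<lambda>w. of_real (normsqA A w) powr s) z
    = s * of_real (normsqA A z) powr s / of_real (normsqA A z) * (\<Sum>c\<in>A. of_nat (c i) * of_real ((cmod (zmon c z))^2)) / cnj (z$i)"
proof -
  let ?G = "\<lambda>w. \<Sum>a\<in>A. zmon a w * zbmon a w"
  let ?m = "\<lambda>a. frechet_derivative (zmon a) (at z)" and ?b = "\<lambda>a. frechet_derivative (zbmon a) (at z)"
  have dm: "(zmon a has_derivative ?m a) (at z)" for a
    unfolding frechet_derivative_works[symmetric] differentiable_def using has_derivative_zmon by blast
  have db: "(zbmon a has_derivative ?b a) (at z)" for a
    unfolding frechet_derivative_works[symmetric] differentiable_def using has_derivative_zbmon by blast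
  have dG: "(?G has_derivative (\<lambda>h. \<Sum>a\<in>A. zmon a z * ?b a h + ?m a h * zbmon a z)) (at z)"
    by (intro has_derivative_sum has_derivative_mult dm db)
  have Gz: "?G z = of_real (normsqA A z)" by (simp add: normsqA_complex)
  have nz: "?G z \<notin> \<real>\<^sub>\<le>\<^sub>0" unfolding Gz using N by simp
  have "((\<lambda>x. x powr s) has_field_derivative s * ?G z powr (s - 1)) (at (?G z))"
    using nz by (rule has_field_derivative_powr)
  from has_derivative_compose[OF dG this[unfolded has_field_derivative_def]]
  have "((\<lambda>w. of_real (normsqA A w) powr s) has_derivative (\<lambda>h. s * ?G z powr (s - 1) * (\<Sum>a\<in>A. zmon a z * ?b a h + ?m a h * zbmon a z))) (at z)"
    unfolding normsqA_complex .
  note fd = frechet_derivative_at[OF this, symmetric]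
  have "wirt i (\<lambda>w. of_real (normsqA A w) powr s) z = s * ?G z powr (s - 1) *
     (\<Sum>a\<in>A. ((zmon a z * ?b a (axis i 1) + ?m a (axis i 1) * zbmon a z) + \<i> * (zmon a z * ?b a (axis i \<i>) + ?m a (axis i \<i>) * zbmon a z)) / 2)"
    unfolding wirt_def fd by (simp add: sum_distrib_left sum.distrib[symmetric] sum_divide_distrib[symmetric] algebra_simps)
  also have "(\<Sum>a\<in>A. ((zmon a z * ?b a (axis i 1) + ?m a (axis i 1) * zbmon a z) + \<i> * (zmon a z * ?b a (axis i \<i>) + ?m a (axis i \<i>) * zbmon a z)) / 2)
     = (\<Sum>a\<in>A. of_nat (a i) * of_real ((cmod (zmon a z))^2)) / cnj (z$i)"
    unfolding sum_divide_distrib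
  proof (intro sum.cong refl)
    fix a
    show "((zmon a z * ?b a (axis i 1) + ?m a (axis i 1) * zbmon a z) + \<i> * (zmon a z * ?b a (axis i \<i>) + ?m a (axis i \<i>) * zbmon a z)) / 2
     = of_nat (a i) * of_real ((cmod (zmon a z))^2) / cnj (z$i)"
      unfolding frechet_zbmon[OF z] frechet_zmon[of a z i \<i>] zmon_zbmon[symmetric] by (simp add: algebra_simps)
  qed
  also have "?G z powr (s - 1) = of_real (normsqA A z) powr s / of_real (normsqA A z)"
    unfolding Gz using N by (simp add: powr_diff)
  finally show ?thesis by simp
qed

lemma det_scale:
  fixes m :: "nat \<Rightarrow> nat \<Rightarrow> complex"
  shows "Determinant.det (mat n n (\<lambda>(i,j). r i * m i j * c j)) = (\<Prod>i<n. r i) * (\<Prod>i<n. c i) * Determinant.det (mat n n (\<lambda>(i,j). m i j))"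
proof -
  have D: "Determinant.det (mat n n (\<lambda>(i,j). f i j)) = (\<Sum>p\<in>{p. p permutes {0..<n}}. signof p * (\<Prod>i<n. f i (p i)))" for f :: "nat \<Rightarrow> nat \<Rightarrow> complex"
    by (subst det_def'[of _ n]) (auto intro!: sum.cong prod.cong simp: atLeast0LessThan permutes_in_image[where S="{..<n}"])
  have "(\<Prod>i<n. c (p i)) = (\<Prod>i<n. c i)" if "p permutes {0..<n}" for p
    using prod.permute[OF that, of c] by (simp add: o_def atLeast0LessThan)
  then show ?thesis
    unfolding D sum_distrib_left by (intro sum.cong refl) (simp add: prod.distrib mult_ac)
qed

lemma sum_nth_sorted_gen:
  fixes f :: "'b \<Rightarrow> complex"
  shows "distinct xs \<Longrightarrow> length xs = n \<Longrightarrow> sum f (set xs) = (\<Sum>p<n. f (xs ! p))"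
  by (auto simp: sum.distinct_set_conv_list sum_list_sum_nth atLeast0LessThan)

text \<open>The constant left after all monomials are pulled out: the exponents of \<open>L'\<close>
  in the coordinates of \<open>L\<close>, bordered by the exponents of \<open>c\<close> and by
  ones.\<close>

definition Dc :: "'n::finite list \<Rightarrow> ('n \<Rightarrow> nat) list \<Rightarrow> ('n \<Rightarrow> nat) \<Rightarrow> complex" where
  "Dc L L' c = cmat (\<lambda>i a. of_nat (a i)) L L' (\<lambda>i. of_nat (c i)) (\<lambda>a. 1)"

lemma prod_insert_index:
  fixes f :: "nat \<Rightarrow> complex"
  assumes "p < Suc k"
  shows "f p * (\<Prod>i<k. f (insert_index p i)) = (\<Prod>i<Suc k. f i)"
proof -
  have "(\<Prod>i<k. f (insert_index p i)) = (\<Prod>i\<in>insert_index p ` {0..<k}. f i)"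
    by (subst prod.reindex) (auto simp: insert_index_inj_on atLeast0LessThan)
  also have "insert_index p ` {0..<k} = {..<Suc k} - {p}"
    using insert_index_image[OF assms] by (simp add: atLeast0LessThan)
  finally show ?thesis using assms prod.remove[of "{..<Suc k}" p f] by (simp del: prod.lessThan_Suc)
qed

lemma prod_nth_distinct: "distinct xs \<Longrightarrow> (\<Prod>i<length xs. f (xs ! i)) = prod f (set xs)"
  by (rule prod.reindex_bij_betw[OF bij_betw_nth]) auto

text \<open>Each term of the cofactor sum contains every row factor and every column factor exactly
  once: the border supplies those of the deleted row and column.\<close>

lemma cmat_scale:
  assumes L: "length L = Suc k" "length L' = Suc k" "distinct L" "distinct L'"
  shows "cmat (\<lambda>i a. \<rho> i * m i a * h a) L L' (\<lambda>i. \<rho> i * g i) h = prod \<rho> (set L) * prod h (set L') * cmat m L L' g (\<lambda>a. 1)"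
  unfolding cmat_def sum_distrib_left
proof (intro sum.cong refl)
  fix p q assume "p \<in> {..<length L}" "q \<in> {..<length L'}"
  then have pq: "p < Suc k" "q < Suc k" using L by auto
  have md: "mat_delete (dmat f L L') p q = mat k k (\<lambda>(i,j). f (L ! insert_index p i) (L' ! insert_index q j))" for f
    using pq L by (intro eq_matI) (auto simp: mat_delete_def dmat_def insert_index_def)
  have "Determinant.det (mat_delete (dmat (\<lambda>i a. \<rho> i * m i a * h a) L L') p q) =
     (\<Prod>i<k. \<rho> (L ! insert_index p i)) * (\<Prod>i<k. h (L' ! insert_index q i)) * Determinant.det (mat_delete (dmat m L L') p q)"
    unfolding md by (rule det_scale)
  then have "\<rho> (L!p) * g (L!p) * h (L'!q) * cofactor (dmat (\<lambda>i a. \<rho> i * m i a * h a) L L') p q =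
     (\<rho> (L!p) * (\<Prod>i<k. \<rho> (L ! insert_index p i))) * (h (L'!q) * (\<Prod>i<k. h (L' ! insert_index q i))) * (g (L!p) * 1 * cofactor (dmat m L L') p q)"
    by (simp add: cofactor_def mult_ac)
  also have "\<rho> (L!p) * (\<Prod>i<k. \<rho> (L ! insert_index p i)) = prod \<rho> (set L)"
    using prod_insert_index[OF pq(1), of "\<lambda>i. \<rho> (L!i)"] prod_nth_distinct[OF L(3), of \<rho>] L by simp
  also have "h (L'!q) * (\<Prod>i<k. h (L' ! insert_index q i)) = prod h (set L')"
    using prod_insert_index[OF pq(2), of "\<lambda>i. h (L'!i)"] prod_nth_distinct[OF L(4), of h] L by simp
  finally show "\<rho> (L!p) * g (L!p) * h (L'!q) * cofactor (dmat (\<lambda>i a. \<rho> i * m i a * h a) L L') p q = prod \<rho> (set L) * prod h (set L') * (g (L!p) * 1 * cofactor (dmat m L L') p q)" .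
qed

lemma cmat_sum: "cmat m L L' (\<lambda>i. \<Sum>c\<in>A. \<gamma> c * g c i) h = (\<Sum>c\<in>A. \<gamma> c * cmat m L L' (g c) h)"
proof -
  have "cmat m L L' (\<lambda>i. \<Sum>c\<in>A. \<gamma> c * g c i) h = (\<Sum>p<length L. \<Sum>q<length L'. \<Sum>c\<in>A. \<gamma> c * (g c (L ! p) * h (L' ! q) * cofactor (dmat m L L') p q))"
    unfolding cmat_def by (intro sum.cong refl) (simp add: sum_distrib_right mult.assoc)
  also have "\<dots> = (\<Sum>p<length L. \<Sum>c\<in>A. \<Sum>q<length L'. \<gamma> c * (g c (L ! p) * h (L' ! q) * cofactor (dmat m L L') p q))"
    by (intro sum.cong refl sum.swap)
  also have "\<dots> = (\<Sum>c\<in>A. \<Sum>p<length L. \<Sum>q<length L'. \<gamma> c * (g c (L ! p) * h (L' ! q) * cofactor (dmat m L L') p q))"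
    by (rule sum.swap)
  finally show ?thesis by (simp add: cmat_def sum_distrib_left)
qed

lemma cmat_cmult: "cmat m L L' (\<lambda>i. k * g i) h = k * cmat m L L' g h"
  unfolding cmat_def sum_distrib_left by (intro sum.cong refl) simp

lemma cmat_cong: "(\<And>i a. i \<in> set L \<Longrightarrow> a \<in> set L' \<Longrightarrow> m i a = m' i a) \<Longrightarrow> (\<And>i. i \<in> set L \<Longrightarrow> g i = g' i) \<Longrightarrow> cmat m L L' g h = cmat m' L L' g' h"
proof -
  assume 1: "\<And>i a. i \<in> set L \<Longrightarrow> a \<in> set L' \<Longrightarrow> m i a = m' i a" and 2: "\<And>i. i \<in> set L \<Longrightarrow> g i = g' i"
  have "dmat m L L' = dmat m' L L'" using 1 by (intro eq_matI) (auto simp: dmat_def)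
  then show ?thesis using 2 by (simp add: cmat_def)
qed

text \<open>Of the exponent \<open>m + 2\<close> in the denominator, \<open>m + 1\<close> comes from
  \<open>uB\<close> and one from differentiating the power of the norm.\<close>

lemma omegaB_formula:
  fixes oN :: "'n::finite list" and oA :: "('n \<Rightarrow> nat) list"
  assumes d: "distinct oN" "set oN = UNIV" "distinct oA"
    and L: "length L = Suc m" "length L' = Suc m" "sorted_wrt (\<lambda>x y. lpos oN x < lpos oN y) L" "sorted_wrt (\<lambda>x y. lpos oA x < lpos oA y) L'"
    and z: "\<And>i. z$i \<noteq> 0" and N: "normsqA A z > 0"
  shows "omegaB oN oA A (set L') s z (Inl ` set L \<union> Inr ` set L') =
     ((-1) ^ m * epsk m * fact m) * s * (\<Sum>c\<in>A. Dc L L' c * (of_real (normsqA A z) powr s *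
       ((\<Prod>i\<in>UNIV. cnj (z$i) ^ alphaB (set L') i) / (\<Prod>i\<in>set L. cnj (z$i)) * of_real ((cmod (zmon c z))^2) / of_real (normsqA A z) ^ (m + 2))))"
proof -
  let ?N = "of_real (normsqA A z) :: complex"
  define \<rho> where "\<rho> i = 1 / cnj (z$i)" for i
  define h where "h a = zbmon a z" for a
  define \<gamma> where "\<gamma> c = (of_real ((cmod (zmon c z))^2) :: complex)" for c
  have dL: "distinct L" "distinct L'" using L(3,4) by (auto intro: sorted_distinct)
  have "cmat (\<lambda>i a. wirt i (zbmon a) z) L L' (\<lambda>i. wirt i (\<lambda>w. of_real (normsqA A w) powr s) z) (\<lambda>a. zbmon a z)
     = cmat (\<lambda>i a. \<rho> i * of_nat (a i) * h a) L L' (\<lambda>i. \<rho> i * ((s * ?N powr s / ?N) * (\<Sum>c\<in>A. \<gamma> c * of_nat (c i)))) h"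
    unfolding h_def
    by (rule cmat_cong) (simp_all add: wirt_zbmon[OF z] wirt_normsqA_powr[OF z N] \<rho>_def \<gamma>_def mult_ac)
  also have "\<dots> = prod \<rho> (set L) * prod h (set L') * ((s * ?N powr s / ?N) * (\<Sum>c\<in>A. \<gamma> c * Dc L L' c))"
    unfolding cmat_scale[OF L(1,2) dL] cmat_cmult cmat_sum Dc_def ..
  also have "prod \<rho> (set L) = 1 / (\<Prod>i\<in>set L. cnj (z$i))"
    by (simp add: \<rho>_def prod_dividef)
  also have "prod h (set L') = (\<Prod>i\<in>UNIV. cnj (z$i) ^ alphaB (set L') i)"
    unfolding h_def zbmon_def alphaB_def power_sum by (rule prod.swap)
  finally have c: "cmat (\<lambda>i a. wirt i (zbmon a) z) L L' (\<lambda>i. wirt i (\<lambda>w. of_real (normsqA A w) powr s) z) (\<lambda>a. zbmon a z)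
    = 1 / (\<Prod>i\<in>set L. cnj (z$i)) * (\<Prod>i\<in>UNIV. cnj (z$i) ^ alphaB (set L') i) * ((s * ?N powr s / ?N) * (\<Sum>c\<in>A. \<gamma> c * Dc L L' c))" .
  show ?thesis
    unfolding omegaB_value[OF d L] c unfolding sum_distrib_left
    by (intro sum.cong refl) (simp add: \<gamma>_def power_add power2_eq_square field_simps)
qed

text \<open>Row \<open>i\<close> of the bordered matrix is 0, border entry included. In each term of
  the cofactor sum this row appears either as the border factor or inside the minor.\<close>

lemma Dc_zero:
  assumes L: "length L = Suc k" "length L' = Suc k" and i: "i \<in> set L" "c i = 0" "\<And>a. a \<in> set L' \<Longrightarrow> a i = 0"
  shows "Dc L L' c = 0"
proof -
  obtain p0 where p0: "p0 < Suc k" "L ! p0 = i" using i(1) L by (auto simp: in_set_conv_nth)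
  have "cofactor (dmat (\<lambda>i a. of_nat (a i)) L L') p q = 0" if "p < Suc k" "q < Suc k" "p \<noteq> p0" for p q
  proof -
    \<comment> \<open>The position of the zero row once row \<open>p\<close> has been
      deleted.\<close>
    define r0 where "r0 = (if p0 < p then p0 else p0 - 1)"
    have r0: "r0 < k" "insert_index p r0 = p0" using that p0 by (auto simp: r0_def insert_index_def)
    have md: "mat_delete (dmat f L L') p q = mat k k (\<lambda>(i,j). f (L ! insert_index p i) (L' ! insert_index q j))" for f
      using that L by (intro eq_matI) (auto simp: mat_delete_def dmat_def insert_index_def)
    have "Determinant.det (mat_delete (dmat (\<lambda>i a. of_nat (a i)) L L') p q) = 0"
      unfolding md
    proof (subst det_def'[of _ k])
      show "(\<Sum>\<pi>\<in>{\<pi>. \<pi> permutes {0..<k}}. signof \<pi> * (\<Prod>i=0..<k. mat k k (\<lambda>(i,j). of_nat ((L' ! insert_index q j) (L ! insert_index p i))) $$ (i, \<pi> i))) = (0::complex)"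
      proof (intro sum.neutral ballI)
        fix \<pi> assume "\<pi> \<in> {\<pi>. \<pi> permutes {0..<k}}"
        then have \<pi>: "\<pi> r0 < k" using r0(1) permutes_in_image[of \<pi> "{0..<k}" r0] by auto
        then have "insert_index q (\<pi> r0) < length L'" using L that by (auto simp: insert_index_def)
        then have "(L' ! insert_index q (\<pi> r0)) i = 0" by (intro i(3) nth_mem)
        then have "mat k k (\<lambda>(i,j). of_nat ((L' ! insert_index q j) (L ! insert_index p i))) $$ (r0, \<pi> r0) = (0::complex)"
          using r0 \<pi> p0 by simp
        then have "(\<Prod>i=0..<k. mat k k (\<lambda>(i,j). of_nat ((L' ! insert_index q j) (L ! insert_index p i))) $$ (i, \<pi> i)) = (0::complex)"
          using r0(1) by (intro prod_zero bexI[of _ r0]) auto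
        then show "signof \<pi> * (\<Prod>i=0..<k. mat k k (\<lambda>(i,j). of_nat ((L' ! insert_index q j) (L ! insert_index p i))) $$ (i, \<pi> i)) = (0::complex)"
          by simp
      qed
    qed simp
    then show ?thesis by (simp add: cofactor_def)
  qed
  then show ?thesis
    unfolding Dc_def cmat_def using p0 i(2) L by (intro sum.neutral ballI) (metis lessThan_iff mult_eq_0_iff of_nat_0)
qed

text \<open>The hypothesis makes the border row of ones the \<open>\<xi>\<close>-combination of the
  rows of the matrix. Multiplying the matrix by its adjugate then shows that the cofactors of a row
  sum to the matching entry of \<open>\<xi>\<close> times the determinant, so \<open>c\<close>
  enters only through its pairing with \<open>\<xi>\<close>.\<close>

lemma Dc_eq_det:
  fixes \<xi> :: "'n::finite \<Rightarrow> complex"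
  assumes L: "length L = n" "length L' = n" "set L = UNIV" "distinct L" and \<xi>: "\<And>a. a \<in> set L' \<Longrightarrow> (\<Sum>i\<in>UNIV. of_nat (a i) * \<xi> i) = 1"
  shows "Dc L L' c = Determinant.det (dmat (\<lambda>i a. of_nat (a i)) L L') * (\<Sum>i\<in>UNIV. of_nat (c i) * \<xi> i)"
proof -
  let ?M = "dmat (\<lambda>i a. of_nat (a i)) L L' :: complex mat"
  have M: "?M \<in> carrier_mat n n" using L by (simp add: dmat_def)
  have sL: "(\<Sum>i\<in>UNIV. f i) = (\<Sum>p<n. f (L ! p))" for f :: "'n \<Rightarrow> complex"
    using L by (metis sum_nth_sorted_gen)
  have adj: "(\<Sum>q<n. ?M $$ (r,q) * cofactor ?M p q) = (if r = p then Determinant.det ?M else 0)" if "r < n" "p < n" for r p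
  proof -
    have "(?M * adj_mat ?M) $$ (r,p) = (\<Sum>q<n. ?M $$ (r,q) * cofactor ?M p q)"
      using that M adj_mat(1)[OF M] by (auto simp: scalar_prod_def adj_mat_def atLeast0LessThan intro!: sum.cong)
    moreover have "(Determinant.det ?M \<cdot>\<^sub>m 1\<^sub>m n) $$ (r,p) = (if r = p then Determinant.det ?M else 0)"
      using that by simp
    ultimately show ?thesis unfolding adj_mat(2)[OF M] by simp
  qed
  have "(\<Sum>q<n. cofactor ?M p q) = Determinant.det ?M * \<xi> (L ! p)" if p: "p < n" for p
  proof -
    have "(\<Sum>q<n. cofactor ?M p q) = (\<Sum>q<n. \<Sum>r<n. \<xi> (L ! r) * (?M $$ (r,q) * cofactor ?M p q))"
    proof (intro sum.cong refl)
      fix q assume q: "q \<in> {..<n}"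
      have "(\<Sum>r<n. of_nat ((L' ! q) (L ! r)) * \<xi> (L ! r)) = 1"
        using \<xi>[of "L' ! q"] q L unfolding sL by simp
      then have "cofactor ?M p q = (\<Sum>r<n. of_nat ((L' ! q) (L ! r)) * \<xi> (L ! r)) * cofactor ?M p q" by simp
      also have "\<dots> = (\<Sum>r<n. \<xi> (L ! r) * (?M $$ (r,q) * cofactor ?M p q))"
        unfolding sum_distrib_right using q L by (intro sum.cong refl) (simp add: dmat_def)
      finally show "cofactor ?M p q = (\<Sum>r<n. \<xi> (L ! r) * (?M $$ (r,q) * cofactor ?M p q))" .
    qed
    also have "\<dots> = (\<Sum>r<n. \<xi> (L ! r) * (\<Sum>q<n. ?M $$ (r,q) * cofactor ?M p q))"
      by (subst sum.swap) (simp add: sum_distrib_left)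
    also have "\<dots> = (\<Sum>r<n. if r = p then \<xi> (L ! p) * Determinant.det ?M else 0)"
      using p by (intro sum.cong refl) (simp add: adj)
    also have "\<dots> = Determinant.det ?M * \<xi> (L ! p)" using p by simp
    finally show ?thesis .
  qed
  then have "Dc L L' c = (\<Sum>p<n. of_nat (c (L ! p)) * (Determinant.det ?M * \<xi> (L ! p)))"
    unfolding Dc_def cmat_def L by (intro sum.cong refl) (simp add: sum_distrib_left[symmetric])
  then show ?thesis unfolding sL by (simp add: sum_distrib_left mult_ac)
qed

text \<open>\<open>B\<close> spans. Stated without enumerating \<open>B\<close>, this mediates
  between the determinant of \<open>dmat\<close>, indexed by lists, and the one in
  \<open>essential\<close>, indexed by a type.\<close>

definition nondeg :: "('n::finite \<Rightarrow> nat) set \<Rightarrow> bool" where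
  "nondeg B \<longleftrightarrow> (\<forall>\<xi>::'n \<Rightarrow> real. (\<forall>b\<in>B. (\<Sum>i\<in>UNIV. real (b i) * \<xi> i) = 0) \<longrightarrow> (\<forall>i. \<xi> i = 0))"

lemma det_dmat_nondeg:
  assumes L: "length L = n" "length L' = n" "set L = UNIV" "distinct L"
  shows "Determinant.det (dmat (\<lambda>i a. of_nat (a i)) L L') \<noteq> (0::complex) \<longleftrightarrow> nondeg (set L')"
proof -
  let ?M = "dmat (\<lambda>i a. of_nat (a i)) L L' :: complex mat"
  have M: "?M \<in> carrier_mat n n" and MT: "transpose_mat ?M \<in> carrier_mat n n" using L by (auto simp: dmat_def)
  have sL: "(\<Sum>i\<in>UNIV. f i) = (\<Sum>p<n. f (L ! p))" for f :: "'a \<Rightarrow> complex"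
    using L by (metis sum_nth_sorted_gen)
  have ex: "\<exists>p<n. L ! p = i" for i using L by (metis UNIV_I in_set_conv_nth)
  have mv: "vec_index (transpose_mat ?M *\<^sub>v v) q = (\<Sum>p<n. of_nat ((L' ! q) (L ! p)) * vec_index v p)" if "q < n" "v \<in> carrier_vec n" for v q
    using that L by (auto simp: dmat_def scalar_prod_def atLeast0LessThan intro!: sum.cong)
  have det0: "Determinant.det ?M = 0 \<longleftrightarrow> (\<exists>v\<in>carrier_vec n. v \<noteq> 0\<^sub>v n \<and> transpose_mat ?M *\<^sub>v v = 0\<^sub>v n)"
    using det_0_iff_vec_prod_zero[OF MT] Determinant.det_transpose[OF M] by auto
  show ?thesis
  proof
    assume nz: "Determinant.det ?M \<noteq> 0"
    show "nondeg (set L')"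
      unfolding nondeg_def
    proof (intro allI impI)
      fix \<xi> :: "'a \<Rightarrow> real" and i assume \<xi>: "\<forall>b\<in>set L'. (\<Sum>i\<in>UNIV. real (b i) * \<xi> i) = 0"
      define v where "v = vec n (\<lambda>p. complex_of_real (\<xi> (L ! p)))"
      have v: "v \<in> carrier_vec n" by (simp add: v_def)
      have "transpose_mat ?M *\<^sub>v v = 0\<^sub>v n"
      proof (rule eq_vecI)
        fix q assume "q < dim_vec (0\<^sub>v n)"
        then have q: "q < n" by simp
        have "vec_index (transpose_mat ?M *\<^sub>v v) q = (\<Sum>p<n. of_nat ((L' ! q) (L ! p)) * of_real (\<xi> (L ! p)))"
          unfolding mv[OF q v] by (intro sum.cong refl) (simp add: v_def)
        also have "\<dots> = (\<Sum>i\<in>UNIV. of_nat ((L' ! q) i) * of_real (\<xi> i))" by (simp add: sL)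
        also have "\<dots> = of_real (\<Sum>i\<in>UNIV. real ((L' ! q) i) * \<xi> i)" by simp
        also have "\<dots> = 0" using \<xi> q L by (metis nth_mem of_real_0)
        finally show "vec_index (transpose_mat ?M *\<^sub>v v) q = vec_index (0\<^sub>v n) q" using q by simp
      qed (use MT in simp)
      then have "v = 0\<^sub>v n" using nz det0 v by blast
      moreover obtain p where "p < n" "L ! p = i" using ex by blast
      ultimately show "\<xi> i = 0" by (metis index_vec index_zero_vec(1) of_real_eq_0_iff v_def)
    qed
  next
    assume nd: "nondeg (set L')"
    show "Determinant.det ?M \<noteq> 0"
    proof
      assume "Determinant.det ?M = 0"
      then obtain v where v: "v \<in> carrier_vec n" "v \<noteq> 0\<^sub>v n" "transpose_mat ?M *\<^sub>v v = 0\<^sub>v n" using det0 by blast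
      define pos where "pos i = (SOME p. p < n \<and> L ! p = i)" for i
      have pos: "pos (L ! p) = p" if "p < n" for p
      proof -
        have "pos (L ! p) < n \<and> L ! pos (L ! p) = L ! p" unfolding pos_def by (rule someI[of _ p]) (use that in auto)
        then show ?thesis using that L by (metis nth_eq_iff_index_eq)
      qed
      have z: "(\<Sum>i\<in>UNIV. of_nat (b i) * vec_index v (pos i)) = 0" if "b \<in> set L'" for b
      proof -
        obtain q where q: "q < n" "L' ! q = b" using \<open>b \<in> set L'\<close> L by (metis in_set_conv_nth)
        have "(\<Sum>i\<in>UNIV. of_nat (b i) * vec_index v (pos i)) = (\<Sum>p<n. of_nat (b (L ! p)) * vec_index v p)"
          unfolding sL by (intro sum.cong refl) (simp add: pos)
        also have "\<dots> = vec_index (transpose_mat ?M *\<^sub>v v) q" unfolding mv[OF q(1) v(1)] q(2) ..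
        finally show ?thesis using v(3) q by simp
      qed
      \<comment> \<open>\<open>nondeg\<close> tests real vectors, so the real and imaginary parts of
        a complex kernel vector are treated apart.\<close>
      have "Re (vec_index v (pos i)) = 0" for i
      proof -
        have "\<forall>b\<in>set L'. (\<Sum>i\<in>UNIV. real (b i) * Re (vec_index v (pos i))) = 0"
        proof
          fix b assume "b \<in> set L'"
          from arg_cong[OF z[OF this], of Re] show "(\<Sum>i\<in>UNIV. real (b i) * Re (vec_index v (pos i))) = 0" by simp
        qed
        then show ?thesis using nd[unfolded nondeg_def, rule_format, of "\<lambda>i. Re (vec_index v (pos i))"] by blast
      qed
      moreover have "Im (vec_index v (pos i)) = 0" for i
      proof -
        have "\<forall>b\<in>set L'. (\<Sum>i\<in>UNIV. real (b i) * Im (vec_index v (pos i))) = 0"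
        proof
          fix b assume "b \<in> set L'"
          from arg_cong[OF z[OF this], of Im] show "(\<Sum>i\<in>UNIV. real (b i) * Im (vec_index v (pos i))) = 0" by simp
        qed
        then show ?thesis using nd[unfolded nondeg_def, rule_format, of "\<lambda>i. Im (vec_index v (pos i))"] by blast
      qed
      ultimately have "vec_index v (pos i) = 0" for i by (simp add: complex_eq_iff)
      then have "v = 0\<^sub>v n" using v(1) by (intro eq_vecI) (auto, metis pos)
      then show False using v(2) by simp
    qed
  qed
qed

section \<open>Essential sets\<close>

lemma rvec_inner: "(\<xi> :: real^'n::finite) \<bullet> rvec a = (\<Sum>i\<in>UNIV. real (a i) * \<xi> $ i)"
  by (simp add: inner_vec_def rvec_def mult.commute)

lemma det_nondeg:
  fixes f :: "'n::finite \<Rightarrow> 'n \<Rightarrow> nat"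
  assumes "bij_betw f UNIV B"
  shows "Determinants.det (\<chi> i j. real (f j i)) \<noteq> 0 \<longleftrightarrow> nondeg B"
proof -
  let ?M = "(\<chi> i j. real (f i j)) :: real^'n^'n"
  have B: "B = range f" using assms by (simp add: bij_betw_def)
  have T: "(\<chi> i j. real (f j i)) = transpose ?M" by (simp add: transpose_def)
  have mv: "(?M *v x) $ j = (\<Sum>i\<in>UNIV. real (f j i) * x $ i)" for x j
    by (simp add: matrix_vector_mult_def)
  have "Determinants.det (\<chi> i j. real (f j i)) \<noteq> 0 \<longleftrightarrow> (\<forall>x. ?M *v x = 0 \<longrightarrow> x = 0)"
    unfolding T Determinants.det_transpose invertible_det_nz[symmetric] invertible_left_inverse matrix_left_invertible_ker ..
  also have "\<dots> \<longleftrightarrow> nondeg B"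
  proof
    assume *: "\<forall>x. ?M *v x = 0 \<longrightarrow> x = 0"
    show "nondeg B" unfolding nondeg_def
    proof (intro allI impI)
      fix \<xi> :: "'n \<Rightarrow> real" and i assume \<xi>: "\<forall>b\<in>B. (\<Sum>i\<in>UNIV. real (b i) * \<xi> i) = 0"
      have "?M *v (\<chi> i. \<xi> i) = 0" using \<xi> B by (simp add: Finite_Cartesian_Product.vec_eq_iff mv)
      then have "(\<chi> i. \<xi> i) = (0 :: real^'n)" using * by blast
      then show "\<xi> i = 0" by (simp add: Finite_Cartesian_Product.vec_eq_iff)
    qed
  next
    assume nd: "nondeg B"
    show "\<forall>x. ?M *v x = 0 \<longrightarrow> x = 0"
    proof (intro allI impI)
      fix x assume "?M *v x = 0"
      then have "(\<Sum>i\<in>UNIV. real (f j i) * x $ i) = 0" for j using mv by (metis zero_index)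
      then have "\<forall>b\<in>B. (\<Sum>i\<in>UNIV. real (b i) * x $ i) = 0" using B by auto
      then show "x = 0" using nd[unfolded nondeg_def, rule_format, of "\<lambda>i. x $ i"] by (simp add: Finite_Cartesian_Product.vec_eq_iff)
    qed
  qed
  finally show ?thesis .
qed

text \<open>For spanning \<open>B\<close>, a facet through \<open>B\<close> amounts to a linear form
  equal to 1 on \<open>B\<close> and at least 1 on \<open>A\<close>. One way, the form is a
  normalised normal of a supporting hyperplane; the other way, its level set 1 cuts out a proper
  face, whose dimension is large because it contains \<open>B\<close>.\<close>

lemma essential_iff:
  fixes A B :: "('n::finite \<Rightarrow> nat) set"
  assumes ax: "\<And>i. \<exists>a\<in>A. \<forall>j. j \<noteq> i \<longrightarrow> a j = 0"
  shows "essential A B \<longleftrightarrow> B \<subseteq> A \<and> card B = CARD('n) \<and> nondeg B \<and>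
    (\<exists>\<xi>::'n \<Rightarrow> real. (\<forall>b\<in>B. (\<Sum>i\<in>UNIV. real (b i) * \<xi> i) = 1) \<and> (\<forall>a\<in>A. (\<Sum>i\<in>UNIV. real (a i) * \<xi> i) \<ge> 1))"
proof -
  let ?P = "newton_polyhedron A"
  have cP: "convex ?P" by (simp add: newton_polyhedron_def convex_convex_hull)
  have inP: "x \<in> ?P" if "a \<in> A" "\<And>i. rvec a $ i \<le> x $ i" for x a
    unfolding newton_polyhedron_def by (rule hull_inc) (use that in auto)
  show ?thesis
  proof (intro iffI)
    assume ess: "essential A B"
    then obtain F f where B: "B \<subseteq> A" "card B = CARD('n)" and F: "F facet_of ?P" "rvec ` B \<subseteq> F"
      and f: "bij_betw f UNIV B" "Determinants.det (\<chi> i j. real (f j i)) \<noteq> 0"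
      unfolding essential_def by blast
    have nd: "nondeg B" using det_nondeg[OF f(1)] f(2) by simp
    have finB: "finite B" and Bne: "B \<noteq> {}" using B(2) card_gt_0_iff[of B] by auto
    \<comment> \<open>The barycentre of \<open>B\<close>: a hyperplane supporting the polyhedron at
      this point must contain every point of \<open>B\<close>.\<close>
    define x0 where "x0 = (\<Sum>b\<in>B. (1 / real (card B)) *\<^sub>R rvec b)"
    have face: "F face_of ?P" using F(1) by (simp add: facet_of_def)
    have "x0 \<in> F"
      unfolding x0_def using finB Bne F(2) face_of_imp_convex[OF face]
      by (intro convex_sum) auto
    moreover have "F \<noteq> ?P" using F(1) by (auto simp: facet_of_def)
    ultimately have "x0 \<in> ?P" "x0 \<notin> rel_interior ?P"
      using face face_of_disjoint_rel_interior[OF face] face_of_imp_subset[OF face] by auto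
    then obtain \<nu> where \<nu>: "\<nu> \<noteq> 0" "\<And>y. y \<in> ?P \<Longrightarrow> \<nu> \<bullet> x0 \<le> \<nu> \<bullet> y"
      using supporting_hyperplane_rel_boundary[OF cP] by metis
    have le: "\<nu> \<bullet> x0 \<le> \<nu> \<bullet> rvec b" if "b \<in> B" for b
      using that B(1) by (intro \<nu>(2) inP[of b]) auto
    have "(\<Sum>b\<in>B. \<nu> \<bullet> rvec b - \<nu> \<bullet> x0) = 0"
    proof -
      have "real (card B) * (\<nu> \<bullet> x0) = (\<Sum>b\<in>B. \<nu> \<bullet> rvec b)"
        using Bne finB by (simp add: x0_def inner_sum_right sum_divide_distrib[symmetric])
      then show ?thesis by (simp add: sum_subtractf)
    qed
    then have eq: "\<nu> \<bullet> rvec b = \<nu> \<bullet> x0" if "b \<in> B" for b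
      using that sum_nonneg_eq_0_iff[OF finB, of "\<lambda>b. \<nu> \<bullet> rvec b - \<nu> \<bullet> x0"] le by simp
    obtain b0 where b0: "b0 \<in> B" using Bne by blast
    \<comment> \<open>Moving from a point of \<open>B\<close> in a coordinate direction stays in the
      polyhedron, so the normal has nonnegative entries.\<close>
    have pos: "\<nu> $ i \<ge> 0" for i
    proof -
      have "rvec b0 + axis i 1 \<in> ?P" using b0 B(1) by (intro inP[of b0]) (auto simp: axis_def)
      from \<nu>(2)[OF this] show ?thesis using eq[OF b0] by (simp add: inner_add_right inner_axis)
    qed
    define v where "v = \<nu> \<bullet> x0"
    have "v \<ge> 0" using eq[OF b0] pos by (simp add: v_def rvec_inner sum_nonneg flip: eq[OF b0])
    moreover have "v \<noteq> 0"
    proof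
      assume "v = 0"
      then have "\<forall>b\<in>B. (\<Sum>i\<in>UNIV. real (b i) * \<nu> $ i) = 0" using eq by (simp add: v_def rvec_inner)
      then have "\<nu> = 0" using nd[unfolded nondeg_def, rule_format, of "\<lambda>i. \<nu> $ i"] by (simp add: Finite_Cartesian_Product.vec_eq_iff)
      then show False using \<nu>(1) by simp
    qed
    ultimately have v: "v > 0" by simp
    have s: "(\<Sum>i\<in>UNIV. real (a i) * (\<nu> $ i / v)) = (\<nu> \<bullet> rvec a) / v" for a
      by (simp add: rvec_inner sum_divide_distrib)
    have "\<forall>b\<in>B. (\<Sum>i\<in>UNIV. real (b i) * (\<nu> $ i / v)) = 1"
      unfolding s using eq v by (simp add: v_def)
    moreover have "\<forall>a\<in>A. (\<Sum>i\<in>UNIV. real (a i) * (\<nu> $ i / v)) \<ge> 1"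
    proof
      fix a assume "a \<in> A"
      then have "v \<le> \<nu> \<bullet> rvec a" unfolding v_def by (intro \<nu>(2) inP[of a]) auto
      then show "(\<Sum>i\<in>UNIV. real (a i) * (\<nu> $ i / v)) \<ge> 1" unfolding s using v by simp
    qed
    ultimately show "B \<subseteq> A \<and> card B = CARD('n) \<and> nondeg B \<and>
      (\<exists>\<xi>::'n \<Rightarrow> real. (\<forall>b\<in>B. (\<Sum>i\<in>UNIV. real (b i) * \<xi> i) = 1) \<and> (\<forall>a\<in>A. (\<Sum>i\<in>UNIV. real (a i) * \<xi> i) \<ge> 1))"
      using B nd by (intro conjI exI[of _ "\<lambda>i. \<nu> $ i / v"]) simp_all
  next
    assume "B \<subseteq> A \<and> card B = CARD('n) \<and> nondeg B \<and>
      (\<exists>\<xi>::'n \<Rightarrow> real. (\<forall>b\<in>B. (\<Sum>i\<in>UNIV. real (b i) * \<xi> i) = 1) \<and> (\<forall>a\<in>A. (\<Sum>i\<in>UNIV. real (a i) * \<xi> i) \<ge> 1))"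
    then obtain \<xi> :: "'n \<Rightarrow> real" where B: "B \<subseteq> A" "card B = CARD('n)" "nondeg B"
      and \<xi>: "\<And>b. b \<in> B \<Longrightarrow> (\<Sum>i\<in>UNIV. real (b i) * \<xi> i) = 1" "\<And>a. a \<in> A \<Longrightarrow> (\<Sum>i\<in>UNIV. real (a i) * \<xi> i) \<ge> 1"
      by blast
    have finB: "finite B" and Bne: "B \<noteq> {}" using B(2) card_gt_0_iff[of B] by auto
    define x where "x = (\<chi> i. \<xi> i)"
    have xi: "x \<bullet> rvec a = (\<Sum>i\<in>UNIV. real (a i) * \<xi> i)" for a by (simp add: x_def rvec_inner)
    have pos: "\<xi> i \<ge> 0" for i
    proof -
      obtain a where a: "a \<in> A" "\<forall>j. j \<noteq> i \<longrightarrow> a j = 0" using ax by blast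
      have "(\<Sum>j\<in>UNIV. real (a j) * \<xi> j) = (\<Sum>j\<in>UNIV. if j = i then real (a i) * \<xi> i else 0)"
        using a(2) by (intro sum.cong) auto
      then have "real (a i) * \<xi> i \<ge> 1" using \<xi>(2)[OF a(1)] by simp
      then show ?thesis by (metis linorder_not_le mult_less_0_iff of_nat_less_0_iff not_one_le_zero order_less_le_trans mult_nonneg_nonpos of_nat_0_le_iff less_imp_le order_trans)
    qed
    have ge: "x \<bullet> y \<ge> 1" if "y \<in> ?P" for y
    proof -
      have "?P \<subseteq> {y. x \<bullet> y \<ge> 1}"
        unfolding newton_polyhedron_def
      proof (rule hull_minimal)
        show "convex {y. 1 \<le> x \<bullet> y}" by (rule convex_halfspace_ge)
        show "(\<Union>a\<in>A. {y. \<forall>i. rvec a $ i \<le> y $ i}) \<subseteq> {y. 1 \<le> x \<bullet> y}"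
        proof clarsimp
          fix y a assume a: "a \<in> A" "\<forall>i. rvec a $ i \<le> y $ i"
          have "1 \<le> x \<bullet> rvec a" using \<xi>(2)[OF a(1)] xi by simp
          also have "\<dots> \<le> x \<bullet> y"
            unfolding inner_vec_def using a(2) pos by (intro sum_mono) (auto simp: x_def intro!: mult_left_mono)
          finally show "1 \<le> x \<bullet> y" .
        qed
      qed
      then show ?thesis using that by blast
    qed
    define F where "F = ?P \<inter> {y. x \<bullet> y = 1}"
    have face: "F face_of ?P" unfolding F_def by (rule face_of_Int_supporting_hyperplane_ge[OF cP]) (rule ge)
    have BF: "rvec ` B \<subseteq> F" unfolding F_def using B(1) \<xi>(1) by (auto intro!: inP simp: xi)
    obtain b0 where b0: "b0 \<in> B" using Bne by blast
    \<comment> \<open>Twice a point of \<open>B\<close> stays in the polyhedron but has value 2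
      under the form, so the face is proper.\<close>
    have "F \<noteq> ?P"
    proof
      assume eq: "F = ?P"
      have "2 *\<^sub>R rvec b0 \<in> ?P" using b0 B(1) by (intro inP[of b0]) (auto simp: rvec_def)
      then have "2 *\<^sub>R rvec b0 \<in> F" using eq by (simp only:)
      then have "x \<bullet> (2 *\<^sub>R rvec b0) = 1" by (simp only: F_def Int_iff mem_Collect_eq)
      then show False using \<xi>(1)[OF b0] xi[of b0] by simp
    qed
    then have lt: "aff_dim F < aff_dim ?P" by (rule face_of_aff_dim_lt[OF cP face])
    have "aff_dim ?P \<le> int (CARD('n))" using aff_dim_le_DIM[of ?P] by simp
    moreover have "aff_dim F \<ge> int (CARD('n)) - 1"
    proof -
      have "dim (rvec ` B) = CARD('n)"
      proof (rule ccontr)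
        assume "dim (rvec ` B) \<noteq> CARD('n)"
        then have "dim (rvec ` B) < DIM(real^'n)" using dim_subset_UNIV[of "rvec ` B"] by simp
        then obtain y where y: "y \<noteq> 0" "\<And>w. w \<in> span (rvec ` B) \<Longrightarrow> real_inner_class.orthogonal y w"
          using orthogonal_to_subspace_exists by metis
        have "\<forall>b\<in>B. (\<Sum>i\<in>UNIV. real (b i) * y $ i) = 0"
          using y(2) by (auto simp: span_base real_inner_class.orthogonal_def rvec_inner[symmetric])
        then have "y = 0" using B(3)[unfolded nondeg_def, rule_format, of "\<lambda>i. y $ i"] by (simp add: Finite_Cartesian_Product.vec_eq_iff)
        then show False using y(1) by simp
      qed
      \<comment> \<open>Adding the origin turns linear into affine dimension and raises the latter
        by at most one; this gives the lower bound \<open>n - 1\<close>.\<close>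
      then have "dim (insert 0 (rvec ` B)) = CARD('n)" by (metis dim_span span_insert_0)
      then have "aff_dim (insert 0 (rvec ` B)) = int (CARD('n))"
        by (subst aff_dim_zero) (auto simp: hull_inc)
      then have "aff_dim (rvec ` B) \<ge> int (CARD('n)) - 1"
        using aff_dim_insert[of 0 "rvec ` B"] by (simp split: if_splits)
      then show ?thesis using aff_dim_subset[OF BF] by simp
    qed
    ultimately have "aff_dim F = aff_dim ?P - 1" using lt by linarith
    moreover have "F \<noteq> {}" using BF b0 by blast
    ultimately have facet: "F facet_of ?P" using face by (simp add: facet_of_def)
    obtain f where f: "bij_betw f (UNIV::'n set) B"
      using finite_same_card_bij[of "UNIV :: 'n set" B] finB B(2) by auto
    then have "Determinants.det (\<chi> i j. real (f j i)) \<noteq> 0" using det_nondeg[OF f] B(3) by simp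
    then show "essential A B"
      unfolding essential_def using B facet BF f by blast
  qed
qed

section \<open>Decay of monomial integrals\<close>

text \<open>The formulas that divide by coordinates hold off the coordinate hyperplanes only; these
  form a null set.\<close>

lemma AE_nonzero: "AE z in (lborel :: (complex^'n::finite) measure). \<forall>i. z$i \<noteq> 0"
proof (subst AE_all_countable, rule allI)
  fix i :: 'n
  let ?H = "{z :: complex^'n. z \<bullet> axis i 1 = 0}"
  have "negligible ?H" by (rule negligible_standard_hyperplane) (auto simp: Basis_vec_def Basis_complex_def)
  then have "?H \<in> null_sets lebesgue" by (simp add: negligible_iff_null_sets)
  moreover have "?H \<in> sets lborel" by (simp add: closed_hyperplane[of "axis i 1" 0, simplified inner_commute] borel_closed)
  ultimately have "?H \<in> null_sets lborel" by (simp add: null_sets_completion_iff)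
  then have "AE z in lborel. z \<notin> ?H" by (rule AE_not_in)
  then show "AE z in (lborel :: (complex^'n) measure). z$i \<noteq> 0"
    by (rule AE_mp) (auto simp: inner_axis)
qed

definition polydisc :: "real \<Rightarrow> (complex^'n::finite) set" where
  "polydisc R = {z. \<forall>i. cmod (z$i) \<le> R}"

lemma indicator_polydisc: "indicator (polydisc R) z = (\<Prod>i\<in>UNIV. indicator (cball 0 R) (z$i) :: real)"
  by (auto simp: polydisc_def indicator_def prod_eq_1_iff prod_zero_iff)

lemma polydisc_borel [measurable]: "polydisc R \<in> sets borel"
proof -
  have "closed (polydisc R)" unfolding polydisc_def by (intro closed_Collect_all closed_Collect_le continuous_intros)
  then show ?thesis by (rule borel_closed)
qed

lemma pred_polydisc [measurable]: "Measurable.pred borel (\<lambda>z. z \<in> polydisc R)"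
  using polydisc_borel[of R] by (simp add: pred_def)

lemma integrable_polydisc:
  assumes "d > 0" "R \<ge> 0"
  shows "integrable lborel (\<lambda>z::complex^'n::finite. indicator (polydisc R) z * (\<Prod>i\<in>UNIV. cmod (z$i) powr (2 * d - 2)))"
proof -
  have "integrable lborel (\<lambda>z::complex^'n. \<Prod>i\<in>UNIV. indicator (cball 0 R) (z$i) * cmod (z$i) powr (2 * d - 2))"
    by (rule integrable_prod_vec) (rule integrable_norm_powr_cball[OF assms])
  then show ?thesis by (simp add: indicator_polydisc prod.distrib)
qed

lemma continuous_on_Max:
  fixes f :: "'b \<Rightarrow> 'a::topological_space \<Rightarrow> real"
  assumes "finite A" "A \<noteq> {}" "\<And>a. a \<in> A \<Longrightarrow> continuous_on S (f a)"
  shows "continuous_on S (\<lambda>x. Max ((\<lambda>a. f a x) ` A))"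
  using assms
proof (induction A rule: finite_ne_induct)
  case (insert a A)
  have "continuous_on S (\<lambda>x. max (f a x) (Max ((\<lambda>a. f a x) ` A)))"
    using insert by (intro continuous_on_max) auto
  then show ?case using insert by simp
qed simp

lemma measurable_normsqA [measurable]: "normsqA A \<in> borel_measurable borel"
  unfolding normsqA_def[abs_def] zmon_def by measurable

lemma measurable_zmon [measurable]: "zmon a \<in> borel_measurable borel"
  unfolding zmon_def[abs_def] by measurable

lemma measurable_zz [measurable]: "zz \<beta> \<gamma> \<in> borel_measurable borel"
  unfolding zz_def[abs_def] by measurable

lemma normsqA_nonneg: "normsqA A z \<ge> 0"
  by (simp add: normsqA_def sum_nonneg)

lemma cmod_zmon: "cmod (zmon a z) = (\<Prod>i\<in>UNIV. cmod (z$i) ^ a i)"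
  by (simp add: zmon_def norm_power flip: prod_norm)

text \<open>\<open>ax\<close> is the combinatorial content of the origin being the only common zero:
  \<open>A\<close> contains a pure power of every coordinate.\<close>

locale monomials =
  fixes A :: "('n::finite \<Rightarrow> nat) set"
  assumes finA: "finite A" and ax: "\<And>i. \<exists>a\<in>A. a i > 0 \<and> (\<forall>j. j \<noteq> i \<longrightarrow> a j = 0)"
begin

lemma A_ne: "A \<noteq> {}" using ax by blast

lemma normsqA_ge: "a \<in> A \<Longrightarrow> (cmod (zmon a z))^2 \<le> normsqA A z"
  unfolding normsqA_def using finA by (intro member_le_sum) auto

lemma normsqA_pos: "(\<And>i. z$i \<noteq> 0) \<Longrightarrow> normsqA A z > 0"
proof -
  assume z: "\<And>i. z$i \<noteq> 0"
  obtain a where a: "a \<in> A" using A_ne by blast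
  have "0 < (cmod (zmon a z))^2" using z by (simp add: zmon_def)
  then show ?thesis using normsqA_ge[OF a, of z] by linarith
qed

lemma normsqA_bounded:
  assumes "R \<ge> 1"
  obtains C where "C \<ge> 1" "\<And>z. z \<in> polydisc R \<Longrightarrow> normsqA A z \<le> C"
proof
  let ?C = "1 + (\<Sum>a\<in>A. (\<Prod>i\<in>UNIV. R ^ a i)^2)"
  show "?C \<ge> 1" by (simp add: sum_nonneg)
  fix z :: "complex^'n" assume "z \<in> polydisc R"
  then have "normsqA A z \<le> (\<Sum>a\<in>A. (\<Prod>i\<in>UNIV. R ^ a i)^2)"
    unfolding normsqA_def cmod_zmon
    by (intro sum_mono power_mono prod_mono) (auto simp: polydisc_def intro!: power_mono prod_nonneg)
  then show "normsqA A z \<le> ?C" by simp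
qed

section \<open>Decay in logarithmic coordinates\<close>

definition dt :: "('n \<Rightarrow> nat) \<Rightarrow> ('n \<Rightarrow> real) \<Rightarrow> real" where
  "dt a x = (\<Sum>i\<in>UNIV. real (a i) * x i)"

text \<open>The condition is homogeneous in \<open>x\<close>. On the compact part of the unit sphere
  in the nonpositive orthant the maximum over \<open>A\<close> of the differences is continuous and
  positive, so its minimum there is a uniform gap.\<close>

lemma decay_uniform:
  fixes u :: "'n \<Rightarrow> real" and l :: real
  assumes st: "\<And>x. (\<And>i. x i \<le> 0) \<Longrightarrow> (\<exists>i. x i \<noteq> 0) \<Longrightarrow> \<exists>a\<in>A. (\<Sum>i\<in>UNIV. u i * x i) < l * dt a x"
  obtains \<eta> where "\<eta> > 0" "\<And>x :: real^'n. (\<And>i. x$i \<le> 0) \<Longrightarrow> \<exists>a\<in>A. (\<Sum>i\<in>UNIV. u i * x$i) + \<eta> * norm x \<le> l * dt a (\<lambda>i. x$i)"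
proof -
  define f where "f a x = l * dt a (\<lambda>i. x$i) - (\<Sum>i\<in>UNIV. u i * x$i)" for a and x :: "real^'n"
  define F where "F x = Max ((\<lambda>a. f a x) ` A)" for x
  define K where "K = sphere 0 1 \<inter> {x :: real^'n. \<forall>i. x$i \<le> 0}"
  have "closed {x :: real^'n. \<forall>i. x$i \<le> 0}" by (intro closed_Collect_all closed_Collect_le continuous_intros)
  then have cK: "compact K" unfolding K_def by (intro compact_Int_closed compact_sphere)
  have neK: "K \<noteq> {}"
  proof -
    have "- axis undefined 1 $ i \<le> (0::real)" for i :: 'n by (simp add: axis_def)
    then have "- axis undefined 1 \<in> K" by (simp add: K_def norm_axis_1)
    then show ?thesis by blast
  qed
  have "continuous_on K F"
    unfolding F_def f_def dt_def by (intro continuous_on_Max finA A_ne continuous_intros)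
  then obtain x0 where x0: "x0 \<in> K" "\<And>x. x \<in> K \<Longrightarrow> F x0 \<le> F x"
    using continuous_attains_inf[OF cK neK] by blast
  have "F x0 > 0"
  proof -
    have "x0 \<noteq> 0" using x0(1) by (auto simp: K_def)
    then have "\<exists>i. x0$i \<noteq> 0" by (simp add: Finite_Cartesian_Product.vec_eq_iff)
    then obtain a where "a \<in> A" "(\<Sum>i\<in>UNIV. u i * x0$i) < l * dt a (\<lambda>i. x0$i)"
      using st[of "\<lambda>i. x0$i"] x0(1) by (auto simp: K_def)
    then have "0 < f a x0" by (simp add: f_def)
    moreover have "f a x0 \<le> F x0" unfolding F_def using finA \<open>a \<in> A\<close> by (intro Max_ge) auto
    ultimately show ?thesis by linarith
  qed
  moreover have "\<exists>a\<in>A. (\<Sum>i\<in>UNIV. u i * x$i) + F x0 * norm x \<le> l * dt a (\<lambda>i. x$i)" if x: "\<And>i. x$i \<le> 0" for x :: "real^'n"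
  proof (cases "x = 0")
    case True
    then show ?thesis using A_ne by (auto simp: dt_def)
  next
    case False
    define y where "y = x /\<^sub>R norm x"
    have "y \<in> K" using x False by (auto simp: K_def y_def mult_nonneg_nonpos)
    then have "F x0 \<le> F y" by (rule x0(2))
    moreover have "F y \<in> (\<lambda>a. f a y) ` A" unfolding F_def using finA A_ne by (intro Max_in) auto
    ultimately obtain a where a: "a \<in> A" "F x0 \<le> f a y" by auto
    have "norm x * f a y = f a x"
    proof -
      have "norm x * dt a (\<lambda>i. y$i) = dt a (\<lambda>i. x$i)" "norm x * (\<Sum>i\<in>UNIV. u i * y$i) = (\<Sum>i\<in>UNIV. u i * x$i)"
        unfolding dt_def sum_distrib_left using False by (auto intro!: sum.cong simp: y_def)
      then show ?thesis unfolding f_def by (simp add: right_diff_distrib mult.left_commute)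
    qed
    then have "F x0 * norm x \<le> f a x" using mult_left_mono[OF a(2), of "norm x"] by (simp add: mult.commute)
    then show ?thesis by (intro bexI[OF _ a(1)]) (simp add: f_def)
  qed
  ultimately show ?thesis using that by blast
qed

lemma cmod_zmon_exp:
  assumes "\<And>i. z$i \<noteq> 0"
  shows "(cmod (zmon a z))^2 = exp (dt a (\<lambda>i. ln ((cmod (z$i))^2)))"
proof -
  have "(cmod (zmon a z))^2 = (\<Prod>i\<in>UNIV. ((cmod (z$i))^2) ^ a i)"
    by (simp add: cmod_zmon prod_power_distrib power_mult[symmetric] mult.commute)
  also have "\<dots> = (\<Prod>i\<in>UNIV. exp (real (a i) * ln ((cmod (z$i))^2)))"
  proof (intro prod.cong refl)
    fix i
    have "0 < (cmod (z$i))^2" using assms by simp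
    then show "((cmod (z$i))^2) ^ a i = exp (real (a i) * ln ((cmod (z$i))^2))"
      by (simp only: exp_of_nat_mult exp_ln)
  qed
  finally show ?thesis by (simp add: dt_def exp_sum)
qed

text \<open>In the coordinates \<open>x_i = ln |z_i|^2\<close> all factors become exponentials. The
  gap \<open>\<eta> * norm x\<close> is spent in two halves, one on the additional power
  \<open>\<epsilon>\<close> of the norm and one on the positive exponents
  \<open>\<delta>\<close>.\<close>

lemma decay_pointwise:
  fixes u :: "'n \<Rightarrow> real" and l :: real
  assumes st: "\<And>x. (\<And>i. x i \<le> 0) \<Longrightarrow> (\<exists>i. x i \<noteq> 0) \<Longrightarrow> \<exists>a\<in>A. (\<Sum>i\<in>UNIV. u i * x i) < l * dt a x"
    and l: "l \<ge> 0"
  obtains \<epsilon> \<delta> where "\<epsilon> > 0" "\<delta> > 0"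
    "\<And>z. z \<in> polydisc 1 \<Longrightarrow> (\<And>i. z$i \<noteq> 0) \<Longrightarrow>
      normsqA A z powr (- (l + \<epsilon>)) * (\<Prod>i\<in>UNIV. cmod (z$i) powr (2 * u i - 2)) \<le> (\<Prod>i\<in>UNIV. cmod (z$i) powr (2 * \<delta> - 2))"
proof -
  obtain \<eta> where \<eta>: "\<eta> > 0" "\<And>x :: real^'n. (\<And>i. x$i \<le> 0) \<Longrightarrow> \<exists>a\<in>A. (\<Sum>i\<in>UNIV. u i * x$i) + \<eta> * norm x \<le> l * dt a (\<lambda>i. x$i)"
    using decay_uniform[OF st] by blast
  \<comment> \<open>\<open>S * norm x\<close> bounds the absolute value of every pairing
    \<open>dt a x\<close>; the summand 1 keeps the divisor positive.\<close>
  define S where "S = 1 + (\<Sum>a\<in>A. \<Sum>i\<in>UNIV. real (a i))"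
  have S: "S \<ge> 1" by (simp add: S_def sum_nonneg)
  define \<epsilon> where "\<epsilon> = \<eta> / (2 * S)"
  define \<delta> where "\<delta> = \<eta> / (2 * real CARD('n))"
  have pos: "\<epsilon> > 0" "\<delta> > 0" using \<eta>(1) S by (auto simp: \<epsilon>_def \<delta>_def)
  have "normsqA A z powr (- (l + \<epsilon>)) * (\<Prod>i\<in>UNIV. cmod (z$i) powr (2 * u i - 2)) \<le> (\<Prod>i\<in>UNIV. cmod (z$i) powr (2 * \<delta> - 2))"
    if zP: "z \<in> polydisc 1" and z: "\<And>i. z$i \<noteq> 0" for z :: "complex^'n"
  proof -
    define x where "x = (\<chi> i. ln ((cmod (z$i))^2))"
    have x0: "x$i \<le> 0" for i using zP z by (simp add: x_def polydisc_def power_le_one)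
    obtain a where a: "a \<in> A" "(\<Sum>i\<in>UNIV. u i * x$i) + \<eta> * norm x \<le> l * dt a (\<lambda>i. x$i)" using \<eta>(2)[of x] x0 by blast
    have Na: "exp (dt a (\<lambda>i. x$i)) \<le> normsqA A z"
      using normsqA_ge[OF a(1), of z] cmod_zmon_exp[OF z] by (simp add: x_def)
    have "normsqA A z powr (- (l + \<epsilon>)) \<le> exp (dt a (\<lambda>i. x$i)) powr (- (l + \<epsilon>))"
      using Na l pos by (intro powr_mono2') auto
    also have "\<dots> = exp (- (l + \<epsilon>) * dt a (\<lambda>i. x$i))" by (simp add: powr_def)
    finally have 1: "normsqA A z powr (- (l + \<epsilon>)) \<le> exp (- (l + \<epsilon>) * dt a (\<lambda>i. x$i))" .
    have pe: "cmod (z$i) powr (2 * v - 2) = exp (v * x$i) * exp (- x$i)" for v i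
    proof -
      have "ln ((cmod (z$i))^2) = 2 * ln (cmod (z$i))" using z by (simp add: ln_realpow)
      then show ?thesis using z[of i] unfolding exp_add[symmetric] by (simp add: powr_def x_def algebra_simps)
    qed
    have pp: "(\<Prod>i\<in>UNIV. cmod (z$i) powr (2 * v i - 2)) = exp (\<Sum>i\<in>UNIV. v i * x$i) * exp (- (\<Sum>i\<in>UNIV. x$i))" for v :: "'n \<Rightarrow> real"
      by (simp add: pe prod.distrib exp_sum flip: sum_negf)
    have "\<bar>dt a (\<lambda>i. x$i)\<bar> \<le> S * norm x"
    proof -
      have "\<bar>dt a (\<lambda>i. x$i)\<bar> \<le> (\<Sum>i\<in>UNIV. real (a i) * norm x)"
        unfolding dt_def by (rule order_trans[OF sum_abs]) (auto intro!: sum_mono mult_left_mono component_le_norm_cart simp: abs_mult)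
      also have "\<dots> = (\<Sum>i\<in>UNIV. real (a i)) * norm x" by (simp add: sum_distrib_right)
      also have "\<dots> \<le> S * norm x"
        using member_le_sum[OF a(1) _ finA, of "\<lambda>a. \<Sum>i\<in>UNIV. real (a i)"]
        by (intro mult_right_mono) (auto simp: S_def sum_nonneg)
      finally show ?thesis .
    qed
    then have "\<epsilon> * \<bar>dt a (\<lambda>i. x$i)\<bar> \<le> \<epsilon> * (S * norm x)" using pos by (intro mult_left_mono) auto
    also have "\<dots> = (\<eta>/2) * norm x" using S by (simp add: \<epsilon>_def)
    finally have e: "- \<epsilon> * dt a (\<lambda>i. x$i) \<le> (\<eta>/2) * norm x" 
      using mult_left_mono[OF abs_ge_minus_self[of "dt a (\<lambda>i. x$i)"], of \<epsilon>] pos by linarith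
    have "- (\<Sum>i\<in>UNIV. x$i) \<le> real CARD('n) * norm x"
    proof -
      have "- (\<Sum>i\<in>UNIV. x$i) \<le> (\<Sum>i\<in>(UNIV::'n set). norm x)"
        unfolding sum_negf[symmetric] using component_le_norm_cart[of x] by (intro sum_mono) (simp add: abs_le_iff)
      then show ?thesis by simp
    qed
    then have "\<delta> * (- (\<Sum>i\<in>UNIV. x$i)) \<le> \<delta> * (real CARD('n) * norm x)" using pos by (intro mult_left_mono) auto
    also have "\<dots> = (\<eta>/2) * norm x" by (simp add: \<delta>_def)
    finally have d: "\<delta> * (- (\<Sum>i\<in>UNIV. x$i)) \<le> (\<eta>/2) * norm x" .
    have ex: "- (l + \<epsilon>) * dt a (\<lambda>i. x$i) + (\<Sum>i\<in>UNIV. u i * x$i) \<le> (\<Sum>i\<in>UNIV. \<delta> * x$i)"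
      using a(2) e d by (simp add: algebra_simps sum_distrib_left[symmetric])
    have "normsqA A z powr (- (l + \<epsilon>)) * (\<Prod>i\<in>UNIV. cmod (z$i) powr (2 * u i - 2))
        \<le> exp (- (l + \<epsilon>) * dt a (\<lambda>i. x$i)) * (exp (\<Sum>i\<in>UNIV. u i * x$i) * exp (- (\<Sum>i\<in>UNIV. x$i)))"
      unfolding pp using 1 by (intro mult_right_mono) auto
    also have "\<dots> = exp (- (l + \<epsilon>) * dt a (\<lambda>i. x$i) + (\<Sum>i\<in>UNIV. u i * x$i)) * exp (- (\<Sum>i\<in>UNIV. x$i))"
      by (simp only: exp_add mult.assoc)
    also have "\<dots> \<le> exp (\<Sum>i\<in>UNIV. \<delta> * x$i) * exp (- (\<Sum>i\<in>UNIV. x$i))"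
      using ex by (intro mult_right_mono) auto
    also have "\<dots> = (\<Prod>i\<in>UNIV. cmod (z$i) powr (2 * \<delta> - 2))" unfolding pp ..
    finally show ?thesis .
  qed
  then show ?thesis using that pos by blast
qed

text \<open>Only an upper bound by a monomial with real exponents is asked, so bounded weights such
  as \<open>1 - rho\<close> can be discarded.\<close>

lemma decay_integrable:
  fixes u :: "'n \<Rightarrow> real" and l C :: real and h :: "complex^'n \<Rightarrow> complex"
  assumes st: "\<And>x. (\<And>i. x i \<le> 0) \<Longrightarrow> (\<exists>i. x i \<noteq> 0) \<Longrightarrow> \<exists>a\<in>A. (\<Sum>i\<in>UNIV. u i * x i) < l * dt a x"
    and l: "l \<ge> 0" and [measurable]: "h \<in> borel_measurable borel"
    and h: "\<And>z. (\<And>i. z$i \<noteq> 0) \<Longrightarrow> cmod (h z) \<le> C * (indicator (polydisc 1) z * normsqA A z powr (- l) * (\<Prod>i\<in>UNIV. cmod (z$i) powr (2 * u i - 2)))"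
  shows "\<exists>\<epsilon>>0. integrable lborel (\<lambda>z. normsqA A z powr (- \<epsilon>) * cmod (h z))"
proof -
  obtain \<epsilon> \<delta> where ed: "\<epsilon> > 0" "\<delta> > 0"
    "\<And>z. z \<in> polydisc 1 \<Longrightarrow> (\<And>i. z$i \<noteq> 0) \<Longrightarrow>
      normsqA A z powr (- (l + \<epsilon>)) * (\<Prod>i\<in>UNIV. cmod (z$i) powr (2 * u i - 2)) \<le> (\<Prod>i\<in>UNIV. cmod (z$i) powr (2 * \<delta> - 2))"
    using decay_pointwise[OF st l] by blast
  have "integrable lborel (\<lambda>z. normsqA A z powr (- \<epsilon>) * cmod (h z))"
  proof (rule Bochner_Integration.integrable_bound)
    show "integrable lborel (\<lambda>z::complex^'n. \<bar>C\<bar> * (indicator (polydisc 1) z * (\<Prod>i\<in>UNIV. cmod (z$i) powr (2 * \<delta> - 2))))"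
      by (intro integrable_mult_right integrable_polydisc ed) simp
    show "AE z in lborel. norm (normsqA A z powr (- \<epsilon>) * cmod (h z)) \<le> norm (\<bar>C\<bar> * (indicator (polydisc 1) z * (\<Prod>i\<in>UNIV. cmod (z$i) powr (2 * \<delta> - 2))))"
      using AE_nonzero
    proof eventually_elim
      case (elim z)
      let ?X = "\<Prod>i\<in>UNIV. cmod (z$i) powr (2 * u i - 2)" and ?Y = "\<Prod>i\<in>UNIV. cmod (z$i) powr (2 * \<delta> - 2)"
      have nn: "?X \<ge> 0" "?Y \<ge> 0" by (auto intro: prod_nonneg)
      have "normsqA A z powr (- \<epsilon>) * cmod (h z) \<le> normsqA A z powr (- \<epsilon>) * (C * (indicator (polydisc 1) z * normsqA A z powr (- l) * ?X))"
        using h[of z] elim by (intro mult_left_mono) auto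
      also have "\<dots> \<le> normsqA A z powr (- \<epsilon>) * (\<bar>C\<bar> * (indicator (polydisc 1) z * normsqA A z powr (- l) * ?X))"
        using nn by (intro mult_left_mono mult_right_mono) auto
      also have "\<dots> = \<bar>C\<bar> * (indicator (polydisc 1) z * (normsqA A z powr (- (l + \<epsilon>)) * ?X))"
      proof -
        have "normsqA A z powr (- (l + \<epsilon>)) = normsqA A z powr (- \<epsilon>) * normsqA A z powr (- l)"
          unfolding powr_add[symmetric] by (simp add: algebra_simps)
        then show ?thesis by (simp only: mult_ac)
      qed
      also have "\<dots> \<le> \<bar>C\<bar> * (indicator (polydisc 1) z * ?Y)"
        using ed(3)[of z] elim by (cases "z \<in> polydisc 1") (simp_all add: mult_left_mono)
      finally show ?case using nn by (simp add: abs_mult)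
    qed
  qed measurable
  then show ?thesis using ed(1) by blast
qed

text \<open>The squared modulus of a pure power is at most the norm, so \<open>|z_i|^K\<close> with
  \<open>K \<ge> 2 * p * (l + 1)\<close> absorbs \<open>l + 1\<close> negative powers of it: the
  \<open>l\<close> of the kernel and one more, which is the margin beyond \<open>s = 0\<close>. The
  remaining factors \<open>1 / |z_i|\<close> are integrable.\<close>

lemma remainder_integrable:
  fixes h :: "complex^'n \<Rightarrow> complex" and l p :: nat
  assumes [measurable]: "h \<in> borel_measurable borel" and R: "R \<ge> 1"
    and p: "\<And>i. \<exists>a\<in>A. a i \<le> p \<and> (\<forall>j. j \<noteq> i \<longrightarrow> a j = 0)" and K: "K \<ge> 2 * p * (l + 1)" and C: "C \<ge> 0"
    and h: "\<And>z. (\<And>i. z$i \<noteq> 0) \<Longrightarrow> cmod (h z) \<le> C * (indicator (polydisc R) z * normsqA A z powr (- real l) * (\<Prod>i\<in>UNIV. cmod (z$i) powr (-1)) * (\<Sum>i\<in>UNIV. cmod (z$i) ^ K))"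
  shows "integrable lborel (\<lambda>z. normsqA A z powr (- 1) * cmod (h z))"
proof (rule Bochner_Integration.integrable_bound)
  let ?C = "C * (real CARD('n) * R ^ K)"
  show "integrable lborel (\<lambda>z::complex^'n. ?C * (indicator (polydisc R) z * (\<Prod>i\<in>UNIV. cmod (z$i) powr (2 * (1/2) - 2))))"
    using R by (intro integrable_mult_right integrable_polydisc) auto
  show "AE z in lborel. norm (normsqA A z powr (- 1) * cmod (h z)) \<le> norm (?C * (indicator (polydisc R) z * (\<Prod>i\<in>UNIV. cmod (z$i) powr (2 * (1/2) - 2))))"
    using AE_nonzero
  proof eventually_elim
    case (elim z)
    show ?case
    proof (cases "z \<in> polydisc R")
      case False
      then have "h z = 0" using h[of z] elim by simp
      then show ?thesis using R C by simp
    next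
      case True
      let ?N = "normsqA A z" and ?X = "\<Prod>i\<in>UNIV. cmod (z$i) powr (-1)"
      have N: "?N > 0" using elim normsqA_pos by blast
      have X: "?X \<ge> 0" by (auto intro: prod_nonneg)
      have one: "?N powr (- real (l + 1)) * cmod (z$i) ^ K \<le> R ^ K" for i
      proof -
        obtain a where a: "a \<in> A" "a i \<le> p" "\<forall>j. j \<noteq> i \<longrightarrow> a j = 0" using p by blast
        have zi: "0 < cmod (z$i)" "cmod (z$i) \<le> R" using elim True by (auto simp: polydisc_def)
        have "cmod (zmon a z) = (\<Prod>j\<in>UNIV. if j = i then cmod (z$i) ^ a i else 1)"
          unfolding cmod_zmon using a(3) by (intro prod.cong) auto
        then have "(cmod (z$i) ^ a i)^2 \<le> ?N" using normsqA_ge[OF a(1), of z] by simp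
        then have "((cmod (z$i) ^ a i)^2) ^ (l + 1) \<le> ?N ^ (l + 1)" by (intro power_mono) auto
        then have *: "cmod (z$i) ^ (2 * a i * (l + 1)) \<le> ?N ^ (l + 1)"
          unfolding power_mult[symmetric] by (simp only: mult.commute[of "a i" 2])
        have le: "2 * a i * (l + 1) \<le> K" using K a(2) by (meson mult_le_mono order_trans le_refl)
        have "cmod (z$i) ^ K = cmod (z$i) ^ (K - 2 * a i * (l + 1)) * cmod (z$i) ^ (2 * a i * (l + 1))"
          using le by (simp flip: power_add)
        also have "\<dots> \<le> R ^ K * ?N ^ (l + 1)"
        proof (intro mult_mono *)
          have "cmod (z$i) ^ (K - 2 * a i * (l + 1)) \<le> R ^ (K - 2 * a i * (l + 1))" using zi by (intro power_mono) auto
          also have "\<dots> \<le> R ^ K" using R by (intro power_increasing) auto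
          finally show "cmod (z$i) ^ (K - 2 * a i * (l + 1)) \<le> R ^ K" .
        qed (use R zi in auto)
        finally have "cmod (z$i) ^ K \<le> R ^ K * ?N ^ (l + 1)" .
        moreover have "?N powr (- real (l + 1)) = 1 / ?N ^ (l + 1)" using N by (simp only: powr_minus_divide powr_realpow)
        ultimately show ?thesis using N by (simp add: divide_le_eq del: power_Suc)
      qed
      have "?N powr (- 1) * cmod (h z) \<le> ?N powr (- 1) * (C * (1 * ?N powr (- real l) * ?X * (\<Sum>i\<in>UNIV. cmod (z$i) ^ K)))"
        using h[of z] elim True by (intro mult_left_mono) auto
      also have "\<dots> = C * ?X * (\<Sum>i\<in>UNIV. ?N powr (- real (l + 1)) * cmod (z$i) ^ K)"
      proof -
        have "?N powr (- real (l + 1)) = ?N powr (- 1) * ?N powr (- real l)" unfolding powr_add[symmetric] by simp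
        then show ?thesis by (simp add: sum_distrib_left sum_distrib_right mult_ac)
      qed
      also have "\<dots> \<le> C * ?X * (\<Sum>i\<in>(UNIV::'n set). R ^ K)"
        using C X by (intro mult_left_mono sum_mono one) auto
      finally show ?thesis using True C X R by (simp add: abs_mult mult_ac)
    qed
  qed
qed measurable

lemma integral_eq_0_of_rotation_vec:
  fixes h :: "complex^'n \<Rightarrow> complex"
  assumes [measurable]: "h \<in> borel_measurable borel" and "norm c = 1" "k \<noteq> 1" "\<And>z. h (upd z i (c * z$i)) = k * h z"
  shows "(\<integral>z. h z \<partial>lborel) = 0"
proof -
  define T where "T j w = (if j = i then c * w else w)" for j :: 'n and w
  have Tm [measurable]: "T j \<in> borel_measurable borel" for j unfolding T_def by measurable
  have "distr lborel borel (T j) = lborel" for j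
    unfolding T_def using lborel_complex_rotate[OF assms(2)] by (cases "j = i") (auto simp: distr_id2)
  then have D: "distr lborel borel (\<lambda>z::complex^'n. \<chi> j. T j (z$j)) = lborel"
    by (intro lborel_distr_componentwise Tm)
  have Tu: "(\<chi> j. T j (z$j)) = upd z i (c * z$i)" for z by (simp add: Finite_Cartesian_Product.vec_eq_iff T_def)
  have "(\<integral>z. h z \<partial>lborel) = (\<integral>z. h z \<partial>distr lborel borel (\<lambda>z::complex^'n. \<chi> j. T j (z$j)))"
    by (simp add: D)
  also have "\<dots> = (\<integral>z. h (\<chi> j. T j (z$j)) \<partial>lborel)"
    by (intro integral_distr) measurable
  also have "\<dots> = k * (\<integral>z. h z \<partial>lborel)" by (simp add: Tu assms)
  finally show ?thesis using assms by simp
qed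

end

section \<open>An Euler identity\<close>

lemma acv_mult_entire:
  assumes "acv F v" "G holomorphic_on UNIV"
  shows "acv (\<lambda>s. G s * F s) (G 0 * v)"
proof -
  obtain e g d where 1: "e > 0" "g holomorphic_on {s. - e < Re s}" "\<And>s. d < Re s \<Longrightarrow> g s = F s" "g 0 = v"
    using assms(1) unfolding acv_def by blast
  show ?thesis
    by (rule acvI[of e "\<lambda>s. G s * g s" d])
       (use 1 holomorphic_on_subset[OF assms(2)] in \<open>auto intro!: holomorphic_intros\<close>)
qed

lemma powr_half_square: "(r :: real) > 0 \<Longrightarrow> (r powr (x / 2))^2 = r powr x"
  by (simp only: power2_eq_square powr_add[symmetric]) simp

lemma powr_power_mult: "(r :: real) > 0 \<Longrightarrow> (r powr x) ^ n = r powr (real n * x)"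
proof (induction n)
  case (Suc n)
  have "r powr (real (Suc n) * x) = r powr (x + real n * x)" by (simp add: distrib_right)
  then show ?case using Suc by (simp only: powr_add power_Suc)
qed simp

lemma emeasure_polydisc_finite: "emeasure lborel (polydisc R :: (complex^'n::finite) set) < \<infinity>"
proof -
  have "bounded (polydisc R :: (complex^'n) set)"
  proof (rule boundedI[of _ "real CARD('n) * \<bar>R\<bar>"])
    fix z :: "complex^'n" assume z: "z \<in> polydisc R"
    have "norm z \<le> (\<Sum>j\<in>UNIV. cmod (z $ j))" unfolding norm_vec_def by (rule L2_set_le_sum) auto
    also have "\<dots> \<le> (\<Sum>j\<in>(UNIV::'n set). \<bar>R\<bar>)" using z by (intro sum_mono) (auto simp: polydisc_def intro: order_trans)
    finally show "norm z \<le> real CARD('n) * \<bar>R\<bar>" by simp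
  qed
  then show ?thesis by (rule emeasure_bounded_finite)
qed

lemma emeasure_polydisc_pos: "emeasure lborel (polydisc 1 :: (complex^'n::finite) set) > 0"
proof -
  have "ball 0 1 \<subseteq> (polydisc 1 :: (complex^'n) set)"
    by (auto simp: polydisc_def intro: order_trans[OF Finite_Cartesian_Product.norm_nth_le] less_imp_le)
  then have "emeasure lborel (ball (0 :: complex^'n) 1) \<le> emeasure lborel (polydisc 1 :: (complex^'n) set)"
    by (intro emeasure_mono) auto
  moreover have "emeasure lborel (ball (0 :: complex^'n) 1) > 0"
    by (subst emeasure_ball) auto
  ultimately show ?thesis by (rule less_le_trans[rotated])
qed

text \<open>Both exchanges of integration in the Euler identity concern a bounded integrand on the
  product of the unit interval and the unit polydisc, a set of finite measure.\<close>

lemma fubini_bounded: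
  fixes k :: "real \<Rightarrow> complex^'n::finite \<Rightarrow> complex"
  assumes [measurable]: "case_prod k \<in> borel_measurable (borel \<Otimes>\<^sub>M borel)"
    and bd: "\<And>r z. cmod (k r z) \<le> B * (indicator {0<..<1} r * indicator (polydisc 1) z)" and B: "B \<ge> 0"
  shows "(\<integral>z. (\<integral>r. k r z \<partial>lborel) \<partial>lborel) = (\<integral>r. (\<integral>z. k r z \<partial>lborel) \<partial>lborel)"
proof (rule lborel_pair.Fubini_integral)
  let ?S = "{0<..<1::real} \<times> (polydisc 1 :: (complex^'n) set)"
  have S: "?S \<in> sets (lborel \<Otimes>\<^sub>M lborel)" by (intro pair_measureI) auto
  have "emeasure (lborel \<Otimes>\<^sub>M lborel) ?S = emeasure lborel {0<..<1::real} * emeasure lborel (polydisc 1 :: (complex^'n) set)"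
    by (intro lborel.emeasure_pair_measure_Times) auto
  also have "\<dots> < \<infinity>" using emeasure_polydisc_finite[of 1] by (simp add: ennreal_mult_less_top)
  finally have "integrable (lborel \<Otimes>\<^sub>M lborel) (\<lambda>x. B * indicator ?S x)"
    using S by (intro integrable_mult_right) (simp add: integrable_indicator_iff)
  then show "integrable (lborel \<Otimes>\<^sub>M lborel) (case_prod k)"
  proof (rule Bochner_Integration.integrable_bound)
    show "AE x in lborel \<Otimes>\<^sub>M lborel. norm (case_prod k x) \<le> norm (B * indicator ?S x)"
      using bd B by (intro AE_I2) (auto simp: indicator_times split: prod.split)
  qed measurable
qed

section \<open>Weighted dilations and their gauge\<close>

context monomials
begin

text \<open>For positive \<open>\<xi>\<close> the gauge of the weighted dilations: homogeneous of
  degree one under \<open>Sc\<close>, with the unit polydisc as unit ball and the dilated polydiscs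
  as sublevel sets.\<close>

definition rho :: "('n \<Rightarrow> real) \<Rightarrow> complex^'n \<Rightarrow> real" where
  "rho \<xi> z = Max (range (\<lambda>i. ((cmod (z$i))^2) powr (1 / \<xi> i)))"

definition tm :: "('n \<Rightarrow> nat) \<Rightarrow> complex^'n \<Rightarrow> real" where
  "tm m z = (\<Prod>i\<in>UNIV. ((cmod (z$i))^2) ^ m i)"

lemma measurable_rho [measurable]: "rho \<xi> \<in> borel_measurable borel"
  unfolding rho_def[abs_def] by measurable

lemma measurable_tm [measurable]: "tm m \<in> borel_measurable borel"
  unfolding tm_def[abs_def] by measurable

lemma tm_nonneg: "tm m z \<ge> 0" by (simp add: tm_def prod_nonneg)

lemma tm_le_1: "z \<in> polydisc 1 \<Longrightarrow> tm m z \<le> 1"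
  unfolding tm_def by (intro prod_le_1) (auto simp: polydisc_def intro!: power_le_one)

lemma cmod_zmon_tm: "(cmod (zmon a z))^2 = tm a z"
  by (simp add: tm_def cmod_zmon prod_power_distrib power_mult[symmetric] mult.commute)

lemma normsqA_tm: "normsqA A z = (\<Sum>a\<in>A. tm a z)"
  by (simp add: normsqA_def cmod_zmon_tm)

lemma rho_le_iff:
  assumes "\<And>i. \<xi> i > 0" "r \<ge> 0"
  shows "rho \<xi> z \<le> r \<longleftrightarrow> (\<forall>i. (cmod (z$i))^2 \<le> r powr \<xi> i)"
proof -
  have "((cmod (z$i))^2) powr (1 / \<xi> i) \<le> r \<longleftrightarrow> (cmod (z$i))^2 \<le> r powr \<xi> i" for i
  proof
    assume "((cmod (z$i))^2) powr (1 / \<xi> i) \<le> r"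
    then have "(((cmod (z$i))^2) powr (1 / \<xi> i)) powr \<xi> i \<le> r powr \<xi> i"
      using assms(1)[of i] by (intro powr_mono2) auto
    then show "(cmod (z$i))^2 \<le> r powr \<xi> i" using assms(1)[of i] by (simp add: powr_powr)
  next
    assume "(cmod (z$i))^2 \<le> r powr \<xi> i"
    then have "((cmod (z$i))^2) powr (1 / \<xi> i) \<le> (r powr \<xi> i) powr (1 / \<xi> i)"
      using assms(1)[of i] by (intro powr_mono2) auto
    then show "((cmod (z$i))^2) powr (1 / \<xi> i) \<le> r" using assms(1)[of i] assms(2) by (simp add: powr_powr)
  qed
  then show ?thesis unfolding rho_def by (subst Max_le_iff) auto
qed

lemma rho_nonneg: "rho \<xi> z \<ge> 0"
proof -
  have "((cmod (z$undefined))^2) powr (1 / \<xi> undefined) \<le> rho \<xi> z" unfolding rho_def by (intro Max_ge) auto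
  then show ?thesis using powr_ge_zero order_trans by blast
qed

lemma rho_le_1: "(\<And>i. \<xi> i > 0) \<Longrightarrow> rho \<xi> z \<le> 1 \<longleftrightarrow> z \<in> polydisc 1"
  by (subst rho_le_iff) (auto simp: polydisc_def power_le_one_iff)

lemma rho_pos: "z$i \<noteq> 0 \<Longrightarrow> rho \<xi> z > 0"
proof -
  assume "z$i \<noteq> 0"
  then have "0 < ((cmod (z$i))^2) powr (1 / \<xi> i)" by simp
  also have "\<dots> \<le> rho \<xi> z" unfolding rho_def by (intro Max_ge) auto
  finally show ?thesis .
qed

lemma rho_le_sum: "rho \<xi> z \<le> (\<Sum>i\<in>UNIV. ((cmod (z$i))^2) powr (1 / \<xi> i))"
  unfolding rho_def by (subst Max_le_iff) (auto intro!: member_le_sum)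

text \<open>The exponent \<open>\<xi> i / 2\<close> makes \<open>|z_i|^2\<close> scale by
  \<open>r powr \<xi> i\<close>, hence \<open>tm m\<close> by \<open>r powr dt m \<xi>\<close> and
  volume by \<open>r\<close> to the sum of \<open>\<xi>\<close>.\<close>

definition Sc :: "('n \<Rightarrow> real) \<Rightarrow> real \<Rightarrow> complex^'n \<Rightarrow> complex^'n" where
  "Sc \<xi> r z = (\<chi> i. (r powr (\<xi> i / 2)) *\<^sub>R z$i)"

lemma tm_Sc:
  assumes "r > 0"
  shows "tm m (Sc \<xi> r z) = r powr (dt m \<xi>) * tm m z"
proof -
  have "((cmod (Sc \<xi> r z $ i))^2) ^ m i = r powr (real (m i) * \<xi> i) * ((cmod (z$i))^2) ^ m i" for i
  proof -
    have "(r powr (\<xi> i / 2))^2 = r powr \<xi> i" using assms by (rule powr_half_square)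
    then have "(cmod (Sc \<xi> r z $ i))^2 = r powr \<xi> i * (cmod (z$i))^2"
      by (simp add: Sc_def power_mult_distrib)
    moreover have "(r powr \<xi> i) ^ m i = r powr (real (m i) * \<xi> i)"
      using assms by (rule powr_power_mult)
    ultimately show ?thesis by (simp add: power_mult_distrib)
  qed
  then show ?thesis
    using assms unfolding tm_def dt_def by (simp add: prod.distrib powr_sum)
qed

lemma Sc_polydisc:
  assumes "\<And>i. \<xi> i > 0" "0 < r" "r \<le> 1" "z \<in> polydisc 1"
  shows "Sc \<xi> r z \<in> polydisc 1"
proof -
  have "r powr (\<xi> i / 2) \<le> 1" for i using assms(1)[of i] assms(2,3) by (intro powr_le1) auto
  then show ?thesis using assms(4) by (auto simp: polydisc_def Sc_def intro!: mult_le_one)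
qed

text \<open>Differentiating \<open>r^(l+1) * N(Sc r z)^(s-l)\<close> in \<open>r\<close>, where
  \<open>N\<close> is the norm, separates what exact homogeneity of degree 1 would give from a
  correction with weights \<open>dt a \<xi> - 1\<close>. Integrating over the polydisc and changing
  variables for each \<open>r\<close> brings back the original integral, and solving for it leaves
  the factor \<open>s\<close> in front. For \<open>Re s > l + 1\<close> all integrands are
  bounded.\<close>

lemma euler_identity:
  fixes \<xi> :: "'n \<Rightarrow> real" and m :: "'n \<Rightarrow> nat" and l :: nat
  assumes \<xi>: "\<And>i. \<xi> i > 0" and q1: "\<And>a. a \<in> A \<Longrightarrow> dt a \<xi> \<ge> 1"
    and l: "dt m \<xi> + (\<Sum>i\<in>UNIV. \<xi> i) = real l" and s: "Re s > real l + 1"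
  shows "s * (\<integral>z. of_real (normsqA A z) powr s * of_real (indicator (polydisc 1) z * tm m z / normsqA A z ^ l) \<partial>lborel)
    = (s + 1) * (\<integral>z. of_real (normsqA A z) powr s * of_real (indicator (polydisc 1) z * rho \<xi> z * tm m z / normsqA A z ^ l) \<partial>lborel)
    + (of_nat l - s) * (\<Sum>a\<in>A. of_real (dt a \<xi> - 1) *
        (\<integral>z. of_real (normsqA A z) powr s * of_real (indicator (polydisc 1) z * (1 - rho \<xi> z) * tm m z * tm a z / normsqA A z ^ (l + 1)) \<partial>lborel))"
proof -
  let ?N = "normsqA A"
  \<comment> \<open>Up to the Jacobian, \<open>h\<close> at the dilated point is the derivative in
    \<open>r\<close> of the function \<open>y\<close> introduced further on.\<close>
  define h where "h z = of_real (?N z) powr s * ((s + 1) * of_real (tm m z / ?N z ^ l) + (s - of_nat l) * (\<Sum>a\<in>A. of_real (dt a \<xi> - 1) * of_real (tm m z * tm a z / ?N z ^ (l + 1))))" for z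
  have hm [measurable]: "h \<in> borel_measurable borel" unfolding h_def[abs_def] by measurable
  obtain C where C: "C \<ge> 1" "\<And>z. z \<in> polydisc 1 \<Longrightarrow> ?N z \<le> C" using normsqA_bounded[of 1] by auto
  define D where "D = C powr Re s"
  have NB: "cmod (of_real (?N z) powr s) / ?N z ^ j \<le> D" if z: "z \<in> polydisc 1" and j: "j \<le> l + 1" for z j
  proof (cases "?N z = 0")
    case True
    then show ?thesis by (simp add: D_def)
  next
    case False
    then have N: "?N z > 0" using normsqA_nonneg[of A z] by simp
    have "cmod (of_real (?N z) powr s) / ?N z ^ j = ?N z powr (Re s - real j)"
      using N by (simp add: norm_powr_real_powr powr_diff powr_realpow)
    also have "\<dots> \<le> C powr (Re s - real j)" using N C(2)[OF z] s j by (intro powr_mono2) auto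
    also have "\<dots> \<le> D" unfolding D_def using C(1) by (intro powr_mono) auto
    finally show ?thesis .
  qed
  define B where "B = cmod (s + 1) * D + cmod (s - of_nat l) * (\<Sum>a\<in>A. \<bar>dt a \<xi> - 1\<bar> * D)"
  have D0: "D \<ge> 0" by (simp add: D_def)
  have B0: "B \<ge> 0" unfolding B_def using D0 by (intro add_nonneg_nonneg mult_nonneg_nonneg sum_nonneg) auto
  have hB: "cmod (h z) \<le> B" if z: "z \<in> polydisc 1" for z
  proof -
    have e: "h z = (s + 1) * (of_real (?N z) powr s * of_real (tm m z / ?N z ^ l)) + (s - of_nat l) * (\<Sum>a\<in>A. of_real (dt a \<xi> - 1) * (of_real (?N z) powr s * of_real (tm m z * tm a z / ?N z ^ (l + 1))))"
      unfolding h_def distrib_left sum_distrib_left by (simp only: mult.left_commute)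
    have b: "cmod (of_real (?N z) powr s * of_real (v / ?N z ^ j)) \<le> D" if "0 \<le> v" "v \<le> 1" "j \<le> l + 1" for v j
    proof -
      have "cmod (of_real (?N z) powr s * of_real (v / ?N z ^ j)) = v * (cmod (of_real (?N z) powr s) / ?N z ^ j)"
        using that normsqA_nonneg[of A z] by (simp add: norm_mult norm_divide norm_power del: of_real_divide) 
      also have "\<dots> \<le> 1 * D" using that NB[OF z, of j] normsqA_nonneg[of A z] by (intro mult_mono) auto
      finally show ?thesis by simp
    qed
    have t1: "0 \<le> tm m z" "tm m z \<le> 1" "\<And>a. 0 \<le> tm m z * tm a z" "\<And>a. tm m z * tm a z \<le> 1"
      using tm_nonneg tm_le_1[OF z] by (auto intro!: mult_le_one)
    have b1: "cmod (of_real (?N z) powr s * of_real (tm m z / ?N z ^ l)) \<le> D"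
      by (rule b[OF t1(1,2)]) simp
    have b2: "cmod (of_real (?N z) powr s * of_real (tm m z * tm a z / ?N z ^ (l + 1))) \<le> D" for a
      by (rule b[OF t1(3,4)]) simp
    have b3: "cmod (\<Sum>a\<in>A. of_real (dt a \<xi> - 1) * (of_real (?N z) powr s * of_real (tm m z * tm a z / ?N z ^ (l + 1)))) \<le> (\<Sum>a\<in>A. \<bar>dt a \<xi> - 1\<bar> * D)"
    proof (rule sum_norm_le)
      fix a
      show "cmod (of_real (dt a \<xi> - 1) * (of_real (?N z) powr s * of_real (tm m z * tm a z / ?N z ^ (l + 1)))) \<le> \<bar>dt a \<xi> - 1\<bar> * D"
        unfolding norm_mult[of "of_real (dt a \<xi> - 1)"] norm_of_real by (rule mult_left_mono[OF b2]) simp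
    qed
    show ?thesis unfolding e B_def
      by (rule norm_triangle_le, unfold norm_mult[of "s + 1"] norm_mult[of "s - of_nat l"], rule add_mono[OF mult_left_mono[OF b1] mult_left_mono[OF b3]]) simp_all
  qed
  have sx: "0 < (\<Sum>i\<in>UNIV. \<xi> i)" using \<xi> by (intro sum_pos) auto
  have ftc: "of_real (?N z) powr s * of_real (tm m z / ?N z ^ l) = (\<integral>r. indicator {0<..<1} r * (of_real (r powr (\<Sum>i\<in>UNIV. \<xi> i)) * h (Sc \<xi> r z)) \<partial>lborel)"
    if z: "\<And>i. z$i \<noteq> 0" and zP: "z \<in> polydisc 1" for z
  proof -
    define Nr where "Nr r = (\<Sum>a\<in>A. r powr (dt a \<xi>) * tm a z)" for r :: real
    have tp: "tm a z > 0" for a using z by (auto simp: tm_def intro!: prod_pos)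
    have Nrpos: "Nr r > 0" if "r > 0" for r unfolding Nr_def using that finA A_ne tp by (intro sum_pos) auto
    have Nr: "?N (Sc \<xi> r z) = Nr r" if "r > 0" for r using that by (simp add: normsqA_tm Nr_def tm_Sc)
    have Nr1: "Nr 1 = ?N z" by (simp add: Nr_def normsqA_tm)
    \<comment> \<open>The exponent \<open>l + 1\<close> exceeds the homogeneous degree
      \<open>l\<close> by one. The later integral over \<open>r\<close> is thereby one of
      \<open>dr\<close> instead of \<open>dr / r\<close>, and the bounded weight
      \<open>1 - rho\<close> appears in place of a logarithm.\<close>
    define y where "y r = of_real (r ^ (l + 1)) * of_real (Nr r) powr (s - of_nat l) * of_real (tm m z)" for r
    define y' where "y' r = of_real (r powr (\<Sum>i\<in>UNIV. \<xi> i)) * h (Sc \<xi> r z)" for r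
    have cNr: "continuous_on {0..1} Nr"
      unfolding Nr_def using q1 by (intro continuous_intros continuous_on_powr') force+
    have cy: "continuous_on {0..1} y"
    proof -
      have "continuous_on {0..1} (\<lambda>r. complex_of_real (Nr r) powr (s - of_nat l))"
      proof (rule continuous_on_powr_complex)
        show "{0..1} \<subseteq> {r. 0 \<le> Re (complex_of_real (Nr r)) \<or> Im (complex_of_real (Nr r)) \<noteq> 0}"
          using tp by (auto simp: Nr_def less_imp_le intro!: sum_nonneg)
        show "0 < Re (s - of_nat l)" for r using s by simp
        show "continuous_on {0..1} (\<lambda>r. complex_of_real (Nr r))" by (intro continuous_on_of_real cNr)
      qed (rule continuous_on_const)
      then show ?thesis
        unfolding y_def by (intro continuous_on_mult continuous_on_of_real continuous_on_power continuous_on_id continuous_on_const)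
    qed
    have dy: "(y has_vector_derivative y' r) (at r)" if r: "r \<in> {0<..<1}" for r
    proof -
      have r0: "r > 0" using r by simp
      define X where "X = (\<Sum>a\<in>A. (dt a \<xi> - 1) * (r powr dt a \<xi> * tm a z))"
      have dN: "(Nr has_real_derivative (Nr r + X) / r) (at r)"
      proof -
        have "(Nr has_real_derivative (\<Sum>a\<in>A. dt a \<xi> * r powr (dt a \<xi> - 1) * tm a z)) (at r)"
          unfolding Nr_def using r0 by (auto intro!: derivative_eq_intros)
        also have "(\<Sum>a\<in>A. dt a \<xi> * r powr (dt a \<xi> - 1) * tm a z) = (Nr r + X) / r"
          unfolding Nr_def X_def sum.distrib[symmetric] sum_divide_distrib using r0
          by (intro sum.cong refl) (simp add: powr_diff field_simps)
        finally show ?thesis .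
      qed
      have dNc: "((\<lambda>r. complex_of_real (Nr r)) has_vector_derivative of_real ((Nr r + X) / r)) (at r)"
        by (rule has_vector_derivative_of_real) (use dN in \<open>simp add: has_real_derivative_iff_has_vector_derivative\<close>)
      have dp: "((\<lambda>w. w powr (s - of_nat l)) has_field_derivative (s - of_nat l) * of_real (Nr r) powr (s - of_nat l - 1)) (at (of_real (Nr r)))"
        using Nrpos[OF r0] by (intro has_field_derivative_powr) auto
      have d2: "((\<lambda>r. of_real (Nr r) powr (s - of_nat l)) has_vector_derivative of_real ((Nr r + X) / r) * ((s - of_nat l) * of_real (Nr r) powr (s - of_nat l - 1))) (at r)"
        using field_vector_diff_chain_at[OF dNc dp] by (simp add: o_def)
      have d1: "((\<lambda>r. complex_of_real (r ^ (l + 1))) has_vector_derivative of_real (real (l + 1) * r ^ l)) (at r)"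
      proof -
        have "((\<lambda>r. r ^ Suc l) has_real_derivative real (Suc l) * r ^ l) (at r)"
          using DERIV_pow[of "Suc l" r] by simp
        then have "((\<lambda>r. r ^ (l + 1)) has_vector_derivative real (l + 1) * r ^ l) (at r)"
          by (simp add: has_real_derivative_iff_has_vector_derivative)
        then show ?thesis
          using bounded_linear.has_vector_derivative[OF bounded_linear_of_real] by blast
      qed
      have "(y has_vector_derivative
         (of_real (r ^ (l + 1)) * (of_real ((Nr r + X) / r) * ((s - of_nat l) * of_real (Nr r) powr (s - of_nat l - 1)))
          + of_real (real (l + 1) * r ^ l) * of_real (Nr r) powr (s - of_nat l)) * of_real (tm m z)) (at r)"
        unfolding y_def by (intro has_vector_derivative_mult_left has_vector_derivative_mult d1 d2)
      moreover have "(of_real (r ^ (l + 1)) * (of_real ((Nr r + X) / r) * ((s - of_nat l) * of_real (Nr r) powr (s - of_nat l - 1)))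
          + of_real (real (l + 1) * r ^ l) * of_real (Nr r) powr (s - of_nat l)) * of_real (tm m z) = y' r"
      proof -
        define W where "W = of_real (Nr r) powr s"
        define n where "n = complex_of_real (Nr r)"
        have n0: "n \<noteq> 0" using Nrpos[OF r0] by (simp add: n_def)
        have p1: "of_real (Nr r) powr (s - of_nat l) = W / n ^ l"
          using n0 by (simp add: W_def n_def powr_diff powr_nat)
        have p2: "of_real (Nr r) powr (s - of_nat l - 1) = W / n ^ (l + 1)"
          using n0 unfolding powr_diff p1 by (simp add: n_def W_def powr_nat mult.commute)
        have rl: "r powr (\<Sum>i\<in>UNIV. \<xi> i) * r powr (dt m \<xi>) = r ^ l"
          using r0 l by (simp add: powr_add[symmetric] powr_realpow add.commute)
        have Xs: "of_real X = (\<Sum>a\<in>A. of_real (dt a \<xi> - 1) * of_real (r powr dt a \<xi> * tm a z) :: complex)"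
          by (simp add: X_def)
        have hS: "h (Sc \<xi> r z) = W * ((s + 1) * (of_real (r powr dt m \<xi> * tm m z) / n ^ l) + (s - of_nat l) * (of_real X * (of_real (r powr dt m \<xi> * tm m z) / n ^ (l + 1))))"
          unfolding h_def Nr[OF r0] tm_Sc[OF r0] Xs sum_distrib_right W_def[symmetric]
          by (simp add: n_def mult_ac)
        have "y' r = of_real (r powr (\<Sum>i\<in>UNIV. \<xi> i) * r powr dt m \<xi>) * (W * ((s + 1) * (of_real (tm m z) / n ^ l) + (s - of_nat l) * (of_real X * (of_real (tm m z) / n ^ (l + 1)))))"
          unfolding y'_def hS by (simp add: algebra_simps)
        also have "\<dots> = of_real (r ^ l) * (W * ((s + 1) * (of_real (tm m z) / n ^ l) + (s - of_nat l) * (of_real X * (of_real (tm m z) / n ^ (l + 1)))))"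
          unfolding rl ..
        finally have Y: "y' r = of_real (r ^ l) * (W * ((s + 1) * (of_real (tm m z) / n ^ l) + (s - of_nat l) * (of_real X * (of_real (tm m z) / n ^ (l + 1)))))" .
        have "of_real (r ^ (l + 1)) * of_real ((Nr r + X) / r) = of_real (r ^ l) * (n + of_real X)"
          using r0 by (simp add: n_def)
        then have "of_real (r ^ (l + 1)) * (of_real ((Nr r + X) / r) * ((s - of_nat l) * (W / n ^ (l + 1)))) = of_real (r ^ l) * (n + of_real X) * ((s - of_nat l) * (W / n ^ (l + 1)))"
          by (simp only: mult.assoc[symmetric])
        moreover have "(of_real (r ^ l) * (n + of_real X) * ((s - of_nat l) * (W / n ^ (l + 1))) + of_real (real (l + 1) * r ^ l) * (W / n ^ l)) * of_real (tm m z)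
          = of_real (r ^ l) * (W * ((s + 1) * (of_real (tm m z) / n ^ l) + (s - of_nat l) * (of_real X * (of_real (tm m z) / n ^ (l + 1)))))"
          using n0 by (simp add: field_simps)
        ultimately show ?thesis unfolding p1 p2 Y by simp
      qed
      ultimately show ?thesis by simp
    qed
    have "(y' has_integral (y 1 - y 0)) {0..1}"
      using dy cy by (intro fundamental_theorem_of_calculus_interior) auto
    then have "(y' has_integral (y 1 - y 0)) {0<..<1}"
      by (simp add: has_integral_Icc_iff_Ioo)
    moreover have "set_integrable lborel {0<..<1} y'"
      unfolding set_integrable_def
    proof (rule integrableI_bounded_set[where A="{0<..<1}" and B="B"])
      show "(\<lambda>r. indicator {0<..<1} r *\<^sub>R y' r) \<in> borel_measurable lborel"
        unfolding y'_def Sc_def by measurable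
      show "AE r in lborel. r \<in> {0<..<1} \<longrightarrow> norm (indicator {0<..<1} r *\<^sub>R y' r) \<le> B"
      proof (intro AE_I2 impI)
        fix r :: real assume r: "r \<in> {0<..<1}"
        have "r powr (\<Sum>i\<in>UNIV. \<xi> i) \<le> 1" using r sx by (intro powr_le1) auto
        moreover have "cmod (h (Sc \<xi> r z)) \<le> B" using r by (intro hB Sc_polydisc \<xi> zP) auto
        ultimately have "cmod (y' r) \<le> 1 * B" unfolding y'_def norm_mult by (intro mult_mono) auto
        then show "norm (indicator {0<..<1} r *\<^sub>R y' r) \<le> B" using r by simp
      qed
    qed auto
    ultimately have "(LINT r:{0<..<1}|lborel. y' r) = y 1 - y 0"
      using set_borel_integral_eq_integral(2) integral_unique by metis
    moreover have "(LINT r:{0<..<1}|lborel. y' r) = (\<integral>r. indicator {0<..<1} r * y' r \<partial>lborel)"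
      unfolding set_lebesgue_integral_def by (intro Bochner_Integration.integral_cong refl) (simp add: indicator_def)
    moreover have "y 0 = 0" by (simp add: y_def)
    moreover have "y 1 = of_real (?N z) powr s * of_real (tm m z / ?N z ^ l)"
      unfolding y_def Nr1 using Nrpos[of 1] Nr1 by (simp add: powr_diff powr_nat)
    ultimately show ?thesis unfolding y'_def by simp
  qed
  \<comment> \<open>\<open>?ind\<close> runs over the polydisc and evaluates \<open>h\<close> at the
    dilated point. \<open>?ind2\<close> is its form after the change of variables, where the dilated
    polydisc is the sublevel set of \<open>rho\<close> at \<open>r\<close>.\<close>
  let ?ind = "\<lambda>r z. indicator {0<..<1} r * (indicator (polydisc 1) z * (of_real (r powr (\<Sum>i\<in>UNIV. \<xi> i)) * h (Sc \<xi> r z))) :: complex"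
  let ?ind2 = "\<lambda>r z. indicator {0<..<1} r * (indicator {z. \<forall>i. (cmod (z$i))^2 \<le> r powr \<xi> i} z * h z) :: complex"
  have PrP: "z \<in> polydisc 1" if "0 < r" "r < 1" "\<forall>i. (cmod (z$i))^2 \<le> r powr \<xi> i" for r z
    unfolding rho_le_1[where \<xi>=\<xi>, OF \<xi>, symmetric] using that rho_le_iff[where \<xi>=\<xi> and r=r and z=z, OF \<xi>] by simp
  have "(\<integral>z. of_real (?N z) powr s * of_real (indicator (polydisc 1) z * tm m z / ?N z ^ l) \<partial>lborel)
      = (\<integral>z. (\<integral>r. ?ind r z \<partial>lborel) \<partial>lborel)"
  proof (rule integral_cong_AE)
    show "AE z in lborel. of_real (?N z) powr s * of_real (indicator (polydisc 1) z * tm m z / ?N z ^ l) = (\<integral>r. ?ind r z \<partial>lborel)"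
      using AE_nonzero
    proof eventually_elim
      case (elim z)
      show ?case using ftc[of z] elim by (cases "z \<in> polydisc 1") simp_all
    qed
    have "(\<lambda>(z, r). ?ind r z) \<in> borel_measurable (borel \<Otimes>\<^sub>M lborel)"
      unfolding Sc_def by measurable
    then show "(\<lambda>z. \<integral>r. ?ind r z \<partial>lborel) \<in> borel_measurable lborel"
      using lborel.borel_measurable_lebesgue_integral[of "\<lambda>z r. ?ind r z" borel] by (simp add: case_prod_unfold)
  qed measurable
  also have "\<dots> = (\<integral>r. (\<integral>z. ?ind r z \<partial>lborel) \<partial>lborel)"
  proof (rule fubini_bounded[OF _ _ B0])
    show "case_prod ?ind \<in> borel_measurable (borel \<Otimes>\<^sub>M borel)"
      unfolding Sc_def by measurable
    show "cmod (?ind r z) \<le> B * (indicator {0<..<1} r * indicator (polydisc 1) z)" for r z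
    proof (cases "r \<in> {0<..<1} \<and> z \<in> polydisc 1")
      case True
      have "r powr (\<Sum>i\<in>UNIV. \<xi> i) \<le> 1" using True sx by (intro powr_le1) auto
      moreover have "cmod (h (Sc \<xi> r z)) \<le> B" using True by (intro hB Sc_polydisc \<xi>) auto
      ultimately have "cmod (of_real (r powr (\<Sum>i\<in>UNIV. \<xi> i)) * h (Sc \<xi> r z)) \<le> 1 * B" unfolding norm_mult by (intro mult_mono) auto
      then show ?thesis using True by simp
    qed auto
  qed
  also have "\<dots> = (\<integral>r. (\<integral>z. ?ind2 r z \<partial>lborel) \<partial>lborel)"
  proof (rule Bochner_Integration.integral_cong[OF refl])
    fix r :: real
    show "(\<integral>z. ?ind r z \<partial>lborel) = (\<integral>z. ?ind2 r z \<partial>lborel)"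
    proof (cases "r \<in> {0<..<1}")
      case True
      let ?g = "\<lambda>z. indicator {z. \<forall>i. (cmod (z$i))^2 \<le> r powr \<xi> i} z * h z :: complex"
      have Pb: "{z :: complex^'n. \<forall>i. (cmod (z$i))^2 \<le> r powr \<xi> i} \<in> sets borel"
        by (intro borel_closed closed_Collect_all closed_Collect_le continuous_intros)
      then have gm: "?g \<in> borel_measurable borel" by measurable
      have "(\<integral>z. ?g z \<partial>lborel) = (\<Prod>i\<in>UNIV. (r powr (\<xi> i / 2)) ^ DIM(complex)) * (\<integral>z. ?g (\<chi> i. (r powr (\<xi> i / 2)) *\<^sub>R z$i) \<partial>lborel)"
        using True gm by (intro integral_scale_componentwise) auto
      also have "(\<Prod>i\<in>UNIV. (r powr (\<xi> i / 2)) ^ DIM(complex)) = r powr (\<Sum>i\<in>UNIV. \<xi> i)"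
      proof -
        have "(r powr (\<xi> i / 2)) ^ DIM(complex) = r powr \<xi> i" for i
          using True by (simp add: powr_half_square)
        then show ?thesis using True by (simp add: powr_sum)
      qed
      also have "(\<lambda>z. ?g (\<chi> i. (r powr (\<xi> i / 2)) *\<^sub>R z$i)) = (\<lambda>z. indicator (polydisc 1) z * h (Sc \<xi> r z))"
      proof
        fix z :: "complex^'n"
        have "(cmod (Sc \<xi> r z $ i))^2 \<le> r powr \<xi> i \<longleftrightarrow> cmod (z$i) \<le> 1" for i
        proof -
          have "(r powr (\<xi> i / 2))^2 = r powr \<xi> i" using True by (simp add: powr_half_square)
          then have "(cmod (Sc \<xi> r z $ i))^2 = r powr \<xi> i * (cmod (z$i))^2" by (simp add: Sc_def power_mult_distrib)
          moreover have "r powr \<xi> i > 0" using True by simp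
          ultimately show ?thesis by (simp add: power_le_one_iff)
        qed
        then show "?g (\<chi> i. (r powr (\<xi> i / 2)) *\<^sub>R z$i) = indicator (polydisc 1) z * h (Sc \<xi> r z)"
          unfolding Sc_def[symmetric] by (simp add: indicator_def polydisc_def)
      qed
      finally have e: "(\<integral>z. ?g z \<partial>lborel) = r powr (\<Sum>i\<in>UNIV. \<xi> i) * (\<integral>z. indicator (polydisc 1) z * h (Sc \<xi> r z) \<partial>lborel)" .
      have "(\<integral>z. indicator (polydisc 1) z * (of_real (r powr (\<Sum>i\<in>UNIV. \<xi> i)) * h (Sc \<xi> r z)) \<partial>lborel) = r powr (\<Sum>i\<in>UNIV. \<xi> i) * (\<integral>z. indicator (polydisc 1) z * h (Sc \<xi> r z) \<partial>lborel)"
        by (subst integral_mult_right_zero[symmetric]) (simp only: mult.left_commute)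
      then show ?thesis using True e by simp
    qed simp
  qed
  also have "\<dots> = (\<integral>z. (\<integral>r. ?ind2 r z \<partial>lborel) \<partial>lborel)"
  proof (rule fubini_bounded[OF _ _ B0, symmetric])
    have "(\<lambda>x. indicator {z. \<forall>i. (cmod (z$i))^2 \<le> fst x powr \<xi> i} (snd x)) \<in> borel_measurable (borel \<Otimes>\<^sub>M (borel :: (complex^'n) measure))"
      by (subst indicator_def, simp only: mem_Collect_eq) measurable
    then show "case_prod ?ind2 \<in> borel_measurable (borel \<Otimes>\<^sub>M borel)"
      unfolding case_prod_unfold by measurable
    show "cmod (?ind2 r z) \<le> B * (indicator {0<..<1} r * indicator (polydisc 1) z)" for r z
      using PrP[of r z] hB[of z] B0 by (auto simp: indicator_def)
  qed
  also have "\<dots> = (\<integral>z. indicator (polydisc 1) z * of_real (1 - rho \<xi> z) * h z \<partial>lborel)"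
  proof (intro Bochner_Integration.integral_cong refl)
    fix z :: "complex^'n"
    \<comment> \<open>For fixed \<open>z\<close> in the polydisc the admissible \<open>r\<close>
      fill the interval from \<open>rho \<xi> z\<close> to 1, whose length is the weight.\<close>
    have "(\<integral>r. ?ind2 r z \<partial>lborel) = (\<integral>r. indicator {r. 0 < r \<and> r < 1 \<and> rho \<xi> z \<le> r} r *\<^sub>R h z \<partial>lborel)"
      by (intro Bochner_Integration.integral_cong refl) (auto simp: indicator_def rho_le_iff[where \<xi>=\<xi>, OF \<xi>])
    also have "\<dots> = measure lborel {r. 0 < r \<and> r < 1 \<and> rho \<xi> z \<le> r} *\<^sub>R h z"
    proof (subst integral_scaleR_left)
      have "{r::real. 0 < r \<and> r < 1 \<and> rho \<xi> z \<le> r} = {0<..<1} \<inter> {rho \<xi> z..}" by auto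
      then have "integrable lborel (indicator {r::real. 0 < r \<and> r < 1 \<and> rho \<xi> z \<le> r} :: real \<Rightarrow> real)"
        by (simp add: integrable_indicator_iff) (metis emeasure_lborel_Ioo emeasure_mono ennreal_less_top inf_le1 le_less_trans sets_lborel borel_open open_greaterThanLessThan zero_le_one)
      then show "integrable lborel (indicator {r::real. 0 < r \<and> r < 1 \<and> rho \<xi> z \<le> r} :: real \<Rightarrow> real)" if "h z \<noteq> 0" by simp
    qed simp
    also have "\<dots> = indicator (polydisc 1) z * of_real (1 - rho \<xi> z) * h z"
    proof (cases "z \<in> polydisc 1")
      case True
      then have r: "0 \<le> rho \<xi> z" "rho \<xi> z \<le> 1" using rho_nonneg rho_le_1[where \<xi>=\<xi>, OF \<xi>] by auto
      have "measure lborel {r. 0 < r \<and> r < 1 \<and> rho \<xi> z \<le> r} = 1 - rho \<xi> z"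
      proof (cases "rho \<xi> z = 0")
        case True
        then have "{r. 0 < r \<and> r < 1 \<and> rho \<xi> z \<le> r} = {0<..<1}" by auto
        then show ?thesis using True by simp
      next
        case False
        then have "{r. 0 < r \<and> r < 1 \<and> rho \<xi> z \<le> r} = {rho \<xi> z..<1}" using r by auto
        then show ?thesis using r by simp
      qed
      then show ?thesis using True by (simp add: scaleR_conv_of_real)
    next
      case False
      then have "rho \<xi> z > 1" using rho_le_1[where \<xi>=\<xi> and z=z, OF \<xi>] by simp
      then have "{r. 0 < r \<and> r < 1 \<and> rho \<xi> z \<le> r} = {}" by auto
      then have "measure lborel {r. 0 < r \<and> r < 1 \<and> rho \<xi> z \<le> r} = 0" by (simp only: measure_empty)
      then show ?thesis using False by (simp only: scaleR_zero_left indicator_simps mult_zero_left if_False not_False_eq_True)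
    qed
    finally show "(\<integral>r. ?ind2 r z \<partial>lborel) = indicator (polydisc 1) z * of_real (1 - rho \<xi> z) * h z" .
  qed
  also have "\<dots> = (\<integral>z. (s + 1) * (of_real (?N z) powr s * of_real (indicator (polydisc 1) z * tm m z / ?N z ^ l) - of_real (?N z) powr s * of_real (indicator (polydisc 1) z * rho \<xi> z * tm m z / ?N z ^ l))
      + (s - of_nat l) * (\<Sum>a\<in>A. of_real (dt a \<xi> - 1) * (of_real (?N z) powr s * of_real (indicator (polydisc 1) z * (1 - rho \<xi> z) * tm m z * tm a z / ?N z ^ (l + 1)))) \<partial>lborel)"
  proof (intro Bochner_Integration.integral_cong refl)
    fix z :: "complex^'n"
    show "indicator (polydisc 1) z * of_real (1 - rho \<xi> z) * h z = (s + 1) * (of_real (?N z) powr s * of_real (indicator (polydisc 1) z * tm m z / ?N z ^ l) - of_real (?N z) powr s * of_real (indicator (polydisc 1) z * rho \<xi> z * tm m z / ?N z ^ l))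
      + (s - of_nat l) * (\<Sum>a\<in>A. of_real (dt a \<xi> - 1) * (of_real (?N z) powr s * of_real (indicator (polydisc 1) z * (1 - rho \<xi> z) * tm m z * tm a z / ?N z ^ (l + 1))))"
    proof (cases "z \<in> polydisc 1")
      case True
      have A1: "of_real (1 - rho \<xi> z) * (of_real (?N z) powr s * (\<Sum>a\<in>A. of_real (dt a \<xi> - 1) * of_real (tm m z * tm a z / ?N z ^ (l + 1))))
        = (\<Sum>a\<in>A. of_real (dt a \<xi> - 1) * (of_real (?N z) powr s * of_real ((1 - rho \<xi> z) * tm m z * tm a z / ?N z ^ (l + 1))))"
        unfolding sum_distrib_left by (intro sum.cong refl) simp
      have A2: "of_real (1 - rho \<xi> z) * (of_real (?N z) powr s * of_real (tm m z / ?N z ^ l)) = of_real (?N z) powr s * of_real (tm m z / ?N z ^ l) - of_real (?N z) powr s * of_real (rho \<xi> z * tm m z / ?N z ^ l)"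
        by (simp add: algebra_simps diff_divide_distrib)
      have alg: "k * (p * (u * T + v * S)) = u * (k * (p * T)) + v * (k * (p * S))" for k p u v T S :: complex
        by (simp add: algebra_simps)
      have i1: "indicator (polydisc 1) z = (1 :: complex)" "indicator (polydisc 1) z = (1 :: real)" using True by simp_all
      show ?thesis unfolding h_def i1 mult_1 alg A1 A2 ..
    qed simp
  qed
  also have "\<dots> = (s + 1) * ((\<integral>z. of_real (?N z) powr s * of_real (indicator (polydisc 1) z * tm m z / ?N z ^ l) \<partial>lborel) - (\<integral>z. of_real (?N z) powr s * of_real (indicator (polydisc 1) z * rho \<xi> z * tm m z / ?N z ^ l) \<partial>lborel))
      + (s - of_nat l) * (\<Sum>a\<in>A. of_real (dt a \<xi> - 1) * (\<integral>z. of_real (?N z) powr s * of_real (indicator (polydisc 1) z * (1 - rho \<xi> z) * tm m z * tm a z / ?N z ^ (l + 1)) \<partial>lborel))"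
  proof -
    have int: "integrable lborel (\<lambda>z. of_real (?N z) powr s * of_real (indicator (polydisc 1) z * v z / ?N z ^ j))"
      if [measurable]: "v \<in> borel_measurable borel" and v: "\<And>z. z \<in> polydisc 1 \<Longrightarrow> 0 \<le> v z \<and> v z \<le> 1" and j: "j \<le> l + 1" for v j
    proof (rule integrableI_bounded_set[where A="polydisc 1" and B=D])
      show "AE z in lborel. z \<in> polydisc 1 \<longrightarrow> norm (of_real (?N z) powr s * of_real (indicator (polydisc 1) z * v z / ?N z ^ j)) \<le> D"
      proof (intro AE_I2 impI)
        fix z :: "complex^'n" assume z: "z \<in> polydisc 1"
        have "cmod (of_real (?N z) powr s * of_real (indicator (polydisc 1) z * v z / ?N z ^ j)) = v z * (cmod (of_real (?N z) powr s) / ?N z ^ j)"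
          using z v[OF z] normsqA_nonneg[of A z] by (simp add: norm_mult norm_divide norm_power)
        also have "\<dots> \<le> 1 * D" using v[OF z] NB[OF z j] normsqA_nonneg[of A z] by (intro mult_mono) auto
        finally show "norm (of_real (?N z) powr s * of_real (indicator (polydisc 1) z * v z / ?N z ^ j)) \<le> D" by simp
      qed
    qed (use emeasure_polydisc_finite[of 1] in auto)
    have rz: "0 \<le> rho \<xi> z \<and> rho \<xi> z \<le> 1" if "z \<in> polydisc 1" for z using that rho_nonneg rho_le_1[where \<xi>=\<xi>, OF \<xi>] by auto
    have i0: "integrable lborel (\<lambda>z. of_real (?N z) powr s * of_real (indicator (polydisc 1) z * tm m z / ?N z ^ l))"
      by (rule int) (auto simp: tm_nonneg tm_le_1)
    have i1: "integrable lborel (\<lambda>z. of_real (?N z) powr s * of_real (indicator (polydisc 1) z * rho \<xi> z * tm m z / ?N z ^ l))"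
      using int[of "\<lambda>z. rho \<xi> z * tm m z" l] rz tm_le_1 by (simp add: tm_nonneg mult_le_one mult.assoc)
    have i2: "integrable lborel (\<lambda>z. of_real (?N z) powr s * of_real (indicator (polydisc 1) z * (1 - rho \<xi> z) * tm m z * tm a z / ?N z ^ (l + 1)))" for a
      using int[of "\<lambda>z. (1 - rho \<xi> z) * tm m z * tm a z" "l + 1"] rz tm_le_1 by (simp add: tm_nonneg mult_le_one mult.assoc)
    show ?thesis using i0 i1 i2 by (simp only: Bochner_Integration.integral_add Bochner_Integration.integral_diff Bochner_Integration.integral_sum
      integrable_mult_right Bochner_Integration.integrable_diff Bochner_Integration.integrable_sum integral_mult_right_zero)
  qed
  finally show ?thesis by (simp add: algebra_simps)
qed

section \<open>Positivity of the essential terms\<close>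

lemma dt_axis_scale: "dt a (\<lambda>i. x i / M) = dt a x / M"
  by (simp add: dt_def sum_divide_distrib)

lemma tm_powr:
  assumes "\<And>i. z$i \<noteq> 0"
  shows "tm m z = (\<Prod>i\<in>UNIV. cmod (z$i) powr (2 * (real (m i) + 1) - 2))"
  unfolding tm_def
proof (intro prod.cong refl)
  fix i
  have "cmod (z$i) powr (2 * (real (m i) + 1) - 2) = cmod (z$i) powr real (2 * m i)" by simp
  also have "\<dots> = cmod (z$i) ^ (2 * m i)" using assms[of i] by (subst powr_realpow) auto
  finally show "((cmod (z$i))^2) ^ m i = cmod (z$i) powr (2 * (real (m i) + 1) - 2)" by (simp add: power_mult)
qed

lemma integrable_smaller_exponent:
  fixes g :: "complex^'n \<Rightarrow> complex"
  assumes [measurable]: "g \<in> borel_measurable borel" and supp: "\<And>z. z \<notin> polydisc R \<Longrightarrow> g z = 0" and R: "R \<ge> 1"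
    and int: "integrable lborel (\<lambda>z. normsqA A z powr (- e) * cmod (g z))" and le: "e' \<le> e"
  shows "integrable lborel (\<lambda>z. of_real (normsqA A z) powr (of_real (- e')) * g z)"
    and "integrable lborel (\<lambda>z. normsqA A z powr (- e') * cmod (g z))"
proof -
  obtain C where C: "\<And>z. z \<in> polydisc R \<Longrightarrow> normsqA A z \<le> C" using normsqA_bounded[OF R] by blast
  show 1: "integrable lborel (\<lambda>z. of_real (normsqA A z) powr (of_real (- e')) * g z)"
    by (rule integrable_powr_mult[OF _ _ normsqA_nonneg _ int, where C=C]) (use C supp le in auto)
  have nrm: "cmod (of_real (normsqA A z) powr (of_real (- e'))) = normsqA A z powr (- e')" for z
    by (subst norm_powr_real_powr) (use normsqA_nonneg in auto)
  from integrable_norm[OF 1] show "integrable lborel (\<lambda>z. normsqA A z powr (- e') * cmod (g z))"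
    by (simp only: norm_mult nrm)
qed

lemma acv_decay:
  fixes h :: "complex^'n \<Rightarrow> complex"
  assumes [measurable]: "h \<in> borel_measurable borel" and supp: "\<And>z. z \<notin> polydisc R \<Longrightarrow> h z = 0" and R: "R \<ge> 1"
    and e: "e > 0" and int: "integrable lborel (\<lambda>z. normsqA A z powr (- e) * cmod (h z))"
  shows "acv (\<lambda>s. \<integral>z. of_real (normsqA A z) powr s * h z \<partial>lborel) (\<integral>z. of_real (normsqA A z) powr 0 * h z \<partial>lborel)"
proof -
  obtain C where C: "\<And>z. z \<in> polydisc R \<Longrightarrow> normsqA A z \<le> C" using normsqA_bounded[OF R] by blast
  show ?thesis
    by (rule acv_integral_powr[OF _ _ normsqA_nonneg _ e int, where C=C]) (use C supp in auto)
qed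

text \<open>The Euler identity trades the borderline integral for one with the factor
  \<open>rho\<close> and, for each \<open>a\<close> with \<open>dt a \<xi> \<noteq> 1\<close>, one
  with the factor \<open>tm a\<close>. \<open>st1\<close> and \<open>st2\<close> are the strict
  decay conditions for these, and at \<open>s = 0\<close> all weights are nonnegative.\<close>

lemma piece_nondecay:
  fixes \<xi> :: "'n \<Rightarrow> real" and m :: "'n \<Rightarrow> nat" and l :: nat
  assumes \<xi>: "\<And>i. \<xi> i > 0" and q1: "\<And>a. a \<in> A \<Longrightarrow> dt a \<xi> \<ge> 1"
    and l: "dt m \<xi> + (\<Sum>i\<in>UNIV. \<xi> i) = real l" and l1: "l \<ge> 1"
    and st1: "\<And>i x. (\<And>i. x i \<le> 0) \<Longrightarrow> (\<exists>i. x i \<noteq> 0) \<Longrightarrow> \<exists>a\<in>A. (\<Sum>j\<in>UNIV. (real (m j) + 1) * x j) + x i / \<xi> i < real l * dt a x"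
    and st2: "\<And>a x. a \<in> A \<Longrightarrow> dt a \<xi> \<noteq> 1 \<Longrightarrow> (\<And>i. x i \<le> 0) \<Longrightarrow> (\<exists>i. x i \<noteq> 0) \<Longrightarrow> \<exists>a'\<in>A. (\<Sum>j\<in>UNIV. (real (m j) + 1) * x j) + dt a x < real (l + 1) * dt a' x"
  shows "\<exists>Q>0. acv (\<lambda>s. s * (\<integral>z. of_real (normsqA A z) powr s * of_real (indicator (polydisc 1) z * tm m z / normsqA A z ^ l) \<partial>lborel)) (of_real Q)"
proof -
  let ?N = "normsqA A"
  define h1 where "h1 z = indicator (polydisc 1) z * rho \<xi> z * tm m z / ?N z ^ l" for z
  define h2 where "h2 a z = indicator (polydisc 1) z * (1 - rho \<xi> z) * tm m z * tm a z / ?N z ^ (l + 1)" for a z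
  have [measurable]: "h1 \<in> borel_measurable borel" "h2 a \<in> borel_measurable borel" for a
    unfolding h1_def[abs_def] h2_def[abs_def] by measurable
  have rz: "0 \<le> rho \<xi> z \<and> rho \<xi> z \<le> 1" if "z \<in> polydisc 1" for z using that rho_nonneg rho_le_1[where \<xi>=\<xi>, OF \<xi>] by auto
  have h10: "h1 z \<ge> 0" for z
    unfolding h1_def by (intro divide_nonneg_nonneg mult_nonneg_nonneg rho_nonneg tm_nonneg zero_le_power normsqA_nonneg) simp
  have h20: "h2 a z \<ge> 0" for a z
    unfolding h2_def using rz[of z]
    by (cases "z \<in> polydisc 1") (auto intro!: divide_nonneg_nonneg mult_nonneg_nonneg tm_nonneg zero_le_power normsqA_nonneg simp del: power_Suc)
  have Npow: "?N z powr (- real j) = 1 / ?N z ^ j" if "?N z > 0" for z j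
    using that by (simp add: powr_minus_divide powr_realpow)
  \<comment> \<open>\<open>rho\<close> is a maximum, hence at most the sum of its entries; each
    entry is a real power of one coordinate and merely shifts one exponent by
    \<open>1 / \<xi> i\<close>.\<close>
  define g where "g i z = indicator (polydisc 1) z * ((cmod (z$i))^2) powr (1 / \<xi> i) * tm m z / ?N z ^ l" for i z
  have gm [measurable]: "g i \<in> borel_measurable borel" for i unfolding g_def[abs_def] by measurable
  have g0: "g i z \<ge> 0" for i z
    unfolding g_def by (intro divide_nonneg_nonneg mult_nonneg_nonneg tm_nonneg zero_le_power normsqA_nonneg) simp_all
  have "\<exists>e>0. integrable lborel (\<lambda>z. ?N z powr (- e) * cmod (of_real (g i z)))" for i
  proof (rule decay_integrable[where u="\<lambda>j. real (m j) + 1 + (if j = i then 1 / \<xi> i else 0)" and l="real l" and C=1])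
    fix x :: "'n \<Rightarrow> real" assume "\<And>i. x i \<le> 0" "\<exists>i. x i \<noteq> 0"
    from st1[OF this, of i] show "\<exists>a\<in>A. (\<Sum>j\<in>UNIV. (real (m j) + 1 + (if j = i then 1 / \<xi> i else 0)) * x j) < real l * dt a x"
    proof -
      have "(\<Sum>j\<in>UNIV. (real (m j) + 1 + (if j = i then 1 / \<xi> i else 0)) * x j) = (\<Sum>j\<in>UNIV. (real (m j) + 1) * x j + (if j = i then x i / \<xi> i else 0))"
        by (intro sum.cong refl) (simp add: distrib_right)
      also have "\<dots> = (\<Sum>j\<in>UNIV. (real (m j) + 1) * x j) + x i / \<xi> i" by (simp add: sum.distrib)
      finally show ?thesis using st1[OF \<open>\<And>i. x i \<le> 0\<close> \<open>\<exists>i. x i \<noteq> 0\<close>, of i] by simp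
    qed
  next
    fix z :: "complex^'n" assume z: "\<And>i. z$i \<noteq> 0"
    have N: "?N z > 0" using normsqA_pos z by blast
    have pw: "((cmod (z$i))^2) powr (1 / \<xi> i) = (\<Prod>j\<in>UNIV. if j = i then cmod (z$i) powr (2 * (1 / \<xi> i)) else 1)"
    proof -
      have "(cmod (z$i))^2 = cmod (z$i) powr 2" using z by simp
      then have "((cmod (z$i))^2) powr (1 / \<xi> i) = cmod (z$i) powr (2 * (1 / \<xi> i))" by (simp only: powr_powr)
      then show ?thesis by simp
    qed
    have "((cmod (z$i))^2) powr (1 / \<xi> i) * tm m z = (\<Prod>j\<in>UNIV. cmod (z$j) powr (2 * (real (m j) + 1 + (if j = i then 1 / \<xi> i else 0)) - 2))"
      unfolding pw tm_powr[OF z] prod.distrib[symmetric] using z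
      by (intro prod.cong refl) (simp add: powr_add[symmetric] algebra_simps)
    then show "cmod (of_real (g i z)) \<le> 1 * (indicator (polydisc 1) z * ?N z powr (- real l) * (\<Prod>j\<in>UNIV. cmod (z$j) powr (2 * (real (m j) + 1 + (if j = i then 1 / \<xi> i else 0)) - 2)))"
    proof -
      assume e: "((cmod (z$i))^2) powr (1 / \<xi> i) * tm m z = (\<Prod>j\<in>UNIV. cmod (z$j) powr (2 * (real (m j) + 1 + (if j = i then 1 / \<xi> i else 0)) - 2))"
      have "g i z = indicator (polydisc 1) z * (1 / ?N z ^ l) * (((cmod (z$i))^2) powr (1 / \<xi> i) * tm m z)"
        by (simp add: g_def)
      then show ?thesis unfolding e Npow[OF N] norm_of_real abs_of_nonneg[OF g0] by simp
    qed
  qed simp_all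
  then have "\<forall>i. \<exists>e. e > 0 \<and> integrable lborel (\<lambda>z. ?N z powr (- e) * cmod (of_real (g i z)))" by blast
  then obtain e where e: "\<And>i. e i > 0" "\<And>i. integrable lborel (\<lambda>z. ?N z powr (- e i) * cmod (of_real (g i z)))"
    unfolding choice_iff by blast
  define e0 where "e0 = Min (range e)"
  have e0: "e0 > 0" "\<And>i. e0 \<le> e i" using e(1) by (auto simp: e0_def)
  have int1: "integrable lborel (\<lambda>z. ?N z powr (- e0) * cmod (of_real (h1 z)))"
  proof (rule Bochner_Integration.integrable_bound)
    show "integrable lborel (\<lambda>z. \<Sum>i\<in>UNIV. ?N z powr (- e0) * cmod (of_real (g i z)))"
      by (intro Bochner_Integration.integrable_sum integrable_smaller_exponent(2)[OF _ _ _ e(2) e0(2), where R=1]) (auto simp: g_def)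
    show "AE z in lborel. norm (?N z powr (- e0) * cmod (of_real (h1 z))) \<le> norm (\<Sum>i\<in>UNIV. ?N z powr (- e0) * cmod (of_real (g i z)))"
    proof (rule AE_I2)
      fix z
      have "h1 z = (indicator (polydisc 1) z * tm m z / ?N z ^ l) * rho \<xi> z" by (simp add: h1_def)
      also have "\<dots> \<le> (indicator (polydisc 1) z * tm m z / ?N z ^ l) * (\<Sum>i\<in>UNIV. ((cmod (z$i))^2) powr (1 / \<xi> i))"
        by (intro mult_left_mono rho_le_sum divide_nonneg_nonneg mult_nonneg_nonneg tm_nonneg zero_le_power normsqA_nonneg) simp
      also have "\<dots> = (\<Sum>i\<in>UNIV. g i z)" by (simp add: g_def sum_distrib_left mult_ac)
      finally have "?N z powr (- e0) * h1 z \<le> ?N z powr (- e0) * (\<Sum>i\<in>UNIV. g i z)" by (intro mult_left_mono) auto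
      then have "?N z powr (- e0) * h1 z \<le> (\<Sum>i\<in>UNIV. ?N z powr (- e0) * g i z)" by (simp add: sum_distrib_left)
      then show "norm (?N z powr (- e0) * cmod (of_real (h1 z))) \<le> norm (\<Sum>i\<in>UNIV. ?N z powr (- e0) * cmod (of_real (g i z)))"
        using h10[of z] g0 by (simp add: sum_nonneg)
    qed
  qed measurable
  \<comment> \<open>At a zero of the norm both sides are 0: \<open>powr 0\<close> by convention,
    \<open>h1\<close> and \<open>h2\<close> through division by 0, where \<open>l \<ge> 1\<close>
    makes the denominator of \<open>h1\<close> vanish.\<close>
  have p0: "of_real (?N z) powr 0 * of_real (h1 z) = (of_real (h1 z) :: complex)" "of_real (?N z) powr 0 * of_real (h2 a z) = (of_real (h2 a z) :: complex)" for z a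
    using l1 by (auto simp: h1_def h2_def)
  have acv1: "acv (\<lambda>s. \<integral>z. of_real (?N z) powr s * of_real (h1 z) \<partial>lborel) (of_real (\<integral>z. h1 z \<partial>lborel))"
  proof -
    have "acv (\<lambda>s. \<integral>z. of_real (?N z) powr s * of_real (h1 z) \<partial>lborel) (\<integral>z. of_real (?N z) powr 0 * of_real (h1 z) \<partial>lborel)"
      by (rule acv_decay[OF _ _ _ e0(1) int1, where R=1]) (measurable, auto simp: h1_def)
    then show ?thesis unfolding p0 by (simp only: integral_complex_of_real)
  qed
  have inth1: "integrable lborel h1"
  proof -
    have "integrable lborel (\<lambda>z. of_real (?N z) powr (of_real (- 0)) * of_real (h1 z) :: complex)"
      by (rule integrable_smaller_exponent(1)[OF _ _ _ int1 less_imp_le[OF e0(1)], where R=1]) (measurable, auto simp: h1_def)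
    then have "integrable lborel (\<lambda>z. of_real (h1 z) :: complex)" unfolding minus_zero of_real_0 p0 .
    from integrable_Re[OF this] show ?thesis by simp
  qed
  have pos1: "(\<integral>z. h1 z \<partial>lborel) > 0"
  proof -
    have "(\<integral>z. h1 z \<partial>lborel) \<ge> 0" using h10 by (simp add: integral_nonneg)
    moreover have "(\<integral>z. h1 z \<partial>lborel) \<noteq> 0"
    proof
      assume "(\<integral>z. h1 z \<partial>lborel) = 0"
      then have "AE z in lborel. h1 z = 0"
        using integral_nonneg_eq_0_iff_AE[OF inth1] h10 by simp
      then have "AE z in lborel. z \<notin> (polydisc 1 :: (complex^'n) set)"
        using AE_nonzero
      proof eventually_elim
        case (elim z)
        have "?N z > 0" "tm m z > 0" using normsqA_pos elim by (auto simp: tm_def intro!: prod_pos)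
        moreover have "rho \<xi> z > 0" using elim rho_pos by blast
        ultimately show ?case using elim(1) by (auto simp: h1_def)
      qed
      then have "emeasure lborel (polydisc 1 :: (complex^'n) set) = 0"
        by (subst (asm) AE_iff_measurable[OF _ refl]) auto
      then show False using emeasure_polydisc_pos[where 'n='n] by simp
    qed
    ultimately show ?thesis by simp
  qed
  have acv2: "acv (\<lambda>s. of_real (dt a \<xi> - 1) * (\<integral>z. of_real (?N z) powr s * of_real (h2 a z) \<partial>lborel)) (of_real ((dt a \<xi> - 1) * (\<integral>z. h2 a z \<partial>lborel)))"
    if a: "a \<in> A" for a
  proof (cases "dt a \<xi> = 1")
    case True
    then show ?thesis by (simp add: acv_zero)
  next
    case False
    have "\<exists>e>0. integrable lborel (\<lambda>z. ?N z powr (- e) * cmod (of_real (h2 a z)))"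
    proof (rule decay_integrable[where u="\<lambda>j. real (m j) + 1 + real (a j)" and l="real (l + 1)" and C=1])
      fix x :: "'n \<Rightarrow> real" assume x: "\<And>i. x i \<le> 0" "\<exists>i. x i \<noteq> 0"
      have "(\<Sum>j\<in>UNIV. (real (m j) + 1 + real (a j)) * x j) = (\<Sum>j\<in>UNIV. (real (m j) + 1) * x j) + dt a x"
        by (simp add: dt_def distrib_right sum.distrib)
      then show "\<exists>a'\<in>A. (\<Sum>j\<in>UNIV. (real (m j) + 1 + real (a j)) * x j) < real (l + 1) * dt a' x"
        using st2[OF a False x] by simp
    next
      fix z :: "complex^'n" assume z: "\<And>i. z$i \<noteq> 0"
      have N: "?N z > 0" using normsqA_pos z by blast
      have "tm m z * tm a z = (\<Prod>j\<in>UNIV. cmod (z$j) powr (2 * (real (m j) + 1 + real (a j)) - 2))"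
      proof -
        have "tm m z * tm a z = tm (\<lambda>j. m j + a j) z" by (simp add: tm_def power_add prod.distrib)
        then show ?thesis unfolding tm_powr[OF z] by (simp add: algebra_simps)
      qed
      moreover have "h2 a z \<le> indicator (polydisc 1) z * (tm m z * tm a z) / ?N z ^ (l + 1)"
      proof (cases "z \<in> polydisc 1")
        case True
        have "(1 - rho \<xi> z) * (tm m z * tm a z) \<le> 1 * (tm m z * tm a z)"
          using rz[OF True] tm_nonneg by (intro mult_right_mono) auto
        then show ?thesis using True N by (simp add: h2_def divide_right_mono mult.assoc)
      qed (simp add: h2_def)
      ultimately show "cmod (of_real (h2 a z)) \<le> 1 * (indicator (polydisc 1) z * ?N z powr (- real (l + 1)) * (\<Prod>j\<in>UNIV. cmod (z$j) powr (2 * (real (m j) + 1 + real (a j)) - 2)))"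
        using h20[of a z] unfolding Npow[OF N] norm_of_real by simp
    qed simp_all
    then obtain e' where e': "e' > 0" "integrable lborel (\<lambda>z. ?N z powr (- e') * cmod (of_real (h2 a z)))" by blast
    have "acv (\<lambda>s. \<integral>z. of_real (?N z) powr s * of_real (h2 a z) \<partial>lborel) (of_real (\<integral>z. h2 a z \<partial>lborel))"
    proof -
      have "acv (\<lambda>s. \<integral>z. of_real (?N z) powr s * of_real (h2 a z) \<partial>lborel) (\<integral>z. of_real (?N z) powr 0 * of_real (h2 a z) \<partial>lborel)"
        by (rule acv_decay[OF _ _ _ e', where R=1]) (measurable, auto simp: h2_def)
      then show ?thesis unfolding p0 by (simp only: integral_complex_of_real)
    qed
    then show ?thesis unfolding of_real_mult by (rule acv_cmult)
  qed
  \<comment> \<open>The right-hand side of the Euler identity at \<open>s = 0\<close>. The first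
    integral is positive, the others are nonnegative with weights
    \<open>dt a \<xi> - 1 \<ge> 0\<close>.\<close>
  define Q where "Q = (\<integral>z. h1 z \<partial>lborel) + real l * (\<Sum>a\<in>A. (dt a \<xi> - 1) * (\<integral>z. h2 a z \<partial>lborel))"
  have "Q > 0"
    unfolding Q_def using pos1 q1 h20
    by (intro add_pos_nonneg mult_nonneg_nonneg sum_nonneg integral_nonneg) auto
  have "acv (\<lambda>s. (s + 1) * (\<integral>z. of_real (?N z) powr s * of_real (h1 z) \<partial>lborel)
     + (of_nat l - s) * (\<Sum>a\<in>A. of_real (dt a \<xi> - 1) * (\<integral>z. of_real (?N z) powr s * of_real (h2 a z) \<partial>lborel)))
     ((0 + 1) * of_real (\<integral>z. h1 z \<partial>lborel) + (of_nat l - 0) * (\<Sum>a\<in>A. of_real ((dt a \<xi> - 1) * (\<integral>z. h2 a z \<partial>lborel))))"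
    by (intro acv_add acv_mult_entire[OF acv1, of "\<lambda>s. s + 1"] acv_mult_entire[where G="\<lambda>s. of_nat l - s"] acv_sum acv2 holomorphic_intros)
  also have "((0 + 1) * of_real (\<integral>z. h1 z \<partial>lborel) + (of_nat l - 0) * (\<Sum>a\<in>A. of_real ((dt a \<xi> - 1) * (\<integral>z. h2 a z \<partial>lborel)))) = (of_real Q :: complex)"
    unfolding Q_def by (simp only: of_real_add of_real_mult of_real_sum of_real_of_nat_eq add_0 mult_1 diff_zero)
  finally have "acv (\<lambda>s. s * (\<integral>z. of_real (normsqA A z) powr s * of_real (indicator (polydisc 1) z * tm m z / normsqA A z ^ l) \<partial>lborel)) (of_real Q)"
    by (rule acv_cong[where c="real l + 1"]) (simp only: euler_identity[where \<xi>=\<xi> and m=m, OF \<xi> q1 l] h1_def h2_def)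
  then show ?thesis using \<open>Q > 0\<close> by blast
qed

text \<open>If strict decay fails at \<open>x\<close>, a sum of \<open>card B + 1\<close> pairings,
  none above the maximum \<open>M\<close> over \<open>A\<close>, reaches
  \<open>(card B + 1) * M\<close> although the slack \<open>e\<close> can only lower it. So all
  pairings equal \<open>M\<close> and the slack vanishes termwise. For \<open>M < 0\<close> the pure
  powers force every entry of \<open>x\<close> to be negative; for \<open>M = 0\<close> the
  coordinates with \<open>x i \<noteq> 0\<close> do not occur in \<open>B\<close> or
  \<open>c\<close>.\<close>

lemma nonstrict_analysis:
  fixes B :: "('n \<Rightarrow> nat) set" and x :: "'n \<Rightarrow> real"
  assumes B: "B \<subseteq> A" and c: "c \<in> A" and x: "\<And>i. x i \<le> 0" "\<exists>i. x i \<noteq> 0" and e: "\<And>i. e i \<ge> 0"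
    and le: "\<And>a. a \<in> A \<Longrightarrow> (real (card B) + 1) * dt a x \<le> (\<Sum>b\<in>B. dt b x) + dt c x + (\<Sum>i\<in>UNIV. e i * x i)"
  obtains M where "M \<le> 0" "\<And>b. b \<in> B \<Longrightarrow> dt b x = M" "dt c x = M" "\<And>i. e i * x i = 0" "\<And>a. a \<in> A \<Longrightarrow> dt a x \<le> M"
    "M = 0 \<Longrightarrow> \<forall>b\<in>insert c B. \<forall>i. real (b i) * x i = 0" "M \<noteq> 0 \<Longrightarrow> \<forall>i. x i < 0"
proof -
  define M where "M = Max ((\<lambda>a. dt a x) ` A)"
  have ge: "dt a x \<le> M" if "a \<in> A" for a unfolding M_def using that finA by (intro Max_ge) auto
  have "M \<in> (\<lambda>a. dt a x) ` A" unfolding M_def using finA A_ne by (intro Max_in) auto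
  then obtain a0 where a0: "a0 \<in> A" "M = dt a0 x" by blast
  have finB: "finite B" using B finA finite_subset by blast
  have ex: "e i * x i \<le> 0" for i using e x(1) by (simp add: mult_nonneg_nonpos)
  have nonpos: "dt a x \<le> 0" for a unfolding dt_def using x(1) by (intro sum_nonpos) (simp add: mult_nonneg_nonpos)
  have S1: "(\<Sum>b\<in>B. M - dt b x) \<ge> 0" using ge B by (intro sum_nonneg) auto
  have S2: "(\<Sum>i\<in>UNIV. e i * x i) \<le> 0" using ex by (intro sum_nonpos) auto
  have "(real (card B) + 1) * M \<le> (\<Sum>b\<in>B. dt b x) + dt c x + (\<Sum>i\<in>UNIV. e i * x i)" using le[OF a0(1)] a0(2) by simp
  moreover have "(\<Sum>b\<in>B. M - dt b x) = real (card B) * M - (\<Sum>b\<in>B. dt b x)" by (simp add: sum_subtractf)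
  ultimately have eqs: "(\<Sum>b\<in>B. M - dt b x) = 0" "dt c x = M" "(\<Sum>i\<in>UNIV. e i * x i) = 0"
    using S1 S2 ge[OF c] by (simp_all add: distrib_right)
  have b: "dt b x = M" if "b \<in> B" for b
  proof -
    have "M - dt b x = 0" by (rule sum_nonneg_0[OF finB _ eqs(1) that]) (use ge B in auto)
    then show ?thesis by simp
  qed
  have ez: "e i * x i = 0" for i
    using sum_nonneg_0[of UNIV "\<lambda>i. - (e i * x i)" i] eqs(3) ex by (simp add: sum_negf)
  have z: "\<forall>b\<in>insert c B. \<forall>i. real (b i) * x i = 0" if "M = 0"
  proof (intro ballI allI)
    fix b' i assume "b' \<in> insert c B"
    then have "(\<Sum>i\<in>UNIV. real (b' i) * x i) = 0" using b eqs(2) that by (auto simp: dt_def)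
    then show "real (b' i) * x i = 0"
      using sum_nonneg_0[of UNIV "\<lambda>i. - (real (b' i) * x i)" i] x(1) by (simp add: mult_nonneg_nonpos sum_negf)
  qed
  have M0: "M \<le> 0" using nonpos a0 by simp
  have neg: "\<forall>i. x i < 0" if "M \<noteq> 0"
  proof
    fix i
    obtain a where a: "a \<in> A" "a i > 0" "\<forall>j. j \<noteq> i \<longrightarrow> a j = 0" using ax by blast
    have "dt a x = (\<Sum>j\<in>UNIV. if j = i then real (a i) * x i else 0)" unfolding dt_def using a(3) by (intro sum.cong) auto
    then have "real (a i) * x i \<le> M" using ge[OF a(1)] by simp
    then have "real (a i) * x i < 0" using M0 that by linarith
    then show "x i < 0" by (simp add: mult_less_0_iff)
  qed
  show ?thesis by (rule that[OF M0 b eqs(2) ez ge z neg])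
qed

lemma xi_pos:
  assumes "\<And>a. a \<in> A \<Longrightarrow> dt a \<xi> \<ge> 1"
  shows "\<xi> i > 0"
proof -
  obtain a where a: "a \<in> A" "a i > 0" "\<forall>j. j \<noteq> i \<longrightarrow> a j = 0" using ax by blast
  have "dt a \<xi> = (\<Sum>j\<in>UNIV. if j = i then real (a i) * \<xi> i else 0)" unfolding dt_def using a(3) by (intro sum.cong) auto
  then have "real (a i) * \<xi> i > 0" using assms[OF a(1)] by simp
  then show ?thesis using a(2) by (simp add: zero_less_mult_iff)
qed

lemma nondeg_alphaB_pos:
  assumes "nondeg B" "finite B"
  shows "alphaB B i \<ge> 1"
proof (rule ccontr)
  assume "\<not> alphaB B i \<ge> 1"
  moreover have "b i \<le> alphaB B i" if "b \<in> B" for b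
    unfolding alphaB_def using assms(2) that by (intro member_le_sum) auto
  ultimately have "\<forall>b\<in>B. b i = 0" by fastforce
  then have "\<forall>b\<in>B. (\<Sum>j\<in>UNIV. real (b j) * (if j = i then 1 else 0)) = 0"
    by (intro ballI sum.neutral) auto
  from assms(1)[unfolded nondeg_def, rule_format, OF this[rule_format], of i] show False by simp
qed

lemma dt_alphaB: "(\<Sum>i\<in>UNIV. real (alphaB B i) * x i) = (\<Sum>b\<in>B. dt b x)"
  unfolding dt_def alphaB_def of_nat_sum sum_distrib_right by (rule sum.swap)

text \<open>Because of the Jacobian, \<open>tm\<close> with exponent \<open>\<alpha> + c - 1\<close>
  has logarithmic exponent \<open>\<alpha> + c\<close>, the sum of \<open>c\<close> and the elements
  of \<open>B\<close>; its value under \<open>\<xi>\<close> is exactly \<open>card B + 1\<close>,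
  the borderline. The subtraction is genuine because spanning gives \<open>\<alpha> \<ge> 1\<close>,
  and spanning also yields the two auxiliary decay conditions.\<close>

lemma piece_essential:
  fixes B :: "('n \<Rightarrow> nat) set" and \<xi> :: "'n \<Rightarrow> real"
  assumes B: "B \<subseteq> A" "nondeg B" and c: "c \<in> A" and \<xi>: "\<And>b. b \<in> B \<Longrightarrow> dt b \<xi> = 1" "dt c \<xi> = 1" "\<And>a. a \<in> A \<Longrightarrow> dt a \<xi> \<ge> 1"
  shows "\<exists>Q>0. acv (\<lambda>s. s * (\<integral>z. of_real (normsqA A z) powr s *
     of_real (indicator (polydisc 1) z * tm (\<lambda>i. alphaB B i + c i - 1) z / normsqA A z ^ (card B + 1)) \<partial>lborel)) (of_real Q)"
proof (rule piece_nondecay[where \<xi>=\<xi>])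
  have finB: "finite B" using B finA finite_subset by blast
  have al: "alphaB B i \<ge> 1" for i by (rule nondeg_alphaB_pos[OF B(2) finB])
  then have m: "real (alphaB B i + c i - 1) + 1 = real (alphaB B i) + real (c i)" for i by (simp add: of_nat_diff add_increasing2)
  show "\<xi> i > 0" for i using \<xi>(3) by (rule xi_pos)
  show "1 \<le> dt a \<xi>" if "a \<in> A" for a using \<xi>(3)[OF that] .
  have S: "(\<Sum>j\<in>UNIV. (real (alphaB B j + c j - 1) + 1) * x j) = (\<Sum>b\<in>B. dt b x) + dt c x" for x
    unfolding m distrib_right sum.distrib dt_alphaB by (simp add: dt_def)
  have "dt (\<lambda>i. alphaB B i + c i - 1) \<xi> + (\<Sum>i\<in>UNIV. \<xi> i) = (\<Sum>j\<in>UNIV. (real (alphaB B j + c j - 1) + 1) * \<xi> j)"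
    by (simp add: dt_def distrib_right sum.distrib)
  then show "dt (\<lambda>i. alphaB B i + c i - 1) \<xi> + (\<Sum>i\<in>UNIV. \<xi> i) = real (card B + 1)"
    unfolding S using \<xi> by simp
  \<comment> \<open>The slack is \<open>1 / \<xi> i\<close> at the single index \<open>i\<close>. It
    forces \<open>x i = 0\<close>, hence \<open>M = 0\<close>; every coordinate occurs in some
    element of \<open>B\<close>, so \<open>x\<close> would be 0.\<close>
  show "\<exists>a\<in>A. (\<Sum>j\<in>UNIV. (real (alphaB B j + c j - 1) + 1) * x j) + x i / \<xi> i < real (card B + 1) * dt a x"
    if x: "\<And>i. x i \<le> 0" "\<exists>i. x i \<noteq> 0" for i and x :: "'n \<Rightarrow> real"
  proof (rule ccontr)
    have xp: "\<xi> i > 0" using \<xi>(3) by (rule xi_pos)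
    assume neg: "\<not> ?thesis"
    have le: "(real (card B) + 1) * dt a x \<le> (\<Sum>b\<in>B. dt b x) + dt c x + (\<Sum>j\<in>UNIV. (if j = i then 1 / \<xi> i else 0) * x j)" if "a \<in> A" for a
    proof -
      have "(\<Sum>j\<in>UNIV. (if j = i then 1 / \<xi> i else 0) * x j) = (\<Sum>j\<in>UNIV. if j = i then x i / \<xi> i else 0)"
        by (intro sum.cong refl) simp
      then have e: "(\<Sum>j\<in>UNIV. (if j = i then 1 / \<xi> i else 0) * x j) = x i / \<xi> i" by simp
      have "\<not> (\<Sum>b\<in>B. dt b x) + dt c x + x i / \<xi> i < real (card B + 1) * dt a x"
        using neg that unfolding S by blast
      then show ?thesis unfolding e by (simp add: algebra_simps)
    qed
    have e0: "(if j = i then 1 / \<xi> i else 0) \<ge> 0" for j using xp by simp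
    obtain M where "M \<le> 0" "\<And>b. b \<in> B \<Longrightarrow> dt b x = M" "dt c x = M" and M1: "\<And>j. (if j = i then 1 / \<xi> i else 0) * x j = 0"
      and "\<And>a. a \<in> A \<Longrightarrow> dt a x \<le> M" and M2: "M = 0 \<Longrightarrow> \<forall>b\<in>insert c B. \<forall>i. real (b i) * x i = 0" and M3: "M \<noteq> 0 \<Longrightarrow> \<forall>i. x i < 0"
      by (rule nonstrict_analysis[OF B(1) c x e0 le], assumption) (rule that; assumption)
    note M = M1 M2 M3
    have "x i = 0" using M(1)[of i] xp by simp
    then have "M = 0" using M(3) by (metis less_irrefl)
    then have "real (b j) * x j = 0" if "b \<in> B" for b j using M(2) that by blast
    then have "real (alphaB B j) * x j = 0" for j unfolding alphaB_def of_nat_sum sum_distrib_right by (intro sum.neutral) auto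
    then have "x j = 0" for j using al[of j] by (metis mult_eq_0_iff not_one_le_zero of_nat_eq_0_iff)
    then show False using x(2) by blast
  qed
  \<comment> \<open>Now \<open>card B + 2\<close> pairings reach the maximum \<open>M\<close>, that
    of \<open>a\<close> included. As \<open>B\<close> spans, \<open>x\<close> equals
    \<open>M * \<xi>\<close> with \<open>M \<noteq> 0\<close>, so the pairing with \<open>a\<close>
    is \<open>M * dt a \<xi>\<close>, against \<open>dt a \<xi> \<noteq> 1\<close>.\<close>
  show "\<exists>a'\<in>A. (\<Sum>j\<in>UNIV. (real (alphaB B j + c j - 1) + 1) * x j) + dt a x < real (card B + 1 + 1) * dt a' x"
    if a: "a \<in> A" "dt a \<xi> \<noteq> 1" and x: "\<And>i. x i \<le> 0" "\<exists>i. x i \<noteq> 0" for a and x :: "'n \<Rightarrow> real"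
  proof (rule ccontr)
    assume neg: "\<not> ?thesis"
    have le: "(real (card B) + 2) * dt a' x \<le> (\<Sum>b\<in>B. dt b x) + dt c x + dt a x" if "a' \<in> A" for a'
    proof -
      have "\<not> (\<Sum>b\<in>B. dt b x) + dt c x + dt a x < real (card B + 1 + 1) * dt a' x"
        using neg that unfolding S by blast
      then show ?thesis by (simp add: algebra_simps)
    qed
    define M where "M = Max ((\<lambda>a. dt a x) ` A)"
    have ge: "dt a x \<le> M" if "a \<in> A" for a unfolding M_def using that finA by (intro Max_ge) auto
    have "M \<in> (\<lambda>a. dt a x) ` A" unfolding M_def using finA A_ne by (intro Max_in) auto
    then obtain a0 where a0: "a0 \<in> A" "M = dt a0 x" by blast
    have S1: "(\<Sum>b\<in>B. M - dt b x) \<ge> 0" using ge B by (intro sum_nonneg) auto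
    have "(real (card B) + 2) * M \<le> (\<Sum>b\<in>B. dt b x) + dt c x + dt a x" using le[OF a0(1)] a0(2) by simp
    moreover have "(\<Sum>b\<in>B. M - dt b x) = real (card B) * M - (\<Sum>b\<in>B. dt b x)" by (simp add: sum_subtractf)
    ultimately have eqs: "(\<Sum>b\<in>B. M - dt b x) = 0" "dt a x = M"
      using S1 ge[OF c] ge[OF a(1)] by (simp_all add: distrib_right)
    have b: "dt b x = M" if "b \<in> B" for b
    proof -
    have "M - dt b x = 0" by (rule sum_nonneg_0[OF finB _ eqs(1) that]) (use ge B in auto)
    then show ?thesis by simp
  qed
    have "\<forall>b\<in>B. (\<Sum>i\<in>UNIV. real (b i) * (x i - M * \<xi> i)) = 0"
    proof
      fix b' assume b': "b' \<in> B"
      have "(\<Sum>i\<in>UNIV. real (b' i) * (x i - M * \<xi> i)) = dt b' x - M * dt b' \<xi>"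
        unfolding dt_def sum_distrib_left sum_subtractf[symmetric] by (intro sum.cong refl) (simp add: algebra_simps)
      then show "(\<Sum>i\<in>UNIV. real (b' i) * (x i - M * \<xi> i)) = 0" using b[OF b'] \<xi>(1)[OF b'] by simp
    qed
    from B(2)[unfolded nondeg_def, rule_format, OF this[rule_format]] have xM: "x i = M * \<xi> i" for i by simp
    then have "dt a x = M * dt a \<xi>" unfolding dt_def sum_distrib_left by (intro sum.cong refl) simp
    moreover have "M \<noteq> 0" using xM x(2) by auto
    ultimately show False using eqs(2) a(2) by simp
  qed
qed simp

end

section \<open>Monomial terms of the residue\<close>

text \<open>Off \<open>p\<close> the derivative is the limit of difference quotients with steps
  \<open>1 / (k + 1)\<close>. In the application \<open>p\<close> is the origin, where a power of
  the norm need not be differentiable.\<close>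

lemma measurable_frechet_off_point:
  fixes f :: "complex^'n::finite \<Rightarrow> complex"
  assumes [measurable]: "f \<in> borel_measurable borel" and d: "\<And>z. z \<noteq> p \<Longrightarrow> f differentiable (at z)"
  shows "(\<lambda>z. frechet_derivative f (at z) v) \<in> borel_measurable borel"
proof -
  define q where "q k z = (if z = p then frechet_derivative f (at p) v else (f (z + (1 / real (Suc k)) *\<^sub>R v) - f z) /\<^sub>R (1 / real (Suc k)))" for k z
  have [measurable]: "{p} \<in> sets borel" by simp
  have [measurable]: "(\<lambda>z. f (z + (1 / real (Suc k)) *\<^sub>R v)) \<in> borel_measurable borel" for k
    by (rule measurable_compose[OF _ assms(1)]) measurable
  have [measurable]: "Measurable.pred borel (\<lambda>z. z = p)"
    unfolding pred_def by simp
  have qm: "q k \<in> borel_measurable borel" for k unfolding q_def[abs_def] by measurable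
  have ql: "(\<lambda>k. q k z) \<longlonglongrightarrow> frechet_derivative f (at z) v" for z
  proof (cases "z = p")
    case False
    have D: "(f has_derivative frechet_derivative f (at z)) (at z)" using d[OF False] frechet_derivative_works by blast
    interpret L: bounded_linear "frechet_derivative f (at z)" using D by (rule has_derivative_bounded_linear)
    have "((\<lambda>t. z + t *\<^sub>R v) has_derivative (\<lambda>t. t *\<^sub>R v)) (at (0::real))"
      by (auto intro!: derivative_eq_intros)
    then have "((\<lambda>t. f (z + t *\<^sub>R v)) has_derivative (\<lambda>t. frechet_derivative f (at z) (t *\<^sub>R v))) (at 0)"
      using has_derivative_compose[of "\<lambda>t. z + t *\<^sub>R v" "\<lambda>t. t *\<^sub>R v" 0 UNIV f "frechet_derivative f (at z)"] D by simp
    then have "((\<lambda>t. f (z + t *\<^sub>R v)) has_vector_derivative frechet_derivative f (at z) v) (at 0)"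
      unfolding has_vector_derivative_def L.scaleR .
    then have "((\<lambda>t. (f (z + t *\<^sub>R v) - f z) /\<^sub>R t) \<longlongrightarrow> frechet_derivative f (at z) v) (at 0)"
    proof -
      assume "((\<lambda>t. f (z + t *\<^sub>R v)) has_vector_derivative frechet_derivative f (at z) v) (at 0)"
      then have lim: "((\<lambda>t. norm (f (z + t *\<^sub>R v) - f z - t *\<^sub>R frechet_derivative f (at z) v) / norm t) \<longlongrightarrow> 0) (at 0)"
        unfolding has_vector_derivative_def has_derivative_at by simp
      have eq: "norm (f (z + t *\<^sub>R v) - f z - t *\<^sub>R frechet_derivative f (at z) v) / norm t
          = norm ((f (z + t *\<^sub>R v) - f z) /\<^sub>R t - frechet_derivative f (at z) v)" if "t \<noteq> 0" for t
      proof -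
        have "f (z + t *\<^sub>R v) - f z - t *\<^sub>R frechet_derivative f (at z) v = t *\<^sub>R ((f (z + t *\<^sub>R v) - f z) /\<^sub>R t - frechet_derivative f (at z) v)"
          using that by (simp add: scaleR_right_diff_distrib)
        then show ?thesis using that by simp
      qed
      have "((\<lambda>t. norm ((f (z + t *\<^sub>R v) - f z) /\<^sub>R t - frechet_derivative f (at z) v)) \<longlongrightarrow> 0) (at 0)"
        by (rule Lim_transform_eventually[OF lim]) (rule eventually_mono[OF eventually_neq_at_within[of 0]], rule eq)
      then show ?thesis by (rule LIM_zero_cancel[OF tendsto_norm_zero_cancel])
    qed
    moreover have "filterlim (\<lambda>k. 1 / real (Suc k)) (at 0) sequentially"
      using LIMSEQ_Suc[OF lim_1_over_n] by (simp add: filterlim_at)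
    ultimately have "(\<lambda>k. (f (z + (1 / real (Suc k)) *\<^sub>R v) - f z) /\<^sub>R (1 / real (Suc k))) \<longlonglongrightarrow> frechet_derivative f (at z) v"
      by (rule filterlim_compose)
    then show ?thesis using False by (simp add: q_def)
  qed (simp add: q_def)
  show ?thesis by (rule borel_measurable_LIMSEQ_metric[OF qm ql])
qed

lemma measurable_wirt:
  fixes f :: "complex^'n::finite \<Rightarrow> complex"
  assumes "f \<in> borel_measurable borel" "\<And>z. z \<noteq> p \<Longrightarrow> f differentiable (at z)"
  shows "wirt i f \<in> borel_measurable borel"
proof -
  note [measurable] = measurable_frechet_off_point[OF assms]
  show ?thesis unfolding wirt_def[abs_def] by measurable
qed

lemma measurable_wedge:
  assumes [measurable]: "\<And>U. (\<lambda>z. F z U) \<in> borel_measurable borel" "\<And>U. (\<lambda>z. G z U) \<in> borel_measurable borel"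
  shows "(\<lambda>z. wedge oN oA (F z) (G z) U) \<in> borel_measurable borel"
  unfolding wedge_def by measurable

lemma measurable_mono: "f \<in> borel_measurable borel \<Longrightarrow> (\<lambda>z. mono S (f z) U) \<in> borel_measurable borel"
  unfolding mono_def by simp

lemma measurable_wpow:
  assumes "\<And>U. (\<lambda>z. F z U) \<in> borel_measurable borel"
  shows "(\<lambda>z. wpow oN oA (F z) k U) \<in> borel_measurable borel"
proof (induction k arbitrary: U)
  case 0
  show ?case by (simp add: measurable_mono)
next
  case (Suc k)
  show ?case unfolding wpow.simps by (intro measurable_wedge assms Suc)
qed

lemma measurable_dbarF:
  assumes "\<And>U. (\<lambda>z. F z U) \<in> borel_measurable borel" "\<And>U z. z \<noteq> p \<Longrightarrow> (\<lambda>z. F z U) differentiable (at z)"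
  shows "(\<lambda>z. dbarF oN oA F z U) \<in> borel_measurable borel"
  unfolding dbarF_def by (intro borel_measurable_sum measurable_wedge measurable_mono borel_measurable_const measurable_wirt[where p=p] assms)

lemma zbmon_differentiable: "zbmon a differentiable (at z)"
  using has_derivative_zbmon differentiable_def by blast

lemma measurable_zbmon: "zbmon a \<in> borel_measurable borel"
  unfolding zbmon_def[abs_def] by measurable

lemma normsqA_powr_differentiable:
  assumes "normsqA A z > 0"
  shows "(\<lambda>w. of_real (normsqA A w) powr s :: complex) differentiable (at z)"
proof -
  have "(\<lambda>w. \<Sum>a\<in>A. zmon a w * zbmon a w) differentiable (at z)"
  proof -
    have "zmon a differentiable (at z)" for a
      unfolding differentiable_def using has_derivative_zmon by blast
    then show ?thesis
      by (cases "finite A") (auto intro!: differentiable_sum differentiable_mult zbmon_differentiable)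
  qed
  then obtain D where D: "((\<lambda>w. complex_of_real (normsqA A w)) has_derivative D) (at z)"
    unfolding normsqA_complex differentiable_def by blast
  have "((\<lambda>x. x powr s) has_field_derivative s * of_real (normsqA A z) powr (s - 1)) (at (complex_of_real (normsqA A z)))"
    using assms by (intro has_field_derivative_powr) simp
  from has_derivative_compose[OF D this[unfolded has_field_derivative_def]] show ?thesis
    unfolding differentiable_def by blast
qed

lemma measurable_omegaB:
  fixes A :: "('n::finite \<Rightarrow> nat) set"
  assumes "\<And>z. z \<noteq> 0 \<Longrightarrow> normsqA A z > 0"
  shows "(\<lambda>z. omegaB oN oA A B s z U) \<in> borel_measurable borel"
proof -
  have d0: "(\<lambda>z::complex^'n. mono S (f z) V) differentiable (at z)" if "f differentiable (at z)" for S V and f :: "complex^'n \<Rightarrow> complex" and z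
    using that by (cases "V = S") (simp_all add: mono_def)
  have sBm: "(\<lambda>z. sB B z V) \<in> borel_measurable borel" for V
    unfolding sB_def by (intro borel_measurable_sum measurable_mono measurable_zbmon)
  have sBd: "(\<lambda>z. sB B z V) differentiable (at z)" for V z
    unfolding sB_def by (cases "finite B") (auto intro!: differentiable_sum d0 zbmon_differentiable)
  have [measurable]: "(\<lambda>z. of_real (normsqA A z) powr s :: complex) \<in> borel_measurable borel" by measurable
  show ?thesis
    unfolding omegaB_def uB_def
    by (intro measurable_wedge measurable_dbarF[where p=0] borel_measurable_divide measurable_wpow measurable_mono d0 normsqA_powr_differentiable assms sBm sBd) measurable
qed

section \<open>Kernels multiplied by Taylor monomials\<close>

context monomials
begin

text \<open>What the summand \<open>c\<close> contributes to the component with \<open>dzbar\<close>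
  indices \<open>J\<close>, apart from the constant \<open>Dc\<close>, the factor \<open>s\<close>
  and the power \<open>s\<close> of the norm.\<close>

definition kern :: "('n \<Rightarrow> nat) set \<Rightarrow> 'n set \<Rightarrow> ('n \<Rightarrow> nat) \<Rightarrow> complex^'n \<Rightarrow> complex" where
  "kern B J c z = (\<Prod>i\<in>UNIV. cnj (z$i) ^ alphaB B i) / (\<Prod>i\<in>J. cnj (z$i)) * of_real ((cmod (zmon c z))^2) / of_real (normsqA A z) ^ (card B + 1)"

definition piece :: "('n \<Rightarrow> nat) set \<Rightarrow> 'n set \<Rightarrow> ('n \<Rightarrow> nat) \<Rightarrow> ('n \<Rightarrow> nat) \<Rightarrow> ('n \<Rightarrow> nat) \<Rightarrow> complex^'n \<Rightarrow> complex" where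
  "piece B J c \<beta> \<gamma> z = indicator (polydisc 1) z * (kern B J c z * zz \<beta> \<gamma> z)"

lemma measurable_kern [measurable]: "kern B J c \<in> borel_measurable borel"
  unfolding kern_def[abs_def] by measurable

lemma measurable_piece [measurable]: "piece B J c \<beta> \<gamma> \<in> borel_measurable borel"
  unfolding piece_def[abs_def] by measurable

lemma prod_upd:
  assumes "finite S" "f i w = k * f i (z$i)"
  shows "(\<Prod>j\<in>S. f j (upd z i w $ j)) = (if i \<in> S then k else 1) * (\<Prod>j\<in>S. f j (z$j) :: 'b::comm_monoid_mult)"
proof (cases "i \<in> S")
  case True
  have "(\<Prod>j\<in>S - {i}. f j (upd z i w $ j)) = (\<Prod>j\<in>S - {i}. f j (z$j))" by (intro prod.cong) (auto simp: upd_def)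
  then show ?thesis
    using True assms by (simp add: prod.remove[OF assms(1) True] upd_def mult.assoc)
next
  case False
  then show ?thesis by (auto simp: upd_def intro!: prod.cong)
qed

lemma normsqA_rotate: "cmod u = 1 \<Longrightarrow> normsqA A (upd z i (u * z$i)) = normsqA A z"
  and zmon_rotate: "cmod u = 1 \<Longrightarrow> cmod (zmon c (upd z i (u * z$i))) = cmod (zmon c z)"
proof -
  show *: "cmod (zmon c (upd z i (u * z$i))) = cmod (zmon c z)" if "cmod u = 1" for c
    unfolding cmod_zmon using prod_upd[of UNIV "\<lambda>j w. cmod w ^ c j" i "u * z$i" 1 z] that by (simp add: norm_mult)
  show "normsqA A (upd z i (u * z$i)) = normsqA A z" if "cmod u = 1"
    unfolding normsqA_def *[OF that] ..
qed

text \<open>Since \<open>cnj u = 1 / u\<close>, rotating \<open>z_i\<close> by \<open>u\<close>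
  multiplies the integrand by \<open>u\<close> to the difference of the two sides; the norm and the
  polydisc are invariant.\<close>

lemma integral_piece_mismatch:
  assumes "\<beta> i + (if i \<in> J then 1 else 0) \<noteq> alphaB B i + \<gamma> i"
  shows "(\<integral>z. of_real (normsqA A z) powr s * piece B J c \<beta> \<gamma> z \<partial>lborel) = 0"
proof -
  obtain u where u: "cmod u = 1" "u ^ (\<beta> i + (if i \<in> J then 1 else 0)) \<noteq> u ^ (alphaB B i + \<gamma> i)"
    using unit_power_neq[OF assms] by blast
  have cu: "u * cnj u = 1" using complex_norm_square[of u] u(1) by simp
  have u0: "u \<noteq> 0" using u(1) by auto
  define k where "k = cnj u ^ alphaB B i / (if i \<in> J then cnj u else 1) * (u ^ \<beta> i * cnj u ^ \<gamma> i)"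
  have "cnj u = 1 / u" using cu u0 by (simp add: field_simps)
  then have "k * u ^ (alphaB B i + \<gamma> i) = u ^ (\<beta> i + (if i \<in> J then 1 else 0))"
    unfolding k_def using u0 by (simp add: power_add power_divide)
  then have k1: "k \<noteq> 1" using u(2) by auto
  show ?thesis
  proof (rule integral_eq_0_of_rotation_vec[OF _ u(1) k1, of _ i])
    fix z
    have 1: "(\<Prod>j\<in>UNIV. cnj (upd z i (u * z$i) $ j) ^ alphaB B j) = cnj u ^ alphaB B i * (\<Prod>j\<in>UNIV. cnj (z$j) ^ alphaB B j)"
      using prod_upd[of UNIV "\<lambda>j w. cnj w ^ alphaB B j" i "u * z$i" "cnj u ^ alphaB B i" z] by (simp add: power_mult_distrib)
    have 2: "(\<Prod>j\<in>J. cnj (upd z i (u * z$i) $ j)) = (if i \<in> J then cnj u else 1) * (\<Prod>j\<in>J. cnj (z$j))"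
      using prod_upd[of J "\<lambda>j w. cnj w" i "u * z$i" "cnj u" z] by simp
    have 3: "zz \<beta> \<gamma> (upd z i (u * z$i)) = (u ^ \<beta> i * cnj u ^ \<gamma> i) * zz \<beta> \<gamma> z"
      unfolding zz_def using prod_upd[of UNIV "\<lambda>j w. w ^ \<beta> j * cnj w ^ \<gamma> j" i "u * z$i" "u ^ \<beta> i * cnj u ^ \<gamma> i" z] by (simp add: power_mult_distrib mult_ac)
    have 4: "indicator (polydisc 1) (upd z i (u * z$i)) = (indicator (polydisc 1) z :: complex)"
    proof -
      have "cmod (upd z i (u * z$i) $ j) = cmod (z$j)" for j using u(1) by (simp add: upd_def norm_mult)
      then show ?thesis by (simp add: polydisc_def indicator_def)
    qed
    show "of_real (normsqA A (upd z i (u * z$i))) powr s * piece B J c \<beta> \<gamma> (upd z i (u * z$i)) = k * (of_real (normsqA A z) powr s * piece B J c \<beta> \<gamma> z)"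
      unfolding piece_def kern_def 1 2 3 4 normsqA_rotate[OF u(1)] zmon_rotate[OF u(1)] k_def by (simp add: mult_ac)
  qed measurable
qed

text \<open>With balanced exponents the factors pair up to the squared modulus of
  \<open>z^\<beta>\<close>, so the integrand is nonnegative and of the kind the decay estimates
  treat.\<close>

lemma piece_match:
  assumes m: "\<And>i. \<beta> i + (if i \<in> J then 1 else 0) = alphaB B i + \<gamma> i" and z: "\<And>i. z$i \<noteq> 0"
  shows "piece B J c \<beta> \<gamma> z = of_real (indicator (polydisc 1) z * tm (\<lambda>i. \<beta> i + c i) z / normsqA A z ^ (card B + 1))"
proof -
  have P: "(\<Prod>i\<in>J. cnj (z$i)) = (\<Prod>i\<in>UNIV. if i \<in> J then cnj (z$i) else 1)" by (simp add: prod.If_cases)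
  have "(\<Prod>i\<in>UNIV. cnj (z$i) ^ alphaB B i) / (\<Prod>i\<in>J. cnj (z$i)) * zz \<beta> \<gamma> z = (\<Prod>i\<in>UNIV. of_real (((cmod (z$i))^2) ^ \<beta> i))"
    unfolding P zz_def prod_dividef[symmetric] prod.distrib[symmetric]
  proof (intro prod.cong refl)
    fix i
    have "cnj (z$i) ^ alphaB B i / (if i \<in> J then cnj (z$i) else 1) * (z$i ^ \<beta> i * cnj (z$i) ^ \<gamma> i)
        = cnj (z$i) ^ (alphaB B i + \<gamma> i) / (if i \<in> J then cnj (z$i) else 1) * z$i ^ \<beta> i" by (simp add: power_add)
    also have "\<dots> = (z$i * cnj (z$i)) ^ \<beta> i" unfolding m[symmetric] using z by (simp add: power_add power_mult_distrib)
    also have "\<dots> = of_real (((cmod (z$i))^2) ^ \<beta> i)" by (simp only: complex_norm_square[symmetric] of_real_power)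
    finally show "cnj (z$i) ^ alphaB B i / (if i \<in> J then cnj (z$i) else 1) * (z$i ^ \<beta> i * cnj (z$i) ^ \<gamma> i) = of_real (((cmod (z$i))^2) ^ \<beta> i)" .
  qed
  moreover have "(\<Prod>i\<in>UNIV. of_real (((cmod (z$i))^2) ^ \<beta> i)) = complex_of_real (tm \<beta> z)" by (simp add: tm_def)
  ultimately have 1: "(\<Prod>i\<in>UNIV. cnj (z$i) ^ alphaB B i) / (\<Prod>i\<in>J. cnj (z$i)) * zz \<beta> \<gamma> z = of_real (tm \<beta> z)" by simp
  have 2: "tm (\<lambda>i. \<beta> i + c i) z = tm \<beta> z * (cmod (zmon c z))^2" unfolding cmod_zmon_tm by (simp add: tm_def power_add prod.distrib)
  have "piece B J c \<beta> \<gamma> z = indicator (polydisc 1) z * (((\<Prod>i\<in>UNIV. cnj (z$i) ^ alphaB B i) / (\<Prod>i\<in>J. cnj (z$i)) * zz \<beta> \<gamma> z) * of_real ((cmod (zmon c z))^2) / of_real (normsqA A z) ^ (card B + 1))"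
    unfolding piece_def kern_def by simp
  also have "\<dots> = of_real (indicator (polydisc 1) z * tm (\<lambda>i. \<beta> i + c i) z / normsqA A z ^ (card B + 1))"
    unfolding 1 2 by (simp add: indicator_def)
  finally show ?thesis .
qed

text \<open>The summands that contribute: as \<open>B\<close> spans, the form \<open>\<xi>\<close>
  is determined by \<open>B\<close>, and \<open>c\<close> has to lie on the same supporting
  hyperplane.\<close>

definition ess_at :: "('n \<Rightarrow> nat) set \<Rightarrow> ('n \<Rightarrow> nat) \<Rightarrow> bool" where
  "ess_at B c \<longleftrightarrow> nondeg B \<and> (\<exists>\<xi>. (\<forall>b\<in>B. dt b \<xi> = 1) \<and> dt c \<xi> = 1 \<and> (\<forall>a\<in>A. dt a \<xi> \<ge> 1))"

text \<open>Where strict decay fails, \<open>nonstrict_analysis\<close> applies.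
  \<open>M = 0\<close> would put a zero row into the bordered determinant. \<open>M < 0\<close>
  removes all slack and turns \<open>x / M\<close> into a form that is 1 on \<open>B\<close> and
  \<open>c\<close>; then the bordered determinant is the determinant of \<open>B\<close>, so
  \<open>B\<close> spans.\<close>

lemma piece_cases:
  assumes L: "length L = Suc k" "length L' = Suc k" "distinct L" "distinct L'" and B: "set L' \<subseteq> A" and c: "c \<in> A" and Dc: "Dc L L' c \<noteq> 0"
    and m: "\<And>i. \<beta> i + (if i \<in> set L then 1 else 0) = alphaB (set L') i + \<gamma> i"
  shows "acv (\<lambda>s. s * (\<integral>z. of_real (normsqA A z) powr s * piece (set L') (set L) c \<beta> \<gamma> z \<partial>lborel)) 0 \<or>
    (set L = UNIV \<and> \<gamma> = (\<lambda>i. 0) \<and> ess_at (set L') c)"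
proof (cases "\<forall>x. (\<forall>i. x i \<le> 0) \<and> (\<exists>i. x i \<noteq> 0) \<longrightarrow> (\<exists>a\<in>A. (\<Sum>i\<in>UNIV. (real (\<beta> i + c i) + 1) * x i) < real (card (set L') + 1) * dt a x)")
  case True
  let ?h = "piece (set L') (set L) c \<beta> \<gamma>" and ?l = "card (set L') + 1"
  have "\<exists>e>0. integrable lborel (\<lambda>z. normsqA A z powr (- e) * cmod (?h z))"
  proof (rule decay_integrable[where u="\<lambda>i. real (\<beta> i + c i) + 1" and l="real ?l" and C=1])
    fix z :: "complex^'n" assume z: "\<And>i. z$i \<noteq> 0"
    have N: "normsqA A z > 0" using normsqA_pos z by blast
    then have Np: "normsqA A z powr (- real ?l) = 1 / normsqA A z ^ ?l" by (simp only: powr_minus_divide powr_realpow)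
    have "0 \<le> indicator (polydisc 1) z * tm (\<lambda>i. \<beta> i + c i) z / normsqA A z ^ ?l"
      by (intro divide_nonneg_nonneg mult_nonneg_nonneg tm_nonneg zero_le_power normsqA_nonneg) simp
    then show "cmod (?h z) \<le> 1 * (indicator (polydisc 1) z * normsqA A z powr (- real ?l) * (\<Prod>i\<in>UNIV. cmod (z$i) powr (2 * (real (\<beta> i + c i) + 1) - 2)))"
      unfolding piece_match[OF m z] norm_of_real tm_powr[OF z, symmetric] Np by simp
  qed (use True in auto)
  then obtain e where e: "e > 0" "integrable lborel (\<lambda>z. normsqA A z powr (- e) * cmod (?h z))" by blast
  have "acv (\<lambda>s. \<integral>z. of_real (normsqA A z) powr s * ?h z \<partial>lborel) (\<integral>z. of_real (normsqA A z) powr 0 * ?h z \<partial>lborel)"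
    by (rule acv_decay[OF _ _ _ e, where R=1]) (auto simp: piece_def)
  from acv_mult_0[OF this] show ?thesis ..
next
  case False
  then obtain x where x: "\<And>i. x i \<le> 0" "\<exists>i. x i \<noteq> 0"
    and le0: "\<And>a. a \<in> A \<Longrightarrow> real (card (set L') + 1) * dt a x \<le> (\<Sum>i\<in>UNIV. (real (\<beta> i + c i) + 1) * x i)" by (auto simp: not_less)
  \<comment> \<open>The slack: \<open>\<gamma> i\<close> from the antiholomorphic part of the
    monomial, and 1 where no \<open>dzbar_i\<close> lowers the exponent.\<close>
  define e where "e i = real (\<gamma> i) + (if i \<in> set L then 0 else 1)" for i
  have u: "real (\<beta> i + c i) + 1 = real (alphaB (set L') i) + real (c i) + e i" for i
  proof -
    have "real (\<beta> i + (if i \<in> set L then 1 else 0)) = real (alphaB (set L') i + \<gamma> i)" unfolding m ..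
    then show ?thesis unfolding e_def by (simp split: if_splits)
  qed
  have "(\<Sum>i\<in>UNIV. (real (\<beta> i + c i) + 1) * x i) = (\<Sum>b\<in>set L'. dt b x) + dt c x + (\<Sum>i\<in>UNIV. e i * x i)"
    unfolding u distrib_right sum.distrib dt_alphaB by (simp add: dt_def)
  then have le: "(real (card (set L')) + 1) * dt a x \<le> (\<Sum>b\<in>set L'. dt b x) + dt c x + (\<Sum>i\<in>UNIV. e i * x i)" if "a \<in> A" for a
    using le0[OF that] by (simp add: algebra_simps)
  have e0: "e i \<ge> 0" for i by (simp add: e_def)
  obtain M where M0: "M \<le> 0" and Mb: "\<And>b. b \<in> set L' \<Longrightarrow> dt b x = M" and Mc: "dt c x = M" and Me: "\<And>i. e i * x i = 0" and Ma: "\<And>a. a \<in> A \<Longrightarrow> dt a x \<le> M"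
    and Mz: "M = 0 \<Longrightarrow> \<forall>b\<in>insert c (set L'). \<forall>i. real (b i) * x i = 0" and Mn: "M \<noteq> 0 \<Longrightarrow> \<forall>i. x i < 0"
    by (rule nonstrict_analysis[OF B c x e0 le], assumption) (rule that; assumption)
  have "M \<noteq> 0"
  proof
    assume "M = 0"
    obtain i where i: "x i \<noteq> 0" using x(2) by blast
    then have "e i = 0" using Me[of i] by simp
    then have "i \<in> set L" by (simp add: e_def split: if_splits)
    moreover have "c i = 0" "\<And>a. a \<in> set L' \<Longrightarrow> a i = 0" using Mz[OF \<open>M = 0\<close>] i by auto
    ultimately have "Dc L L' c = 0" by (rule Dc_zero[OF L(1,2)])
    then show False using Dc by simp
  qed
  then have xn: "x i < 0" for i using Mn by blast
  then have e00: "e i = 0" for i using Me[of i] by (metis less_irrefl mult_eq_0_iff)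
  have "i \<in> set L \<and> \<gamma> i = 0" for i using e00[of i] by (simp add: e_def split: if_splits)
  then have J: "set L = UNIV" "\<gamma> = (\<lambda>i. 0)" by auto
  have Mneg: "M < 0" using M0 \<open>M \<noteq> 0\<close> by simp
  \<comment> \<open>\<open>M\<close> is negative, so division turns the upper bound \<open>M\<close>
    on \<open>A\<close> into the lower bound 1.\<close>
  define \<xi> where "\<xi> i = x i / M" for i
  have dtx: "dt a \<xi> = dt a x / M" for a unfolding \<xi>_def by (rule dt_axis_scale)
  have \<xi>: "\<forall>b\<in>set L'. dt b \<xi> = 1" "dt c \<xi> = 1" "\<forall>a\<in>A. dt a \<xi> \<ge> 1"
    unfolding dtx using Mb Mc Ma Mneg by (auto simp: divide_simps)
  have "(\<Sum>i\<in>UNIV. of_nat (a i) * complex_of_real (\<xi> i)) = 1" if "a \<in> set L'" for a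
  proof -
    have "(\<Sum>i\<in>UNIV. of_nat (a i) * complex_of_real (\<xi> i)) = of_real (dt a \<xi>)" by (simp add: dt_def)
    then show ?thesis using \<xi>(1) that by simp
  qed
  then have "Determinant.det (dmat (\<lambda>i a. of_nat (a i)) L L') \<noteq> (0::complex)"
    using Dc Dc_eq_det[OF L(1,2) J(1) L(3), of "\<lambda>i. of_real (\<xi> i)" c] by auto
  then have "nondeg (set L')" using det_dmat_nondeg[OF L(1,2) J(1) L(3)] by blast
  then show ?thesis using J \<xi> unfolding ess_at_def by blast
qed

text \<open>The value of the continuation at 0 when it is positive, and 0 by convention otherwise.\<close>

definition weight :: "('n \<Rightarrow> nat) set \<Rightarrow> 'n set \<Rightarrow> ('n \<Rightarrow> nat) \<Rightarrow> real" where
  "weight B J c = (if \<exists>w>0. acv (\<lambda>s. s * (\<integral>z. of_real (normsqA A z) powr s * piece B J c (\<lambda>i. alphaB B i - 1) (\<lambda>i. 0) z \<partial>lborel)) (of_real w)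
     then SOME w. w > 0 \<and> acv (\<lambda>s. s * (\<integral>z. of_real (normsqA A z) powr s * piece B J c (\<lambda>i. alphaB B i - 1) (\<lambda>i. 0) z \<partial>lborel)) (of_real w) else 0)"

lemma weight_cases:
  obtains "weight B J c = 0" "\<not> (\<exists>w>0. acv (\<lambda>s. s * (\<integral>z. of_real (normsqA A z) powr s * piece B J c (\<lambda>i. alphaB B i - 1) (\<lambda>i. 0) z \<partial>lborel)) (of_real w))"
  | "weight B J c > 0" "acv (\<lambda>s. s * (\<integral>z. of_real (normsqA A z) powr s * piece B J c (\<lambda>i. alphaB B i - 1) (\<lambda>i. 0) z \<partial>lborel)) (of_real (weight B J c))"
proof (cases "\<exists>w>0. acv (\<lambda>s. s * (\<integral>z. of_real (normsqA A z) powr s * piece B J c (\<lambda>i. alphaB B i - 1) (\<lambda>i. 0) z \<partial>lborel)) (of_real w)")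
  case True
  have w: "weight B J c = (SOME w. w > 0 \<and> acv (\<lambda>s. s * (\<integral>z. of_real (normsqA A z) powr s * piece B J c (\<lambda>i. alphaB B i - 1) (\<lambda>i. 0) z \<partial>lborel)) (of_real w))"
    unfolding weight_def by (rule if_P[OF True])
  from someI_ex[OF True] show ?thesis using that(2) unfolding w by blast
next
  case False
  have "weight B J c = 0" unfolding weight_def by (rule if_not_P[OF False])
  then show ?thesis by (rule that(1)[OF _ False])
qed

lemma weight_eq_0:
  assumes "acv (\<lambda>s. s * (\<integral>z. of_real (normsqA A z) powr s * piece B J c (\<lambda>i. alphaB B i - 1) (\<lambda>i. 0) z \<partial>lborel)) 0"
  shows "weight B J c = 0"
proof (cases rule: weight_cases[of B J c])
  case 2
  from acv_unique[OF assms 2(2)] show ?thesis by simp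
qed

lemma weight_pos:
  assumes "acv (\<lambda>s. s * (\<integral>z. of_real (normsqA A z) powr s * piece B J c (\<lambda>i. alphaB B i - 1) (\<lambda>i. 0) z \<partial>lborel)) (of_real Q)" "Q > 0"
  shows "weight B J c > 0"
proof (cases rule: weight_cases[of B J c])
  case 1
  then show ?thesis using assms by blast
qed

lemma weight_acv:
  assumes "weight B J c \<noteq> 0"
  shows "weight B J c > 0" "acv (\<lambda>s. s * (\<integral>z. of_real (normsqA A z) powr s * piece B J c (\<lambda>i. alphaB B i - 1) (\<lambda>i. 0) z \<partial>lborel)) (of_real (weight B J c))"
proof -
  show "weight B J c > 0" by (cases rule: weight_cases[of B J c]) (use assms in blast)+
  show "acv (\<lambda>s. s * (\<integral>z. of_real (normsqA A z) powr s * piece B J c (\<lambda>i. alphaB B i - 1) (\<lambda>i. 0) z \<partial>lborel)) (of_real (weight B J c))"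
    by (cases rule: weight_cases[of B J c]) (use assms in blast)+
qed

text \<open>Transfers \<open>piece_essential\<close> to \<open>weight\<close>; the exponents
  \<open>\<alpha> - 1 + c\<close> and \<open>\<alpha> + c - 1\<close> agree in the naturals because
  \<open>\<alpha> \<ge> 1\<close>.\<close>

lemma weight_ess:
  assumes "ess_at B c" "B \<subseteq> A" "c \<in> A"
  shows "weight B UNIV c > 0"
proof -
  have al: "alphaB B i \<ge> 1" for i using assms(1,2) finA finite_subset unfolding ess_at_def by (blast intro: nondeg_alphaB_pos)
  obtain \<xi> where \<xi>: "nondeg B" "\<And>b. b \<in> B \<Longrightarrow> dt b \<xi> = 1" "dt c \<xi> = 1" "\<And>a. a \<in> A \<Longrightarrow> dt a \<xi> \<ge> 1"
    using assms(1) unfolding ess_at_def by blast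
  obtain Q where Q: "Q > 0" "acv (\<lambda>s. s * (\<integral>z. of_real (normsqA A z) powr s *
     of_real (indicator (polydisc 1) z * tm (\<lambda>i. alphaB B i + c i - 1) z / normsqA A z ^ (card B + 1)) \<partial>lborel)) (of_real Q)"
    using piece_essential[OF assms(2) \<xi>(1) assms(3) \<xi>(2-4)] by blast
  have m: "alphaB B i - 1 + (if i \<in> UNIV then 1 else 0) = alphaB B i + 0" for i using al[of i] by simp
  have e: "(\<lambda>i. alphaB B i - 1 + c i) = (\<lambda>i. alphaB B i + c i - 1)" using al by auto
  have "(\<integral>z. of_real (normsqA A z) powr s * of_real (indicator (polydisc 1) z * tm (\<lambda>i. alphaB B i + c i - 1) z / normsqA A z ^ (card B + 1)) \<partial>lborel)
    = (\<integral>z. of_real (normsqA A z) powr s * piece B UNIV c (\<lambda>i. alphaB B i - 1) (\<lambda>i. 0) z \<partial>lborel)" for s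
  proof (rule integral_cong_AE)
    show "AE z in lborel. of_real (normsqA A z) powr s * of_real (indicator (polydisc 1) z * tm (\<lambda>i. alphaB B i + c i - 1) z / normsqA A z ^ (card B + 1))
       = of_real (normsqA A z) powr s * piece B UNIV c (\<lambda>i. alphaB B i - 1) (\<lambda>i. 0) z"
      using AE_nonzero
    proof eventually_elim
      case (elim z)
      show ?case using piece_match[where J=UNIV and B=B and \<beta>="\<lambda>i. alphaB B i - 1" and \<gamma>="\<lambda>i. 0" and c=c, OF m, of z] elim unfolding e by simp
    qed
  qed measurable
  then have "acv (\<lambda>s. s * (\<integral>z. of_real (normsqA A z) powr s * piece B UNIV c (\<lambda>i. alphaB B i - 1) (\<lambda>i. 0) z \<partial>lborel)) (of_real Q)"
    using Q(2) by simp
  from weight_pos[OF this Q(1)] show ?thesis .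
qed

text \<open>\<open>weight\<close> is determined by \<open>B\<close>, \<open>J\<close> and
  \<open>c\<close> alone, so each Taylor monomial contributes a fixed number and the test function
  enters through a single coefficient.\<close>

lemma piece_value:
  assumes L: "length L = Suc k" "length L' = Suc k" "distinct L" "distinct L'" and B: "set L' \<subseteq> A" and c: "c \<in> A"
  shows "acv (\<lambda>s. Dc L L' c * (s * (\<integral>z. of_real (normsqA A z) powr s * piece (set L') (set L) c \<beta> \<gamma> z \<partial>lborel)))
    (Dc L L' c * (if \<beta> = (\<lambda>i. alphaB (set L') i - 1) \<and> \<gamma> = (\<lambda>i. 0) then of_real (weight (set L') (set L) c) else 0))"
    (is "acv (\<lambda>s. _ * ?X s) (_ * ?v)")
proof (cases "Dc L L' c = 0")
  case True
  then show ?thesis by (simp add: acv_zero)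
next
  case False
  have 0: ?thesis if X: "acv ?X 0"
  proof -
    have "?v = 0"
    proof (cases "\<beta> = (\<lambda>i. alphaB (set L') i - 1) \<and> \<gamma> = (\<lambda>i. 0)")
      case True
      then have X': "acv (\<lambda>s. s * (\<integral>z. of_real (normsqA A z) powr s * piece (set L') (set L) c (\<lambda>i. alphaB (set L') i - 1) (\<lambda>i. 0) z \<partial>lborel)) 0"
        using X by simp
      show ?thesis using weight_eq_0[OF X'] by simp
    qed auto
    then show ?thesis using acv_cmult[OF X, of "Dc L L' c"] by (simp only: mult_zero_right)
  qed
  show ?thesis
  proof (cases "\<forall>i. \<beta> i + (if i \<in> set L then 1 else 0) = alphaB (set L') i + \<gamma> i")
    case match: True
    show ?thesis
    proof (cases "acv ?X 0")
      case False
      then have ess: "set L = UNIV" "\<gamma> = (\<lambda>i. 0)" "ess_at (set L') c"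
        using piece_cases[OF L B c \<open>Dc L L' c \<noteq> 0\<close>, of \<beta> \<gamma>] match by blast+
      have \<beta>: "\<beta> = (\<lambda>i. alphaB (set L') i - 1)"
      proof
        fix i show "\<beta> i = alphaB (set L') i - 1" using match[rule_format, of i] ess by simp
      qed
      have "weight (set L') (set L) c > 0" unfolding ess(1) by (rule weight_ess[OF ess(3) B c])
      then have "acv ?X (of_real (weight (set L') (set L) c))"
        unfolding \<beta> ess(2) by (intro weight_acv(2)) simp
      then show ?thesis using \<beta> ess(2) by (intro acv_cmult) simp
    qed (rule 0)
  next
    case False
    then obtain i where "\<beta> i + (if i \<in> set L then 1 else 0) \<noteq> alphaB (set L') i + \<gamma> i" by blast
    then show ?thesis by (intro 0) (simp only: integral_piece_mismatch mult_zero_right acv_zero)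
  qed
qed

text \<open>Unbalanced exponents also give value 0, so a nonzero weight means that
  \<open>z^(\<alpha>-1)\<close> is balanced and leaves only the second alternative of
  \<open>piece_cases\<close>.\<close>

lemma weight_nonzero:
  assumes L: "length L = Suc k" "length L' = Suc k" "distinct L" "distinct L'" and B: "set L' \<subseteq> A" and c: "c \<in> A"
    and nz: "Dc L L' c * of_real (weight (set L') (set L) c) \<noteq> 0"
  shows "set L = UNIV \<and> ess_at (set L') c"
proof -
  have D: "Dc L L' c \<noteq> 0" and w: "weight (set L') (set L) c \<noteq> 0"
    using nz by auto
  then have n0: "\<not> acv (\<lambda>s. s * (\<integral>z. of_real (normsqA A z) powr s * piece (set L') (set L) c (\<lambda>i. alphaB (set L') i - 1) (\<lambda>i. 0) z \<partial>lborel)) 0"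
    using weight_eq_0 by blast
  have m: "alphaB (set L') i - 1 + (if i \<in> set L then 1 else 0) = alphaB (set L') i + 0" for i
  proof (rule ccontr)
    assume "\<not> ?thesis"
    then have "acv (\<lambda>s. s * (\<integral>z. of_real (normsqA A z) powr s * piece (set L') (set L) c (\<lambda>i. alphaB (set L') i - 1) (\<lambda>i. 0) z \<partial>lborel)) 0"
      using integral_piece_mismatch[of "\<lambda>i. alphaB (set L') i - 1" i "set L" "set L'" "\<lambda>i. 0"] by (simp add: acv_zero)
    then show False using n0 by blast
  qed
  show ?thesis using piece_cases[OF L B c D, of "\<lambda>i. alphaB (set L') i - 1" "\<lambda>i. 0"] m n0 by blast
qed

section \<open>The residue current\<close>

lemma normsqA_pos_off_0:
  assumes "z \<noteq> 0"
  shows "normsqA A z > 0"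
proof -
  obtain i where i: "z$i \<noteq> 0" using assms by (auto simp: Finite_Cartesian_Product.vec_eq_iff)
  obtain a where a: "a \<in> A" "\<forall>j. j \<noteq> i \<longrightarrow> a j = 0" using ax by blast
  have "cmod (zmon a z) = (\<Prod>j\<in>UNIV. if j = i then cmod (z$i) ^ a i else 1)"
    unfolding cmod_zmon using a(2) by (intro prod.cong) auto
  then have "0 < (cmod (zmon a z))^2" using i by simp
  then show ?thesis using normsqA_ge[OF a(1), of z] by linarith
qed

text \<open>A crude bound: the numerators are bounded on the polydisc, and every coordinate is
  charged \<open>1 / |z_i|\<close> whether or not it lies in \<open>J\<close>, which is still
  integrable in the plane.\<close>

lemma kern_bound:
  assumes R: "R \<ge> 1" and c: "c \<in> A"
  obtains C0 where "C0 \<ge> 0" "\<And>z. z \<in> polydisc R \<Longrightarrow> (\<And>i. z$i \<noteq> 0) \<Longrightarrow>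
    cmod (kern B J c z) \<le> C0 * (normsqA A z powr (- real (card B + 1)) * (\<Prod>i\<in>UNIV. cmod (z$i) powr (-1)))"
proof -
  obtain C1 where C1: "C1 \<ge> 1" "\<And>z. z \<in> polydisc R \<Longrightarrow> normsqA A z \<le> C1" using normsqA_bounded[OF R] by blast
  let ?P = "\<Prod>i\<in>UNIV. R ^ alphaB B i"
  have P: "?P \<ge> 0" using R by (intro prod_nonneg) auto
  have "cmod (kern B J c z) \<le> (?P * R ^ CARD('n) * C1) * (normsqA A z powr (- real (card B + 1)) * (\<Prod>i\<in>UNIV. cmod (z$i) powr (-1)))"
    if zR: "z \<in> polydisc R" and z: "\<And>i. z$i \<noteq> 0" for z
  proof -
    have N: "normsqA A z > 0" using normsqA_pos z by blast
    have Np: "normsqA A z powr (- real (card B + 1)) = 1 / normsqA A z ^ (card B + 1)" using N by (simp only: powr_minus_divide powr_realpow)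
    have 1: "(\<Prod>i\<in>UNIV. cmod (z$i) ^ alphaB B i) \<le> ?P"
      using zR by (intro prod_mono) (auto simp: polydisc_def intro!: power_mono)
    have "1 / (\<Prod>i\<in>J. cmod (z$i)) = (\<Prod>i\<in>UNIV. if i \<in> J then 1 / cmod (z$i) else 1)" by (simp add: prod.If_cases prod_dividef)
    also have "\<dots> \<le> (\<Prod>i\<in>UNIV. R * cmod (z$i) powr (-1))"
    proof (intro prod_mono conjI)
      fix i
      have zi: "0 < cmod (z$i)" "cmod (z$i) \<le> R" using z zR by (auto simp: polydisc_def)
      then show "(if i \<in> J then 1 / cmod (z$i) else 1) \<le> R * cmod (z$i) powr (-1)"
        using R by (simp add: powr_minus_divide divide_simps)
    qed auto
    also have "\<dots> = R ^ CARD('n) * (\<Prod>i\<in>UNIV. cmod (z$i) powr (-1))" unfolding prod.distrib by simp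
    finally have 2: "1 / (\<Prod>i\<in>J. cmod (z$i)) \<le> R ^ CARD('n) * (\<Prod>i\<in>UNIV. cmod (z$i) powr (-1))" .
    have 3: "(cmod (zmon c z))^2 \<le> C1" using normsqA_ge[OF c, of z] C1(2)[OF zR] by linarith
    have nn: "0 \<le> (\<Prod>i\<in>UNIV. cmod (z$i) powr (-1))" "0 \<le> 1 / (\<Prod>i\<in>J. cmod (z$i))" by (auto intro!: prod_nonneg)
    have "cmod (kern B J c z) = (\<Prod>i\<in>UNIV. cmod (z$i) ^ alphaB B i) * (1 / (\<Prod>i\<in>J. cmod (z$i))) * (cmod (zmon c z))^2 * (1 / normsqA A z ^ (card B + 1))"
      using N unfolding kern_def by (simp add: norm_mult norm_divide norm_power prod_norm[symmetric])
    also have "\<dots> \<le> ?P * (R ^ CARD('n) * (\<Prod>i\<in>UNIV. cmod (z$i) powr (-1))) * C1 * (1 / normsqA A z ^ (card B + 1))"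
      using P N nn R C1 by (intro mult_mono 1 2 3 order_refl) (auto intro!: prod_nonneg mult_nonneg_nonneg)
    finally show ?thesis unfolding Np by (simp add: mult_ac)
  qed
  then show ?thesis using that[of "?P * R ^ CARD('n) * C1"] P R C1 by simp
qed

text \<open>With \<open>card B + 1\<close> powers of the norm its negative powers are cancelled, and
  the factors \<open>1 / |z_i|\<close> that remain are integrable.\<close>

lemma integrable_piece:
  assumes c: "c \<in> A" and s: "Re s \<ge> real (card B + 1)"
  shows "integrable lborel (\<lambda>z. of_real (normsqA A z) powr s * piece B J c \<beta> \<gamma> z)"
proof -
  obtain C0 where C0: "C0 \<ge> 0" "\<And>z. z \<in> polydisc 1 \<Longrightarrow> (\<And>i. z$i \<noteq> 0) \<Longrightarrow>
    cmod (kern B J c z) \<le> C0 * (normsqA A z powr (- real (card B + 1)) * (\<Prod>i\<in>UNIV. cmod (z$i) powr (-1)))"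
    using kern_bound[OF order_refl c] by blast
  obtain C1 where C1: "\<And>z. z \<in> polydisc 1 \<Longrightarrow> normsqA A z \<le> C1" using normsqA_bounded[OF order_refl] by blast
  have "integrable lborel (\<lambda>z. normsqA A z powr real (card B + 1) * cmod (piece B J c \<beta> \<gamma> z))"
  proof (rule Bochner_Integration.integrable_bound)
    show "integrable lborel (\<lambda>z::complex^'n. C0 * (indicator (polydisc 1) z * (\<Prod>i\<in>UNIV. cmod (z$i) powr (2 * (1/2) - 2))))"
      by (intro integrable_mult_right integrable_polydisc) auto
    show "AE z in lborel. norm (normsqA A z powr real (card B + 1) * cmod (piece B J c \<beta> \<gamma> z)) \<le> norm (C0 * (indicator (polydisc 1) z * (\<Prod>i\<in>UNIV. cmod (z$i) powr (2 * (1/2) - 2))))"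
      using AE_nonzero
    proof eventually_elim
      case (elim z)
      show ?case
      proof (cases "z \<in> polydisc 1")
        case True
        let ?N = "normsqA A z powr real (card B + 1)" and ?X = "\<Prod>i\<in>UNIV. cmod (z$i) powr (-1)"
        have N: "normsqA A z > 0" using elim normsqA_pos by blast
        have X: "?X \<ge> 0" by (auto intro: prod_nonneg)
        have "cmod (zz \<beta> \<gamma> z) \<le> 1" using True by (intro norm_zz_le_1) (auto simp: polydisc_def)
        then have "cmod (kern B J c z) * cmod (zz \<beta> \<gamma> z) \<le> cmod (kern B J c z) * 1" by (intro mult_left_mono) auto
        also have "\<dots> \<le> C0 * (normsqA A z powr (- real (card B + 1)) * ?X)" using C0(2)[OF True] elim by simp
        finally have "?N * cmod (piece B J c \<beta> \<gamma> z) \<le> ?N * (C0 * (normsqA A z powr (- real (card B + 1)) * ?X))"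
          using True by (intro mult_left_mono) (auto simp: piece_def norm_mult)
        also have "\<dots> = C0 * ?X * (?N * normsqA A z powr (- real (card B + 1)))" by (simp only: mult_ac)
        also have "?N * normsqA A z powr (- real (card B + 1)) = 1" unfolding powr_add[symmetric] using N by simp
        finally show ?thesis using True X C0(1) by (simp add: abs_mult)
      qed (simp add: piece_def)
    qed
  qed measurable
  then show ?thesis
    using C1 s by (intro integrable_powr_mult[where a="real (card B + 1)" and C=C1] normsqA_nonneg) (auto simp: piece_def indicator_def split: if_splits)
qed

lemma remainder_value:
  fixes r :: "complex^'n \<Rightarrow> complex"
  assumes c: "c \<in> A" and R: "R \<ge> 1" and [measurable]: "r \<in> borel_measurable borel" and supp: "\<And>z. z \<notin> polydisc R \<Longrightarrow> r z = 0"
    and p: "\<And>i. \<exists>a\<in>A. a i \<le> p \<and> (\<forall>j. j \<noteq> i \<longrightarrow> a j = 0)" and K: "K \<ge> 2 * p * (card B + 1 + 1)"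
    and D: "D \<ge> 0" "\<And>z. cmod (r z) \<le> D * (\<Sum>i\<in>UNIV. cmod (z$i) ^ K)"
  shows "acv (\<lambda>s. s * (\<integral>z. of_real (normsqA A z) powr s * (kern B J c z * r z) \<partial>lborel)) 0"
    and "Re s \<ge> 0 \<Longrightarrow> integrable lborel (\<lambda>z. of_real (normsqA A z) powr s * (kern B J c z * r z))"
proof -
  obtain C0 where C0: "C0 \<ge> 0" "\<And>z. z \<in> polydisc R \<Longrightarrow> (\<And>i. z$i \<noteq> 0) \<Longrightarrow>
    cmod (kern B J c z) \<le> C0 * (normsqA A z powr (- real (card B + 1)) * (\<Prod>i\<in>UNIV. cmod (z$i) powr (-1)))"
    using kern_bound[OF R c] by blast
  have int: "integrable lborel (\<lambda>z. normsqA A z powr (- 1) * cmod (kern B J c z * r z))"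
  proof (rule remainder_integrable[OF _ R p K])
    show "C0 * D \<ge> 0" using C0 D by simp
    fix z :: "complex^'n" assume z: "\<And>i. z$i \<noteq> 0"
    show "cmod (kern B J c z * r z) \<le> C0 * D * (indicator (polydisc R) z * normsqA A z powr (- real (card B + 1)) * (\<Prod>i\<in>UNIV. cmod (z$i) powr (-1)) * (\<Sum>i\<in>UNIV. cmod (z$i) ^ K))"
    proof (cases "z \<in> polydisc R")
      case True
      have "cmod (kern B J c z) * cmod (r z) \<le> (C0 * (normsqA A z powr (- real (card B + 1)) * (\<Prod>i\<in>UNIV. cmod (z$i) powr (-1)))) * (D * (\<Sum>i\<in>UNIV. cmod (z$i) ^ K))"
        using C0 True z D by (intro mult_mono C0(2) D(2)) (auto intro!: mult_nonneg_nonneg prod_nonneg)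
      then show ?thesis using True by (simp add: norm_mult mult_ac)
    qed (simp add: supp)
  qed measurable
  have "acv (\<lambda>s. \<integral>z. of_real (normsqA A z) powr s * (kern B J c z * r z) \<partial>lborel) (\<integral>z. of_real (normsqA A z) powr 0 * (kern B J c z * r z) \<partial>lborel)"
  proof (rule acv_decay[where e=1 and R=R])
    show "integrable lborel (\<lambda>z. normsqA A z powr (- 1) * cmod (kern B J c z * r z))" by (rule int)
  qed (use R supp in auto)
  then show "acv (\<lambda>s. s * (\<integral>z. of_real (normsqA A z) powr s * (kern B J c z * r z) \<partial>lborel)) 0" by (rule acv_mult_0)
  obtain C1 where C1: "\<And>z. z \<in> polydisc R \<Longrightarrow> normsqA A z \<le> C1" using normsqA_bounded[OF R] by blast
  show "integrable lborel (\<lambda>z. of_real (normsqA A z) powr s * (kern B J c z * r z))" if "Re s \<ge> 0"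
    using C1 supp that by (intro integrable_powr_mult[OF _ _ normsqA_nonneg _ int, where C=C1]) auto
qed

text \<open>The witness \<open>V\<close> is the Taylor coefficient of \<open>z^(\<alpha>-1)\<close>.
  One and the same \<open>V\<close> in the residue and in the tensor product makes their quotient
  independent of \<open>\<phi>\<close>; the second formula is restricted to
  \<open>\<alpha> \<ge> 1\<close>, as the one-variable formula is.\<close>

lemma RB_value:
  assumes d: "distinct oN" "set oN = UNIV" "distinct oA"
    and L: "length L = Suc m" "length L' = Suc m" "sorted_wrt (\<lambda>x y. lpos oN x < lpos oN y) L" "sorted_wrt (\<lambda>x y. lpos oA x < lpos oA y) L'"
    and B: "set L' \<subseteq> A" and t: "test_fun \<phi>"
  shows "\<exists>V. RB oN oA A (set L') (Inl ` set L \<union> Inr ` set L') \<phi>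
      = ((-1) ^ m * epsk m * fact m) * (\<Sum>c\<in>A. Dc L L' c * of_real (weight (set L') (set L) c)) * V \<and>
    ((\<forall>i. alphaB (set L') i \<ge> 1) \<longrightarrow> tens oN (alphaB (set L')) \<phi> 0 = of_real pi ^ length oN * V)"
proof -
  let ?B = "set L'" and ?J = "set L"
  let ?N = "normsqA A"
  let ?\<kappa> = "(-1) ^ m * epsk m * fact m :: complex"
  have dL: "distinct L" "distinct L'" using L(3,4) by (auto intro: sorted_distinct)
  have cB: "card ?B + 1 = m + 2" using distinct_card[OF dL(2)] L(2) by simp
  define p where "p = (\<Sum>a\<in>A. \<Sum>i\<in>UNIV. a i)"
  have p: "\<exists>a\<in>A. a i \<le> p \<and> (\<forall>j. j \<noteq> i \<longrightarrow> a j = 0)" for i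
  proof -
    obtain a where a: "a \<in> A" "\<forall>j. j \<noteq> i \<longrightarrow> a j = 0" using ax by blast
    have "a i \<le> (\<Sum>i\<in>UNIV. a i)" by (intro member_le_sum) auto
    also have "\<dots> \<le> p" unfolding p_def using finA a(1) by (intro member_le_sum) auto
    finally show ?thesis using a by blast
  qed
  \<comment> \<open>The summands serve, in order, the remainder estimate, the requirement that
    \<open>K\<close> bound every \<open>\<alpha> i\<close>, and \<open>K \<ge> 1\<close>.\<close>
  define K where "K = 2 * p * (card ?B + 1 + 1) + (\<Sum>i\<in>UNIV. alphaB ?B i) + 1"
  have K: "2 * p * (card ?B + 1 + 1) \<le> K" "alphaB ?B i \<le> K" "1 \<le> K" for i
    using member_le_sum[of i UNIV "alphaB ?B"] by (auto simp: K_def)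
  have cls: "cls {} \<phi>" using t by (rule test_fun_cls)
  have if_UNIV: "(\<lambda>i. if i \<in> set oN then alphaB ?B i - 1 else 0) = (\<lambda>i. alphaB ?B i - 1)" using d(2) by simp
  obtain Q \<Phi> C where Q0: "finite Q" "\<forall>\<beta> \<gamma>. cls (set oN) (\<Phi> \<beta> \<gamma>)"
    "\<forall>z. (\<forall>i. cmod (z$i) \<le> 1) \<longrightarrow> cmod (\<phi> z - (\<Sum>(\<beta>,\<gamma>)\<in>Q. \<Phi> \<beta> \<gamma> z * zz \<beta> \<gamma> z)) \<le> C * (\<Sum>i\<in>UNIV. cmod (z$i) ^ K)"
    "(\<lambda>i. alphaB ?B i - 1, \<lambda>i. 0) \<in> Q"
    "(\<forall>i. alphaB ?B i \<ge> 1) \<longrightarrow> (\<forall>z. tens oN (alphaB ?B) \<phi> z = of_real pi ^ length oN * \<Phi> (\<lambda>i. alphaB ?B i - 1) (\<lambda>i. 0) z)"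
    using taylor_multi[where p="alphaB ?B", OF cls d(1) K(2,3)] unfolding if_UNIV by (elim exE conjE) (rule that; assumption)
  note Q = Q0(1) Q0(2)[unfolded d(2), THEN spec, THEN spec] Q0(3)[THEN spec, THEN mp] Q0(4) Q0(5)
  define co where "co x = \<Phi> (fst x) (snd x) 0" for x
  \<comment> \<open>After expansion in all coordinates the coefficients depend on no variable, so
    they are numbers.\<close>
  have \<Phi>: "\<Phi> \<beta> \<gamma> z = co (\<beta>, \<gamma>)" for \<beta> \<gamma> z
    using cls_project[OF Q(2)[of \<beta> \<gamma>] subset_refl, of z] cls_project[OF Q(2)[of \<beta> \<gamma>] subset_refl, of 0] by (simp add: co_def)
  define T where "T z = (\<Sum>x\<in>Q. co x * zz (fst x) (snd x) z)" for z
  define r where "r z = \<phi> z - indicator (polydisc 1) z * T z" for z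
  have phm [measurable]: "\<phi> \<in> borel_measurable borel"
    using smooth_continuous[OF cls_smooth[OF cls]] by (rule borel_measurable_continuous_onI)
  have [measurable]: "r \<in> borel_measurable borel" unfolding r_def[abs_def] T_def by measurable
  obtain R0 where R0': "\<forall>z. (\<exists>j. j \<notin> {} \<and> cmod (z$j) > R0) \<longrightarrow> \<phi> z = 0"
    using cls unfolding cls_def by (elim conjE exE) (rule that; assumption)
  have R0: "\<phi> z = 0" if "cmod (z$j) > R0" for z j using R0' that by blast
  define R where "R = max R0 1"
  have R: "R \<ge> 1" by (simp add: R_def)
  have supp: "r z = 0" if zR: "z \<notin> polydisc R" for z
  proof -
    obtain j where "cmod (z$j) > R" using zR by (auto simp: polydisc_def not_le)
    then have "cmod (z$j) > R0" "cmod (z$j) > 1" by (auto simp: R_def)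
    moreover have "z \<notin> polydisc 1" using \<open>cmod (z$j) > 1\<close> by (auto simp: polydisc_def not_le intro: exI[of _ j])
    ultimately show ?thesis using R0[of z j] by (simp add: r_def)
  qed
  have "\<exists>b. \<forall>z. cmod (\<phi> z) \<le> b"
  proof (rule cls_bounded[OF cls])
    fix b assume "\<And>z. cmod (\<phi> z) \<le> b"
    then show ?thesis by blast
  qed
  then obtain C\<phi> where C\<phi>: "\<And>z. cmod (\<phi> z) \<le> C\<phi>" by blast
  \<comment> \<open>On the unit polydisc the Taylor estimate applies; outside, some
    \<open>|z_j|^K\<close> is at least 1 and a bound for \<open>\<phi>\<close> suffices.\<close>
  define D where "D = max C 0 + max C\<phi> 0"
  have D: "D \<ge> 0" by (simp add: D_def)
  have rb: "cmod (r z) \<le> D * (\<Sum>i\<in>UNIV. cmod (z$i) ^ K)" for z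
  proof (cases "z \<in> polydisc 1")
    case True
    have "(\<Sum>(\<beta>,\<gamma>)\<in>Q. \<Phi> \<beta> \<gamma> z * zz \<beta> \<gamma> z) = T z" unfolding T_def \<Phi> by (intro sum.cong) auto
    then have "cmod (r z) \<le> C * (\<Sum>i\<in>UNIV. cmod (z$i) ^ K)" using Q(3)[of z] True by (simp add: r_def polydisc_def)
    also have "\<dots> \<le> D * (\<Sum>i\<in>UNIV. cmod (z$i) ^ K)" by (intro mult_right_mono sum_nonneg) (auto simp: D_def)
    finally show ?thesis .
  next
    case False
    then obtain j where j: "cmod (z$j) > 1" by (auto simp: polydisc_def not_le)
    have "1 \<le> cmod (z$j) ^ K" using j by (intro one_le_power) simp
    also have "\<dots> \<le> (\<Sum>i\<in>UNIV. cmod (z$i) ^ K)" by (intro member_le_sum) auto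
    finally have "D * 1 \<le> D * (\<Sum>i\<in>UNIV. cmod (z$i) ^ K)" using D by (intro mult_left_mono)
    moreover have "cmod (r z) \<le> D" using C\<phi>[of z] False by (simp add: r_def D_def)
    ultimately show ?thesis by linarith
  qed
  note rem = remainder_value[where B="?B" and J="?J", OF _ R _ supp p K(1) D rb]
  define I where "I c x s = (\<integral>z. of_real (?N z) powr s * piece ?B ?J c (fst x) (snd x) z \<partial>lborel)" for c x s
  define I' where "I' c s = (\<integral>z. of_real (?N z) powr s * (kern ?B ?J c z * r z) \<partial>lborel)" for c s
  have split: "of_real (?N z) powr s * (kern ?B ?J c z * \<phi> z) = (\<Sum>x\<in>Q. co x * (of_real (?N z) powr s * piece ?B ?J c (fst x) (snd x) z)) + of_real (?N z) powr s * (kern ?B ?J c z * r z)" for c z s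
  proof -
    have "(\<Sum>x\<in>Q. co x * (of_real (?N z) powr s * piece ?B ?J c (fst x) (snd x) z)) = of_real (?N z) powr s * (kern ?B ?J c z * (indicator (polydisc 1) z * T z))"
      unfolding T_def piece_def sum_distrib_left by (intro sum.cong refl) (simp only: mult_ac)
    moreover have "\<phi> z = indicator (polydisc 1) z * T z + r z" by (simp add: r_def)
    ultimately show ?thesis by (simp only: distrib_left)
  qed
  have int: "integrable lborel (\<lambda>z. of_real (?N z) powr s * (kern ?B ?J c z * \<phi> z))"
    "(\<integral>z. of_real (?N z) powr s * (kern ?B ?J c z * \<phi> z) \<partial>lborel) = (\<Sum>x\<in>Q. co x * I c x s) + I' c s"
    if c: "c \<in> A" and s: "real (m + 2) < Re s" for c s
  proof -
    have s': "real (card ?B + 1) \<le> Re s" "0 \<le> Re s" using s unfolding cB by auto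
    have 1: "integrable lborel (\<lambda>z. co x * (of_real (?N z) powr s * piece ?B ?J c (fst x) (snd x) z))" for x
      by (intro integrable_mult_right integrable_piece c s'(1))
    have 2: "integrable lborel (\<lambda>z. of_real (?N z) powr s * (kern ?B ?J c z * r z))"
      using s'(2) by (intro rem(2) c) measurable
    show "integrable lborel (\<lambda>z. of_real (?N z) powr s * (kern ?B ?J c z * \<phi> z))"
      unfolding split by (intro Bochner_Integration.integrable_add Bochner_Integration.integrable_sum 1 2)
    show "(\<integral>z. of_real (?N z) powr s * (kern ?B ?J c z * \<phi> z) \<partial>lborel) = (\<Sum>x\<in>Q. co x * I c x s) + I' c s"
      unfolding split I_def I'_def
      by (subst Bochner_Integration.integral_add[OF Bochner_Integration.integrable_sum[OF 1] 2])
         (simp add: Bochner_Integration.integral_sum[OF 1])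
  qed
  have F: "(\<integral>z. omegaB oN oA A ?B s z (Inl ` ?J \<union> Inr ` ?B) * \<phi> z \<partial>lborel)
     = ?\<kappa> * (\<Sum>c\<in>A. (\<Sum>x\<in>Q. co x * (Dc L L' c * (s * I c x s))) + Dc L L' c * (s * I' c s))"
    if s: "real (m + 2) < Re s" for s
  proof -
    have [measurable]: "(\<lambda>z. omegaB oN oA A ?B s z (Inl ` ?J \<union> Inr ` ?B)) \<in> borel_measurable borel"
      by (intro measurable_omegaB normsqA_pos_off_0)
    have "(\<integral>z. omegaB oN oA A ?B s z (Inl ` ?J \<union> Inr ` ?B) * \<phi> z \<partial>lborel)
       = (\<integral>z. ?\<kappa> * s * (\<Sum>c\<in>A. Dc L L' c * (of_real (?N z) powr s * (kern ?B ?J c z * \<phi> z))) \<partial>lborel)"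
    proof (rule integral_cong_AE)
      show "AE z in lborel. omegaB oN oA A ?B s z (Inl ` ?J \<union> Inr ` ?B) * \<phi> z = ?\<kappa> * s * (\<Sum>c\<in>A. Dc L L' c * (of_real (?N z) powr s * (kern ?B ?J c z * \<phi> z)))"
        using AE_nonzero
      proof eventually_elim
        case (elim z)
        have N: "?N z > 0" using elim normsqA_pos by blast
        have z: "\<And>i. z$i \<noteq> 0" using elim by blast
        show ?case
          unfolding omegaB_formula[OF d L z N] kern_def cB sum_distrib_left sum_distrib_right by (simp only: mult_ac)
      qed
    qed measurable
    also have "\<dots> = ?\<kappa> * s * (\<Sum>c\<in>A. Dc L L' c * ((\<Sum>x\<in>Q. co x * I c x s) + I' c s))"
    proof -
      have "integrable lborel (\<lambda>z. Dc L L' c * (of_real (?N z) powr s * (kern ?B ?J c z * \<phi> z)))" if "c \<in> A" for c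
        by (intro integrable_mult_right int(1) that s)
      then show ?thesis
        by (simp add: Bochner_Integration.integral_sum int(2)[OF _ s] cong: sum.cong)
    qed
    also have "\<dots> = ?\<kappa> * (\<Sum>c\<in>A. (\<Sum>x\<in>Q. co x * (Dc L L' c * (s * I c x s))) + Dc L L' c * (s * I' c s))"
    proof -
      have "s * (Dc L L' c * ((\<Sum>x\<in>Q. co x * I c x s) + I' c s)) = (\<Sum>x\<in>Q. co x * (Dc L L' c * (s * I c x s))) + Dc L L' c * (s * I' c s)" for c
        by (simp add: distrib_left sum_distrib_left mult_ac)
      then have "s * (\<Sum>c\<in>A. Dc L L' c * ((\<Sum>x\<in>Q. co x * I c x s) + I' c s)) = (\<Sum>c\<in>A. (\<Sum>x\<in>Q. co x * (Dc L L' c * (s * I c x s))) + Dc L L' c * (s * I' c s))"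
        by (subst sum_distrib_left) (intro sum.cong refl)
      then show ?thesis by (simp only: mult.assoc)
    qed
    finally show ?thesis .
  qed
  let ?v = "\<lambda>c x. if fst x = (\<lambda>i. alphaB ?B i - 1) \<and> snd x = (\<lambda>i. 0) then complex_of_real (weight ?B ?J c) else 0"
  have av: "acv (\<lambda>s. Dc L L' c * (s * I c x s)) (Dc L L' c * ?v c x)" if "c \<in> A" for c x
    unfolding I_def by (rule piece_value[OF L(1,2) dL B that])
  have av': "acv (\<lambda>s. Dc L L' c * (s * I' c s)) (Dc L L' c * 0)" if "c \<in> A" for c
    unfolding I'_def by (rule acv_cmult, rule rem(1)[OF that]) measurable
  have acv_c: "acv (\<lambda>s. (\<Sum>x\<in>Q. co x * (Dc L L' c * (s * I c x s))) + Dc L L' c * (s * I' c s))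
     ((\<Sum>x\<in>Q. co x * (Dc L L' c * ?v c x)) + Dc L L' c * 0)" if c: "c \<in> A" for c
  proof (rule acv_add[OF _ av'[OF c]])
    show "acv (\<lambda>s. \<Sum>x\<in>Q. co x * (Dc L L' c * (s * I c x s))) (\<Sum>x\<in>Q. co x * (Dc L L' c * ?v c x))"
      by (rule acv_sum[OF acv_cmult[OF av[OF c]]])
  qed
  have "acv (\<lambda>s. ?\<kappa> * (\<Sum>c\<in>A. (\<Sum>x\<in>Q. co x * (Dc L L' c * (s * I c x s))) + Dc L L' c * (s * I' c s)))
     (?\<kappa> * (\<Sum>c\<in>A. (\<Sum>x\<in>Q. co x * (Dc L L' c * ?v c x)) + Dc L L' c * 0))"
    by (rule acv_cmult[OF acv_sum[OF acv_c]])
  then have "acv (\<lambda>s. \<integral>z. omegaB oN oA A ?B s z (Inl ` ?J \<union> Inr ` ?B) * \<phi> z \<partial>lborel)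
     (?\<kappa> * (\<Sum>c\<in>A. (\<Sum>x\<in>Q. co x * (Dc L L' c * ?v c x)) + Dc L L' c * 0))"
    by (rule acv_cong[where c="real (m + 2)"]) (simp only: F)
  then have val: "RB oN oA A ?B (Inl ` ?J \<union> Inr ` ?B) \<phi> = ?\<kappa> * (\<Sum>c\<in>A. (\<Sum>x\<in>Q. co x * (Dc L L' c * ?v c x)) + Dc L L' c * 0)"
    unfolding RB_def by (rule acont0_eq)
  have E: "(\<Sum>x\<in>Q. co x * (Dc L L' c * ?v c x)) = Dc L L' c * of_real (weight ?B ?J c) * co (\<lambda>i. alphaB ?B i - 1, \<lambda>i. 0)" for c
  proof -
    have "(\<Sum>x\<in>Q. co x * (Dc L L' c * ?v c x)) = (\<Sum>x\<in>Q. if x = (\<lambda>i. alphaB ?B i - 1, \<lambda>i. 0) then Dc L L' c * of_real (weight ?B ?J c) * co x else 0)"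
      by (intro sum.cong refl) (auto simp: prod_eq_iff)
    then show ?thesis using Q(1,4) by simp
  qed
  have "RB oN oA A ?B (Inl ` ?J \<union> Inr ` ?B) \<phi> = ?\<kappa> * (\<Sum>c\<in>A. Dc L L' c * of_real (weight ?B ?J c)) * co (\<lambda>i. alphaB ?B i - 1, \<lambda>i. 0)"
    unfolding val E by (simp add: sum_distrib_right mult.assoc)
  moreover have "(\<forall>i. alphaB ?B i \<ge> 1) \<longrightarrow> tens oN (alphaB ?B) \<phi> 0 = of_real pi ^ length oN * co (\<lambda>i. alphaB ?B i - 1, \<lambda>i. 0)"
    using Q(5) by (auto simp: co_def)
  ultimately show ?thesis by blast
qed

lemma RB_eq_tensor:
  assumes d: "distinct oN" "set oN = UNIV" "distinct oA" "set oA = A" and B: "B \<subseteq> A" "B \<noteq> {}"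
  shows "\<exists>C::complex. (\<forall>U \<phi>. test_fun \<phi> \<longrightarrow> RB oN oA A B U \<phi> = C * PB oN B U \<phi>) \<and> (C \<noteq> 0 \<longleftrightarrow> essential A B)"
proof -
  have fB: "finite B" using B(1) finA finite_subset by blast
  obtain m where m: "card B = Suc m" using B(2) fB by (metis card_eq_0_iff not0_implies_Suc)
  define L' where "L' = filter (\<lambda>a. a \<in> B) oA"
  have L': "set L' = B" "distinct L'" "length L' = Suc m" "sorted_wrt (\<lambda>x y. lpos oA x < lpos oA y) L'"
  proof -
    show "set L' = B" "distinct L'" using d B by (auto simp: L'_def)
    then show "length L' = Suc m" using m distinct_card by metis
    show "sorted_wrt (\<lambda>x y. lpos oA x < lpos oA y) L'" unfolding L'_def by (intro sorted_wrt_filter sorted_lpos d)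
  qed
  let ?S = "\<Sum>c\<in>A. Dc oN L' c * complex_of_real (weight B UNIV c)"
  let ?\<kappa> = "(-1) ^ m * epsk m * fact m :: complex"
  have \<kappa>: "?\<kappa> \<noteq> 0" using epsk_nz by simp
  \<comment> \<open>In the component with all \<open>dzbar\<close> the residue is
    \<open>?\<kappa> * ?S\<close> times the Taylor coefficient and the tensor product is
    \<open>pi ^ n\<close> times it. If \<open>card B\<close> differs from \<open>n\<close>, the
    residue is 0 in every component.\<close>
  define C where "C = (if card B = CARD('n) then ?\<kappa> * ?S / of_real pi ^ length oN else 0)"
  have len: "length oN = Suc m" if "card B = CARD('n)" using that m d distinct_card by metis
  have dcw: "ess_at B c" if "card B = CARD('n)" "c \<in> A" "Dc oN L' c * complex_of_real (weight B UNIV c) \<noteq> 0" for c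
    using weight_nonzero[of oN m L' c] that len d L' B by simp
  have eq: "RB oN oA A B U \<phi> = C * PB oN B U \<phi>" if t: "test_fun \<phi>" for U \<phi>
  proof (cases "\<exists>J. U = Inl ` J \<union> Inr ` B \<and> card J = card B")
    case False
    have "RB oN oA A B U \<phi> = 0"
      unfolding RB_def omegaB_zero[OF d(1-3) fB B(2) False] by (simp add: acont0_eq acv_zero)
    moreover have "C * PB oN B U \<phi> = 0"
    proof (cases "U = Inl ` UNIV \<union> Inr ` B")
      case True
      then have "card B \<noteq> CARD('n)" using False by auto
      then show ?thesis by (simp add: C_def)
    qed (simp add: PB_def)
    ultimately show ?thesis by simp
  next
    case True
    then obtain J where J: "U = Inl ` J \<union> Inr ` B" "card J = card B" by blast
    define L where "L = filter (\<lambda>i. i \<in> J) oN"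
    have L: "set L = J" "distinct L" using d by (auto simp: L_def)
    then have "length L = Suc m" using m J(2) distinct_card by metis
    moreover have "sorted_wrt (\<lambda>x y. lpos oN x < lpos oN y) L" unfolding L_def by (intro sorted_wrt_filter sorted_lpos d)
    ultimately have L2: "length L = Suc m" "sorted_wrt (\<lambda>x y. lpos oN x < lpos oN y) L" by auto
    obtain V where V: "RB oN oA A B U \<phi> = ?\<kappa> * (\<Sum>c\<in>A. Dc L L' c * of_real (weight B J c)) * V"
      "(\<forall>i. alphaB B i \<ge> 1) \<longrightarrow> tens oN (alphaB B) \<phi> 0 = of_real pi ^ length oN * V"
      using RB_value[OF d(1-3) L2(1) L'(3) L2(2) L'(4) _ t] B(1) unfolding L'(1) L(1) J(1) by blast
    show ?thesis
    proof (cases "J = UNIV")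
      case True
      then have n: "card B = CARD('n)" and LoN: "L = oN" using J(2) by (auto simp: L_def)
      have PBt: "PB oN B U \<phi> = tens oN (alphaB B) \<phi> 0" using J(1) True by (simp add: PB_def)
      show ?thesis
      proof (cases "?S = 0")
        case True
        then show ?thesis using V(1) \<open>J = UNIV\<close> LoN by (simp add: C_def)
      next
        case False
        then obtain c where "c \<in> A" "Dc oN L' c * complex_of_real (weight B UNIV c) \<noteq> 0" using sum.not_neutral_contains_not_neutral by blast
        \<comment> \<open>A nonzero sum has a contributing \<open>c\<close>, which makes
          \<open>B\<close> spanning; so every \<open>\<alpha> i\<close> is at least 1 and the
          formula for the tensor product is available.\<close>
        then have "nondeg B" using dcw[OF n] by (simp add: ess_at_def)
        then have "tens oN (alphaB B) \<phi> 0 = of_real pi ^ length oN * V" using V(2) nondeg_alphaB_pos fB by blast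
        then show ?thesis unfolding PBt V(1) using n \<open>J = UNIV\<close> LoN by (simp add: C_def)
      qed
    next
      case False
      have "Dc L L' c * complex_of_real (weight B J c) = 0" if "c \<in> A" for c
        using weight_nonzero[of L m L' c] that False L L2 L' B by auto
      then have "(\<Sum>c\<in>A. Dc L L' c * complex_of_real (weight B J c)) = 0" by (intro sum.neutral ballI)
      then have "RB oN oA A B U \<phi> = 0" unfolding V(1) by simp
      moreover have "U \<noteq> Inl ` UNIV \<union> Inr ` B" using False J(1) by auto
      ultimately show ?thesis by (simp add: PB_def)
    qed
  qed
  have ax': "\<And>i. \<exists>a\<in>A. \<forall>j. j \<noteq> i \<longrightarrow> a j = 0" using ax by blast
  have "C \<noteq> 0 \<longleftrightarrow> essential A B"
  proof
    assume "C \<noteq> 0"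
    then have n: "card B = CARD('n)" and "?S \<noteq> 0" by (auto simp: C_def split: if_splits)
    then obtain c where "c \<in> A" "Dc oN L' c * complex_of_real (weight B UNIV c) \<noteq> 0" using sum.not_neutral_contains_not_neutral by blast
    then have "ess_at B c" using dcw[OF n] by blast
    then show "essential A B" unfolding essential_iff[OF ax'] using n B(1) unfolding ess_at_def dt_def by blast
  next
    assume "essential A B"
    then have n: "card B = CARD('n)" "nondeg B" and "\<exists>\<xi>. (\<forall>b\<in>B. dt b \<xi> = 1) \<and> (\<forall>a\<in>A. dt a \<xi> \<ge> 1)"
      unfolding essential_iff[OF ax'] dt_def by blast+
    then obtain \<xi> where \<xi>: "\<forall>b\<in>B. dt b \<xi> = 1" "\<forall>a\<in>A. dt a \<xi> \<ge> 1" by blast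
    obtain b0 where b0: "b0 \<in> B" using B(2) by blast
    let ?d = "Determinant.det (dmat (\<lambda>i a. of_nat (a i)) oN L') :: complex"
    have d0: "?d \<noteq> 0" using det_dmat_nondeg[OF len[OF n(1)] L'(3) d(2,1)] n(2) L'(1) by simp
    \<comment> \<open>On contributing \<open>c\<close> the bordered determinant is
      \<open>?d\<close>, the same for all of them; \<open>?S\<close> is thus a nonzero number times
      a sum of nonnegative weights.\<close>
    define w where "w c = (if ess_at B c then weight B UNIV c else 0)" for c
    have "Dc oN L' c * complex_of_real (weight B UNIV c) = ?d * of_real (w c)" if c: "c \<in> A" for c
    proof (cases "ess_at B c")
      case True
      then obtain \<eta> where \<eta>: "\<forall>b\<in>B. dt b \<eta> = 1" "dt c \<eta> = 1" unfolding ess_at_def by blast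
      have cd: "(\<Sum>i\<in>UNIV. of_nat (a i) * complex_of_real (\<eta> i)) = of_real (dt a \<eta>)" for a by (simp add: dt_def)
      have "Dc oN L' c = ?d * (\<Sum>i\<in>UNIV. of_nat (c i) * complex_of_real (\<eta> i))"
        by (rule Dc_eq_det[OF len[OF n(1)] L'(3) d(2,1)]) (use \<eta> L'(1) in \<open>simp add: cd\<close>)
      then show ?thesis using True \<eta>(2) unfolding cd by (simp add: w_def)
    next
      case False
      then show ?thesis using dcw[OF n(1) c] by (auto simp: w_def)
    qed
    then have S: "?S = ?d * of_real (\<Sum>c\<in>A. w c)" by (simp add: sum_distrib_left)
    \<comment> \<open>Any element of \<open>B\<close> lies on the hyperplane of \<open>B\<close>, so
      at least one weight is strictly positive.\<close>
    have "ess_at B b0" unfolding ess_at_def using n(2) \<xi> b0 by blast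
    then have "w b0 > 0" using weight_ess[of B b0] b0 B(1) by (auto simp: w_def)
    moreover have "w c \<ge> 0" if "c \<in> A" for c using weight_ess[of B c] that B(1) by (auto simp: w_def intro: less_imp_le)
    ultimately have "(\<Sum>c\<in>A. w c) > 0" using b0 B(1) finA by (intro sum_pos2[of A b0]) auto
    then show "C \<noteq> 0" using n(1) d0 \<kappa> unfolding C_def S by (simp del: of_real_sum)
  qed
  then show ?thesis using eq by blast
qed

end

theorem theorem3p1:
  fixes A :: "('n::finite \<Rightarrow> nat) set"
    and oA :: "('n \<Rightarrow> nat) list" and oN :: "'n list"
  assumes "finite A" and "A \<noteq> {}"
    and "{z :: complex^'n. \<forall>a\<in>A. zmon a z = 0} = {0}"
    and "distinct oA" and "set oA = A"
    and "distinct oN" and "set oN = UNIV"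
  shows "\<forall>B. B \<subseteq> A \<and> B \<noteq> {} \<longrightarrow>
           (\<exists>C::complex. (\<forall>U \<phi>. test_fun \<phi> \<longrightarrow> RB oN oA A B U \<phi> = C * PB oN B U \<phi>)
                         \<and> (C \<noteq> 0 \<longleftrightarrow> essential A B))"
proof -
  interpret monomials A
  proof
    show "finite A" by fact
    fix i :: 'n
    \<comment> \<open>A monomial not vanishing at the unit vector of coordinate \<open>i\<close>
      involves no other coordinate; its exponent there is positive because all monomials of
      \<open>A\<close> vanish at 0.\<close>
    have "axis i 1 \<noteq> (0 :: complex^'n)" by (simp add: axis_eq_0_iff)
    then obtain a where a: "a \<in> A" "zmon a (axis i 1) \<noteq> 0" using assms(3) by blast
    have j: "a j = 0" if "j \<noteq> i" for j
    proof (rule ccontr)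
      assume "a j \<noteq> 0"
      then have "(axis i 1 $ j :: complex) ^ a j = 0" using that by (simp add: axis_def)
      then show False using a(2) unfolding zmon_def by (metis UNIV_I finite prod_zero_iff)
    qed
    have "a i > 0"
    proof (rule ccontr)
      assume "\<not> a i > 0"
      then have "a k = 0" for k using j by (cases "k = i") auto
      then have "zmon a 0 \<noteq> 0" by (simp add: zmon_def)
      then show False using assms(3) a(1) by blast
    qed
    then show "\<exists>a\<in>A. a i > 0 \<and> (\<forall>j. j \<noteq> i \<longrightarrow> a j = 0)" using a(1) j by blast
  qed
  show ?thesis using RB_eq_tensor[OF assms(6,7,4,5)] by blast
qed

end
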